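(* Let $m\ge 3$. Let $\tilde A_m:\mathcal{M}_m(\mathbb{C})\to\mathcal{M}_n(\mathbb{C})$ be a determinantal representation of $\operatorname{perm}_m$ that respects $N(T^{\mathrm{GL}(E)})$. Then $n\ge 2^m-1$. Moreover, Grenet's determinantal representation of $\operatorname{perm}_m$ respects $N(T^{\mathrm{GL}(E)})$ and has size $2^m-1$.
   Context: All spaces are over $\mathbb{C}$. $\mathcal{M}_n(\mathbb{C})$ is the space of $n\times n$ complex matrices and $\det_n$ the determinant polynomial on it; $\operatorname{perm}_m(y)=\sum_{\sigma\in\mathfrak{S}_m}\prod_{i=1}^m y^i_{\sigma(i)}$ on $\mathcal{M}_m(\mathbb{C})$. Equivariance. For a nonzero homogeneous polynomial $P$ on a finite-dimensional $V$, $\mathbb{G}_P=\{g\in \mathrm{GL}(V): \exists c\in\mathbb{C}^*,\ P(g^{-1}y)=cP(y)\ \forall y\in V\}$; in particular $\mathbb{G}_{\det_n}\subset \mathrm{GL}(\mathcal{M}_n(\mathbb{C}))$. A determinantal representation of $P$ of size $n$ is an affine linear map $\tilde A=\Lambda+A:V\to\mathcal{M}_n(\mathbb{C})$ ($\Lambda$ a fixed matrix, $A$ linear) with $P=\det_n\circ\tilde A$. Put $\mathbb{G}_A=\{g\in\mathbb{G}_{\det_n}: g\cdot\Lambda=\Lambda,\ g\cdot A(V)=A(V)\}$. Assume $P$ cannot be expressed using $\dim V-1$ variables (true for $\operatorname{perm}_m$), so $A:V\to A(V)$ is bijective, and let $\bar\rho_A:\mathbb{G}_A\to \mathrm{GL}(V)$,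 $\bar\rho_A(g)=A^{-1}\circ (g|_{A(V)})\circ A$. For a subgroup $G\subseteq\mathbb{G}_P$, $\tilde A$ respects $G$ if $G\subseteq\bar\rho_A(\mathbb{G}_A)$. The group. Let $E=F=\mathbb{C}^m$ and $\mathcal{M}_m(\mathbb{C})=\mathrm{Hom}(F,E)=E\otimes F^*$. $T^{\mathrm{GL}(E)}\subset \mathrm{GL}(E)$ is the group of invertible diagonal matrices and $N(T^{\mathrm{GL}(E)})=T^{\mathrm{GL}(E)}\rtimes\mathfrak{S}_m$ its normalizer in $\mathrm{GL}(E)$ (the monomial matrices). It is regarded as a subgroup of $\mathbb{G}_{\operatorname{perm}_m}\subset \mathrm{GL}(\mathcal{M}_m(\mathbb{C}))$ via $g\mapsto\{M\mapsto gM\}$. Grenet's representation. Let $e_1,\dots,e_m$ be the standard basis of $E$ and $f_1,\dots,f_m$ a basis of $F^*$ (dual to the standard basis of $F$). Let $(S^kE)_{reg}\subset S^kE$ be the span of the square-free monomials $\prod_{i\in I}e_i$, $I\subset\{1,\dots,m\}$, $|I|=k$, and let $\pi_k:S^kE\to(S^kE)_{reg}$ be the projection killing all non-square-free monomials. For $v\in E$ let $s_k(v):(S^kE)_{reg}\to(S^{k+1}E)_{reg}$ be multiplication by $v$ followed by $\pi_{k+1}$. Let $\mathbb{C}^n=\bigoplus_{k=0}^{m-1}(S^kE)_{reg}$, so $n=2^m-1$, and identify $(S^mE)_{reg}\simeq S^0E=\mathbb{C}$ by $e_1\cdots e_m\mapsto 1$. Grenet's representation is $\tilde A(y)=\Lambda+\sum_{k=0}^{m-1}s_k(v_{k+1})$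 for $y=\sum_{j=1}^m v_j\otimes f_j$ ($v_j\in E$ the $j$-th column of $y$), where $\Lambda=(-1)^{m+1}\mathrm{Id}_{(S^1E)_{reg}}+\sum_{k=2}^{m-1}\mathrm{Id}_{(S^kE)_{reg}}$ and each map is regarded as an element of $\mathrm{End}(\mathbb{C}^n)\simeq\mathcal{M}_n(\mathbb{C})$, $s_{m-1}$ mapping into $S^0E$. *)

theory Defs
  imports
    "HOL-Library.FuncSet"
    "HOL-Library.Nat_Bijection"
    "HOL-Library.Poly_Mapping"
    "HOL-Combinatorics.Permutations"
    "HOL-Algebra.Group_Action"
    "Jordan_Normal_Form.Determinant"
    "Jordan_Normal_Form.VS_Connect"
begin

text \<open>All indices are 0-based: rows, columns and basis vectors of an \<open>m\<close>-dimensional space are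
  numbered \<open>0, \<dots>, m - 1\<close>.  The ambient vector space \<open>V\<close> is always a space of square matrices
  \<open>carrier_mat k k\<close>.\<close>

definition perm_poly :: "nat \<Rightarrow> complex mat \<Rightarrow> complex" where
  "perm_poly m y = (\<Sum>\<sigma> | \<sigma> permutes {0..<m}. \<Prod>i = 0..<m. y $$ (i, \<sigma> i))"

abbreviation mat_linear :: "nat \<Rightarrow> nat \<Rightarrow> (complex mat \<Rightarrow> complex mat) \<Rightarrow> bool" where
  "mat_linear m n \<equiv>
     linear_map class_ring (module_mat TYPE(complex) m m) (module_mat TYPE(complex) n n)"

text \<open>\<open>GL(M\<^sub>k(C))\<close>.  Its elements are extensional functions, so that equality of elements
  is equality of the maps on the carrier.\<close>

definition GL_mats :: "nat \<Rightarrow> (complex mat \<Rightarrow> complex mat) set" where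
  "GL_mats k = {g \<in> extensional (carrier_mat k k).
      mat_linear k k g \<and> bij_betw g (carrier_mat k k) (carrier_mat k k)}"

definition symmetry_group :: "nat \<Rightarrow> (complex mat \<Rightarrow> complex) \<Rightarrow> (complex mat \<Rightarrow> complex mat) set" where
  "symmetry_group k P = {g \<in> GL_mats k. \<exists>c. c \<noteq> 0 \<and>
      (\<forall>y \<in> carrier_mat k k. P (inv_into (carrier_mat k k) g y) = c * P y)}"

text \<open>An affine linear map is given by its constant part \<open>\<Lambda>\<close> and its linear part \<open>A\<close>.\<close>

definition det_rep ::
  "nat \<Rightarrow> (complex mat \<Rightarrow> complex) \<Rightarrow> nat \<Rightarrow> complex mat \<Rightarrow> (complex mat \<Rightarrow> complex mat) \<Rightarrow> bool"
where
  "det_rep m P n \<Lambda> A \<longleftrightarrow> \<Lambda> \<in> carrier_mat n n \<and> mat_linear m n A \<and>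
     (\<forall>y \<in> carrier_mat m m. P y = det (\<Lambda> + A y))"

definition rep_group ::
  "nat \<Rightarrow> nat \<Rightarrow> complex mat \<Rightarrow> (complex mat \<Rightarrow> complex mat) \<Rightarrow> (complex mat \<Rightarrow> complex mat) set"
where
  "rep_group m n \<Lambda> A =
     {g \<in> symmetry_group n det. g \<Lambda> = \<Lambda> \<and> g ` A ` carrier_mat m m = A ` carrier_mat m m}"

text \<open>The map \<open>A\<^sup>-\<^sup>1 \<circ> g \<circ> A\<close>; meaningful when \<open>A\<close> is injective, which is automatic for
  representations of a polynomial that genuinely depends on all of its variables.\<close>

definition rho_bar ::
  "nat \<Rightarrow> (complex mat \<Rightarrow> complex mat) \<Rightarrow> (complex mat \<Rightarrow> complex mat) \<Rightarrow> complex mat \<Rightarrow> complex mat"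
where
  "rho_bar m A g = (\<lambda>y \<in> carrier_mat m m. inv_into (carrier_mat m m) A (g (A y)))"

definition rep_respects ::
  "nat \<Rightarrow> nat \<Rightarrow> complex mat \<Rightarrow> (complex mat \<Rightarrow> complex mat) \<Rightarrow> (complex mat \<Rightarrow> complex mat) set \<Rightarrow> bool"
where
  "rep_respects m n \<Lambda> A G \<longleftrightarrow> G \<subseteq> rho_bar m A ` rep_group m n \<Lambda> A"


abbreviation GL_group :: "nat \<Rightarrow> complex mat monoid" where
  "GL_group m \<equiv> units_of (ring_mat TYPE(complex) m ())"

definition torus :: "nat \<Rightarrow> complex mat set" where
  "torus m = {t \<in> carrier (GL_group m). diagonal_mat t}"

definition NT_action :: "nat \<Rightarrow> (complex mat \<Rightarrow> complex mat) set" where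
  "NT_action m = (\<lambda>g. \<lambda>M \<in> carrier_mat m m. g * M) ` normalizer (GL_group m) (torus m)"


text \<open>The symmetric algebra of \<open>E = C\<^sup>m\<close> is realised inside the polynomial ring in the variables
  \<open>e\<^sub>0, e\<^sub>1, \<dots>\<close>: a polynomial maps exponent vectors to coefficients.\<close>

type_synonym sym_alg = "(nat \<Rightarrow>\<^sub>0 nat) \<Rightarrow>\<^sub>0 complex"

definition const_sym :: "complex \<Rightarrow> sym_alg" where
  "const_sym c = Poly_Mapping.single 0 c"

definition e_sym :: "nat \<Rightarrow> sym_alg" where
  "e_sym i = Poly_Mapping.single (Poly_Mapping.single i 1) 1"

definition vec_sym :: "complex vec \<Rightarrow> sym_alg" where
  "vec_sym v = (\<Sum>i = 0..<dim_vec v. const_sym (v $ i) * e_sym i)"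

definition sqfree_monom :: "nat set \<Rightarrow> sym_alg" where
  "sqfree_monom I = (\<Prod>i\<in>I. e_sym i)"

definition sqfree_coeff :: "nat set \<Rightarrow> sym_alg \<Rightarrow> complex" where
  "sqfree_coeff I p = Poly_Mapping.lookup p (\<Sum>i\<in>I. Poly_Mapping.single i 1)"

text \<open>On \<open>S\<^sup>kE\<close> this is the projection \<open>\<pi>\<^sub>k\<close> to \<open>(S\<^sup>kE)\<^sub>r\<^sub>e\<^sub>g\<close>; on the sum of all \<open>(S\<^sup>jE)\<^sub>r\<^sub>e\<^sub>g\<close> it is the
  projection to the \<open>k\<close>-th summand.\<close>

definition reg_proj :: "nat \<Rightarrow> nat \<Rightarrow> sym_alg \<Rightarrow> sym_alg" where
  "reg_proj m k p =
     (\<Sum>I | I \<subseteq> {0..<m} \<and> card I = k. const_sym (sqfree_coeff I p) * sqfree_monom I)"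

definition s_map :: "nat \<Rightarrow> nat \<Rightarrow> complex vec \<Rightarrow> sym_alg \<Rightarrow> sym_alg" where
  "s_map m k v p = reg_proj m (Suc k) (vec_sym v * p)"

definition top_ident :: "nat \<Rightarrow> sym_alg \<Rightarrow> sym_alg" where
  "top_ident m p = const_sym (sqfree_coeff {0..<m} p)"

text \<open>\<open>s\<^sub>k(v)\<close> extended by zero to an endomorphism of the direct sum of the \<open>(S\<^sup>jE)\<^sub>r\<^sub>e\<^sub>g\<close>, \<open>j < m\<close>;
  the last one is followed by the identification of \<open>(S\<^sup>mE)\<^sub>r\<^sub>e\<^sub>g\<close> with \<open>S\<^sup>0E\<close>.\<close>

definition s_end :: "nat \<Rightarrow> nat \<Rightarrow> complex vec \<Rightarrow> sym_alg \<Rightarrow> sym_alg" where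
  "s_end m k v p =
     (let q = s_map m k v (reg_proj m k p) in if Suc k = m then top_ident m q else q)"

text \<open>Matrix of an endomorphism of that direct sum in the basis of square-free monomials
  of degree less than \<open>m\<close>.  The proper subsets of \<open>{0..<m}\<close> are numbered by binary expansion;
  the number \<open>2 ^ m - 1\<close> left out would be the full set.\<close>

lemma bij_betw_set_decode_proper:
  "bij_betw set_decode {0..<2 ^ m - 1} {I. I \<subset> {0..<m}}"
proof -
  have full: "set_encode {0..<m} = 2 ^ m - 1" for m :: nat
    by (simp add: set_encode_def atLeast0LessThan mask_eq_sum_exp_nat lessThan_def)
  have le: "set_encode I \<le> 2 ^ m - 1" if "I \<subseteq> {0..<m}" for I
  proof -
    have "finite I" using that finite_subset by blast
    then have "set_decode (set_encode I) \<subseteq> set_decode (set_encode {0..<m})"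
      using that by simp
    then show ?thesis unfolding full[symmetric] by (rule subset_decode_imp_le)
  qed
  have sub: "set_decode i \<subseteq> {0..<m}" if "i < 2 ^ m" for i
  proof
    fix x assume "x \<in> set_decode i"
    then have "odd (i div 2 ^ x)" by (simp add: set_decode_def)
    then have "2 ^ x \<le> i" by (metis div_less even_zero not_le)
    then have "(2::nat) ^ x < 2 ^ m" using that by (rule le_less_trans)
    then show "x \<in> {0..<m}" by simp
  qed
  show ?thesis
  proof (rule bij_betw_byWitness[where f' = set_encode])
    show "\<forall>a\<in>{0..<2 ^ m - 1}. set_encode (set_decode a) = a" by simp
    show "\<forall>a\<in>{I. I \<subset> {0..<m}}. set_decode (set_encode a) = a"
      by (auto intro!: set_encode_inverse dest: psubset_imp_subset intro: finite_subset)
    show "set_decode ` {0..<2 ^ m - 1} \<subseteq> {I. I \<subset> {0..<m}}"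
    proof clarsimp
      fix i :: nat assume i: "i < 2 ^ m - Suc 0"
      have "set_decode i \<noteq> {0..<m}"
      proof
        assume "set_decode i = {0..<m}"
        then have "i = 2 ^ m - 1" using full[of m] set_decode_inverse[of i] by metis
        with i show False by simp
      qed
      moreover have "set_decode i \<subseteq> {0..<m}"
        by (rule sub) (use i in linarith)
      ultimately show "set_decode i \<subset> {0..<m}" by (rule psubsetI[rotated])
    qed
    show "set_encode ` {I. I \<subset> {0..<m}} \<subseteq> {0..<2 ^ m - 1}"
    proof
      fix x assume "x \<in> set_encode ` {I. I \<subset> {0..<m}}"
      then obtain I where I: "I \<subset> {0..<m}" and x: "x = set_encode I" by blast
      then have f: "finite I" "I \<subseteq> {0..<m}" by (auto intro: finite_subset)
      have "set_encode I \<noteq> set_encode {0..<m}"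
        using I f set_encode_eq[of I "{0..<m}"] by simp
      then show "x \<in> {0..<2 ^ m - 1}" using le[OF f(2)] full x by simp
    qed
  qed
qed

definition end_mat :: "nat \<Rightarrow> (sym_alg \<Rightarrow> sym_alg) \<Rightarrow> complex mat" where
  "end_mat m \<phi> = mat (2 ^ m - 1) (2 ^ m - 1)
     (\<lambda>(r, c). sqfree_coeff (set_decode r) (\<phi> (sqfree_monom (set_decode c))))"

definition grenet_const :: "nat \<Rightarrow> complex mat" where
  "grenet_const m =
     end_mat m (\<lambda>p. (-1) ^ (m + 1) * reg_proj m 1 p + (\<Sum>k = 2..m - 1. reg_proj m k p))"

definition grenet_lin :: "nat \<Rightarrow> complex mat \<Rightarrow> complex mat" where
  "grenet_lin m y = end_mat m (\<lambda>p. \<Sum>k = 0..m - 1. s_end m k (col y k) p)"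

end

theory Submission
  imports Defs "Jordan_Normal_Form.Jordan_Normal_Form_Existence"
    "HOL-Computational_Algebra.Primes" "HOL-Library.Infinite_Set"
begin

text \<open>Lower bound.  By Frobenius' theorem on linear maps preserving the determinant, the square of
  every monomial matrix \<open>g\<close> lifts to a pair \<open>(P, Q)\<close> with \<open>P * X(y) * Q = X(g * g * y)\<close>, where \<open>X(y)\<close> is the
  representation.  Lifting a diagonal matrix with distinct prime entries and putting \<open>P\<close> and \<open>Q\<close> into
  Jordan form gives the rows and columns of \<open>X\<close> integer weights \<open>\<mu>\<close> and \<open>\<nu>\<close> in \<open>\<int>\<^sup>m\<close> such that the entry \<open>(a, b)\<close>
  is homogeneous of multidegree \<open>\<mu> a - \<nu> b\<close> in the rows of \<open>y\<close>.  Eliminating invertible constants shows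
  that the constant part \<open>\<Lambda>\<close> has corank one.  The entry of \<open>adj X(u) * \<Lambda> * adj X(v)\<close> in a pivot position
  has no terms of degree below \<open>m\<close>; its leading part \<open>B(u, v)\<close> on the diagonal \<open>u = v\<close> forces, for each size,
  some subset \<open>I\<close> of the rows such that \<open>B\<close> does not vanish identically for \<open>v\<close> supported on \<open>I\<close> and
  \<open>u\<close> off \<open>I\<close>, which makes the indicator of \<open>I\<close> a (shifted) weight \<open>\<nu> b\<close>.  The lifts of the 3-cycles
  transport this to all subsets of the same size, so the \<open>2\<^sup>m - 1\<close> proper subsets give distinct columns.

  Grenet's representation.  A column operation with the permanents of the first \<open>k\<close> columns as
  coefficients turns its matrix into a block triangular one.  A monomial matrix acts on it by permuting the
  square-free monomials and rescaling them, where \<open>S\<^sup>0E\<close> as the target is rescaled like \<open>(S\<^sup>mE)\<^sub>r\<^sub>e\<^sub>g\<close>.\<close>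

section \<open>Matrices over a field\<close>

text \<open>Lifts of group elements are chosen one by one and need not form a homomorphism, so there
  is no action on rows and columns to decompose. Two consequences shape the argument. The torus
  cannot be diagonalised as a whole: one diagonal matrix must carry all the information, and prime
  entries do so because they are multiplicatively independent. And the lift of a row permutation
  need not permute the weight spaces found in this way. What it respects is anything defined from
  \<open>X\<close> up to \<open>X |-> P * X * Q\<close>; hence nonvanishing of \<open>B\<close>, not
  the existence of a weight, is transported between subsets, and weights are read off only at the
  end. Only squares are sure to lift without a transposition, so row permutations enter through
  3-cycles, which are squares of 3-cycles, and not through transpositions. Corank one is where three
  rows are indispensable: the permanent of size two is the determinant of a matrix of linear forms,
  with \<open>\<Lambda> = 0\<close>. For size three, two linear conditions, each on a single row,
  never force the permanent to vanish, and the induction starts there.\<close>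

lemma mult_mat_index:
  assumes "A \<in> carrier_mat n k" "B \<in> carrier_mat k p" "i < n" "j < p"
  shows "(A * B) $$ (i, j) = (\<Sum>l = 0..<k. A $$ (i, l) * B $$ (l, j))"
  using assms by (simp add: scalar_prod_def)

lemma mult3_mat_index:
  assumes A: "A \<in> carrier_mat n n" and B: "B \<in> carrier_mat n n" and C: "C \<in> carrier_mat n n"
    and "i < n" "j < n"
  shows "(A * B * C) $$ (i, j) = (\<Sum>k = 0..<n. \<Sum>l = 0..<n. A $$ (i, k) * B $$ (k, l) * C $$ (l, j))"
proof -
  have "(A * B * C) $$ (i, j) = (\<Sum>l = 0..<n. (A * B) $$ (i, l) * C $$ (l, j))"
    by (rule mult_mat_index[OF mult_carrier_mat[OF A B] C]) fact+
  also have "\<dots> = (\<Sum>l = 0..<n. (\<Sum>k = 0..<n. A $$ (i, k) * B $$ (k, l)) * C $$ (l, j))"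
    using assms by (intro sum.cong refl arg_cong2[where f = "(*)"] mult_mat_index) auto
  also have "\<dots> = (\<Sum>k = 0..<n. \<Sum>l = 0..<n. A $$ (i, k) * B $$ (k, l) * C $$ (l, j))"
    by (subst sum.swap) (simp add: sum_distrib_right)
  finally show ?thesis .
qed

lemma det_nonzero_inverse:
  fixes P :: "'a :: field mat"
  assumes P: "P \<in> carrier_mat n n" and d: "det P \<noteq> 0"
  obtains P' where "P' \<in> carrier_mat n n" "P * P' = 1\<^sub>m n" "P' * P = 1\<^sub>m n" "det P' \<noteq> 0"
proof -
  from det_non_zero_imp_unit[OF P d, of undefined] obtain P' where
    P': "P' \<in> carrier_mat n n" "P * P' = 1\<^sub>m n" "P' * P = 1\<^sub>m n"
    unfolding Units_def ring_mat_def by auto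
  have "det P * det P' = 1" using det_mult[OF P P'(1)] P'(2) by simp
  then have "det P' \<noteq> 0" by auto
  with P' that show thesis by blast
qed

definition unit_mat :: "nat \<Rightarrow> nat \<Rightarrow> nat \<Rightarrow> complex mat" where
  "unit_mat n a b = mat n n (\<lambda>(i, j). if i = a \<and> j = b then 1 else 0)"

lemma unit_mat_carrier [simp]: "unit_mat n a b \<in> carrier_mat n n"
  by (simp add: unit_mat_def)

lemma unit_mat_dim [simp]: "dim_row (unit_mat n a b) = n" "dim_col (unit_mat n a b) = n"
  by (simp_all add: unit_mat_def)

lemma unit_mat_index [simp]:
  "i < n \<Longrightarrow> j < n \<Longrightarrow> unit_mat n a b $$ (i, j) = (if i = a \<and> j = b then 1 else 0)"
  by (simp add: unit_mat_def)

lemma cofactor_cong_row: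
  assumes A: "A \<in> carrier_mat n n" and B: "B \<in> carrier_mat n n" and a: "a < n"
    and eq: "\<And>i j. i < n \<Longrightarrow> j < n \<Longrightarrow> i \<noteq> a \<Longrightarrow> A $$ (i, j) = B $$ (i, j)"
  shows "cofactor A a b = cofactor B a b"
proof -
  have "mat_delete A a b = mat_delete B a b"
    using assms by (intro eq_matI) (auto simp: mat_delete_def)
  then show ?thesis by (simp add: cofactor_def)
qed

text \<open>Laplace expansion along row \<open>a\<close>, whose cofactors do not see that row. It
  serves twice: a singular matrix becomes invertible by changing one entry exactly if a cofactor is
  nonzero, and adding a matrix of rank one changes the determinant affinely.\<close>

lemma det_add_unit_mat:
  assumes M: "M \<in> carrier_mat n n" and a: "a < n" and b: "b < n"
  shows "det (M + c \<cdot>\<^sub>m unit_mat n a b) = det M + c * cofactor M a b"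
proof -
  let ?N = "M + c \<cdot>\<^sub>m unit_mat n a b"
  have N: "?N \<in> carrier_mat n n" using M by simp
  have cof: "cofactor ?N a j = cofactor M a j" for j
    by (rule cofactor_cong_row[OF N M a]) (use M in auto)
  have "det ?N = (\<Sum>j<n. ?N $$ (a, j) * cofactor M a j)"
    by (simp add: laplace_expansion_row[OF N a] cof)
  also have "\<dots> = (\<Sum>j<n. M $$ (a, j) * cofactor M a j + (if j = b then c * cofactor M a j else 0))"
    using M a b by (intro sum.cong) (auto simp: algebra_simps)
  also have "\<dots> = det M + c * cofactor M a b"
    using b by (simp add: sum.distrib laplace_expansion_row[OF M a])
  finally show ?thesis .
qed

section \<open>Elimination of a pivot and the rank normal form\<close>

definition corner_block :: "complex \<Rightarrow> complex mat \<Rightarrow> complex mat" where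
  "corner_block c N = mat (Suc (dim_row N)) (Suc (dim_col N))
     (\<lambda>(i, j). if i = 0 \<and> j = 0 then c else if i = 0 \<or> j = 0 then 0 else N $$ (i - 1, j - 1))"

lemma corner_block_carrier [simp]:
  "N \<in> carrier_mat k k \<Longrightarrow> corner_block c N \<in> carrier_mat (Suc k) (Suc k)"
  by (auto simp: corner_block_def)

lemma det_corner_block:
  assumes N: "N \<in> carrier_mat k k"
  shows "det (corner_block c N) = c * det N"
proof -
  have C: "corner_block c N \<in> carrier_mat (Suc k) (Suc k)" using N by simp
  have "mat_delete (corner_block c N) 0 0 = N"
    using N by (intro eq_matI) (auto simp: mat_delete_def corner_block_def)
  then have "cofactor (corner_block c N) 0 0 = det N" by (simp add: cofactor_def)
  moreover have "(\<Sum>i<k. corner_block c N $$ (Suc i, 0) * cofactor (corner_block c N) (Suc i) 0) = 0"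
    using N by (intro sum.neutral) (auto simp: corner_block_def)
  moreover have "corner_block c N $$ (0, 0) = c" by (simp add: corner_block_def)
  moreover have "det (corner_block c N) = (\<Sum>i<Suc k. corner_block c N $$ (i, 0) * cofactor (corner_block c N) i 0)"
    by (rule laplace_expansion_column[OF C]) simp
  ultimately show ?thesis by (simp add: sum.lessThan_Suc_shift del: sum.lessThan_Suc)
qed

lemma corner_block_mult:
  assumes N: "N \<in> carrier_mat k k" and N': "N' \<in> carrier_mat k k"
  shows "corner_block c N * corner_block d N' = corner_block (c * d) (N * N')"
proof (rule eq_matI)
  let ?C = "corner_block c N" and ?D = "corner_block d N'"
  fix i j assume "i < dim_row (corner_block (c * d) (N * N'))" "j < dim_col (corner_block (c * d) (N * N'))"
  then have ij: "i < Suc k" "j < Suc k" using N N' by (auto simp: corner_block_def)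
  have "(?C * ?D) $$ (i, j) = (\<Sum>l = 0..<Suc k. ?C $$ (i, l) * ?D $$ (l, j))"
    using N N' ij by (intro mult_mat_index) auto
  also have "\<dots> = ?C $$ (i, 0) * ?D $$ (0, j) + (\<Sum>l = 0..<k. ?C $$ (i, Suc l) * ?D $$ (Suc l, j))"
    by (simp add: sum.atLeast0_lessThan_Suc_shift del: sum.op_ivl_Suc)
  also have "\<dots> = corner_block (c * d) (N * N') $$ (i, j)"
    using N N' ij by (cases i; cases j) (auto simp: corner_block_def scalar_prod_def intro!: sum.neutral)
  finally show "(?C * ?D) $$ (i, j) = corner_block (c * d) (N * N') $$ (i, j)" .
qed (use N N' in \<open>auto simp: corner_block_def\<close>)

definition schur_compl :: "complex mat \<Rightarrow> complex mat" where
  "schur_compl M = mat (dim_row M - 1) (dim_col M - 1)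
     (\<lambda>(i, j). M $$ (Suc i, Suc j) - M $$ (Suc i, 0) * M $$ (0, Suc j) / M $$ (0, 0))"

lemma schur_compl_carrier [simp]:
  "M \<in> carrier_mat (Suc k) (Suc k) \<Longrightarrow> schur_compl M \<in> carrier_mat k k"
  by (auto simp: schur_compl_def)

text \<open>Row and column operations clear the first column and the first row; collected into
  unitriangular matrices, they introduce no determinant factor.\<close>

lemma pivot_elimination:
  assumes M: "M \<in> carrier_mat (Suc k) (Suc k)" and p: "M $$ (0, 0) \<noteq> 0"
  obtains E F where "E \<in> carrier_mat (Suc k) (Suc k)" "F \<in> carrier_mat (Suc k) (Suc k)"
    "det E = 1" "det F = 1" "E * M * F = corner_block (M $$ (0, 0)) (schur_compl M)"
proof -
  let ?n = "Suc k" let ?p = "M $$ (0, 0)"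
  define E where "E = mat ?n ?n (\<lambda>(i, j). if i = j then 1 else if j = 0 then - M $$ (i, 0) / ?p else 0)"
  define F where "F = mat ?n ?n (\<lambda>(i, j). if i = j then 1 else if i = 0 then - M $$ (0, j) / ?p else 0)"
  have E: "E \<in> carrier_mat ?n ?n" and F: "F \<in> carrier_mat ?n ?n" by (simp_all add: E_def F_def)
  have dE: "det E = 1"
    by (subst det_lower_triangular[OF _ E]) (auto simp: E_def prod_list_diag_prod)
  have dF: "det F = 1"
    by (subst det_upper_triangular[OF _ F]) (auto simp: F_def prod_list_diag_prod)
  have row: "(\<Sum>l = 0..<?n. E $$ (i, l) * f l) = (if i = 0 then f 0 else f i - M $$ (i, 0) / ?p * f 0)"
    if "i < ?n" for i f
  proof -
    have "(\<Sum>l = 0..<?n. E $$ (i, l) * f l) = (\<Sum>l = 0..<?n. (if l = i then f l else 0) + (if l = 0 then (if i = 0 then 0 else - M $$ (i, 0) / ?p * f 0) else 0))"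
      using that by (intro sum.cong) (auto simp: E_def)
    also have "\<dots> = f i + (if i = 0 then 0 else - M $$ (i, 0) / ?p * f 0)"
      using that unfolding sum.distrib by (subst (1 2) sum.delta) auto
    finally show ?thesis by auto
  qed
  have col: "(\<Sum>l = 0..<?n. f l * F $$ (l, j)) = (if j = 0 then f 0 else f j - f 0 * M $$ (0, j) / ?p)"
    if "j < ?n" for j f
  proof -
    have "(\<Sum>l = 0..<?n. f l * F $$ (l, j)) = (\<Sum>l = 0..<?n. (if l = j then f l else 0) + (if l = 0 then (if j = 0 then 0 else - f 0 * M $$ (0, j) / ?p) else 0))"
      using that by (intro sum.cong) (auto simp: F_def)
    also have "\<dots> = f j + (if j = 0 then 0 else - f 0 * M $$ (0, j) / ?p)"
      using that unfolding sum.distrib by (subst (1 2) sum.delta) auto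
    finally show ?thesis by auto
  qed
  have EM: "(E * M) $$ (i, j) = (if i = 0 then M $$ (0, j) else M $$ (i, j) - M $$ (i, 0) / ?p * M $$ (0, j))"
    if "i < ?n" "j < ?n" for i j
    using mult_mat_index[OF E M that] row[OF that(1), of "\<lambda>l. M $$ (l, j)"] by simp
  have "E * M * F = corner_block ?p (schur_compl M)"
  proof (rule eq_matI)
    fix i j assume "i < dim_row (corner_block ?p (schur_compl M))" "j < dim_col (corner_block ?p (schur_compl M))"
    then have ij: "i < ?n" "j < ?n" using M by (auto simp: corner_block_def schur_compl_def)
    have "(E * M * F) $$ (i, j) = (if j = 0 then (E * M) $$ (i, 0) else (E * M) $$ (i, j) - (E * M) $$ (i, 0) * M $$ (0, j) / ?p)"
      using mult_mat_index[OF mult_carrier_mat[OF E M] F ij] col[OF ij(2), of "\<lambda>l. (E * M) $$ (i, l)"] by simp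
    also have "\<dots> = corner_block ?p (schur_compl M) $$ (i, j)"
      using ij M p by (cases i; cases j) (auto simp: EM corner_block_def schur_compl_def field_simps)
    finally show "(E * M * F) $$ (i, j) = corner_block ?p (schur_compl M) $$ (i, j)" .
  qed (use M E F in \<open>auto simp: corner_block_def schur_compl_def\<close>)
  with E F dE dF that show thesis by blast
qed

lemma det_schur_compl:
  assumes M: "M \<in> carrier_mat (Suc k) (Suc k)" and p: "M $$ (0, 0) \<noteq> 0"
  shows "det M = M $$ (0, 0) * det (schur_compl M)"
proof -
  obtain E F where EF: "E \<in> carrier_mat (Suc k) (Suc k)" "F \<in> carrier_mat (Suc k) (Suc k)"
    "det E = 1" "det F = 1" "E * M * F = corner_block (M $$ (0, 0)) (schur_compl M)"
    by (rule pivot_elimination[OF M p])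
  have "det (E * M * F) = det M"
    using EF(1-4) M by (simp add: det_mult[of _ "Suc k"])
  then show ?thesis using EF(5) det_corner_block[OF schur_compl_carrier[OF M]] by simp
qed

lemma det_permute_rows_cols:
  assumes M: "M \<in> carrier_mat n n" and s: "s permutes {0..<n}" and t: "t permutes {0..<n}"
  shows "det (mat n n (\<lambda>(i, j). M $$ (s i, t j))) = signof s * signof t * det M"
proof -
  let ?N = "mat n n (\<lambda>(i, j). M $$ (i, t j))"
  have N: "?N \<in> carrier_mat n n" by simp
  have "det ?N = det (transpose_mat ?N)" by (simp add: det_transpose[OF N])
  also have "transpose_mat ?N = mat n n (\<lambda>(i, j). transpose_mat M $$ (t i, j))"
    using M permutes_in_image[OF t] by (intro eq_matI) auto
  also have "det \<dots> = signof t * det (transpose_mat M)"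
    by (rule det_permute_rows) (use M t in auto)
  finally have "det ?N = signof t * det M" by (simp add: det_transpose[OF M])
  moreover have "det (mat n n (\<lambda>(i, j). ?N $$ (s i, j))) = signof s * det ?N"
    by (rule det_permute_rows[OF N s])
  moreover have "mat n n (\<lambda>(i, j). ?N $$ (s i, j)) = mat n n (\<lambda>(i, j). M $$ (s i, t j))"
    using permutes_in_image[OF s] by (intro eq_matI) auto
  ultimately show ?thesis by simp
qed

definition diag_ones :: "nat \<Rightarrow> nat \<Rightarrow> complex mat" where
  "diag_ones n r = mat n n (\<lambda>(i, j). if i = j \<and> i < r then 1 else 0)"

lemma permutation_mat_mult:
  assumes M: "M \<in> carrier_mat n n" and s: "s permutes {0..<n}"
  defines "P \<equiv> mat n n (\<lambda>(i, j). if s i = j then 1 else 0 :: complex)"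
  defines "Q \<equiv> mat n n (\<lambda>(i, j). if s j = i then 1 else 0 :: complex)"
  shows "P * M = mat n n (\<lambda>(i, j). M $$ (s i, j))" "M * Q = mat n n (\<lambda>(i, j). M $$ (i, s j))"
    "det P \<noteq> 0" "det Q \<noteq> 0"
proof -
  have P: "P \<in> carrier_mat n n" and Q: "Q \<in> carrier_mat n n" by (simp_all add: P_def Q_def)
  have si: "i < n \<Longrightarrow> s i < n" for i using permutes_in_image[OF s, of i] by simp
  show "P * M = mat n n (\<lambda>(i, j). M $$ (s i, j))"
  proof (rule eq_matI)
    fix i j assume "i < dim_row (mat n n (\<lambda>(i, j). M $$ (s i, j)))" "j < dim_col (mat n n (\<lambda>(i, j). M $$ (s i, j)))"
    then have ij: "i < n" "j < n" by auto
    have "(P * M) $$ (i, j) = (\<Sum>l = 0..<n. if l = s i then M $$ (l, j) else 0)"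
      unfolding mult_mat_index[OF P M ij] using ij by (intro sum.cong) (auto simp: P_def)
    then show "(P * M) $$ (i, j) = mat n n (\<lambda>(i, j). M $$ (s i, j)) $$ (i, j)"
      using ij si by simp
  qed (use P M in auto)
  show "M * Q = mat n n (\<lambda>(i, j). M $$ (i, s j))"
  proof (rule eq_matI)
    fix i j assume "i < dim_row (mat n n (\<lambda>(i, j). M $$ (i, s j)))" "j < dim_col (mat n n (\<lambda>(i, j). M $$ (i, s j)))"
    then have ij: "i < n" "j < n" by auto
    have "(M * Q) $$ (i, j) = (\<Sum>l = 0..<n. if l = s j then M $$ (i, l) else 0)"
      unfolding mult_mat_index[OF M Q ij] using ij by (intro sum.cong) (auto simp: Q_def)
    then show "(M * Q) $$ (i, j) = mat n n (\<lambda>(i, j). M $$ (i, s j)) $$ (i, j)"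
      using ij si by simp
  qed (use Q M in auto)
  have "P = mat n n (\<lambda>(i, j). 1\<^sub>m n $$ (s i, j))"
    using si by (intro eq_matI) (auto simp: P_def)
  then have "det P = signof s * det (1\<^sub>m n)"
    using det_permute_rows[of "1\<^sub>m n :: complex mat" n s] s by simp
  then show dP: "det P \<noteq> 0" by (simp add: sign_def)
  have "Q = transpose_mat P" by (intro eq_matI) (auto simp: P_def Q_def)
  then show "det Q \<noteq> 0" using dP det_transpose[OF P] by simp
qed

text \<open>Gaussian elimination: a nonzero entry is swapped to the corner and cleared, and the
  induction hypothesis applies to the Schur complement.\<close>

theorem rank_normal_form:
  assumes "M \<in> carrier_mat n n"
  shows "\<exists>P Q r. P \<in> carrier_mat n n \<and> Q \<in> carrier_mat n n \<and> det P \<noteq> 0 \<and> det Q \<noteq> 0 \<and>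
    r \<le> n \<and> P * M * Q = diag_ones n r"
  using assms
proof (induction n arbitrary: M)
  case 0
  then show ?case by (intro exI[of _ "1\<^sub>m 0"] exI[of _ 0]) (auto simp: diag_ones_def)
next
  case (Suc k)
  let ?n = "Suc k"
  note M = Suc.prems
  show ?case
  proof (cases "\<exists>a < ?n. \<exists>b < ?n. M $$ (a, b) \<noteq> 0")
    case False
    then have "M = diag_ones ?n 0" using M by (intro eq_matI) (auto simp: diag_ones_def)
    then show ?thesis using M by (intro exI[of _ "1\<^sub>m ?n"] exI[of _ 0]) auto
  next
    case True
    then obtain a b where ab: "a < ?n" "b < ?n" and nz: "M $$ (a, b) \<noteq> 0" by blast
    define s where "s = Transposition.transpose 0 a"
    define t where "t = Transposition.transpose 0 b"
    have s: "s permutes {0..<?n}" and t: "t permutes {0..<?n}"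
      unfolding s_def t_def using ab by (auto intro!: permutes_swap_id)
    define P1 where "P1 = mat ?n ?n (\<lambda>(i, j). if s i = j then 1 else 0 :: complex)"
    define Q1 where "Q1 = mat ?n ?n (\<lambda>(i, j). if t j = i then 1 else 0 :: complex)"
    have PQ1: "P1 \<in> carrier_mat ?n ?n" "Q1 \<in> carrier_mat ?n ?n" by (simp_all add: P1_def Q1_def)
    have dPQ1: "det P1 \<noteq> 0" "det Q1 \<noteq> 0"
      unfolding P1_def Q1_def using permutation_mat_mult[OF M s] permutation_mat_mult[OF M t] by auto
    define M1 where "M1 = P1 * M * Q1"
    have M1: "M1 \<in> carrier_mat ?n ?n" using PQ1 M by (simp add: M1_def)
    have "P1 * M \<in> carrier_mat ?n ?n" using PQ1 M by simp
    from permutation_mat_mult(2)[OF this t] permutation_mat_mult(1)[OF M s]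
    have "M1 $$ (0, 0) = M $$ (a, b)"
      unfolding M1_def P1_def Q1_def using ab by (simp add: s_def t_def)
    with nz have p: "M1 $$ (0, 0) \<noteq> 0" by simp
    obtain E F where EF: "E \<in> carrier_mat ?n ?n" "F \<in> carrier_mat ?n ?n" "det E = 1" "det F = 1"
      "E * M1 * F = corner_block (M1 $$ (0, 0)) (schur_compl M1)"
      by (rule pivot_elimination[OF M1 p])
    let ?S = "schur_compl M1"
    have S: "?S \<in> carrier_mat k k" using M1 by simp
    from Suc.IH[OF S] obtain P' Q' r where IH: "P' \<in> carrier_mat k k" "Q' \<in> carrier_mat k k"
      "det P' \<noteq> 0" "det Q' \<noteq> 0" "r \<le> k" "P' * ?S * Q' = diag_ones k r" by blast
    \<comment> \<open>The corner entry turns the pivot into a one.\<close>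
    define P2 where "P2 = corner_block (1 / M1 $$ (0, 0)) P'"
    define Q2 where "Q2 = corner_block 1 Q'"
    have PQ2: "P2 \<in> carrier_mat ?n ?n" "Q2 \<in> carrier_mat ?n ?n" using IH by (simp_all add: P2_def Q2_def)
    have dPQ2: "det P2 \<noteq> 0" "det Q2 \<noteq> 0" using IH p by (simp_all add: P2_def Q2_def det_corner_block)
    have "P2 * (E * M1 * F) * Q2 = corner_block 1 (P' * ?S * Q')"
      unfolding EF(5) P2_def Q2_def using IH S p
      by (simp add: corner_block_mult[OF IH(1) S] corner_block_mult[OF mult_carrier_mat[OF IH(1) S] IH(2)])
    also have "\<dots> = diag_ones ?n (Suc r)"
      unfolding IH(6) by (intro eq_matI) (auto simp: corner_block_def diag_ones_def)
    finally have fin: "P2 * (E * M1 * F) * Q2 = diag_ones ?n (Suc r)" .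
    have "P2 * (E * M1 * F) * Q2 = (P2 * E * P1) * M * (Q1 * F * Q2)"
      unfolding M1_def using PQ1 PQ2 EF M by (simp add: assoc_mult_mat[of _ ?n ?n _ ?n _ ?n])
    moreover have "det (P2 * E * P1) \<noteq> 0" "det (Q1 * F * Q2) \<noteq> 0"
      using PQ1 PQ2 EF dPQ1 dPQ2 by (simp_all add: det_mult[of _ ?n])
    moreover have "P2 * E * P1 \<in> carrier_mat ?n ?n" "Q1 * F * Q2 \<in> carrier_mat ?n ?n"
      using PQ1 PQ2 EF by auto
    ultimately show ?thesis using fin IH(5) by (intro exI[of _ "P2 * E * P1"] exI[of _ "Q1 * F * Q2"] exI[of _ "Suc r"]) auto
  qed
qed

section \<open>Gradings by eigenvalues\<close>

text \<open>A Jordan matrix with its block structure forgotten: enough to make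
  \<open>Z |-> J1 * Z * J2\<close> triangular, with steps only between equal eigenvalues.\<close>

definition bidiagonal :: "nat \<Rightarrow> complex mat \<Rightarrow> bool" where
  "bidiagonal n J \<longleftrightarrow> J \<in> carrier_mat n n \<and>
     (\<forall>i < n. \<forall>j < n. i \<noteq> j \<and> J $$ (i, j) \<noteq> 0 \<longrightarrow> j = Suc i \<and> J $$ (i, i) = J $$ (j, j))"

lemma bidiagonal_jordan_matrix: "bidiagonal (sum_list (map fst n_as)) (jordan_matrix n_as)"
proof (induction n_as)
  case Nil
  then show ?case by (auto simp: bidiagonal_def jordan_matrix_def)
next
  case (Cons ka n_as)
  obtain k a where ka: "ka = (k, a)" by force
  let ?N = "sum_list (map fst n_as)"
  have J: "jordan_matrix n_as \<in> carrier_mat ?N ?N" by simp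
  show ?case
    unfolding bidiagonal_def
  proof (intro conjI allI impI)
    show "jordan_matrix (ka # n_as) \<in> carrier_mat (sum_list (map fst (ka # n_as))) (sum_list (map fst (ka # n_as)))"
      unfolding ka jordan_matrix_Cons using J by auto
  next
    fix i j assume ij: "i < sum_list (map fst (ka # n_as))" "j < sum_list (map fst (ka # n_as))"
      and nz: "i \<noteq> j \<and> jordan_matrix (ka # n_as) $$ (i, j) \<noteq> 0"
    show "j = Suc i" "jordan_matrix (ka # n_as) $$ (i, i) = jordan_matrix (ka # n_as) $$ (j, j)"
    proof -
      have "j = Suc i \<and> jordan_matrix (ka # n_as) $$ (i, i) = jordan_matrix (ka # n_as) $$ (j, j)"
      proof (cases "i < k \<or> j < k")
        case True
        then show ?thesis using ij nz J unfolding ka jordan_matrix_Cons by (auto split: if_splits)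
      next
        case False
        then have "i - k < ?N" "j - k < ?N" "i - k \<noteq> j - k" "jordan_matrix n_as $$ (i - k, j - k) \<noteq> 0"
          using ij nz J unfolding ka jordan_matrix_Cons by auto
        with Cons have "j - k = Suc (i - k)" "jordan_matrix n_as $$ (i - k, i - k) = jordan_matrix n_as $$ (j - k, j - k)"
          unfolding bidiagonal_def by blast+
        then show ?thesis using False ij J unfolding ka jordan_matrix_Cons by auto
      qed
      then show "j = Suc i" "jordan_matrix (ka # n_as) $$ (i, i) = jordan_matrix (ka # n_as) $$ (j, j)" by auto
    qed
  qed
qed

lemma similar_bidiagonal:
  assumes A: "A \<in> carrier_mat n n"
  obtains S S' J where "S \<in> carrier_mat n n" "S' \<in> carrier_mat n n" "S * S' = 1\<^sub>m n" "S' * S = 1\<^sub>m n"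
    "A = S * J * S'" "bidiagonal n J"
proof -
  from char_poly_factorized[OF A] obtain as where "char_poly A = (\<Prod>a\<leftarrow>as. [:- a, 1:])" by auto
  from jordan_nf_exists[OF A this] obtain n_as where sim: "similar_mat A (jordan_matrix n_as)"
    by (auto simp: jordan_nf_def)
  from similar_matD[OF sim] obtain k P Q where *: "{A, jordan_matrix n_as, P, Q} \<subseteq> carrier_mat k k"
    "P * Q = 1\<^sub>m k" "Q * P = 1\<^sub>m k" "A = P * jordan_matrix n_as * Q" by blast
  with A have "k = n" by auto
  moreover have "jordan_matrix n_as \<in> carrier_mat n n" using * \<open>k = n\<close> by auto
  then have "sum_list (map fst n_as) = n" by (metis carrier_matD(1) jordan_matrix_dim(1))
  then have "bidiagonal n (jordan_matrix n_as)" using bidiagonal_jordan_matrix by metis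
  ultimately show thesis using that * by auto
qed

text \<open>On matrix entries \<open>Z |-> J1 * Z * J2\<close> is triangular: the entry
  \<open>(a, b)\<close> receives only from \<open>(a, b)\<close>, \<open>(a + 1, b)\<close>,
  \<open>(a, b - 1)\<close> and \<open>(a + 1, b - 1)\<close>, and only where the eigenvalues agree.
  If the product of eigenvalues is not \<open>c\<close>, induction on \<open>n - a + b\<close> makes
  the entry vanish.\<close>

lemma bidiagonal_weight:
  assumes J1: "bidiagonal n J1" and J2: "bidiagonal n J2" and Z: "Z \<in> carrier_mat n n"
    and eq: "J1 * Z * J2 = c \<cdot>\<^sub>m Z"
    and ab: "a < n" "b < n" and nz: "Z $$ (a, b) \<noteq> 0"
  shows "J1 $$ (a, a) * J2 $$ (b, b) = c"
proof -
  have "J1 $$ (a, a) * J2 $$ (b, b) \<noteq> c \<longrightarrow> Z $$ (a, b) = 0"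
    using ab
  proof (induction "n - a + b" arbitrary: a b rule: less_induct)
    case less
    show ?case
    proof
      assume ne: "J1 $$ (a, a) * J2 $$ (b, b) \<noteq> c"
      have z: "J1 $$ (a, k) * Z $$ (k, l) * J2 $$ (l, b) = 0" if "k < n" "l < n" "(k, l) \<noteq> (a, b)" for k l
      proof (rule ccontr)
        assume "\<not> ?thesis"
        then have nz: "J1 $$ (a, k) \<noteq> 0" "Z $$ (k, l) \<noteq> 0" "J2 $$ (l, b) \<noteq> 0" by auto
        have 1: "k = a \<or> k = Suc a \<and> J1 $$ (a, a) = J1 $$ (k, k)"
          using J1 nz(1) that less.prems unfolding bidiagonal_def by blast
        have 2: "l = b \<or> b = Suc l \<and> J2 $$ (l, l) = J2 $$ (b, b)"
          using J2 nz(3) that less.prems unfolding bidiagonal_def by blast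
        from 1 2 ne have "J1 $$ (k, k) * J2 $$ (l, l) \<noteq> c" by auto
        moreover have "n - k + l < n - a + b" using 1 2 that less.prems by auto
        ultimately show False using less.hyps that(1,2) nz(2) by blast
      qed
      have "(\<Sum>l = 0..<n. J1 $$ (a, k) * Z $$ (k, l) * J2 $$ (l, b))
          = (if k = a then J1 $$ (a, a) * Z $$ (a, b) * J2 $$ (b, b) else 0)" if "k < n" for k
      proof (cases "k = a")
        case True
        then have "(\<Sum>l = 0..<n. J1 $$ (a, k) * Z $$ (k, l) * J2 $$ (l, b))
          = (\<Sum>l = 0..<n. if l = b then J1 $$ (a, a) * Z $$ (a, b) * J2 $$ (b, b) else 0)"
          using z that by (intro sum.cong) auto
        then show ?thesis using True less.prems by simp
      next
        case False
        then show ?thesis using z that by (auto intro!: sum.neutral)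
      qed
      then have "(J1 * Z * J2) $$ (a, b) = (\<Sum>k = 0..<n. if k = a then J1 $$ (a, a) * Z $$ (a, b) * J2 $$ (b, b) else 0)"
        using J1 J2 Z less.prems by (subst mult3_mat_index[of _ n]) (auto simp: bidiagonal_def intro!: sum.cong)
      also have "\<dots> = J1 $$ (a, a) * Z $$ (a, b) * J2 $$ (b, b)" using less.prems by simp
      finally have "(J1 * Z * J2) $$ (a, b) = J1 $$ (a, a) * Z $$ (a, b) * J2 $$ (b, b)" .
      moreover have "(J1 * Z * J2) $$ (a, b) = c * Z $$ (a, b)"
        unfolding eq using Z less.prems by simp
      ultimately have "(J1 $$ (a, a) * J2 $$ (b, b) - c) * Z $$ (a, b) = 0" by (auto simp: algebra_simps)
      with ne show "Z $$ (a, b) = 0" by auto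
    qed
  qed
  with nz show ?thesis by blast
qed

lemma bidiagonal_det_nonzero:
  assumes J: "bidiagonal n J" and d: "det J \<noteq> 0" and a: "a < n"
  shows "J $$ (a, a) \<noteq> 0"
proof -
  have Jc: "J \<in> carrier_mat n n" using J by (simp add: bidiagonal_def)
  have "upper_triangular J"
  proof (rule upper_triangularI)
    fix i j assume "j < i" "i < dim_row J"
    then have "j < n" "i < n" using Jc by auto
    with \<open>j < i\<close> J show "J $$ (i, j) = 0" unfolding bidiagonal_def by (metis Suc_n_not_le_n less_imp_le_nat nat_neq_iff)
  qed
  from det_upper_triangular[OF this Jc] d have "0 \<notin> set (diag_mat J)" by (simp add: prod_list_zero_iff)
  then show ?thesis using a Jc by (auto simp: diag_mat_def image_iff)
qed

text \<open>\<open>P\<close> and \<open>Q\<close> need not be diagonalisable, but Jordan bases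
  suffice for a statement about supports. The bases depend on \<open>P\<close> and \<open>Q\<close>
  only, so that the constant part and all coefficient matrices, eigenvectors of
  \<open>Z |-> P * Z * Q\<close> for different \<open>c\<close>, are graded at once.\<close>

theorem simultaneous_grading:
  assumes P: "P \<in> carrier_mat n n" and Q: "Q \<in> carrier_mat n n" and d: "det P \<noteq> 0" "det Q \<noteq> 0"
  obtains S S' T T' lam kap where
    "S \<in> carrier_mat n n" "S' \<in> carrier_mat n n" "S * S' = 1\<^sub>m n" "S' * S = 1\<^sub>m n"
    "T \<in> carrier_mat n n" "T' \<in> carrier_mat n n" "T * T' = 1\<^sub>m n" "T' * T = 1\<^sub>m n"
    "\<And>a. a < n \<Longrightarrow> lam a \<noteq> (0 :: complex)" "\<And>b. b < n \<Longrightarrow> kap b \<noteq> (0 :: complex)"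
    "\<And>Z c a b. Z \<in> carrier_mat n n \<Longrightarrow> P * Z * Q = c \<cdot>\<^sub>m Z \<Longrightarrow> a < n \<Longrightarrow> b < n \<Longrightarrow>
        (S' * Z * T) $$ (a, b) \<noteq> 0 \<Longrightarrow> lam a * kap b = c"
proof -
  obtain S S' J where S: "S \<in> carrier_mat n n" "S' \<in> carrier_mat n n" "S * S' = 1\<^sub>m n" "S' * S = 1\<^sub>m n"
    "P = S * J * S'" "bidiagonal n J" by (rule similar_bidiagonal[OF P])
  obtain T T' K where T: "T \<in> carrier_mat n n" "T' \<in> carrier_mat n n" "T * T' = 1\<^sub>m n" "T' * T = 1\<^sub>m n"
    "Q = T * K * T'" "bidiagonal n K" by (rule similar_bidiagonal[OF Q])
  have J: "J \<in> carrier_mat n n" and K: "K \<in> carrier_mat n n" using S T by (auto simp: bidiagonal_def)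
  have dJ: "det J \<noteq> 0" and dK: "det K \<noteq> 0"
    using d S T J K by (auto simp: det_mult[of _ n])
  have w: "J $$ (a, a) * K $$ (b, b) = c"
    if Z: "Z \<in> carrier_mat n n" and eq: "P * Z * Q = c \<cdot>\<^sub>m Z" and ab: "a < n" "b < n"
      and nz: "(S' * Z * T) $$ (a, b) \<noteq> 0" for Z c a b
  proof -
    have "S' * (P * Z * Q) * T = (S' * S) * J * (S' * Z * T) * K * (T' * T)"
      unfolding S(5) T(5) using S(1,2) T(1,2) J K Z
      by (simp add: assoc_mult_mat[of _ n n _ n _ n])
    also have "\<dots> = J * (S' * Z * T) * K"
      using S(1,2,4) T(1,2,4) J K Z by simp
    also have "S' * (P * Z * Q) * T = c \<cdot>\<^sub>m (S' * Z * T)"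
      unfolding eq using S(1,2) T(1,2) Z by (simp add: mult_smult_distrib mult_smult_assoc_mat[of _ n n _ n])
    finally have "J * (S' * Z * T) * K = c \<cdot>\<^sub>m (S' * Z * T)" ..
    then show ?thesis using bidiagonal_weight[OF S(6) T(6) _ _ ab nz] S(1,2) T(1,2) Z by auto
  qed
  show thesis
    by (rule that[OF S(1-4) T(1-4), of "\<lambda>a. J $$ (a, a)" "\<lambda>b. K $$ (b, b)"])
      (use w bidiagonal_det_nonzero[OF S(6) dJ] bidiagonal_det_nonzero[OF T(6) dK] in auto)
qed

text \<open>Moving the negative exponents to the other side gives an equation between natural
  numbers. Comparing multiplicities, the positive part of \<open>k i\<close> equals its negative
  part, so both are zero.\<close>

lemma prime_powers_independent:
  fixes p :: "nat \<Rightarrow> nat" and k :: "nat \<Rightarrow> int"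
  assumes pr: "\<And>i. prime (p i)" and inj: "inj p"
    and eq: "(\<Prod>i<m. (of_nat (p i) :: complex) powi k i) = 1" and i: "i < m"
  shows "k i = 0"
proof -
  have pos: "p i \<noteq> 0" for i using pr[of i] by auto
  have "(of_nat (p i) :: complex) powi k i = of_nat (p i ^ nat (k i)) / of_nat (p i ^ nat (- k i))" for i
    using pos[of i] by (simp add: power_int_def field_simps)
  then have "(\<Prod>i<m. (of_nat (p i ^ nat (k i)) :: complex)) / (\<Prod>i<m. of_nat (p i ^ nat (- k i))) = 1"
    using eq by (simp add: prod_dividef)
  then have "(\<Prod>i<m. (of_nat (p i ^ nat (k i)) :: complex)) = (\<Prod>i<m. of_nat (p i ^ nat (- k i)))"
    by (metis div_by_0 divide_eq_1_iff zero_neq_one)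
  then have "(of_nat (\<Prod>i<m. p i ^ nat (k i)) :: complex) = of_nat (\<Prod>i<m. p i ^ nat (- k i))"
    by simp
  then have eq': "(\<Prod>i<m. p i ^ nat (k i)) = (\<Prod>i<m. p i ^ nat (- k i))"
    using of_nat_eq_iff by blast
  have mult: "multiplicity (p i) (\<Prod>i<m. p i ^ f i) = f i" for f
  proof -
    have "(\<Prod>i<m. p i ^ f i) = (\<Prod>q\<in>p ` {..<m}. q ^ f (inv_into UNIV p q))"
      using inj by (subst prod.reindex) (auto intro: inj_on_subset simp: inv_f_f)
    also have "multiplicity (p i) \<dots> = f (inv_into UNIV p (p i))"
      using pr i by (subst multiplicity_prod_prime_powers) auto
    finally show ?thesis using inj by (simp add: inv_f_f)
  qed
  from eq' have "nat (k i) = nat (- k i)" using mult by metis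
  then show ?thesis by linarith
qed

text \<open>The eigenvalues are sorted into cosets of the free group generated by the primes; a
  representative of each coset turns them into integer exponent vectors.\<close>

lemma integer_weights:
  fixes lam kap :: "nat \<Rightarrow> complex" and p :: "nat \<Rightarrow> nat"
  assumes pr: "\<And>i. prime (p i)" and inj: "inj p"
    and nz: "\<And>a. a < n \<Longrightarrow> lam a \<noteq> 0" "\<And>b. b < n \<Longrightarrow> kap b \<noteq> 0"
  obtains mu nu :: "nat \<Rightarrow> nat \<Rightarrow> int" where
    "\<And>a i. i \<ge> m \<Longrightarrow> mu a i = 0" "\<And>a i. i \<ge> m \<Longrightarrow> nu a i = 0"
    "\<And>a b. a < n \<Longrightarrow> b < n \<Longrightarrow> lam a * kap b = 1 \<Longrightarrow> mu a = nu b"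
    "\<And>a b i. a < n \<Longrightarrow> b < n \<Longrightarrow> i < m \<Longrightarrow> lam a * kap b = of_nat (p i) \<Longrightarrow> mu a = (nu b)(i := nu b i + 1)"
proof -
  define E where "E k = (\<Prod>i<m. (of_nat (p i) :: complex) powi k i)" for k :: "nat \<Rightarrow> int"
  define ok where "ok k \<longleftrightarrow> (\<forall>i\<ge>m. k i = 0)" for k :: "nat \<Rightarrow> int"
  have pos: "(of_nat (p i) :: complex) \<noteq> 0" for i using pr[of i] by auto
  have Enz: "E k \<noteq> 0" for k unfolding E_def using pos by simp
  have Eadd: "E (\<lambda>i. k i + l i) = E k * E l" for k l
    unfolding E_def prod.distrib[symmetric] using pos by (simp add: power_int_add)
  have E0: "E (\<lambda>_. 0) = 1" by (simp add: E_def)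
  have Eneg: "E (\<lambda>i. - k i) = 1 / E k" for k
    using Eadd[of k "\<lambda>i. - k i"] Enz[of k] E0 by (simp add: field_simps)
  have Einj: "k = l" if "E k = E l" "ok k" "ok l" for k l
  proof
    fix i
    show "k i = l i"
    proof (cases "i < m")
      case True
      have "E (\<lambda>i. k i + - l i) = 1" unfolding Eadd Eneg using that(1) Enz by simp
      then have "(\<Prod>i<m. (of_nat (p i) :: complex) powi (k i + - l i)) = 1" by (simp add: E_def)
      from prime_powers_independent[OF pr inj this True] show ?thesis by simp
    next
      case False
      with that show ?thesis by (simp add: ok_def)
    qed
  qed
  define rel where "rel z w \<longleftrightarrow> (\<exists>k. ok k \<and> z = w * E k)" for z w
  have rel_refl: "rel z z" for z unfolding rel_def by (rule exI[of _ "\<lambda>_. 0"]) (simp add: ok_def E0)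
  have rel_sym: "rel w z" if "rel z w" for z w
  proof -
    from that obtain k where "ok k" "z = w * E k" by (auto simp: rel_def)
    then have "ok (\<lambda>i. - k i)" "w = z * E (\<lambda>i. - k i)" using Enz by (auto simp: Eneg ok_def)
    then show ?thesis unfolding rel_def by blast
  qed
  have rel_trans: "rel z w'" if "rel z w" "rel w w'" for z w w'
  proof -
    from that obtain k l where "ok k" "z = w * E k" "ok l" "w = w' * E l" by (auto simp: rel_def)
    then have "ok (\<lambda>i. l i + k i)" "z = w' * E (\<lambda>i. l i + k i)" by (auto simp: Eadd ok_def)
    then show ?thesis unfolding rel_def by blast
  qed
  \<comment> \<open>Equivalent numbers have the same predicate \<open>rel z\<close>, hence the same
    choice.\<close>
  define rep where "rep z = (SOME w. rel z w)" for z
  have rep: "rel z (rep z)" for z unfolding rep_def using rel_refl by (rule someI)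
  have rep_eq: "rep z = rep w" if "rel z w" for z w
  proof -
    have "rel z = rel w" using that rel_trans rel_sym by blast
    then show ?thesis by (simp add: rep_def)
  qed
  define e where "e z = (SOME k. ok k \<and> z = rep z * E k)" for z
  have e: "ok (e z)" "z = rep z * E (e z)" for z
    using rep[of z] someI_ex[of "\<lambda>k. ok k \<and> z = rep z * E k"] unfolding e_def rel_def by auto
  have e_shift: "e (w * E k) = (\<lambda>i. e w i + k i)" if "w \<noteq> 0" "ok k" for w k
  proof -
    let ?z = "w * E k"
    have "rel ?z w" using that(2) by (auto simp: rel_def)
    then have r: "rep ?z = rep w" by (rule rep_eq)
    have rn: "rep w \<noteq> 0" using e(2)[of w] that(1) by auto
    have "rep w * E (e ?z) = rep w * E (\<lambda>i. e w i + k i)"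
      using e(2)[of ?z] e(2)[of w] r by (simp add: Eadd mult.assoc[symmetric])
    then have "E (e ?z) = E (\<lambda>i. e w i + k i)" using rn by simp
    then show ?thesis by (rule Einj) (use e(1) that(2) in \<open>auto simp: ok_def\<close>)
  qed
  define eps :: "nat \<Rightarrow> nat \<Rightarrow> int" where "eps i = (\<lambda>l. if l = i then 1 else 0)" for i
  have Eeps: "E (eps i) = of_nat (p i)" if "i < m" for i
  proof -
    have "E (eps i) = (\<Prod>l<m. if l = i then of_nat (p l) else 1)"
      unfolding E_def eps_def by (intro prod.cong) auto
    then show ?thesis using that by simp
  qed
  show thesis
  \<comment> \<open>Columns use the inverse eigenvalue, since \<open>lam a * kap b = c\<close> says
    that \<open>lam a\<close> is \<open>c\<close> times \<open>1 / kap b\<close>; row and column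
    weights are then measured in the same coset.\<close>
  proof (rule that[of "\<lambda>a. e (lam a)" "\<lambda>b. e (1 / kap b)"])
    fix a b assume "a < n" "b < n" "lam a * kap b = 1"
    then show "e (lam a) = e (1 / kap b)" using nz(2)[of b] by (metis nonzero_eq_divide_eq)
  next
    fix a b i assume *: "a < n" "b < n" "i < m" "lam a * kap b = of_nat (p i)"
    then have "lam a = 1 / kap b * E (eps i)" using nz(2)[of b] by (simp add: Eeps field_simps)
    then show "e (lam a) = (e (1 / kap b))(i := e (1 / kap b) i + 1)"
      using e_shift[of "1 / kap b" "eps i"] nz(2)[of b] * by (auto simp: ok_def eps_def)
  qed (use e(1) in \<open>auto simp: ok_def\<close>)
qed

section \<open>Multihomogeneous functions and permanents\<close>

text \<open>A monomial in the variables \<open>y i j\<close> is a list of index pairs.  Degrees are taken in each row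
  separately and are integers, so that a negative multidegree forces the zero function.\<close>

definition mon :: "(nat \<times> nat) list \<Rightarrow> (nat \<Rightarrow> nat \<Rightarrow> complex) \<Rightarrow> complex" where
  "mon L y = (\<Prod>q\<leftarrow>L. y (fst q) (snd q))"

definition mdeg :: "(nat \<times> nat) list \<Rightarrow> nat \<Rightarrow> int" where
  "mdeg L i = int (length (filter (\<lambda>q. fst q = i) L))"

definition mhom :: "(nat \<Rightarrow> int) \<Rightarrow> ((nat \<Rightarrow> nat \<Rightarrow> complex) \<Rightarrow> complex) \<Rightarrow> bool" where
  "mhom \<alpha> \<phi> \<longleftrightarrow> (\<exists>ts. (\<forall>t \<in> set ts. mdeg (snd t) = \<alpha>) \<and>
     (\<forall>y. \<phi> y = (\<Sum>t\<leftarrow>ts. fst t * mon (snd t) y)))"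

lemma mhom_zero [simp]: "mhom \<alpha> (\<lambda>_. 0)"
  unfolding mhom_def by (rule exI[of _ "[]"]) simp

lemma mhom_mon: "mdeg L = \<alpha> \<Longrightarrow> mhom \<alpha> (\<lambda>y. c * mon L y)"
  unfolding mhom_def by (rule exI[of _ "[(c, L)]"]) simp

lemma mhom_add:
  assumes "mhom \<alpha> \<phi>" "mhom \<alpha> \<psi>" shows "mhom \<alpha> (\<lambda>y. \<phi> y + \<psi> y)"
proof -
  from assms obtain ts us where
    "\<forall>t \<in> set ts. mdeg (snd t) = \<alpha>" "\<forall>y. \<phi> y = (\<Sum>t\<leftarrow>ts. fst t * mon (snd t) y)"
    "\<forall>t \<in> set us. mdeg (snd t) = \<alpha>" "\<forall>y. \<psi> y = (\<Sum>t\<leftarrow>us. fst t * mon (snd t) y)"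
    unfolding mhom_def by blast
  then show ?thesis unfolding mhom_def by (intro exI[of _ "ts @ us"]) auto
qed

lemma mhom_induct [consumes 1, case_names zero add]:
  assumes h: "mhom \<alpha> \<phi>" and z: "P (\<lambda>_. 0)"
    and s: "\<And>c L \<psi>. mdeg L = \<alpha> \<Longrightarrow> mhom \<alpha> \<psi> \<Longrightarrow> P \<psi> \<Longrightarrow> P (\<lambda>y. c * mon L y + \<psi> y)"
  shows "P \<phi>"
proof -
  from h obtain ts where ts: "\<forall>t \<in> set ts. mdeg (snd t) = \<alpha>" "\<forall>y. \<phi> y = (\<Sum>t\<leftarrow>ts. fst t * mon (snd t) y)"
    unfolding mhom_def by blast
  then have \<phi>: "\<phi> = (\<lambda>y. \<Sum>t\<leftarrow>ts. fst t * mon (snd t) y)" by auto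
  have "P (\<lambda>y. \<Sum>t\<leftarrow>ts. fst t * mon (snd t) y)"
    using ts(1)
  proof (induction ts)
    case Nil
    then show ?case using z by simp
  next
    case (Cons t ts)
    have "mhom \<alpha> (\<lambda>y. \<Sum>t\<leftarrow>ts. fst t * mon (snd t) y)"
      unfolding mhom_def using Cons.prems by (intro exI[of _ ts]) auto
    from s[OF _ this, of "snd t" "fst t"] Cons show ?case by simp
  qed
  then show ?thesis by (simp add: \<phi>)
qed

lemma mon_append: "mon (L @ M) y = mon L y * mon M y"
  by (simp add: mon_def)

lemma mdeg_append: "mdeg (L @ M) = (\<lambda>i. mdeg L i + mdeg M i)"
  by (auto simp: mdeg_def)

lemma mhom_mon_mult:
  assumes "mdeg L = \<alpha>" "mhom \<beta> \<psi>" shows "mhom (\<lambda>i. \<alpha> i + \<beta> i) (\<lambda>y. c * mon L y * \<psi> y)"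
  using assms(2)
proof (induction rule: mhom_induct)
  case zero
  then show ?case by simp
next
  case (add d M \<psi>)
  have "mhom (\<lambda>i. \<alpha> i + \<beta> i) (\<lambda>y. (c * d) * mon (L @ M) y)"
    by (rule mhom_mon) (use assms(1) add in \<open>simp add: mdeg_append\<close>)
  from mhom_add[OF this add(3)] show ?case by (simp add: mon_append algebra_simps)
qed

lemma mhom_mult:
  assumes "mhom \<alpha> \<phi>" "mhom \<beta> \<psi>" shows "mhom (\<lambda>i. \<alpha> i + \<beta> i) (\<lambda>y. \<phi> y * \<psi> y)"
  using assms(1)
proof (induction rule: mhom_induct)
  case zero
  then show ?case by simp
next
  case (add c L \<phi>)
  from mhom_add[OF mhom_mon_mult[OF add(1) assms(2), of c] add(3)]
  show ?case by (simp add: algebra_simps)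
qed

lemma mhom_const [simp]: "mhom (\<lambda>_. 0) (\<lambda>_. c)"
  using mhom_mon[of "[]" "\<lambda>_. 0" c] by (simp add: mdeg_def mon_def fun_eq_iff)

lemma mhom_cmult: "mhom \<alpha> \<phi> \<Longrightarrow> mhom \<alpha> (\<lambda>y. c * \<phi> y)"
  using mhom_mult[OF mhom_const, of \<alpha> \<phi> c] by simp

lemma mhom_sum: "finite A \<Longrightarrow> (\<And>a. a \<in> A \<Longrightarrow> mhom \<alpha> (\<phi> a)) \<Longrightarrow> mhom \<alpha> (\<lambda>y. \<Sum>a\<in>A. \<phi> a y)"
  by (induction A rule: finite_induct) (auto intro: mhom_add)

lemma mhom_prod:
  "finite A \<Longrightarrow> (\<And>a. a \<in> A \<Longrightarrow> mhom (\<alpha> a) (\<phi> a)) \<Longrightarrow> mhom (\<lambda>i. \<Sum>a\<in>A. \<alpha> a i) (\<lambda>y. \<Prod>a\<in>A. \<phi> a y)"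
  by (induction A rule: finite_induct) (auto intro: mhom_mult)

lemma mhom_var: "mhom (\<lambda>k. if k = i then 1 else 0) (\<lambda>y. y i j)"
proof -
  have "mdeg [(i, j)] = (\<lambda>k. if k = i then 1 else 0)" by (auto simp: mdeg_def)
  from mhom_mon[OF this, of 1] show ?thesis by (simp add: mon_def)
qed

lemma mhom_neg:
  assumes "mhom \<alpha> \<phi>" "\<alpha> i < 0" shows "\<phi> y = 0"
  using assms
proof (induction rule: mhom_induct)
  case (add c L \<psi>)
  then have "mdeg L i < 0" by simp
  then show ?case by (simp add: mdeg_def)
qed simp

lemma mon_scale_row:
  "mon L (\<lambda>k j. (if k = i then c else 1) * y k j) = c ^ length (filter (\<lambda>q. fst q = i) L) * mon L y"
  by (induction L) (auto simp: mon_def)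

lemma mhom_scale_row:
  assumes "mhom \<alpha> \<phi>"
  shows "\<phi> (\<lambda>k j. (if k = i then c else 1) * y k j) = c ^ nat (\<alpha> i) * \<phi> y"
  using assms
proof (induction rule: mhom_induct)
  case (add d L \<psi>)
  from add(1) have "nat (\<alpha> i) = length (filter (\<lambda>q. fst q = i) L)" by (auto simp: mdeg_def)
  then show ?case unfolding mon_scale_row add(3) by (simp add: algebra_simps)
qed simp

lemma length_eq_sum_mdeg:
  assumes "\<And>i. i \<ge> m \<Longrightarrow> mdeg L i = 0"
  shows "int (length L) = (\<Sum>i<m. mdeg L i)"
  using assms
proof (induction L)
  case (Cons q L)
  have cons: "mdeg (q # L) i = mdeg L i + (if i = fst q then 1 else 0)" for i by (simp add: mdeg_def)
  have nn: "mdeg L i \<ge> 0" for i by (simp add: mdeg_def)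
  have "mdeg L i = 0" if "i \<ge> m" for i using Cons.prems[OF that] nn[of i] by (auto simp: cons split: if_splits)
  with Cons.IH have IH: "int (length L) = (\<Sum>i<m. mdeg L i)" by blast
  have "fst q < m"
  proof (rule ccontr)
    assume "\<not> fst q < m"
    then have "mdeg (q # L) (fst q) = 0" using Cons.prems by auto
    then show False using nn[of "fst q"] by (simp add: cons)
  qed
  then show ?case using IH by (simp add: cons sum.distrib)
qed (simp add: mdeg_def)

lemma mhom_scale_all:
  assumes "mhom \<alpha> \<phi>" "\<And>i. i \<ge> m \<Longrightarrow> \<alpha> i = 0"
  shows "\<phi> (\<lambda>k j. s * y k j) = s ^ nat (\<Sum>i<m. \<alpha> i) * \<phi> y"
  using assms(1)
proof (induction rule: mhom_induct)
  case (add d L \<psi>)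
  have "int (length L) = (\<Sum>i<m. \<alpha> i)"
    using length_eq_sum_mdeg[of m L] add(1) assms(2) by simp
  then have "length L = nat (\<Sum>i<m. \<alpha> i)" by linarith
  moreover have "mon L (\<lambda>k j. s * y k j) = s ^ length L * mon L y"
    by (induction L) (auto simp: mon_def)
  ultimately show ?case unfolding add(3) by (simp add: algebra_simps)
qed simp

lemma mdeg_nonzero_iff: "mdeg L i \<noteq> 0 \<longleftrightarrow> (\<exists>q \<in> set L. fst q = i)"
  by (auto simp: mdeg_def filter_empty_conv)

lemma mhom_local:
  assumes "mhom \<alpha> \<phi>" "\<And>i. \<alpha> i \<noteq> 0 \<Longrightarrow> y i = y' i"
  shows "\<phi> y = \<phi> y'"
  using assms(1)
proof (induction rule: mhom_induct)
  case (add d L \<psi>)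
  have "y (fst q) = y' (fst q)" if "q \<in> set L" for q
    by (rule assms(2)) (use add(1) mdeg_nonzero_iff that in blast)
  then have "mon L y = mon L y'" unfolding mon_def by (intro arg_cong[where f = prod_list] map_cong) auto
  then show ?case using add by simp
qed simp

lemma mhom_zero_row:
  assumes "mhom \<alpha> \<phi>" "\<alpha> i \<noteq> 0" "\<And>j. y i j = 0"
  shows "\<phi> y = 0"
  using assms(1)
proof (induction rule: mhom_induct)
  case (add d L \<psi>)
  from assms(2) add(1) obtain q where "q \<in> set L" "fst q = i" using mdeg_nonzero_iff by blast
  then have "0 \<in> set (map (\<lambda>q. y (fst q) (snd q)) L)" using assms(3) by force
  then have "mon L y = 0" unfolding mon_def by (simp add: prod_list_zero_iff)
  then show ?case using add by simp
qed simp

lemma mhom_at_zero: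
  assumes "mhom \<alpha> \<phi>" "\<phi> (\<lambda>_ _. 0) \<noteq> 0" shows "\<alpha> = (\<lambda>_. 0)"
  using assms mhom_zero_row by fastforce

lemma mhom_nonneg:
  assumes "mhom \<alpha> \<phi>" "\<phi> y \<noteq> 0" shows "\<alpha> i \<ge> 0"
  using assms mhom_neg not_le by blast

text \<open>Scaling row \<open>i\<close> by two reads off the degree in that row, as the powers of
  two are distinct.\<close>

lemma mhom_unique:
  assumes "mhom \<alpha> \<phi>" "mhom \<beta> \<phi>" "\<phi> y \<noteq> 0" shows "\<alpha> = \<beta>"
proof
  fix i
  have "(2 :: complex) ^ nat (\<alpha> i) = 2 ^ nat (\<beta> i)"
    using mhom_scale_row[OF assms(1), of i 2 y] mhom_scale_row[OF assms(2), of i 2 y] assms(3) by simp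
  then have "of_nat (2 ^ nat (\<alpha> i)) = (of_nat (2 ^ nat (\<beta> i)) :: complex)" by simp
  then have "(2 :: nat) ^ nat (\<alpha> i) = 2 ^ nat (\<beta> i)" using of_nat_eq_iff by blast
  then have "nat (\<alpha> i) = nat (\<beta> i)" by simp
  then show "\<alpha> i = \<beta> i" using mhom_nonneg[OF assms(1,3), of i] mhom_nonneg[OF assms(2,3), of i] by simp
qed

definition linear_form :: "((nat \<Rightarrow> complex) \<Rightarrow> complex) \<Rightarrow> bool" where
  "linear_form \<psi> \<longleftrightarrow> (\<forall>v w. \<psi> (\<lambda>j. v j + w j) = \<psi> v + \<psi> w) \<and> (\<forall>c v. \<psi> (\<lambda>j. c * v j) = c * \<psi> v)"

lemma mhom_linear:
  assumes "mhom (\<lambda>k. if k = i then 1 else 0) \<phi>"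
  obtains \<psi> where "linear_form \<psi>" "\<And>y. \<phi> y = \<psi> (y i)"
proof -
  have "\<exists>\<psi>. linear_form \<psi> \<and> (\<forall>y. \<phi> y = \<psi> (y i))"
    using assms
  proof (induction rule: mhom_induct)
    case zero
    then show ?case by (intro exI[of _ "\<lambda>_. 0"]) (simp add: linear_form_def)
  next
    case (add c L \<phi>)
    from add(3) obtain \<psi> where \<psi>: "linear_form \<psi>" "\<forall>y. \<phi> y = \<psi> (y i)" by blast
    have fst: "fst q = i" if "q \<in> set L" for q
    proof (rule ccontr)
      assume "fst q \<noteq> i"
      then have "mdeg L (fst q) = 0" using add(1) by simp
      then show False using that mdeg_nonzero_iff by blast
    qed
    then have "filter (\<lambda>q. fst q = i) L = L" by (simp add: filter_id_conv)
    then have "length L = 1" using add(1) by (auto simp: mdeg_def fun_eq_iff split: if_splits)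
    then obtain q where q: "L = [q]" by (cases L) auto
    with fst have "fst q = i" by simp
    then have "c * mon L y + \<phi> y = c * y i (snd q) + \<psi> (y i)" for y using \<psi>(2) by (simp add: q mon_def)
    then show ?case using \<psi>(1)
      by (intro exI[of _ "\<lambda>v. c * v (snd q) + \<psi> v"]) (auto simp: linear_form_def algebra_simps)
  qed
  with that show thesis by blast
qed

text \<open>Beyond fixing row \<open>i0\<close>, column \<open>j0\<close> is emptied in all other
  rows, so that the expansion of a permanent along row \<open>i0\<close> keeps the single term with
  \<open>v j0\<close>.\<close>

definition subst_row :: "nat \<Rightarrow> (nat \<Rightarrow> complex) \<Rightarrow> nat \<Rightarrow> (nat \<Rightarrow> nat \<Rightarrow> complex) \<Rightarrow> nat \<Rightarrow> nat \<Rightarrow> complex" where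
  "subst_row i0 v j0 y i j = (if i = i0 then v j else if j = j0 then 0 else y i j)"

lemma mon_subst_row: "\<exists>c. \<forall>y. mon L (subst_row i v j y) = c * mon (filter (\<lambda>q. fst q \<noteq> i) L) y"
proof (induction L)
  case Nil
  then show ?case by (intro exI[of _ 1]) (simp add: mon_def)
next
  case (Cons q L)
  then obtain c where c: "\<forall>y. mon L (subst_row i v j y) = c * mon (filter (\<lambda>q. fst q \<noteq> i) L) y" by blast
  show ?case
    by (rule exI[of _ "c * (if fst q = i then v (snd q) else if snd q = j then 0 else 1)"])
      (use c in \<open>auto simp: mon_def subst_row_def\<close>)
qed

lemma mhom_subst_row:
  assumes "mhom \<alpha> \<phi>" shows "mhom (\<alpha>(i := 0)) (\<lambda>y. \<phi> (subst_row i v j y))"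
  using assms
proof (induction rule: mhom_induct)
  case (add d L \<psi>)
  obtain c where c: "\<forall>y. mon L (subst_row i v j y) = c * mon (filter (\<lambda>q. fst q \<noteq> i) L) y"
    using mon_subst_row by blast
  have "mdeg (filter (\<lambda>q. fst q \<noteq> i) L) = \<alpha>(i := 0)"
  proof
    fix x
    have "filter (\<lambda>q. fst q = x \<and> fst q \<noteq> i) L = (if x = i then [] else filter (\<lambda>q. fst q = x) L)"
      by (induction L) auto
    then show "mdeg (filter (\<lambda>q. fst q \<noteq> i) L) x = (\<alpha>(i := 0)) x"
      using add(1) by (auto simp: mdeg_def conj_commute)
  qed
  from mhom_add[OF mhom_mon[OF this, of "d * c"] add(3)] show ?case by (simp add: c mult.assoc)
qed simp

text \<open>Every Leibniz term uses each row weight and each column weight once, so all terms have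
  one common multidegree.\<close>

lemma mhom_det:
  assumes X: "\<And>a b. a < n \<Longrightarrow> b < n \<Longrightarrow> mhom (\<lambda>i. \<mu> a i - \<nu> b i) (X a b)"
  shows "mhom (\<lambda>i. (\<Sum>a<n. \<mu> a i) - (\<Sum>b<n. \<nu> b i)) (\<lambda>y. det (mat n n (\<lambda>(a, b). X a b y)))"
proof -
  have "mhom (\<lambda>i. (\<Sum>a<n. \<mu> a i) - (\<Sum>b<n. \<nu> b i)) (\<lambda>y. signof p * (\<Prod>a = 0..<n. X a (p a) y))"
    if p: "p permutes {0..<n}" for p
  proof (rule mhom_cmult)
    have "mhom (\<lambda>i. \<Sum>a = 0..<n. \<mu> a i - \<nu> (p a) i) (\<lambda>y. \<Prod>a = 0..<n. X a (p a) y)"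
      using permutes_in_image[OF p] by (intro mhom_prod X) auto
    moreover have "(\<Sum>a = 0..<n. \<mu> a i - \<nu> (p a) i) = (\<Sum>a<n. \<mu> a i) - (\<Sum>b<n. \<nu> b i)" for i
      using sum.permute[OF p, of "\<lambda>b. \<nu> b i"] by (simp add: sum_subtractf atLeast0LessThan comp_def)
    ultimately show "mhom (\<lambda>i. (\<Sum>a<n. \<mu> a i) - (\<Sum>b<n. \<nu> b i)) (\<lambda>y. \<Prod>a = 0..<n. X a (p a) y)" by simp
  qed
  moreover have "det (mat n n (\<lambda>(a, b). X a b y)) =
      (\<Sum>p | p permutes {0..<n}. signof p * (\<Prod>a = 0..<n. X a (p a) y))" for y
    using permutes_in_image by (subst det_def'[of _ n]) (auto intro!: sum.cong prod.cong)
  ultimately show ?thesis by (simp only:) (intro mhom_sum, auto simp: finite_permutations)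
qed

text \<open>The permanent of the rows below \<open>k\<close> and the columns in \<open>J\<close>,
  expanded along the last row; this reading supposes \<open>card J = k\<close>. The column set as an
  argument keeps minors within the same notion.\<close>

fun pm :: "nat \<Rightarrow> nat set \<Rightarrow> (nat \<Rightarrow> nat \<Rightarrow> complex) \<Rightarrow> complex" where
  "pm 0 J y = 1"
| "pm (Suc k) J y = (\<Sum>j\<in>J. y k j * pm k (J - {j}) y)"

lemma pm_cong: "(\<And>i j. i < k \<Longrightarrow> j \<in> J \<Longrightarrow> y i j = y' i j) \<Longrightarrow> pm k J y = pm k J y'"
proof (induction k arbitrary: J)
  case (Suc k)
  have "pm k (J - {j}) y = pm k (J - {j}) y'" for j
    by (rule Suc.IH) (use Suc.prems in auto)
  with Suc.prems show ?case by (auto intro!: sum.cong)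
qed simp

lemma pm_zero_col:
  assumes "finite J" "card J = k" "j \<in> J" "\<And>i. i < k \<Longrightarrow> y i j = 0"
  shows "pm k J y = 0"
  using assms
proof (induction k arbitrary: J)
  case (Suc k)
  have "y k j' * pm k (J - {j'}) y = 0" if "j' \<in> J" for j'
  proof (cases "j' = j")
    case False
    with Suc that have "pm k (J - {j'}) y = 0" by (intro Suc.IH) auto
    then show ?thesis by simp
  qed (use Suc.prems in auto)
  then show ?case by simp
qed simp

lemma pm_subst_row:
  assumes "finite J" "card J = Suc k" "j \<in> J"
  shows "pm (Suc k) J (subst_row k v j y) = v j * pm k (J - {j}) y"
proof -
  let ?y = "subst_row k v j y"
  have "v j' * pm k (J - {j'}) ?y = 0" if "j' \<in> J - {j}" for j'
    using assms that pm_zero_col[of "J - {j'}" k j ?y] by (auto simp: subst_row_def)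
  then have "(\<Sum>j'\<in>J. v j' * pm k (J - {j'}) ?y) = v j * pm k (J - {j}) ?y"
    using assms by (subst sum.remove[of _ j]) (auto simp: sum.neutral simp del: mult_eq_0_iff)
  moreover have "pm k (J - {j}) ?y = pm k (J - {j}) y"
    by (rule pm_cong) (auto simp: subst_row_def)
  ultimately show ?thesis by (simp add: subst_row_def)
qed

lemma pm_nonzero:
  assumes "finite J" "card J = k" shows "\<exists>y. pm k J y \<noteq> 0"
  using assms
proof (induction k arbitrary: J)
  case (Suc k)
  then obtain j where j: "j \<in> J" by (metis card_eq_0_iff ex_in_conv nat.distinct(1))
  with Suc have "\<exists>y. pm k (J - {j}) y \<noteq> 0" by (intro Suc.IH) auto
  then obtain y where "pm k (J - {j}) y \<noteq> 0" ..
  then have "pm (Suc k) J (subst_row k (\<lambda>_. 1) j y) \<noteq> 0"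
    by (subst pm_subst_row) (use Suc j in auto)
  then show ?case by blast
qed simp

lemma mhom_pm: "finite J \<Longrightarrow> mhom (\<lambda>i. if i < k then 1 else 0) (pm k J)"
proof (induction k arbitrary: J)
  case 0
  have "pm 0 J = (\<lambda>_. 1)" by auto
  then show ?case by simp
next
  case (Suc k)
  have "mhom (\<lambda>i. (if i = k then 1 else 0) + (if i < k then 1 else 0)) (\<lambda>y. y k j * pm k (J - {j}) y)" for j
    using mhom_mult[OF mhom_var Suc.IH[of "J - {j}"]] Suc.prems by simp
  moreover have "(\<lambda>i. (if i = k then 1 else 0) + (if i < k then 1 else 0)) = (\<lambda>i. if i < Suc k then 1 else 0 :: int)"
    by auto
  ultimately have "mhom (\<lambda>i. if i < Suc k then 1 else 0) (\<lambda>y. y k j * pm k (J - {j}) y)" for j by simp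
  from mhom_sum[OF Suc.prems this] show ?case by simp
qed

text \<open>Extensional, so that each term of the permanent is counted once.\<close>

definition injections :: "nat \<Rightarrow> nat set \<Rightarrow> (nat \<Rightarrow> nat) set" where
  "injections k J = {s \<in> extensional {0..<k}. bij_betw s {0..<k} J}"

lemma pm_injections:
  assumes "finite J" "card J = k"
  shows "pm k J y = (\<Sum>s\<in>injections k J. \<Prod>i = 0..<k. y i (s i))"
  using assms
proof (induction k arbitrary: J)
  case 0
  then have "injections 0 J = {\<lambda>_. undefined}" by (auto simp: injections_def bij_betw_def)
  then show ?case by simp
next
  case (Suc k)
  have fin: "finite (injections k (J - {j}))" for j
  proof (rule finite_subset)
    show "injections k (J - {j}) \<subseteq> {0..<k} \<rightarrow>\<^sub>E J"
      by (auto simp: injections_def PiE_def bij_betw_def)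
    show "finite ({0..<k} \<rightarrow>\<^sub>E J)" using Suc by (intro finite_PiE) auto
  qed
  have "pm (Suc k) J y = (\<Sum>j\<in>J. \<Sum>s\<in>injections k (J - {j}). y k j * (\<Prod>i = 0..<k. y i (s i)))"
    using Suc by (simp add: sum_distrib_left)
  also have "\<dots> = (\<Sum>(j, s)\<in>Sigma J (\<lambda>j. injections k (J - {j})). y k j * (\<Prod>i = 0..<k. y i (s i)))"
    using Suc.prems fin by (intro sum.Sigma) auto
  also have "\<dots> = (\<Sum>s\<in>injections (Suc k) J. \<Prod>i = 0..<Suc k. y i (s i))"
  proof (rule sum.reindex_bij_witness[where i = "\<lambda>s. (s k, restrict s {0..<k})" and j = "\<lambda>(j, s). s(k := j)"])
    fix x assume "x \<in> Sigma J (\<lambda>j. injections k (J - {j}))"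
    then obtain j s where x: "x = (j, s)" "j \<in> J" "s \<in> extensional {0..<k}" "bij_betw s {0..<k} (J - {j})"
      by (auto simp: injections_def)
    show "((case x of (j, s) \<Rightarrow> s(k := j)) k, restrict (case x of (j, s) \<Rightarrow> s(k := j)) {0..<k}) = x"
      using x by (auto simp: fun_eq_iff extensional_def)
    have "bij_betw (s(k := j)) (insert k {0..<k}) (insert j (J - {j}))"
      using x(2,4) by (intro bij_betw_combine[where A = "{k}" and C = "{0..<k}" and B = "{j}", simplified])
        (auto simp: bij_betw_def inj_on_def)
    then have "bij_betw (s(k := j)) {0..<Suc k} J"
      using x(2) by (simp add: insert_absorb atLeast0_lessThan_Suc)
    then show "(case x of (j, s) \<Rightarrow> s(k := j)) \<in> injections (Suc k) J"
      using x by (auto simp: injections_def extensional_def)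
    show "(\<Prod>i = 0..<Suc k. y i ((case x of (j, s) \<Rightarrow> s(k := j)) i)) = (case x of (j, s) \<Rightarrow> y k j * (\<Prod>i = 0..<k. y i (s i)))"
      using x by (simp add: mult.commute)
  next
    fix s assume "s \<in> injections (Suc k) J"
    then have s: "s \<in> extensional {0..<Suc k}" "bij_betw s {0..<Suc k} J" by (auto simp: injections_def)
    show "(case (s k, restrict s {0..<k}) of (j, s) \<Rightarrow> s(k := j)) = s"
      using s(1) by (auto simp: fun_eq_iff extensional_def)
    have "bij_betw s ({0..<Suc k} - {k}) (J - {s k})"
      using s(2) by (intro bij_betw_DiffI) (auto simp: bij_betw_def)
    moreover have "{0..<Suc k} - {k} = {0..<k}" by auto
    ultimately have "bij_betw (restrict s {0..<k}) {0..<k} (J - {s k})"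
      by (simp add: bij_betw_restrict_eq)
    moreover have "s k \<in> J" using s(2) by (auto simp: bij_betw_def)
    ultimately show "(s k, restrict s {0..<k}) \<in> Sigma J (\<lambda>j. injections k (J - {j}))"
      by (auto simp: injections_def)
  qed
  finally show ?case .
qed

lemma pm_permutes: "pm m {0..<m} y = (\<Sum>\<sigma> | \<sigma> permutes {0..<m}. \<Prod>i = 0..<m. y i (\<sigma> i))"
proof -
  have "pm m {0..<m} y = (\<Sum>s\<in>injections m {0..<m}. \<Prod>i = 0..<m. y i (s i))"
    by (rule pm_injections) auto
  also have "\<dots> = (\<Sum>\<sigma> | \<sigma> permutes {0..<m}. \<Prod>i = 0..<m. y i (\<sigma> i))"
  proof (rule sum.reindex_bij_witness[where i = "\<lambda>p. restrict p {0..<m}" and j = "\<lambda>s i. if i < m then s i else i"])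
    fix s assume "s \<in> injections m {0..<m}"
    then have s: "s \<in> extensional {0..<m}" "bij_betw s {0..<m} {0..<m}" by (auto simp: injections_def)
    show "restrict (\<lambda>i. if i < m then s i else i) {0..<m} = s"
      using s(1) by (auto simp: fun_eq_iff extensional_def)
    have "bij_betw (\<lambda>i. if i < m then s i else i) {0..<m} {0..<m}"
      using s(2) by (subst bij_betw_cong[where g = s]) auto
    then show "(\<lambda>i. if i < m then s i else i) \<in> {\<sigma>. \<sigma> permutes {0..<m}}"
      by (auto intro: bij_imp_permutes)
  next
    fix p assume "p \<in> {\<sigma>. \<sigma> permutes {0..<m}}"
    then have p: "p permutes {0..<m}" by simp
    show "(\<lambda>i. if i < m then restrict p {0..<m} i else i) = p"
      using p by (auto simp: fun_eq_iff permutes_def)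
    show "restrict p {0..<m} \<in> injections m {0..<m}"
      using permutes_imp_bij[OF p] by (simp add: injections_def bij_betw_restrict_eq)
  qed auto
  finally show ?thesis .
qed

section \<open>Weighted determinantal representations\<close>

definition eval_mat :: "nat \<Rightarrow> (nat \<Rightarrow> nat \<Rightarrow> (nat \<Rightarrow> nat \<Rightarrow> complex) \<Rightarrow> complex) \<Rightarrow> (nat \<Rightarrow> nat \<Rightarrow> complex) \<Rightarrow> complex mat" where
  "eval_mat n X y = mat n n (\<lambda>(a, b). X a b y)"

lemma eval_mat_carrier [simp]: "eval_mat n X y \<in> carrier_mat n n"
  by (simp add: eval_mat_def)

lemma eval_mat_dim [simp]: "dim_row (eval_mat n X y) = n" "dim_col (eval_mat n X y) = n"
  by (simp_all add: eval_mat_def)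

lemma eval_mat_index [simp]: "a < n \<Longrightarrow> b < n \<Longrightarrow> eval_mat n X y $$ (a, b) = X a b y"
  by (simp add: eval_mat_def)

text \<open>The matrices are given by their entries as functions of \<open>y\<close>; \<open>J\<close> selects the columns of \<open>y\<close>.\<close>

definition weighted_rep where
  "weighted_rep m J n X \<mu> \<nu> \<gamma> \<longleftrightarrow> finite J \<and> card J = m \<and> \<gamma> \<noteq> (0 :: complex) \<and>
     (\<forall>a < n. \<forall>b < n. mhom (\<lambda>i. \<mu> a i - \<nu> b i) (X a b)) \<and>
     (\<forall>a i. m \<le> i \<longrightarrow> \<mu> a i = 0) \<and> (\<forall>b i. m \<le> i \<longrightarrow> \<nu> b i = 0) \<and>
     (\<forall>y. det (eval_mat n X y) = \<gamma> * pm m J y)"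

text \<open>For a singular \<open>M\<close> this says that some cofactor is nonzero, that is, the
  corank is one (\<open>det_add_unit_mat\<close>). The position \<open>(a, b)\<close> becomes the
  pivot at which the adjugate does not vanish.\<close>

definition corank_le_1 :: "nat \<Rightarrow> complex mat \<Rightarrow> bool" where
  "corank_le_1 n M \<longleftrightarrow> (\<exists>a < n. \<exists>b < n. det (M + unit_mat n a b) \<noteq> 0)"

lemma det_nonzero_term:
  fixes M :: "complex mat"
  assumes M: "M \<in> carrier_mat n n" and d: "det M \<noteq> 0"
  obtains p where "p permutes {0..<n}" "\<And>a. a < n \<Longrightarrow> M $$ (a, p a) \<noteq> 0"
proof -
  from d have "(\<Sum>p | p permutes {0..<n}. signof p * (\<Prod>a = 0..<n. M $$ (a, p a))) \<noteq> 0"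
    using det_def'[OF M] by simp
  then obtain p where "p \<in> {p. p permutes {0..<n}}" "signof p * (\<Prod>a = 0..<n. M $$ (a, p a)) \<noteq> 0"
    by (rule sum.not_neutral_contains_not_neutral)
  then have "p permutes {0..<n}" "signof p * (\<Prod>a = 0..<n. M $$ (a, p a)) \<noteq> 0" by simp_all
  then show thesis using that[of p] by auto
qed

text \<open>A nonzero Leibniz term of the perturbed matrix uses the added entry in at most one
  row.\<close>

lemma corank_near_matching:
  assumes M: "M \<in> carrier_mat n n" and c: "corank_le_1 n M"
  obtains p a1 where "p permutes {0..<n}" "a1 < n" "\<And>a. a < n \<Longrightarrow> a \<noteq> a1 \<Longrightarrow> M $$ (a, p a) \<noteq> 0"
proof -
  from c obtain a b where ab: "a < n" "b < n" "det (M + unit_mat n a b) \<noteq> 0"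
    by (auto simp: corank_le_1_def)
  have "M + unit_mat n a b \<in> carrier_mat n n" using M by simp
  from det_nonzero_term[OF this ab(3)] obtain p where p: "p permutes {0..<n}"
    "\<And>k. k < n \<Longrightarrow> (M + unit_mat n a b) $$ (k, p k) \<noteq> 0" by blast
  have "M $$ (k, p k) \<noteq> 0" if "k < n" "k \<noteq> a" for k
  proof -
    have "p k < n" using permutes_in_image[OF p(1), of k] that by simp
    then show ?thesis using p(2)[OF that(1)] that M by simp
  qed
  with p(1) ab(1) that show thesis by blast
qed

text \<open>The determinant is a nonzero multiple of the permanent, and a nonzero function has only
  one multidegree.\<close>

lemma weighted_rep_degree:
  assumes w: "weighted_rep m J n X \<mu> \<nu> \<gamma>"
  shows "(\<Sum>a<n. \<mu> a i) - (\<Sum>b<n. \<nu> b i) = (if i < m then 1 else 0)"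
proof -
  from w have fin: "finite J" "card J = m" "\<gamma> \<noteq> 0"
    and X: "\<And>a b. a < n \<Longrightarrow> b < n \<Longrightarrow> mhom (\<lambda>i. \<mu> a i - \<nu> b i) (X a b)"
    and d: "\<And>y. det (eval_mat n X y) = \<gamma> * pm m J y"
    by (auto simp: weighted_rep_def)
  obtain y where "pm m J y \<noteq> 0" using pm_nonzero fin by blast
  then have nz: "det (eval_mat n X y) \<noteq> 0" using d fin by simp
  have 1: "mhom (\<lambda>i. (\<Sum>a<n. \<mu> a i) - (\<Sum>b<n. \<nu> b i)) (\<lambda>y. det (eval_mat n X y))"
    unfolding eval_mat_def by (rule mhom_det[OF X])
  have 2: "mhom (\<lambda>i. if i < m then 1 else 0) (\<lambda>y. det (eval_mat n X y))"
    unfolding d using mhom_cmult[OF mhom_pm[OF fin(1)]] by simp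
  from fun_cong[OF mhom_unique[OF 1 2 nz], of i] show ?thesis .
qed

lemma weighted_rep_term_degree:
  assumes w: "weighted_rep m J n X \<mu> \<nu> \<gamma>" and p: "p permutes {0..<n}"
    and nz: "\<forall>a < n. X a (p a) y \<noteq> 0"
  shows "a < n \<Longrightarrow> \<mu> a i - \<nu> (p a) i \<ge> 0"
    and "(\<Sum>a<n. \<mu> a i - \<nu> (p a) i) = (if i < m then 1 else 0)"
proof -
  have "p a < n" if "a < n" for a using permutes_in_image[OF p, of a] that by simp
  then have X: "mhom (\<lambda>i. \<mu> a i - \<nu> (p a) i) (X a (p a))" if "a < n" for a
    using w that by (auto simp: weighted_rep_def)
  show "a < n \<Longrightarrow> \<mu> a i - \<nu> (p a) i \<ge> 0"
    using mhom_nonneg[OF X] nz by blast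
  show "(\<Sum>a<n. \<mu> a i - \<nu> (p a) i) = (if i < m then 1 else 0)"
    using sum.permute[OF p, of "\<lambda>b. \<nu> b i"] weighted_rep_degree[OF w, of i]
    by (simp add: sum_subtractf atLeast0LessThan comp_def)
qed

lemma sum_int_eq_1:
  fixes f :: "'a \<Rightarrow> int"
  assumes "finite A" "\<And>a. a \<in> A \<Longrightarrow> f a \<ge> 0" "sum f A = 1"
  obtains a where "a \<in> A" "f a = 1" "\<And>b. b \<in> A \<Longrightarrow> b \<noteq> a \<Longrightarrow> f b = 0"
proof -
  from assms(3) obtain a where a: "a \<in> A" "f a \<noteq> 0" by (metis sum.neutral zero_neq_one)
  have s: "f a + sum f (A - {a}) = 1" using assms a by (simp add: sum.remove)
  have "sum f (A - {a}) \<ge> 0" using assms(2) by (intro sum_nonneg) auto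
  with s a assms(2)[of a] have "f a = 1" "sum f (A - {a}) = 0" by linarith+
  then have "f b = 0" if "b \<in> A" "b \<noteq> a" for b
    using sum_nonneg_eq_0_iff[of "A - {a}" f] assms that by auto
  with a \<open>f a = 1\<close> that show thesis by blast
qed

text \<open>In every nonzero term exactly one factor has positive degree in row \<open>i\<close>; the weight at which
  this happens does not depend on the term, because the sum of squares of the weights does not.\<close>

lemma weighted_rep_jump:
  assumes w: "weighted_rep m J n X \<mu> \<nu> \<gamma>" and i: "i < m"
  obtains x where
    "\<And>p y. p permutes {0..<n} \<Longrightarrow> \<forall>a < n. X a (p a) y \<noteq> 0 \<Longrightarrow>
       \<exists>a0 < n. \<nu> (p a0) i = x \<and> \<mu> a0 i = x + 1 \<and> (\<forall>a < n. a \<noteq> a0 \<longrightarrow> \<mu> a i = \<nu> (p a) i)"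
proof -
  \<comment> \<open>If the jump goes from \<open>x\<close> to \<open>x + 1\<close>, all other
    squares cancel and \<open>(x + 1)^2 - x^2 = 2 * x + 1\<close> is left.\<close>
  define sq where "sq = (\<Sum>a<n. \<mu> a i * \<mu> a i) - (\<Sum>b<n. \<nu> b i * \<nu> b i)"
  have "\<exists>a0 < n. 2 * \<nu> (p a0) i + 1 = sq \<and> \<mu> a0 i = \<nu> (p a0) i + 1 \<and> (\<forall>a < n. a \<noteq> a0 \<longrightarrow> \<mu> a i = \<nu> (p a) i)"
    if p: "p permutes {0..<n}" and nz: "\<forall>a < n. X a (p a) y \<noteq> 0" for p y
  proof -
    note deg = weighted_rep_term_degree[OF w p nz]
    from deg(2)[of i] i have "(\<Sum>a<n. \<mu> a i - \<nu> (p a) i) = 1" by simp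
    then obtain a0 where a0: "a0 < n" "\<mu> a0 i - \<nu> (p a0) i = 1"
      "\<And>a. a < n \<Longrightarrow> a \<noteq> a0 \<Longrightarrow> \<mu> a i - \<nu> (p a) i = 0"
      using sum_int_eq_1[of "{..<n}" "\<lambda>a. \<mu> a i - \<nu> (p a) i"] deg(1)[of _ i] by auto
    have "sq = (\<Sum>a<n. \<mu> a i * \<mu> a i - \<nu> (p a) i * \<nu> (p a) i)"
      unfolding sq_def using sum.permute[OF p, of "\<lambda>b. \<nu> b i * \<nu> b i"]
      by (simp add: sum_subtractf atLeast0LessThan comp_def)
    also have "\<dots> = (\<Sum>a<n. if a = a0 then 2 * \<nu> (p a0) i + 1 else 0)"
    proof (rule sum.cong)
      fix a assume "a \<in> {..<n}"
      moreover have "\<mu> a0 i = \<nu> (p a0) i + 1" using a0(2) by simp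
      ultimately show "\<mu> a i * \<mu> a i - \<nu> (p a) i * \<nu> (p a) i = (if a = a0 then 2 * \<nu> (p a0) i + 1 else 0)"
        using a0(3)[of a] by (auto simp: algebra_simps)
    qed simp
    also have "\<dots> = 2 * \<nu> (p a0) i + 1" using a0(1) by simp
    finally show ?thesis using a0 by (intro exI[of _ a0]) auto
  qed
  note * = this
  show thesis
  proof (rule that[of "(sq - 1) div 2"])
    fix p y assume "p permutes {0..<n}" "\<forall>a < n. X a (p a) y \<noteq> 0"
    from *[OF this] obtain a0 where a0: "a0 < n" "2 * \<nu> (p a0) i + 1 = sq" "\<mu> a0 i = \<nu> (p a0) i + 1"
      "\<forall>a < n. a \<noteq> a0 \<longrightarrow> \<mu> a i = \<nu> (p a) i" by blast
    moreover have "\<nu> (p a0) i = (sq - 1) div 2" using a0(2) by presburger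
    ultimately show "\<exists>a0 < n. \<nu> (p a0) i = (sq - 1) div 2 \<and> \<mu> a0 i = (sq - 1) div 2 + 1 \<and>
        (\<forall>a < n. a \<noteq> a0 \<longrightarrow> \<mu> a i = \<nu> (p a) i)"
      by metis
  qed
qed

lemma linear_form_scale: "linear_form \<psi> \<Longrightarrow> \<psi> (\<lambda>j. c * v j) = c * \<psi> v"
  by (simp add: linear_form_def)

lemma linear_form_sum:
  assumes l: "linear_form \<psi>" and S: "finite S" and v: "\<And>j. j \<notin> S \<Longrightarrow> v j = 0"
  shows "\<psi> v = (\<Sum>j\<in>S. v j * \<psi> (\<lambda>k. if k = j then 1 else 0))"
  using S v
proof (induction S arbitrary: v rule: finite_induct)
  case empty
  then have "v = (\<lambda>j. 0 * v j)" by auto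
  then have "\<psi> v = 0 * \<psi> v" using l unfolding linear_form_def by metis
  then show ?case by simp
next
  case (insert s S)
  let ?e = "\<lambda>k. if k = s then 1 else 0 :: complex"
  have "v = (\<lambda>j. v s * ?e j + (v(s := 0)) j)" by auto
  then have "\<psi> v = \<psi> (\<lambda>j. v s * ?e j) + \<psi> (v(s := 0))" using l unfolding linear_form_def by metis
  moreover have "\<psi> (\<lambda>j. v s * ?e j) = v s * \<psi> ?e" by (rule linear_form_scale[OF l])
  moreover have "\<psi> (v(s := 0)) = (\<Sum>j\<in>S. (v(s := 0)) j * \<psi> (\<lambda>k. if k = j then 1 else 0))"
    by (rule insert.IH) (use insert.prems in auto)
  moreover have "\<dots> = (\<Sum>j\<in>S. v j * \<psi> (\<lambda>k. if k = j then 1 else 0))"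
    using insert.hyps by (intro sum.cong) auto
  ultimately show ?case using insert.hyps by simp
qed

text \<open>The cross product of the coefficient vectors solves both equations. If it is zero the
  vectors are proportional, and a solution of a nonzero one serves for both.\<close>

lemma two_equations_three_unknowns:
  fixes a1 a2 a3 b1 b2 b3 :: complex
  shows "\<exists>x y z. (x \<noteq> 0 \<or> y \<noteq> 0 \<or> z \<noteq> 0) \<and> a1 * x + a2 * y + a3 * z = 0 \<and> b1 * x + b2 * y + b3 * z = 0"
proof -
  define c1 where "c1 = a2 * b3 - a3 * b2"
  define c2 where "c2 = a3 * b1 - a1 * b3"
  define c3 where "c3 = a1 * b2 - a2 * b1"
  show ?thesis
  proof (cases "c1 = 0 \<and> c2 = 0 \<and> c3 = 0")
    case False
    then show ?thesis
      by (intro exI[of _ c1] exI[of _ c2] exI[of _ c3]) (auto simp: c1_def c2_def c3_def algebra_simps)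
  next
    case True
    then have z: "a2 * b3 = a3 * b2" "a3 * b1 = a1 * b3" "a1 * b2 = a2 * b1"
      by (auto simp: c1_def c2_def c3_def)
    have *: "\<exists>x y z. (x \<noteq> 0 \<or> y \<noteq> 0 \<or> z \<noteq> 0) \<and> a1 * x + a2 * y + a3 * z = 0 \<and> b1 * x + b2 * y + b3 * z = 0"
      if z: "a2 * b3 = a3 * b2" "a3 * b1 = a1 * b3" "a1 * b2 = a2 * b1" and nz: "a1 \<noteq> 0 \<or> a2 \<noteq> 0 \<or> a3 \<noteq> 0"
      for a1 a2 a3 b1 b2 b3 :: complex
    proof -
      consider "a1 \<noteq> 0 \<or> a2 \<noteq> 0" | "a3 \<noteq> 0" "a2 = 0" using nz by blast
      then show ?thesis
      proof cases
        case 1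
        then show ?thesis using z
          by (intro exI[of _ a2] exI[of _ "- a1"] exI[of _ 0]) (auto simp: algebra_simps)
      next
        case 2
        then show ?thesis using z
          by (intro exI[of _ "0"] exI[of _ "a3"] exI[of _ "- a2"]) (auto simp: algebra_simps)
      qed
    qed
    show ?thesis
    proof (cases "a1 \<noteq> 0 \<or> a2 \<noteq> 0 \<or> a3 \<noteq> 0")
      case True
      from *[OF z this] show ?thesis .
    next
      case False
      show ?thesis
      proof (cases "b1 \<noteq> 0 \<or> b2 \<noteq> 0 \<or> b3 \<noteq> 0")
        case True
        from *[of b2 a3 b3 a2 a1 b1] z True False show ?thesis by auto
      next
        case F: False
        show ?thesis using False F by (intro exI[of _ 1]) auto
      qed
    qed
  qed
qed

text \<open>Three coordinates inside \<open>J\<close> give three unknowns for two equations.\<close>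

lemma two_forms_kernel:
  assumes l: "linear_form \<psi>" "linear_form \<xi>" and J: "finite J" "3 \<le> card J"
  obtains v where "\<psi> v = 0" "\<xi> v = 0" "\<exists>j\<in>J. v j \<noteq> 0" "\<And>j. j \<notin> J \<Longrightarrow> v j = 0"
proof -
  obtain T where "T \<subseteq> J" "card T = 3" using J by (meson obtain_subset_with_card_n)
  then obtain a b c where abc: "{a, b, c} \<subseteq> J" "a \<noteq> b" "a \<noteq> c" "b \<noteq> c"
    by (auto simp: card_3_iff)
  let ?e = "\<lambda>j k. if k = j then 1 else 0 :: complex"
  obtain x y z where xyz: "x \<noteq> 0 \<or> y \<noteq> 0 \<or> z \<noteq> 0"
    "\<psi> (?e a) * x + \<psi> (?e b) * y + \<psi> (?e c) * z = 0"
    "\<xi> (?e a) * x + \<xi> (?e b) * y + \<xi> (?e c) * z = 0"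
    using two_equations_three_unknowns by blast
  define v where "v k = (if k = a then x else if k = b then y else if k = c then z else 0)" for k
  have v0: "v j = 0" if "j \<notin> {a, b, c}" for j using that by (auto simp: v_def)
  have "\<psi> v = 0" "\<xi> v = 0"
    using linear_form_sum[OF l(1), of "{a, b, c}" v] linear_form_sum[OF l(2), of "{a, b, c}" v] v0 abc xyz
    by (simp_all add: v_def algebra_simps)
  moreover have "\<exists>j\<in>J. v j \<noteq> 0" using xyz(1) abc by (auto simp: v_def)
  moreover have "v j = 0" if "j \<notin> J" for j by (rule v0) (use that abc(1) in auto)
  ultimately show thesis using that by blast
qed

text \<open>Call \<open>p\<close> without row \<open>a1\<close> a near matching. If one lies in
  \<open>R \<times> C\<close>, both sets have at least \<open>n - 1\<close> elements, and the bound
  on the cardinalities leaves \<open>n = 2\<close> or \<open>n = 3\<close>. For \<open>n = 2\<close>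
  the whole of \<open>R \<times> C\<close> has at most two elements; for \<open>n = 3\<close> the
  two positions in one row of \<open>R\<close> do. Two is the number of linear conditions that
  \<open>two_forms_kernel\<close> can satisfy.\<close>

lemma few_entries_meet_matchings:
  assumes n: "2 \<le> n" and R: "R \<subseteq> {0..<n}" and C: "C \<subseteq> {0..<n}" and RC: "card R + card C \<le> n + 1"
  obtains E e f where "E \<subseteq> R \<times> C" "E \<subseteq> {e, f}"
    "\<And>p a1. p permutes {0..<n} \<Longrightarrow> a1 < n \<Longrightarrow> \<forall>a < n. a \<noteq> a1 \<longrightarrow> a \<in> R \<and> p a \<in> C \<Longrightarrow>
       \<exists>a < n. a \<noteq> a1 \<and> (a, p a) \<in> E"
proof -
  have fin: "finite R" "finite C" using R C finite_subset by auto
  have big: "R \<supseteq> {0..<n} - {a1}" "C \<supseteq> p ` ({0..<n} - {a1})" "n - 1 \<le> card R" "n - 1 \<le> card C"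
    if "p permutes {0..<n}" "a1 < n" "\<forall>a < n. a \<noteq> a1 \<longrightarrow> a \<in> R \<and> p a \<in> C" for p a1
  proof -
    show 1: "R \<supseteq> {0..<n} - {a1}" "C \<supseteq> p ` ({0..<n} - {a1})" using that by auto
    have "card (p ` ({0..<n} - {a1})) = n - 1" using that permutes_inj_on[OF that(1)] by (simp add: card_image)
    then show "n - 1 \<le> card C" using 1(2) fin by (metis card_mono)
    have "card ({0..<n} - {a1}) = n - 1" using that by simp
    then show "n - 1 \<le> card R" using 1(1) fin by (metis card_mono)
  qed
  show thesis
  proof (cases "\<exists>p a1. p permutes {0..<n} \<and> a1 < n \<and> (\<forall>a < n. a \<noteq> a1 \<longrightarrow> a \<in> R \<and> p a \<in> C)")
    case False
    show thesis
      by (rule that[of "{}"]) (use False in auto)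
  next
    case True
    then obtain p a1 where "p permutes {0..<n}" "a1 < n" "\<forall>a < n. a \<noteq> a1 \<longrightarrow> a \<in> R \<and> p a \<in> C" by blast
    from big(3,4)[OF this] have cards: "n - 1 \<le> card R" "n - 1 \<le> card C" .
    consider "n = 2" | "n = 3" "card R = 2" "card C = 2" using cards RC n by linarith
    then show thesis
    proof cases
      case 1
      have "card (R \<times> C) \<le> 2" "card (R \<times> C) \<noteq> 0"
      proof -
        have "card R = 1 \<and> card C \<le> 2 \<or> card C = 1 \<and> card R \<le> 2" using 1 cards RC by linarith
        then show "card (R \<times> C) \<le> 2" by (auto simp: card_cartesian_product)
        show "card (R \<times> C) \<noteq> 0" using 1 cards by (auto simp: card_cartesian_product)
      qed
      then have "card (R \<times> C) = 1 \<or> card (R \<times> C) = 2" by linarith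
      then have "\<exists>e f. R \<times> C = {e, f}"
        unfolding card_1_singleton_iff card_2_iff One_nat_def by (metis insert_absorb2)
      then obtain e f where ef: "R \<times> C = {e, f}" by blast
      show thesis
      proof (rule that[of "R \<times> C" e f])
        fix p a1 assume *: "p permutes {0..<n}" "a1 < n" "\<forall>a < n. a \<noteq> a1 \<longrightarrow> a \<in> R \<and> p a \<in> C"
        \<comment> \<open>With two rows, \<open>1 - a1\<close> is the one other than
          \<open>a1\<close>.\<close>
        have "1 - a1 < n" "1 - a1 \<noteq> a1" using 1 *(2) by presburger+
        then show "\<exists>a<n. a \<noteq> a1 \<and> (a, p a) \<in> R \<times> C" using *(3) by blast
      qed (use ef in auto)
    next
      case 2
      obtain r where r: "r \<in> R" using 2 by fastforce
      obtain c d where cd: "C = {c, d}" using 2 by (auto simp: card_2_iff)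
      show thesis
      proof (rule that[of "{(r, c), (r, d)}" "(r, c)" "(r, d)"])
        fix p a1 assume *: "p permutes {0..<n}" "a1 < n" "\<forall>a < n. a \<noteq> a1 \<longrightarrow> a \<in> R \<and> p a \<in> C"
        have "R = {0..<n} - {a1}"
          using big(1)[OF *] 2 *(2) fin by (intro card_seteq[symmetric]) auto
        then have "r < n" "r \<noteq> a1" using r by auto
        then show "\<exists>a<n. a \<noteq> a1 \<and> (a, p a) \<in> {(r, c), (r, d)}" using *(3) cd by blast
      qed (use r cd in auto)
    qed
  qed
qed

lemma mat_row_scale_det_zero:
  fixes M :: "complex mat"
  assumes M: "M \<in> carrier_mat n n" and ab: "a < n" "a' < n" "a \<noteq> a'"
    and eq: "\<And>b. b < n \<Longrightarrow> M $$ (a', b) = c * M $$ (a, b)"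
  shows "det M = 0"
proof -
  define v where "v = vec n (\<lambda>i. if i = a' then 1 else if i = a then - c else 0)"
  have v: "v \<in> carrier_vec n" "v \<noteq> 0\<^sub>v n"
    using ab by (auto simp: v_def vec_eq_iff)
  have "transpose_mat M *\<^sub>v v = 0\<^sub>v n"
  proof (rule eq_vecI)
    fix b assume "b < dim_vec (0\<^sub>v n)"
    then have b: "b < n" by simp
    have "(transpose_mat M *\<^sub>v v) $ b = (\<Sum>i = 0..<n. M $$ (i, b) * v $ i)"
      using M b v by (simp add: scalar_prod_def)
    also have "\<dots> = (\<Sum>i = 0..<n. (if i = a' then M $$ (i, b) else 0) + (if i = a then - c * M $$ (i, b) else 0))"
      using ab by (intro sum.cong) (auto simp: v_def)
    also have "\<dots> = 0" using ab eq[OF b] by (simp add: sum.distrib)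
    finally show "(transpose_mat M *\<^sub>v v) $ b = 0\<^sub>v n $ b" using b by simp
  qed (use M in auto)
  moreover have "transpose_mat M \<in> carrier_mat n n" using M by simp
  ultimately have "det (transpose_mat M) = 0" using det_0_iff_vec_prod_zero v by blast
  then show ?thesis by (simp add: det_transpose[OF M])
qed

lemma det_zero_terms:
  fixes M :: "complex mat"
  assumes M: "M \<in> carrier_mat n n"
    and z: "\<And>p. p permutes {0..<n} \<Longrightarrow> \<exists>a < n. M $$ (a, p a) = 0"
  shows "det M = 0"
  using det_nonzero_term[OF M] z by metis

lemma pm3_expand:
  assumes "distinct [a, b, c]"
  shows "pm 3 {a, b, c} y = y 0 a * y 1 b * y 2 c + y 0 a * y 1 c * y 2 b + y 0 b * y 1 a * y 2 c
    + y 0 b * y 1 c * y 2 a + y 0 c * y 1 a * y 2 b + y 0 c * y 1 b * y 2 a"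
proof -
  have d: "{a, b, c} - {a} = {b, c}" "{a, b, c} - {b} = {a, c}" "{a, b, c} - {c} = {a, b}"
    "{b, c} - {b} = {c}" "{b, c} - {c} = {b}" "{a, c} - {a} = {c}" "{a, c} - {c} = {a}"
    "{a, b} - {a} = {b}" "{a, b} - {b} = {a}" using assms by auto
  have "pm (Suc (Suc (Suc 0))) {a, b, c} y = y 0 a * y 1 b * y 2 c + y 0 a * y 1 c * y 2 b + y 0 b * y 1 a * y 2 c
    + y 0 b * y 1 c * y 2 a + y 0 c * y 1 a * y 2 b + y 0 c * y 1 b * y 2 a"
    using assms by (simp add: d algebra_simps numeral_2_eq_2)
  then show ?thesis by (simp only: numeral_3_eq_3)
qed

text \<open>With the unit vector of the remaining column \<open>c\<close> as third row, the
  permanent reduces to the two-by-two permanent of \<open>v\<close> and \<open>w\<close> in the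
  columns \<open>a\<close> and \<open>b\<close>.\<close>

lemma pm3_pair:
  assumes J: "finite J" "card J = 3" and ij: "i1 < 3" "i2 < 3" "i1 \<noteq> i2"
    and ab: "a \<in> J" "b \<in> J" "a \<noteq> b" and nz: "v a * w b + v b * w a \<noteq> 0"
  obtains y where "y i1 = v" "y i2 = w" "pm 3 J y \<noteq> 0"
proof -
  have "card (J - {a, b}) = 1" using J ab by (simp add: card_Diff_subset)
  then obtain c where c: "J - {a, b} = {c}" by (auto simp: card_1_singleton_iff)
  then have Jeq: "J = {a, b, c}" and d: "distinct [a, b, c]" using ab by auto
  define e where "e = (\<lambda>k. if k = c then 1 else 0 :: complex)"
  define y where "y = (\<lambda>i. if i = i1 then v else if i = i2 then w else e)"
  have "i1 = 0 \<or> i1 = 1 \<or> i1 = 2" "i2 = 0 \<or> i2 = 1 \<or> i2 = 2" using ij by auto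
  then have "pm 3 J y = v a * w b + v b * w a"
    unfolding Jeq pm3_expand[OF d] using d ij(3) by (elim disjE) (simp_all add: y_def e_def)
  then show thesis using that[of y] nz ij(3) by (simp add: y_def)
qed

text \<open>For conditions on one row, a common kernel vector with \<open>v a \<noteq> 0\<close> is
  completed by a unit vector in another column. For two rows, \<open>w\<close> is chosen with
  \<open>w a = 0\<close> where \<open>v a \<noteq> 0\<close>, so that only \<open>v a * w b\<close>
  survives.\<close>

lemma pm3_two_forms:
  assumes J: "finite J" "card J = 3" and i: "i1 < 3" "i2 < 3"
    and l: "linear_form \<psi>" "linear_form \<xi>"
  obtains y where "\<psi> (y i1) = 0" "\<xi> (y i2) = 0" "pm 3 J y \<noteq> 0"
proof (cases "i1 = i2")
  case True
  obtain v where v: "\<psi> v = 0" "\<xi> v = 0" "\<exists>j\<in>J. v j \<noteq> 0"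
    by (rule two_forms_kernel[OF l J(1)]) (use J(2) in auto)
  then obtain a where a: "a \<in> J" "v a \<noteq> 0" by blast
  have "card (J - {a}) = 2" using J a by simp
  then obtain b where b: "b \<in> J" "b \<noteq> a" by (metis DiffD1 DiffD2 card_2_iff insertI1 singletonI)
  obtain i3 where i3: "i3 < 3" "i3 \<noteq> i1"
  proof (cases "i1 = 0")
    case True then show thesis using that[of 1] by simp
  next
    case False then show thesis using that[of 0] by simp
  qed
  obtain y where "y i1 = v" "y i3 = (\<lambda>k. if k = b then 1 else 0)" "pm 3 J y \<noteq> 0"
    by (rule pm3_pair[OF J i(1) i3(1) i3(2)[symmetric] a(1) b(1) b(2)[symmetric], of v "\<lambda>k. if k = b then 1 else 0"])
      (use a b in auto)
  then show thesis using that[of y] v True by simp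
next
  case False
  have l0: "linear_form (\<lambda>_. 0)" by (simp add: linear_form_def)
  obtain v where v: "\<psi> v = 0" "\<exists>j\<in>J. v j \<noteq> 0"
    by (rule two_forms_kernel[OF l(1) l0 J(1)]) (use J(2) in auto)
  then obtain a where a: "a \<in> J" "v a \<noteq> 0" by blast
  have la: "linear_form (\<lambda>u. u a)" by (simp add: linear_form_def)
  obtain w where w: "\<xi> w = 0" "w a = 0" "\<exists>j\<in>J. w j \<noteq> 0"
    by (rule two_forms_kernel[OF l(2) la J(1)]) (use J(2) in auto)
  then obtain b where b: "b \<in> J" "w b \<noteq> 0" by blast
  with w have "a \<noteq> b" by auto
  obtain y where "y i1 = v" "y i2 = w" "pm 3 J y \<noteq> 0"
    by (rule pm3_pair[OF J i False a(1) b(1) \<open>a \<noteq> b\<close>, of v w]) (use a b w in auto)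
  then show thesis using that[of y] v w by simp
qed

lemma permutes_2_cases:
  assumes "p permutes {0..<2::nat}"
  shows "p 0 = 0 \<and> p 1 = 1 \<or> p 0 = 1 \<and> p 1 = 0"
proof -
  have "p 0 < 2" "p 1 < 2" using permutes_in_image[OF assms, of 0] permutes_in_image[OF assms, of 1] by auto
  moreover have "p 0 \<noteq> p 1" using permutes_inj[OF assms] by (metis injD zero_neq_one)
  ultimately show ?thesis by auto
qed

text \<open>Without constants, a factor of multidegree zero would be constant and hence zero; so
  every factor of a nonzero term has degree at least one, while the degrees add up to
  \<open>m\<close>. This bounds the size by \<open>m\<close>.\<close>

lemma weighted_rep_term_total:
  assumes w: "weighted_rep m J n X \<mu> \<nu> \<gamma>" and X0: "\<And>a b. a < n \<Longrightarrow> b < n \<Longrightarrow> X a b (\<lambda>_ _. 0) = 0"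
    and p: "p permutes {0..<n}" and nz: "\<forall>a < n. X a (p a) y \<noteq> 0"
  shows "a < n \<Longrightarrow> (\<Sum>i<m. \<mu> a i - \<nu> (p a) i) \<ge> 1"
    and "(\<Sum>a<n. \<Sum>i<m. \<mu> a i - \<nu> (p a) i) = int m"
proof -
  note deg = weighted_rep_term_degree[OF w p nz]
  show "(\<Sum>a<n. \<Sum>i<m. \<mu> a i - \<nu> (p a) i) = int m"
    by (subst sum.swap) (simp add: deg(2))
  assume a: "a < n"
  have pa: "p a < n" using permutes_in_image[OF p, of a] a by simp
  have h: "mhom (\<lambda>i. \<mu> a i - \<nu> (p a) i) (X a (p a))" using w a pa by (auto simp: weighted_rep_def)
  have "\<exists>i. \<mu> a i - \<nu> (p a) i \<noteq> 0"
  proof (rule ccontr)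
    assume "\<not> ?thesis"
    then have "X a (p a) y = X a (p a) (\<lambda>_ _. 0)" by (intro mhom_local[OF h]) auto
    then show False using nz a X0[OF a pa] by simp
  qed
  then obtain i where i: "\<mu> a i - \<nu> (p a) i \<noteq> 0" ..
  have "i < m"
  proof (rule ccontr)
    assume "\<not> i < m"
    then have "\<mu> a i = 0" "\<nu> (p a) i = 0" using w by (simp_all add: weighted_rep_def)
    with i show False by simp
  qed
  have "\<mu> a i - \<nu> (p a) i \<ge> 1" using deg(1)[OF a, of i] i by linarith
  moreover have "(\<Sum>k<m. \<mu> a k - \<nu> (p a) k) \<ge> \<mu> a i - \<nu> (p a) i"
    using \<open>i < m\<close> deg(1)[OF a] by (intro member_le_sum) auto
  ultimately show "(\<Sum>i<m. \<mu> a i - \<nu> (p a) i) \<ge> 1" by linarith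
qed

lemma weight_total_1:
  fixes \<alpha> :: "nat \<Rightarrow> int"
  assumes "\<And>i. \<alpha> i \<ge> 0" "\<And>i. i \<ge> m \<Longrightarrow> \<alpha> i = 0" "(\<Sum>i<m. \<alpha> i) = 1"
  obtains i where "i < m" "\<alpha> = (\<lambda>k. if k = i then 1 else 0)"
proof -
  obtain i where i: "i \<in> {..<m}" "\<alpha> i = 1" "\<And>k. k \<in> {..<m} \<Longrightarrow> k \<noteq> i \<Longrightarrow> \<alpha> k = 0"
    by (rule sum_int_eq_1[of "{..<m}" \<alpha>]) (use assms in auto)
  have "\<alpha> k = (if k = i then 1 else 0)" for k
    using i assms(2)[of k] by (cases "k < m") auto
  then have "\<alpha> = (\<lambda>k. if k = i then 1 else 0)" by blast
  with i(1) that show thesis by auto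
qed

text \<open>Degree three is shared by two factors of positive degree, so each nonzero Leibniz term
  contains a linear form in a single row. Killing the forms of both terms makes the determinant
  vanish at a point where the permanent does not.\<close>

lemma size_2_impossible:
  assumes w: "weighted_rep 3 J 2 X \<mu> \<nu> \<gamma>" and X0: "\<And>a b. a < 2 \<Longrightarrow> b < 2 \<Longrightarrow> X a b (\<lambda>_ _. 0) = 0"
  shows False
proof -
  from w have J: "finite J" "card J = 3" "\<gamma> \<noteq> 0" and d: "\<And>y. det (eval_mat 2 X y) = \<gamma> * pm 3 J y"
    by (auto simp: weighted_rep_def)
  have kill: "\<exists>\<psi> i. linear_form \<psi> \<and> i < 3 \<and> (\<forall>y. \<psi> (y i) = 0 \<longrightarrow> (\<exists>a < 2. X a (p a) y = 0))"
    if p: "p permutes {0..<2}" for p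
  proof (cases "\<exists>y. \<forall>a < 2. X a (p a) y \<noteq> 0")
    case False
    then show ?thesis by (intro exI[of _ "\<lambda>_. 0"] exI[of _ 0]) (auto simp: linear_form_def)
  next
    case True
    then obtain y where y: "\<forall>a < 2. X a (p a) y \<noteq> 0" by blast
    note tot = weighted_rep_term_total[OF w X0 p y] and deg = weighted_rep_term_degree[OF w p y]
    let ?D = "\<lambda>a. \<Sum>i<3. \<mu> a i - \<nu> (p a) i"
    have "?D 0 + ?D 1 = 3" using tot(2) by (simp add: numeral_2_eq_2)
    moreover have "?D 0 \<ge> 1" "?D 1 \<ge> 1" using tot(1) by auto
    ultimately have "?D 0 = 1 \<or> ?D 1 = 1" by linarith
    then obtain a where a: "a < 2" "?D a = 1" by (metis one_less_numeral_iff pos2 semiring_norm(76))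
    have z: "\<mu> a i - \<nu> (p a) i = 0" if "i \<ge> 3" for i using w that by (auto simp: weighted_rep_def)
    obtain i where i: "i < 3" "(\<lambda>i. \<mu> a i - \<nu> (p a) i) = (\<lambda>k. if k = i then 1 else 0)"
      using weight_total_1[of "\<lambda>i. \<mu> a i - \<nu> (p a) i" 3] deg(1)[OF a(1)] z a(2) by blast
    have "p a < 2" using permutes_in_image[OF p, of a] a by simp
    then have "mhom (\<lambda>i. \<mu> a i - \<nu> (p a) i) (X a (p a))"
      using w a(1) by (auto simp: weighted_rep_def)
    then have "mhom (\<lambda>k. if k = i then 1 else 0) (X a (p a))" unfolding i(2) .
    then obtain \<psi> where "linear_form \<psi>" "\<And>y. X a (p a) y = \<psi> (y i)" by (rule mhom_linear) blast
    then show ?thesis using i(1) a(1) by (intro exI[of _ \<psi>] exI[of _ i]) auto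
  qed
  let ?t = "Transposition.transpose 0 (1::nat)"
  have t: "?t permutes {0..<2}" and id: "id permutes {0..<2::nat}"
    by (auto intro: permutes_swap_id permutes_id)
  obtain \<psi> i where 1: "linear_form \<psi>" "i < 3" "\<forall>y. \<psi> (y i) = 0 \<longrightarrow> (\<exists>a < 2. X a (id a) y = 0)"
    using kill[OF id] by blast
  obtain \<xi> k where 2: "linear_form \<xi>" "k < 3" "\<forall>y. \<xi> (y k) = 0 \<longrightarrow> (\<exists>a < 2. X a (?t a) y = 0)"
    using kill[OF t] by blast
  obtain y where y: "\<psi> (y i) = 0" "\<xi> (y k) = 0" "pm 3 J y \<noteq> 0"
    by (rule pm3_two_forms[OF J(1,2) 1(2) 2(2) 1(1) 2(1)])
  have "det (eval_mat 2 X y) = 0"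
  proof (rule det_zero_terms[OF eval_mat_carrier])
    fix p :: "nat \<Rightarrow> nat" assume p: "p permutes {0..<2}"
    have eq: "p a = id a" if "a < 2" "p 0 = 0" "p 1 = 1" for a using that by (auto simp: less_2_cases_iff)
    have eq': "p a = ?t a" if "a < 2" "p 0 = 1" "p 1 = 0" for a using that by (auto simp: less_2_cases_iff)
    have "\<exists>a < 2. X a (p a) y = 0"
      using permutes_2_cases[OF p] 1(3) 2(3) y(1,2) eq eq' by metis
    then obtain a where "a < 2" "X a (p a) y = 0" by blast
    moreover have "p a < 2" using permutes_in_image[OF p, of a] \<open>a < 2\<close> by simp
    ultimately show "\<exists>a < 2. eval_mat 2 X y $$ (a, p a) = 0" by auto
  qed
  with d J(3) y(3) show False by simp
qed

text \<open>The hypothesis says that in each two-by-two subgrid both diagonals carry the same pair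
  of values. Two rows differing in one column are then constant, and any other row differs from one
  of them in that column, hence is constant as well.\<close>

lemma grid_rows_or_columns:
  fixes r :: "nat \<Rightarrow> nat \<Rightarrow> nat"
  assumes eq: "\<And>a a' b b'. a < n \<Longrightarrow> a' < n \<Longrightarrow> b < n \<Longrightarrow> b' < n \<Longrightarrow>
      r a b = r a' b \<and> r a b' = r a' b' \<or> r a b = r a b' \<and> r a' b = r a' b'"
  shows "(\<forall>a < n. \<forall>b < n. \<forall>b' < n. r a b = r a b') \<or> (\<forall>a < n. \<forall>a' < n. \<forall>b < n. r a b = r a' b)"
proof (rule disjCI)
  assume "\<not> (\<forall>a < n. \<forall>a' < n. \<forall>b < n. r a b = r a' b)"
  then obtain a a' b where ab: "a < n" "a' < n" "b < n" "r a b \<noteq> r a' b" by blast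
  show "\<forall>a < n. \<forall>b < n. \<forall>b' < n. r a b = r a b'"
  proof (intro allI impI)
    fix c d d' assume c: "c < n" "d < n" "d' < n"
    have row: "r a e = r a b" "r a' e = r a' b" if "e < n" for e using eq[OF ab(1,2,3) that] ab(4) by auto
    have "r c e = r c b" if "e < n" for e
    proof (cases "r c b = r a b")
      case True
      then show ?thesis using eq[OF c(1) ab(2) that ab(3)] row[OF that] ab(4) by auto
    next
      case False
      then show ?thesis using eq[OF c(1) ab(1) that ab(3)] row[OF that] by auto
    qed
    then show "r c d = r c d'" using c by simp
  qed
qed

text \<open>Here the permanent is told apart from the determinant. Row \<open>r 0\<close> of
  \<open>y\<close> is set to all ones, and the two conditions that make the second row of the matrix
  proportional to the first leave a nonzero solution \<open>w\<close> for row \<open>r 1\<close>.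
  The determinant then vanishes whatever the third row is, but the two-by-two permanents of the
  all-ones row with \<open>w\<close> do not all vanish: \<open>w i + w j = 0\<close> for all three
  pairs would give \<open>w = 0\<close> on \<open>J\<close>.\<close>

lemma size_3_rows_impossible:
  assumes J: "finite J" "card J = 3" and g: "\<gamma> \<noteq> 0"
    and d: "\<And>y. det (eval_mat 3 X y) = \<gamma> * pm 3 J y"
    and X: "\<And>a b y. a < 3 \<Longrightarrow> b < 3 \<Longrightarrow> X a b y = \<psi> a b (y (r a))"
    and l: "\<And>a b. a < 3 \<Longrightarrow> b < 3 \<Longrightarrow> linear_form (\<psi> a b)"
    and r: "r 0 < 3" "r 1 < 3" "r 0 \<noteq> r 1"
  shows False
proof -
  define v where "v = (\<lambda>_ :: nat. 1 :: complex)"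
  define R where "R = (\<lambda>b. \<psi> 0 b v)"
  \<comment> \<open>Column \<open>b\<close> serves as pivot of the first row at \<open>v\<close>; if
    that row is zero there, any column will do.\<close>
  have "\<exists>b < 3. R b \<noteq> 0 \<or> (\<forall>b < 3. R b = 0)" by (metis zero_less_numeral)
  then obtain b where b: "b < 3" "R b \<noteq> 0 \<or> (\<forall>b < 3. R b = 0)" by blast
  obtain c e where ce: "c < 3" "e < 3" "{0..<3} = {b, c, e}"
  proof -
    have "b = 0 \<or> b = 1 \<or> b = 2" using b by auto
    then show thesis
    proof (elim disjE)
      assume "b = 0" then show thesis by (intro that[of 1 2]) auto
    next
      assume "b = 1" then show thesis by (intro that[of 0 2]) auto
    next
      assume "b = 2" then show thesis by (intro that[of 0 1]) auto
    qed
  qed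
  have lf: "linear_form (\<lambda>w. R b * \<psi> 1 k w - R k * \<psi> 1 b w)" if "k < 3" for k
    using l[OF _ that, of 1] l[OF _ b(1), of 1] by (simp add: linear_form_def algebra_simps)
  obtain w where w: "R b * \<psi> 1 c w - R c * \<psi> 1 b w = 0" "R b * \<psi> 1 e w - R e * \<psi> 1 b w = 0"
    "\<exists>j\<in>J. w j \<noteq> 0"
    by (rule two_forms_kernel[OF lf[OF ce(1)] lf[OF ce(2)] J(1)]) (use J(2) in auto)
  have prp: "R b * \<psi> 1 k w = R k * \<psi> 1 b w" if "k < 3" for k
  proof -
    have "k \<in> {b, c, e}" using that ce(3) by (metis atLeastLessThan_iff zero_le)
    then show ?thesis using w by auto
  qed
  have det0: "det (eval_mat 3 X y) = 0" if y: "y (r 0) = v" "y (r 1) = w" for y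
  proof (cases "R b = 0")
    case True
    then have "\<forall>k < 3. R k = 0" using b by auto
    then have "eval_mat 3 X y $$ (0, k) = 0 * eval_mat 3 X y $$ (1, k)" if "k < 3" for k
      using that X[of 0 k y] y(1) by (simp add: R_def)
    then show ?thesis by (intro mat_row_scale_det_zero[of _ 3 1 0]) auto
  next
    case False
    have "eval_mat 3 X y $$ (1, k) = (\<psi> 1 b w / R b) * eval_mat 3 X y $$ (0, k)" if "k < 3" for k
      using that X[of 0 k y] X[of 1 k y] y prp[OF that] False by (simp add: R_def field_simps)
    then show ?thesis by (intro mat_row_scale_det_zero[of _ 3 0 1 "\<psi> 1 b w / R b"]) auto
  qed
  from w(3) obtain i where i: "i \<in> J" "w i \<noteq> 0" by blast
  have "card (J - {i}) = 2" using J i by simp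
  then obtain j k where jk: "J - {i} = {j, k}" "j \<noteq> k" by (auto simp: card_2_iff)
  have "\<exists>a b'. a \<in> J \<and> b' \<in> J \<and> a \<noteq> b' \<and> v a * w b' + v b' * w a \<noteq> 0"
  proof (rule ccontr)
    assume "\<not> ?thesis"
    then have "v a * w b' + v b' * w a = 0" if "a \<in> J" "b' \<in> J" "a \<noteq> b'" for a b' using that by blast
    then have z: "w b' + w a = 0" if "a \<in> J" "b' \<in> J" "a \<noteq> b'" for a b' using that by (simp add: v_def)
    have s: "w i + w j = 0" "w i + w k = 0" "w j + w k = 0"
      using jk i by (auto intro!: z)
    have "2 * w i = (w i + w j) + (w i + w k) - (w j + w k)" by simp
    then have "2 * w i = 0" unfolding s by simp
    with i show False by simp
  qed
  then obtain a b' where ab: "a \<in> J" "b' \<in> J" "a \<noteq> b'" "v a * w b' + v b' * w a \<noteq> 0" by blast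
  obtain y where "y (r 0) = v" "y (r 1) = w" "pm 3 J y \<noteq> 0"
    by (rule pm3_pair[OF J r ab])
  with det0 d g show False by simp
qed

text \<open>Degree three over three factors makes every factor of a nonzero term linear in a single
  row \<open>r a b\<close> of \<open>y\<close>. As the differences \<open>\<mu> a - \<nu> b\<close>
  are unit vectors, \<open>r\<close> depends on the row or on the column only; either case
  contradicts \<open>size_3_rows_impossible\<close>, directly or after transposition.\<close>

lemma size_3_impossible:
  assumes w: "weighted_rep 3 J 3 X \<mu> \<nu> \<gamma>" and X0: "\<And>a b. a < 3 \<Longrightarrow> b < 3 \<Longrightarrow> X a b (\<lambda>_ _. 0) = 0"
  shows False
proof -
  from w have J: "finite J" "card J = 3" "\<gamma> \<noteq> 0" and d: "\<And>y. det (eval_mat 3 X y) = \<gamma> * pm 3 J y"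
    and h: "\<And>a b. a < 3 \<Longrightarrow> b < 3 \<Longrightarrow> mhom (\<lambda>i. \<mu> a i - \<nu> b i) (X a b)"
    and z: "\<And>a i. i \<ge> 3 \<Longrightarrow> \<mu> a i = 0" "\<And>a i. i \<ge> 3 \<Longrightarrow> \<nu> a i = 0"
    by (auto simp: weighted_rep_def)
  define nzterm where "nzterm p \<longleftrightarrow> p permutes {0..<3} \<and> (\<exists>y. \<forall>a < 3. X a (p a) y \<noteq> 0)" for p
  have lin: "\<exists>i < 3. (\<lambda>k. \<mu> a k - \<nu> (p a) k) = (\<lambda>k. if k = i then 1 else 0)"
    if nt: "nzterm p" and a: "a < 3" for p a
  proof -
    from nt obtain y where p: "p permutes {0..<3}" and y: "\<forall>a < 3. X a (p a) y \<noteq> 0" by (auto simp: nzterm_def)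
    note tot = weighted_rep_term_total[OF w X0 p y] and deg = weighted_rep_term_degree[OF w p y]
    let ?D = "\<lambda>a. \<Sum>i<3. \<mu> a i - \<nu> (p a) i"
    have "?D 0 + ?D 1 + ?D 2 = 3" using tot(2) by (simp add: numeral_3_eq_3 numeral_2_eq_2)
    moreover have "?D 0 \<ge> 1" "?D 1 \<ge> 1" "?D 2 \<ge> 1" using tot(1) by auto
    ultimately have D: "?D 0 = 1" "?D 1 = 1" "?D 2 = 1" by linarith+
    have "a = 0 \<or> a = 1 \<or> a = 2" using a by auto
    with D have "?D a = 1" by auto
    then obtain i where "i < 3" "(\<lambda>i. \<mu> a i - \<nu> (p a) i) = (\<lambda>k. if k = i then 1 else 0)"
      using weight_total_1[of "\<lambda>i. \<mu> a i - \<nu> (p a) i" 3] deg(1)[OF a] z by auto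
    then show ?thesis by blast
  qed
  have kill: "\<exists>\<psi> i. linear_form \<psi> \<and> i < 3 \<and>
      (\<forall>y. \<psi> (y i) = 0 \<longrightarrow> (\<forall>p. p permutes {0..<3} \<longrightarrow> p a = b \<longrightarrow> (\<exists>a < 3. X a (p a) y = 0)))"
    if ab: "a < 3" "b < 3" for a b
  proof (cases "\<exists>p. nzterm p \<and> p a = b")
    case False
    then show ?thesis
      by (intro exI[of _ "\<lambda>_. 0"] exI[of _ 0]) (auto simp: linear_form_def nzterm_def)
  next
    case True
    then obtain p where "nzterm p" "p a = b" by blast
    from lin[OF this(1) ab(1)] this(2) obtain i where i: "i < 3"
      "(\<lambda>k. \<mu> a k - \<nu> b k) = (\<lambda>k. if k = i then 1 else 0)" by auto
    from h[OF ab] have "mhom (\<lambda>k. if k = i then 1 else 0) (X a b)" unfolding i(2) .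
    then obtain \<psi> where "linear_form \<psi>" "\<And>y. X a b y = \<psi> (y i)" by (rule mhom_linear) blast
    then show ?thesis using i(1) ab(1) by (intro exI[of _ \<psi>] exI[of _ i]) auto
  qed
  \<comment> \<open>A position met by no nonzero term leaves two others in its row; killing their
    linear forms kills the determinant.\<close>
  have all: "\<exists>p. nzterm p \<and> p a = b" if ab: "a < 3" "b < 3" for a b
  proof (rule ccontr)
    assume no: "\<not> ?thesis"
    obtain c e where ce: "c < 3" "e < 3" "{0..<3} = {b, c, e}"
    proof -
      have "b = 0 \<or> b = 1 \<or> b = 2" using ab by auto
      then show thesis
      proof (elim disjE)
        assume "b = 0" then show thesis by (intro that[of 1 2]) auto
      next
        assume "b = 1" then show thesis by (intro that[of 0 2]) auto
      next
        assume "b = 2" then show thesis by (intro that[of 0 1]) auto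
      qed
    qed
    obtain \<psi> i where 1: "linear_form \<psi>" "i < 3"
      "\<forall>y. \<psi> (y i) = 0 \<longrightarrow> (\<forall>p. p permutes {0..<3} \<longrightarrow> p a = c \<longrightarrow> (\<exists>a < 3. X a (p a) y = 0))"
      using kill[OF ab(1) ce(1)] by blast
    obtain \<xi> k where 2: "linear_form \<xi>" "k < 3"
      "\<forall>y. \<xi> (y k) = 0 \<longrightarrow> (\<forall>p. p permutes {0..<3} \<longrightarrow> p a = e \<longrightarrow> (\<exists>a < 3. X a (p a) y = 0))"
      using kill[OF ab(1) ce(2)] by blast
    obtain y where y: "\<psi> (y i) = 0" "\<xi> (y k) = 0" "pm 3 J y \<noteq> 0"
      by (rule pm3_two_forms[OF J(1,2) 1(2) 2(2) 1(1) 2(1)])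
    have "det (eval_mat 3 X y) = 0"
    proof (rule det_zero_terms[OF eval_mat_carrier])
      fix p :: "nat \<Rightarrow> nat" assume p: "p permutes {0..<3}"
      have "p a \<in> {0..<3}" using permutes_in_image[OF p, of a] ab(1) by simp
      then have "p a = b \<or> p a = c \<or> p a = e" unfolding ce(3) by simp
      then have "\<exists>a < 3. X a (p a) y = 0"
        using 1(3) 2(3) y(1,2) p no by (auto simp: nzterm_def)
      then obtain a where "a < 3" "X a (p a) y = 0" by blast
      moreover have "p a < 3" using permutes_in_image[OF p, of a] \<open>a < 3\<close> by simp
      ultimately show "\<exists>a < 3. eval_mat 3 X y $$ (a, p a) = 0" by auto
    qed
    with d J(3) y(3) show False by simp
  qed
  have "\<exists>i. i < 3 \<and> (\<lambda>k. \<mu> a k - \<nu> b k) = (\<lambda>k. if k = i then 1 else 0)"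
    if "a < 3" "b < 3" for a b
    using all[OF that] lin[OF _ that(1)] by blast
  then obtain r where r: "\<And>a b. a < 3 \<Longrightarrow> b < 3 \<Longrightarrow> r a b < 3"
    "\<And>a b. a < 3 \<Longrightarrow> b < 3 \<Longrightarrow> (\<lambda>k. \<mu> a k - \<nu> b k) = (\<lambda>k. if k = r a b then 1 else 0)"
    by metis
  have rk: "\<mu> a k - \<nu> b k = (if k = r a b then 1 else 0)" if "a < 3" "b < 3" for a b k
    using fun_cong[OF r(2)[OF that], of k] .
  have "\<exists>\<psi>. linear_form \<psi> \<and> (\<forall>y. X a b y = \<psi> (y (r a b)))" if ab: "a < 3" "b < 3" for a b
  proof -
    from h[OF ab] have "mhom (\<lambda>k. if k = r a b then 1 else 0) (X a b)" unfolding r(2)[OF ab] .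
    then obtain \<psi> where "linear_form \<psi>" "\<And>y. X a b y = \<psi> (y (r a b))" by (rule mhom_linear) blast
    then show ?thesis by blast
  qed
  then obtain \<psi> where \<psi>: "\<And>a b. a < 3 \<Longrightarrow> b < 3 \<Longrightarrow> linear_form (\<psi> a b)"
    "\<And>a b y. a < 3 \<Longrightarrow> b < 3 \<Longrightarrow> X a b y = \<psi> a b (y (r a b))" by metis
  \<comment> \<open>The identity \<open>(\<mu> a - \<nu> b) + (\<mu> a' - \<nu> b') = (\<mu> a' -
    \<nu> b) + (\<mu> a - \<nu> b')\<close> equates two sums of unit vectors.\<close>
  have grid: "r a b = r a' b \<and> r a b' = r a' b' \<or> r a b = r a b' \<and> r a' b = r a' b'"
    if "a < 3" "a' < 3" "b < 3" "b' < 3" for a a' b b'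
  proof -
    have eq: "(if k = r a b then 1 else 0 :: int) + (if k = r a' b' then 1 else 0)
        = (if k = r a' b then 1 else 0) + (if k = r a b' then 1 else 0)" for k
      unfolding rk[OF that(1,3), symmetric] rk[OF that(2,4), symmetric] rk[OF that(2,3), symmetric]
        rk[OF that(1,4), symmetric] by simp
    show ?thesis using eq[of "r a b"] eq[of "r a' b'"] eq[of "r a' b"] eq[of "r a b'"]
      by (auto split: if_splits)
  qed
  obtain p where nt: "nzterm p" using all[of 0 0] by auto
  then obtain y0 where p: "p permutes {0..<3}" and y0: "\<forall>a < 3. X a (p a) y0 \<noteq> 0" by (auto simp: nzterm_def)
  have pl: "p a < 3" if "a < 3" for a using permutes_in_image[OF p, of a] that by simp
  have one: "(\<Sum>a<3. if k = r a (p a) then 1 else 0 :: int) = 1" if "k < 3" for k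
  proof -
    have "(\<Sum>a<3. if k = r a (p a) then 1 else 0 :: int) = (\<Sum>a<3. \<mu> a k - \<nu> (p a) k)"
      by (intro sum.cong) (auto simp: rk pl)
    then show ?thesis using weighted_rep_term_degree(2)[OF w p y0, of k] that by simp
  qed
  have ne: "r a (p a) \<noteq> r b (p b)" if "a < 3" "b < 3" "a \<noteq> b" for a b
  proof
    assume eq: "r a (p a) = r b (p b)"
    have "(\<Sum>c\<in>{a, b}. if r a (p a) = r c (p c) then 1 else 0 :: int)
        \<le> (\<Sum>c<3. if r a (p a) = r c (p c) then 1 else 0 :: int)"
      using that by (intro sum_mono2) auto
    then show False using one[OF r(1)[OF that(1) pl[OF that(1)]]] eq that(3) by simp
  qed
  have "(\<forall>a < 3. \<forall>b < 3. \<forall>b' < 3. r a b = r a b') \<or> (\<forall>a < 3. \<forall>a' < 3. \<forall>b < 3. r a b = r a' b)"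
    by (rule grid_rows_or_columns[OF grid])
  then show False
  proof
    assume rows: "\<forall>a < 3. \<forall>b < 3. \<forall>b' < 3. r a b = r a b'"
    have eq: "r a b = r a 0" if "a < 3" "b < 3" for a b using rows that by (meson zero_less_numeral)
    show False
    proof (rule size_3_rows_impossible[OF J d])
      show "X a b y = \<psi> a b (y (r a 0))" if "a < 3" "b < 3" for a b y
        using \<psi>(2)[OF that] eq[OF that] by metis
      show "r 0 0 < 3" "r 1 0 < 3" using r(1) by auto
      have "r 0 (p 0) \<noteq> r 1 (p 1)" by (rule ne) auto
      moreover have "r 0 (p 0) = r 0 0" "r 1 (p 1) = r 1 0" by (rule eq; use pl in simp)+
      ultimately show "r 0 0 \<noteq> r 1 0" by metis
    qed (use \<psi>(1) in auto)
  next
    assume cols: "\<forall>a < 3. \<forall>a' < 3. \<forall>b < 3. r a b = r a' b"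
    have eq: "r a b = r 0 b" if "a < 3" "b < 3" for a b using cols that by (meson zero_less_numeral)
    have ne': "r 0 b \<noteq> r 0 c" if "b < 3" "c < 3" "b \<noteq> c" for b c
    proof -
      obtain a a' where a: "p a = b" "p a' = c" using permutes_surj[OF p] by (metis surjD)
      then have "a < 3" "a' < 3" using permutes_in_image[OF p, of a] permutes_in_image[OF p, of a'] that by auto
      moreover have "a \<noteq> a'" using a that(3) by auto
      ultimately have "r a b \<noteq> r a' c" using ne[of a a'] a by metis
      moreover have "r a b = r 0 b" "r a' c = r 0 c" by (rule eq; fact)+
      ultimately show ?thesis by metis
    qed
    show False
    proof (rule size_3_rows_impossible[OF J])
      fix y
      have "eval_mat 3 (\<lambda>a b. X b a) y = transpose_mat (eval_mat 3 X y)"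
        by (intro eq_matI) auto
      then show "det (eval_mat 3 (\<lambda>a b. X b a) y) = \<gamma> * pm 3 J y"
        by (simp add: d det_transpose[of _ 3])
    next
      show "X b a y = (\<lambda>a b. \<psi> b a) a b (y (r 0 a))" if "a < 3" "b < 3" for a b y
        using \<psi>(2)[OF that(2,1)] eq[OF that(2,1)] by metis
      show "r 0 0 < 3" "r 0 1 < 3" using r(1) by auto
      show "r 0 0 \<noteq> r 0 1" using ne'[of 0 1] by auto
    qed (use \<psi>(1) in auto)
  qed
qed

text \<open>Each row of a nonzero term contributes degree at least one to a total of three, which
  leaves the sizes two and three.\<close>

lemma weighted_rep_no_constants_3:
  assumes w: "weighted_rep 3 J n X \<mu> \<nu> \<gamma>" and n: "2 \<le> n"
    and X0: "\<And>a b. a < n \<Longrightarrow> b < n \<Longrightarrow> X a b (\<lambda>_ _. 0) = 0"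
  shows False
proof -
  from w have J: "finite J" "card J = 3" "\<gamma> \<noteq> 0" and d: "\<And>y. det (eval_mat n X y) = \<gamma> * pm 3 J y"
    by (auto simp: weighted_rep_def)
  obtain y where "pm 3 J y \<noteq> 0" using pm_nonzero J by blast
  then have "det (eval_mat n X y) \<noteq> 0" using d J by simp
  then obtain p where p: "p permutes {0..<n}" "\<And>a. a < n \<Longrightarrow> eval_mat n X y $$ (a, p a) \<noteq> 0"
    by (rule det_nonzero_term[OF eval_mat_carrier]) blast
  have nz: "\<forall>a < n. X a (p a) y \<noteq> 0"
    using p permutes_in_image[OF p(1)] by (metis atLeastLessThan_iff eval_mat_index zero_le)
  note tot = weighted_rep_term_total[OF w X0 p(1) nz]
  have "int n = (\<Sum>a<n. 1)" by simp
  also have "\<dots> \<le> (\<Sum>a<n. \<Sum>i<3. \<mu> a i - \<nu> (p a) i)"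
    by (intro sum_mono) (use tot(1) in auto)
  also have "\<dots> = 3" using tot(2) by simp
  finally have "n = 2 \<or> n = 3" using n by linarith
  then show False using size_2_impossible[of J X \<mu> \<nu> \<gamma>] size_3_impossible[of J X \<mu> \<nu> \<gamma>] w X0 by blast
qed

text \<open>Fixing the last row to a suitable nonzero vector keeps the constant part of corank at least two
  and turns the permanent into a multiple of a smaller one.\<close>

lemma weighted_rep_no_constants_step:
  assumes w: "weighted_rep (Suc k) J n X \<mu> \<nu> \<gamma>" and k: "3 \<le> k" and n: "2 \<le> n"
    and X0: "\<And>a b. a < n \<Longrightarrow> b < n \<Longrightarrow> X a b (\<lambda>_ _. 0) = 0"
    and smaller: "\<And>J X \<mu> \<nu> \<gamma>. weighted_rep k J n X \<mu> \<nu> \<gamma> \<Longrightarrow> corank_le_1 n (eval_mat n X (\<lambda>_ _. 0))"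
  shows False
proof -
  from w have J: "finite J" "card J = Suc k" "\<gamma> \<noteq> 0" and d: "\<And>y. det (eval_mat n X y) = \<gamma> * pm (Suc k) J y"
    and h: "\<And>a b. a < n \<Longrightarrow> b < n \<Longrightarrow> mhom (\<lambda>i. \<mu> a i - \<nu> b i) (X a b)"
    and z: "\<And>a i. i \<ge> Suc k \<Longrightarrow> \<mu> a i = 0" "\<And>a i. i \<ge> Suc k \<Longrightarrow> \<nu> a i = 0"
    by (auto simp: weighted_rep_def)
  obtain x where x: "\<And>p y. p permutes {0..<n} \<Longrightarrow> \<forall>a < n. X a (p a) y \<noteq> 0 \<Longrightarrow>
       \<exists>a0 < n. \<nu> (p a0) k = x \<and> \<mu> a0 k = x + 1 \<and> (\<forall>a < n. a \<noteq> a0 \<longrightarrow> \<mu> a k = \<nu> (p a) k)"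
    using weighted_rep_jump[OF w, of k] by blast
  \<comment> \<open>By \<open>weighted_rep_jump\<close>, a nonzero Leibniz term uses only positions
    of equal weight in row \<open>k\<close> or the jump from \<open>x\<close> to
    \<open>x + 1\<close>. Emptying all other positions keeps the determinant and confines positive
    degree in row \<open>k\<close> to \<open>R \<times> C\<close>.\<close>
  define Y where "Y a b = (if \<mu> a k = \<nu> b k \<or> \<nu> b k = x \<and> \<mu> a k = x + 1 then X a b else (\<lambda>_. 0))" for a b
  have hY: "mhom (\<lambda>i. \<mu> a i - \<nu> b i) (Y a b)" if "a < n" "b < n" for a b
    using h[OF that] by (simp add: Y_def)
  have Y0: "Y a b (\<lambda>_ _. 0) = 0" if "a < n" "b < n" for a b using X0[OF that] by (simp add: Y_def)
  have dY: "det (eval_mat n Y y) = det (eval_mat n X y)" for y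
  proof -
    have "(\<Prod>a = 0..<n. eval_mat n Y y $$ (a, p a)) = (\<Prod>a = 0..<n. eval_mat n X y $$ (a, p a))"
      if p: "p permutes {0..<n}" for p
    proof (cases "\<forall>a < n. X a (p a) y \<noteq> 0")
      case True
      from x[OF p True] have "Y a (p a) = X a (p a)" if "a < n" for a using that by (auto simp: Y_def)
      then show ?thesis using permutes_in_image[OF p] by (intro prod.cong) auto
    next
      case False
      then obtain a where a: "a < n" "X a (p a) y = 0" by blast
      have "p a < n" using permutes_in_image[OF p, of a] a by simp
      with a have "eval_mat n X y $$ (a, p a) = 0" "eval_mat n Y y $$ (a, p a) = 0" by (auto simp: Y_def)
      then have "(\<Prod>a = 0..<n. eval_mat n X y $$ (a, p a)) = 0" "(\<Prod>a = 0..<n. eval_mat n Y y $$ (a, p a)) = 0"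
        using a(1) by (auto intro: prod_zero)
      then show ?thesis by (simp only:)
    qed
    then show ?thesis unfolding det_def'[OF eval_mat_carrier] by (intro sum.cong) auto
  qed
  define R where "R = {a \<in> {0..<n}. \<mu> a k = x + 1}"
  define C where "C = {b \<in> {0..<n}. \<nu> b k = x}"
  \<comment> \<open>A nonzero term maps \<open>R\<close> without its jumping row to columns of
    weight \<open>x + 1\<close>, hence outside \<open>C\<close>.\<close>
  have RC: "card R + card C \<le> n + 1"
  proof -
    obtain y where "pm (Suc k) J y \<noteq> 0" using pm_nonzero J by blast
    then have "det (eval_mat n X y) \<noteq> 0" using d J by simp
    then obtain p where p: "p permutes {0..<n}" "\<And>a. a < n \<Longrightarrow> eval_mat n X y $$ (a, p a) \<noteq> 0"
      by (rule det_nonzero_term[OF eval_mat_carrier]) blast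
    have pl: "p a < n" if "a < n" for a using permutes_in_image[OF p(1), of a] that by simp
    have nz: "\<forall>a < n. X a (p a) y \<noteq> 0" using p pl by auto
    from x[OF p(1) nz] obtain a0 where a0: "a0 < n" "\<nu> (p a0) k = x" "\<mu> a0 k = x + 1"
      "\<forall>a < n. a \<noteq> a0 \<longrightarrow> \<mu> a k = \<nu> (p a) k" by blast
    have "p ` (R - {a0}) \<inter> C = {}" using a0(4) by (auto simp: R_def C_def)
    moreover have "p ` (R - {a0}) \<union> C \<subseteq> {0..<n}" using pl by (auto simp: R_def C_def)
    moreover have fin: "finite R" "finite C" by (auto simp: R_def C_def)
    ultimately have "card (p ` (R - {a0})) + card C \<le> n"
      by (metis card_Un_disjoint card_atLeastLessThan card_mono diff_zero finite_Diff finite_atLeastLessThan finite_imageI)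
    moreover have "card (p ` (R - {a0})) = card R - 1"
    proof -
      have "inj_on p (R - {a0})" using permutes_inj_on[OF p(1)] .
      moreover have "a0 \<in> R" using a0 by (simp add: R_def)
      ultimately show ?thesis using fin by (simp add: card_image)
    qed
    ultimately show ?thesis by linarith
  qed
  \<comment> \<open>At most two positions have to be killed to destroy every near matching inside
    \<open>R \<times> C\<close>, and row \<open>k\<close> has enough columns for a nonzero vector in
    the kernel of two linear forms.\<close>
  obtain E e f where E: "E \<subseteq> R \<times> C" "E \<subseteq> {e, f}"
    "\<And>p a1. p permutes {0..<n} \<Longrightarrow> a1 < n \<Longrightarrow> \<forall>a < n. a \<noteq> a1 \<longrightarrow> a \<in> R \<and> p a \<in> C \<Longrightarrow>
       \<exists>a < n. a \<noteq> a1 \<and> (a, p a) \<in> E"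
    by (rule few_entries_meet_matchings[OF n _ _ RC]) (auto simp: R_def C_def)
  define last :: "(nat \<Rightarrow> complex) \<Rightarrow> nat \<Rightarrow> nat \<Rightarrow> complex" where
    "last v = (\<lambda>i j. if i = k then v j else 0)" for v
  \<comment> \<open>At a point supported on row \<open>k\<close>, an entry of degree one in that row
    is a linear form if it involves no other row, and zero otherwise.\<close>
  have form: "\<exists>\<psi>. linear_form \<psi> \<and> ((a, b) \<in> E \<longrightarrow> (\<forall>v. Y a b (last v) = \<psi> v))" for a b
  proof (cases "(a, b) \<in> E")
    case True
    then have ab: "a < n" "b < n" "\<mu> a k - \<nu> b k = 1" using E(1) by (auto simp: R_def C_def)
    show ?thesis
    proof (cases "\<forall>i. i \<noteq> k \<longrightarrow> \<mu> a i - \<nu> b i = 0")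
      case True
      then have "(\<lambda>i. \<mu> a i - \<nu> b i) = (\<lambda>i. if i = k then 1 else 0)" using ab(3) by auto
      with hY[OF ab(1,2)] have "mhom (\<lambda>i. if i = k then 1 else 0) (Y a b)" by simp
      then obtain \<psi> where "linear_form \<psi>" "\<And>y. Y a b y = \<psi> (y k)" by (rule mhom_linear) blast
      then show ?thesis by (intro exI[of _ \<psi>]) (simp add: last_def)
    next
      case False
      then obtain i where "i \<noteq> k" "\<mu> a i - \<nu> b i \<noteq> 0" by blast
      then have "Y a b (last v) = 0" for v
        by (intro mhom_zero_row[OF hY[OF ab(1,2)], of i]) (auto simp: last_def)
      then show ?thesis by (intro exI[of _ "\<lambda>_. 0"]) (simp add: linear_form_def)
    qed
  next
    case False
    then show ?thesis by (intro exI[of _ "\<lambda>_. 0"]) (simp add: linear_form_def)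
  qed
  obtain \<psi> where \<psi>: "linear_form \<psi>" "e \<in> E \<longrightarrow> (\<forall>v. Y (fst e) (snd e) (last v) = \<psi> v)"
    using form[of "fst e" "snd e"] by auto
  obtain \<xi> where \<xi>: "linear_form \<xi>" "f \<in> E \<longrightarrow> (\<forall>v. Y (fst f) (snd f) (last v) = \<xi> v)"
    using form[of "fst f" "snd f"] by auto
  obtain v where v: "\<psi> v = 0" "\<xi> v = 0" "\<exists>j\<in>J. v j \<noteq> 0"
    by (rule two_forms_kernel[OF \<psi>(1) \<xi>(1) J(1)]) (use J(2) k in auto)
  then obtain j where j: "j \<in> J" "v j \<noteq> 0" by blast
  have killed: "Y a b (last v) = 0" if "(a, b) \<in> E" for a b
    using that E(2) \<psi>(2) \<xi>(2) v(1,2) by (metis fst_conv insertE singletonD snd_conv subsetD)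
  define X' where "X' a b y = Y a b (subst_row k v j y)" for a b y
  \<comment> \<open>The values at \<open>last v\<close> have become the constants of a
    representation with one row less.\<close>
  have "weighted_rep k (J - {j}) n X' (\<lambda>a. (\<mu> a)(k := 0)) (\<lambda>b. (\<nu> b)(k := 0)) (\<gamma> * v j)"
    unfolding weighted_rep_def
  proof (intro conjI allI impI)
    fix a b assume ab: "a < n" "b < n"
    have "(\<lambda>i. ((\<mu> a)(k := 0)) i - ((\<nu> b)(k := 0)) i) = (\<lambda>i. \<mu> a i - \<nu> b i)(k := 0)" by auto
    then show "mhom (\<lambda>i. ((\<mu> a)(k := 0)) i - ((\<nu> b)(k := 0)) i) (X' a b)"
      unfolding X'_def using mhom_subst_row[OF hY[OF ab], of k v j] by simp
  next
    fix y
    have "eval_mat n X' y = eval_mat n Y (subst_row k v j y)" by (intro eq_matI) (auto simp: X'_def)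
    then show "det (eval_mat n X' y) = \<gamma> * v j * pm k (J - {j}) y"
      by (simp add: dY d pm_subst_row[OF J(1,2) j(1)] del: pm.simps)
  qed (use J j z in auto)
  from smaller[OF this] obtain p a1 where p: "p permutes {0..<n}" "a1 < n"
    "\<And>a. a < n \<Longrightarrow> a \<noteq> a1 \<Longrightarrow> eval_mat n X' (\<lambda>_ _. 0) $$ (a, p a) \<noteq> 0"
    by (rule corank_near_matching[OF eval_mat_carrier]) blast
  have pl: "p a < n" if "a < n" for a using permutes_in_image[OF p(1), of a] that by simp
  have "subst_row k v j (\<lambda>_ _. 0) = last v" by (auto simp: subst_row_def last_def fun_eq_iff)
  then have nz: "Y a (p a) (last v) \<noteq> 0" if "a < n" "a \<noteq> a1" for a
    using p(3)[OF that] pl[OF that(1)] that(1) by (simp add: X'_def)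
  \<comment> \<open>A constant that is nonzero now but was zero before comes from row
    \<open>k\<close> alone, hence from the jump.\<close>
  have "a \<in> R \<and> p a \<in> C" if a: "a < n" "a \<noteq> a1" for a
  proof -
    note hYa = hY[OF a(1) pl[OF a(1)]]
    have others: "\<mu> a i - \<nu> (p a) i = 0" if "i \<noteq> k" for i
      using mhom_zero_row[OF hYa, of i "last v"] nz[OF a] that by (auto simp: last_def)
    have "\<mu> a k - \<nu> (p a) k \<noteq> 0"
    proof
      assume "\<mu> a k - \<nu> (p a) k = 0"
      then have "\<mu> a i - \<nu> (p a) i = 0" for i using others by (cases "i = k") auto
      then have "Y a (p a) (last v) = Y a (p a) (\<lambda>_ _. 0)" by (intro mhom_local[OF hYa]) auto
      with nz[OF a] Y0[OF a(1) pl[OF a(1)]] show False by simp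
    qed
    moreover have "Y a (p a) \<noteq> (\<lambda>_. 0)" using nz[OF a] by auto
    ultimately have "\<nu> (p a) k = x \<and> \<mu> a k = x + 1" unfolding Y_def by (auto split: if_splits)
    then show ?thesis using a pl by (simp add: R_def C_def)
  qed
  then have "\<exists>a < n. a \<noteq> a1 \<and> (a, p a) \<in> E" by (intro E(3)[OF p(1,2)]) blast
  then show False using killed nz by blast
qed

text \<open>An entry that is nonzero at the origin has multidegree zero, so it is constant.
  Eliminating it keeps the corank, and the Schur complement stays multihomogeneous because the
  weights of the pivot row and column agree. The inner induction on the size ends with a
  representation without constants, which the outer induction on the number of rows excludes for
  size at least two.\<close>

theorem weighted_rep_corank:
  assumes "3 \<le> m" "weighted_rep m J n X \<mu> \<nu> \<gamma>"
  shows "corank_le_1 n (eval_mat n X (\<lambda>_ _. 0))"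
  using assms
proof (induction m arbitrary: J n X \<mu> \<nu> \<gamma> rule: less_induct)
  case (less m)
  note m = less.prems(1)
  have no_const: False
    if w: "weighted_rep m J n X \<mu> \<nu> \<gamma>" and n: "2 \<le> n"
      and X0: "\<And>a b. a < n \<Longrightarrow> b < n \<Longrightarrow> X a b (\<lambda>_ _. 0) = 0" for J n X \<mu> \<nu> \<gamma>
  proof (cases "m = 3")
    case True
    then show False using weighted_rep_no_constants_3 w n X0 by blast
  next
    case False
    then obtain k where k: "m = Suc k" "3 \<le> k" using m by (cases m) auto
    show False
      by (rule weighted_rep_no_constants_step[OF w[unfolded k(1)] k(2) n X0 less.IH]) (use k in auto)
  qed
  show ?case using less.prems(2)
  proof (induction n arbitrary: X \<mu> \<nu> \<gamma>)
    case 0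
    \<comment> \<open>The empty determinant is one, while the permanent vanishes at the
      origin.\<close>
    from 0 have "1 = \<gamma> * pm m J (\<lambda>_ _. 0)"
      unfolding weighted_rep_def by (metis det_dim_zero eval_mat_carrier)
    moreover obtain k where "m = Suc k" using m by (cases m) auto
    then have "pm m J (\<lambda>_ _. 0) = 0" by simp
    ultimately show ?case by simp
  next
    case (Suc l)
    note w = Suc.prems
    let ?o = "\<lambda>_ _. 0 :: complex"
    from w have J: "finite J" "card J = m" "\<gamma> \<noteq> 0" and d: "\<And>y. det (eval_mat (Suc l) X y) = \<gamma> * pm m J y"
      and h: "\<And>a b. a < Suc l \<Longrightarrow> b < Suc l \<Longrightarrow> mhom (\<lambda>i. \<mu> a i - \<nu> b i) (X a b)"
      and z: "\<And>a i. i \<ge> m \<Longrightarrow> \<mu> a i = 0" "\<And>a i. i \<ge> m \<Longrightarrow> \<nu> a i = 0"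
      by (auto simp: weighted_rep_def)
    show ?case
    proof (cases "\<exists>a < Suc l. \<exists>b < Suc l. X a b ?o \<noteq> 0")
      case False
      then have "\<not> 2 \<le> Suc l" using no_const[OF w] by blast
      then have "l = 0" by simp
      have "eval_mat (Suc l) X ?o + unit_mat (Suc l) 0 0 = 1\<^sub>m (Suc l)"
        using False \<open>l = 0\<close> by (intro eq_matI) auto
      then show ?thesis unfolding corank_le_1_def by (auto intro!: exI[of _ 0])
    next
      case True
      then obtain a0 b0 where ab0: "a0 < Suc l" "b0 < Suc l" "X a0 b0 ?o \<noteq> 0" by blast
      define s where "s = Transposition.transpose 0 a0"
      define t where "t = Transposition.transpose 0 b0"
      have s: "s permutes {0..<Suc l}" and t: "t permutes {0..<Suc l}"
        unfolding s_def t_def using ab0 by (auto intro!: permutes_swap_id)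
      have sl: "s a < Suc l" "t a < Suc l" if "a < Suc l" for a
        using permutes_in_image[OF s, of a] permutes_in_image[OF t, of a] that by auto
      define M where "M y = mat (Suc l) (Suc l) (\<lambda>(a, b). eval_mat (Suc l) X y $$ (s a, t b))" for y
      have Mc: "M y \<in> carrier_mat (Suc l) (Suc l)" for y by (simp add: M_def)
      have Mi: "M y $$ (a, b) = X (s a) (t b) y" if "a < Suc l" "b < Suc l" for a b y
        using that sl by (simp add: M_def)
      have dM: "det (M y) = signof s * signof t * det (eval_mat (Suc l) X y)" for y
        unfolding M_def by (rule det_permute_rows_cols[OF eval_mat_carrier s t])
      define p where "p = X a0 b0 ?o"
      have "s 0 = a0" "t 0 = b0" by (simp_all add: s_def t_def)
      from h[OF ab0(1,2)] ab0(3) have "(\<lambda>i. \<mu> a0 i - \<nu> b0 i) = (\<lambda>_. 0)" by (rule mhom_at_zero)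
      then have wt: "\<mu> (s 0) i = \<nu> (t 0) i" for i using \<open>s 0 = a0\<close> \<open>t 0 = b0\<close> by (metis eq_iff_diff_eq_0)
      have p: "M y $$ (0, 0) = p" for y
        using Mi[of 0 0 y] mhom_local[OF h[OF ab0(1,2)], of y ?o] wt \<open>s 0 = a0\<close> \<open>t 0 = b0\<close>
        by (simp add: p_def)
      have p0: "p \<noteq> 0" using ab0 by (simp add: p_def)
      define X' where "X' a b y = X (s (Suc a)) (t (Suc b)) y - X (s (Suc a)) (t 0) y * X (s 0) (t (Suc b)) y / p" for a b y
      have S: "schur_compl (M y) = eval_mat l X' y" for y
        using Mc[of y] by (intro eq_matI) (auto simp: schur_compl_def X'_def Mi p)
      have "weighted_rep m J l X' (\<lambda>a. \<mu> (s (Suc a))) (\<lambda>b. \<nu> (t (Suc b))) (signof s * signof t * \<gamma> / p)"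
        unfolding weighted_rep_def
      proof (intro conjI allI impI)
        fix a b assume ab: "a < l" "b < l"
        have 1: "mhom (\<lambda>i. \<mu> (s (Suc a)) i - \<nu> (t (Suc b)) i) (X (s (Suc a)) (t (Suc b)))"
          by (rule h) (use ab sl in auto)
        have 2: "mhom (\<lambda>i. (\<mu> (s (Suc a)) i - \<nu> (t 0) i) + (\<mu> (s 0) i - \<nu> (t (Suc b)) i))
            (\<lambda>y. X (s (Suc a)) (t 0) y * X (s 0) (t (Suc b)) y)"
          by (intro mhom_mult h) (use ab sl in auto)
        have "(\<lambda>i. (\<mu> (s (Suc a)) i - \<nu> (t 0) i) + (\<mu> (s 0) i - \<nu> (t (Suc b)) i)) = (\<lambda>i. \<mu> (s (Suc a)) i - \<nu> (t (Suc b)) i)"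
          using wt by auto
        with 2 have "mhom (\<lambda>i. \<mu> (s (Suc a)) i - \<nu> (t (Suc b)) i) (\<lambda>y. (- 1 / p) * (X (s (Suc a)) (t 0) y * X (s 0) (t (Suc b)) y))"
          by (intro mhom_cmult) simp
        from mhom_add[OF 1 this] show "mhom (\<lambda>i. \<mu> (s (Suc a)) i - \<nu> (t (Suc b)) i) (X' a b)"
          by (simp add: X'_def[abs_def])
      next
        fix y
        have "det (M y) = p * det (eval_mat l X' y)"
          using det_schur_compl[OF Mc, of y] p[of y] p0 S by simp
        then show "det (eval_mat l X' y) = signof s * signof t * \<gamma> / p * pm m J y"
          using p0 by (simp add: dM d field_simps)
      qed (use J z p0 in \<open>auto simp: sign_def\<close>)
      from Suc.IH[OF this] obtain a b where ab: "a < l" "b < l" "det (eval_mat l X' ?o + unit_mat l a b) \<noteq> 0"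
        by (auto simp: corank_le_1_def)
      let ?N = "M ?o + unit_mat (Suc l) (Suc a) (Suc b)"
      have N: "?N \<in> carrier_mat (Suc l) (Suc l)" using Mc by simp
      have N0: "?N $$ (0, 0) = p" using Mc[of ?o] p[of ?o] by simp
      have "schur_compl ?N = eval_mat l X' ?o + unit_mat l a b"
        using Mc[of ?o] N0 by (intro eq_matI) (auto simp: schur_compl_def X'_def Mi p)
      then have "det ?N \<noteq> 0" using det_schur_compl[OF N] N0 p0 ab(3) by simp
      let ?L = "eval_mat (Suc l) X ?o + unit_mat (Suc l) (s (Suc a)) (t (Suc b))"
      have "?N = mat (Suc l) (Suc l) (\<lambda>(i, j). ?L $$ (s i, t j))"
      proof (rule eq_matI)
        fix i j assume "i < dim_row (mat (Suc l) (Suc l) (\<lambda>(i, j). ?L $$ (s i, t j)))"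
          "j < dim_col (mat (Suc l) (Suc l) (\<lambda>(i, j). ?L $$ (s i, t j)))"
        then have ij: "i < Suc l" "j < Suc l" by auto
        have "s i = s (Suc a) \<longleftrightarrow> i = Suc a" "t j = t (Suc b) \<longleftrightarrow> j = Suc b"
          using permutes_inj[OF s] permutes_inj[OF t] by (auto dest: injD)
        then show "?N $$ (i, j) = mat (Suc l) (Suc l) (\<lambda>(i, j). ?L $$ (s i, t j)) $$ (i, j)"
          using ij Mc[of ?o] sl by (simp add: Mi)
      qed (use Mc[of ?o] in auto)
      then have "det ?N = signof s * signof t * det ?L"
        using det_permute_rows_cols[of ?L "Suc l", OF _ s t] by simp
      with \<open>det ?N \<noteq> 0\<close> have "det ?L \<noteq> 0" by auto
      moreover have "s (Suc a) < Suc l" "t (Suc b) < Suc l" using sl ab by auto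
      ultimately show ?thesis unfolding corank_le_1_def by blast
    qed
  qed
qed

section \<open>Adjugates of a weighted representation\<close>

text \<open>Multiplied by \<open>A * B\<close> from the left, both sides become
  \<open>det (A * B)\<close> times the identity; the determinant is then cancelled
  entrywise.\<close>

lemma adj_mat_mult_idom:
  fixes A B :: "'a :: idom mat"
  assumes A: "A \<in> carrier_mat n n" and B: "B \<in> carrier_mat n n" and d: "det A \<noteq> 0" "det B \<noteq> 0"
  shows "adj_mat (A * B) = adj_mat B * adj_mat A"
proof -
  let ?C = "A * B" let ?D = "adj_mat B * adj_mat A"
  have C: "?C \<in> carrier_mat n n" using A B by simp
  note adj = adj_mat[OF A] adj_mat[OF B] adj_mat[OF C]
  have D: "?D \<in> carrier_mat n n" using adj by simp
  have dC: "det ?C = det A * det B" by (rule det_mult[OF A B])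
  have "B * ?D = (B * adj_mat B) * adj_mat A"
    by (rule assoc_mult_mat[symmetric, OF B adj(4,1)])
  also have "\<dots> = det B \<cdot>\<^sub>m adj_mat A"
    using adj by (simp add: mult_smult_assoc_mat[of _ n n _ n])
  finally have "A * (B * ?D) = A * (det B \<cdot>\<^sub>m adj_mat A)" by simp
  also have "\<dots> = det B \<cdot>\<^sub>m (A * adj_mat A)"
    by (rule mult_smult_distrib[OF A adj(1)])
  also have "\<dots> = det ?C \<cdot>\<^sub>m 1\<^sub>m n"
    unfolding adj(2) dC by (intro eq_matI) auto
  finally have CD: "?C * ?D = det ?C \<cdot>\<^sub>m 1\<^sub>m n" unfolding assoc_mult_mat[OF A B D] .
  have "det ?C \<cdot>\<^sub>m ?D = adj_mat ?C * ?C * ?D"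
    using adj D by (simp add: mult_smult_assoc_mat[of _ n n _ n])
  also have "\<dots> = adj_mat ?C * (?C * ?D)"
    using C D adj(7) by (simp add: assoc_mult_mat[of _ n n _ n _ n])
  also have "\<dots> = det ?C \<cdot>\<^sub>m adj_mat ?C"
    unfolding CD using adj(7) by (simp add: mult_smult_distrib[OF adj(7) one_carrier_mat])
  finally have eq: "det ?C \<cdot>\<^sub>m ?D = det ?C \<cdot>\<^sub>m adj_mat ?C" .
  show ?thesis
  proof (rule eq_matI)
    fix i j assume "i < dim_row ?D" "j < dim_col ?D"
    then have ij: "i < n" "j < n" using D by auto
    have "det ?C * ?D $$ (i, j) = det ?C * adj_mat ?C $$ (i, j)"
      using arg_cong[OF eq, of "\<lambda>M. M $$ (i, j)"] ij adj(1,4,7) by simp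
    then show "adj_mat ?C $$ (i, j) = ?D $$ (i, j)" using d dC by simp
  qed (use D adj(7) in auto)
qed

lemma (in comm_ring_hom) adj_mat_hom:
  assumes "A \<in> carrier_mat n n" shows "map_mat hom (adj_mat A) = adj_mat (map_mat hom A)"
proof (rule eq_matI)
  fix i j assume "i < dim_row (adj_mat (map_mat hom A))" "j < dim_col (adj_mat (map_mat hom A))"
  then have ij: "i < n" "j < n" using assms by (auto simp: adj_mat_def)
  have "mat_delete (map_mat hom A) j i = map_mat hom (mat_delete A j i)"
    using assms ij by (intro eq_matI) (auto simp: mat_delete_def)
  then have "cofactor (map_mat hom A) j i = hom (cofactor A j i)"
    by (simp add: cofactor_def hom_distribs)
  then show "map_mat hom (adj_mat A) $$ (i, j) = adj_mat (map_mat hom A) $$ (i, j)"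
    using assms ij by (simp add: adj_mat_def)
qed (use assms in \<open>auto simp: adj_mat_def\<close>)

text \<open>Singular matrices are reached by specialising the invertible polynomial matrices \<open>x + A\<close>.\<close>

lemma adj_mat_mult:
  fixes A B :: "complex mat"
  assumes A: "A \<in> carrier_mat n n" and B: "B \<in> carrier_mat n n"
  shows "adj_mat (A * B) = adj_mat B * adj_mat A"
proof -
  let ?ev = "\<lambda>p :: complex poly. poly p 0"
  let ?P = "\<lambda>M. char_poly_matrix (- M)"
  have P: "?P M \<in> carrier_mat n n" if "M \<in> carrier_mat n n" for M :: "complex mat"
    using that by (simp add: char_poly_matrix_def)
  \<comment> \<open>The determinant of \<open>x + M\<close> is the characteristic polynomial of
    \<open>- M\<close>, which is monic.\<close>
  have dP: "det (?P M) \<noteq> 0" if "M \<in> carrier_mat n n" for M :: "complex mat"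
    using degree_monic_char_poly[of "- M" n] that unfolding char_poly_def by (metis monic_degree_0 one_poly_eq_simps(1) lead_coeff_1 uminus_carrier_mat zero_neq_one leading_coeff_0_iff)
  have evP: "map_mat ?ev (?P M) = M" if "M \<in> carrier_mat n n" for M :: "complex mat"
    using that by (intro eq_matI) (auto simp: char_poly_matrix_def)
  have m: "map_mat ?ev (X * Y) = map_mat ?ev X * map_mat ?ev Y"
    if "X \<in> carrier_mat n n" "Y \<in> carrier_mat n n" for X Y
    by (rule semiring_hom.mat_hom_mult[OF _ that]) (unfold_locales, auto)
  have "adj_mat (?P A * ?P B) = adj_mat (?P B) * adj_mat (?P A)"
    by (rule adj_mat_mult_idom[OF P[OF A] P[OF B] dP[OF A] dP[OF B]])
  then have "map_mat ?ev (adj_mat (?P A * ?P B)) = map_mat ?ev (adj_mat (?P B) * adj_mat (?P A))" by simp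
  then show ?thesis
    using P[OF A] P[OF B] adj_mat(1)[OF P[OF A]] adj_mat(1)[OF P[OF B]]
    by (simp add: poly_hom.adj_mat_hom[of _ n] m evP[OF A] evP[OF B])
qed

lemma adj_mat_index:
  "A \<in> carrier_mat n n \<Longrightarrow> i < n \<Longrightarrow> j < n \<Longrightarrow> adj_mat A $$ (i, j) = cofactor A j i"
  by (simp add: adj_mat_def)

lemma cofactor_eq_det:
  assumes M: "M \<in> carrier_mat n n" and ab: "a < n" "b < n"
  shows "cofactor M a b = det (mat n n (\<lambda>(i, j). if i = a then if j = b then 1 else 0 else M $$ (i, j)))"
    (is "_ = det ?N")
proof -
  have N: "?N \<in> carrier_mat n n" by simp
  have "det ?N = (\<Sum>j<n. ?N $$ (a, j) * cofactor ?N a j)" by (rule laplace_expansion_row[OF N ab(1)])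
  also have "\<dots> = (\<Sum>j<n. if j = b then cofactor M a j else 0)"
  proof (rule sum.cong)
    fix j assume "j \<in> {..<n}"
    moreover have "cofactor ?N a j = cofactor M a j"
      by (rule cofactor_cong_row[OF N M ab(1)]) auto
    ultimately show "?N $$ (a, j) * cofactor ?N a j = (if j = b then cofactor M a j else 0)" using ab by simp
  qed simp
  finally show ?thesis using ab by simp
qed

text \<open>A cofactor is the determinant after replacing row \<open>a\<close> by a unit vector.
  Giving that row the weight of column \<open>b\<close> keeps the matrix multihomogeneous, so that
  \<open>mhom_det\<close> applies.\<close>

lemma mhom_adj_mat:
  assumes X: "\<And>a b. a < n \<Longrightarrow> b < n \<Longrightarrow> mhom (\<lambda>i. \<mu> a i - \<nu> b i) (X a b)" and ab: "a < n" "b < n"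
  shows "mhom (\<lambda>i. (\<Sum>a<n. \<mu> a i) - (\<Sum>b<n. \<nu> b i) - \<mu> a i + \<nu> b i) (\<lambda>y. adj_mat (eval_mat n X y) $$ (b, a))"
proof -
  define X' where "X' i j = (if i = a then (\<lambda>_. if j = b then 1 else 0) else X i j)" for i j
  define \<mu>' where "\<mu>' = \<mu>(a := \<nu> b)"
  have "mhom (\<lambda>k. \<mu>' i k - \<nu> j k) (X' i j)" if "i < n" "j < n" for i j
    using X[OF that] by (auto simp: X'_def \<mu>'_def)
  from mhom_det[of n, OF this] have 1: "mhom (\<lambda>i. (\<Sum>a<n. \<mu>' a i) - (\<Sum>b<n. \<nu> b i)) (\<lambda>y. det (mat n n (\<lambda>(a, b). X' a b y)))" .
  have "(\<Sum>c<n. \<mu>' c i) - (\<Sum>b<n. \<nu> b i) = (\<Sum>c<n. \<mu> c i) - (\<Sum>b<n. \<nu> b i) - \<mu> a i + \<nu> b i" for i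
  proof -
    have "(\<Sum>c<n. \<mu>' c i) = (\<Sum>c<n. \<mu> c i + (if c = a then \<nu> b i - \<mu> a i else 0))"
      by (intro sum.cong) (auto simp: \<mu>'_def)
    then show ?thesis using ab by (simp add: sum.distrib)
  qed
  moreover have "adj_mat (eval_mat n X y) $$ (b, a) = det (mat n n (\<lambda>(a, b). X' a b y))" for y
  proof -
    have "adj_mat (eval_mat n X y) $$ (b, a) = cofactor (eval_mat n X y) a b"
      using ab by (simp add: adj_mat_index[of _ n])
    also have "\<dots> = det (mat n n (\<lambda>(i, j). if i = a then if j = b then 1 else 0 else eval_mat n X y $$ (i, j)))"
      by (rule cofactor_eq_det[OF eval_mat_carrier ab])
    also have "mat n n (\<lambda>(i, j). if i = a then if j = b then 1 else 0 else eval_mat n X y $$ (i, j))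
        = mat n n (\<lambda>(a, b). X' a b y)"
      by (intro eq_matI) (auto simp: X'_def)
    finally show ?thesis .
  qed
  ultimately show ?thesis using 1 by (simp only:)
qed

text \<open>With \<open>H\<close> the inverse of \<open>L + unit_mat n a0 b0\<close>, the equation
  \<open>L * Y = 0\<close> gives \<open>Y = H * unit_mat n a0 b0 * Y\<close>, and symmetrically on
  the right. So \<open>Y\<close> is determined by its pivot entry: the matrices annihilated by
  \<open>L\<close> on both sides form at most a line.\<close>

lemma corank_1_annihilator:
  assumes L: "L \<in> carrier_mat n n" and Z: "Z \<in> carrier_mat n n" and W: "W \<in> carrier_mat n n"
    and ab: "a0 < n" "b0 < n" and d: "det (L + unit_mat n a0 b0) \<noteq> 0"
    and LZ: "L * Z = 0\<^sub>m n n" "Z * L = 0\<^sub>m n n" and LW: "L * W = 0\<^sub>m n n" "W * L = 0\<^sub>m n n"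
    and W0: "W $$ (b0, a0) \<noteq> 0" and ij: "i < n" "j < n"
  shows "Z $$ (i, j) = Z $$ (b0, a0) / W $$ (b0, a0) * W $$ (i, j)"
proof -
  let ?G = "L + unit_mat n a0 b0"
  have G: "?G \<in> carrier_mat n n" using L by simp
  obtain H where H: "H \<in> carrier_mat n n" "?G * H = 1\<^sub>m n" "H * ?G = 1\<^sub>m n"
    using det_nonzero_inverse[OF G d] by blast
  have prod: "Y $$ (i, j) = H $$ (i, a0) * Y $$ (b0, a0) * H $$ (b0, j)"
    if Y: "Y \<in> carrier_mat n n" and LY: "L * Y = 0\<^sub>m n n" "Y * L = 0\<^sub>m n n" and ij: "i < n" "j < n" for Y i j
  proof -
    have left: "Y $$ (i, j) = H $$ (i, a0) * Y $$ (b0, j)" if ij: "i < n" "j < n" for i j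
    proof -
      have "?G * Y = unit_mat n a0 b0 * Y"
        using L Y LY mult_carrier_mat[OF unit_mat_carrier Y] by (simp add: add_mult_distrib_mat[of _ n n])
      then have "H * (unit_mat n a0 b0 * Y) = H * ?G * Y"
        using H(1) G Y by (simp add: assoc_mult_mat[of _ n n _ n _ n])
      then have "Y = H * unit_mat n a0 b0 * Y"
        using H Y by (simp add: assoc_mult_mat[of _ n n _ n _ n])
      then have "Y $$ (i, j) = (H * unit_mat n a0 b0 * Y) $$ (i, j)" by (rule arg_cong)
      also have "\<dots> = (\<Sum>k = 0..<n. \<Sum>l = 0..<n. H $$ (i, k) * unit_mat n a0 b0 $$ (k, l) * Y $$ (l, j))"
        by (rule mult3_mat_index[OF H(1) unit_mat_carrier Y ij])
      also have "\<dots> = (\<Sum>k = 0..<n. if k = a0 then H $$ (i, a0) * Y $$ (b0, j) else 0)"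
      proof (rule sum.cong)
        fix k assume "k \<in> {0..<n}"
        then have "(\<Sum>l = 0..<n. H $$ (i, k) * unit_mat n a0 b0 $$ (k, l) * Y $$ (l, j))
            = (\<Sum>l = 0..<n. if l = b0 then if k = a0 then H $$ (i, a0) * Y $$ (b0, j) else 0 else 0)"
          by (intro sum.cong refl) auto
        then show "(\<Sum>l = 0..<n. H $$ (i, k) * unit_mat n a0 b0 $$ (k, l) * Y $$ (l, j)) = (if k = a0 then H $$ (i, a0) * Y $$ (b0, j) else 0)"
          using ab by simp
      qed simp
      also have "\<dots> = H $$ (i, a0) * Y $$ (b0, j)" using ab by simp
      finally show ?thesis .
    qed
    have right: "Y $$ (i, j) = Y $$ (i, a0) * H $$ (b0, j)" if ij: "i < n" "j < n" for i j
    proof -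
      have "Y * ?G = Y * unit_mat n a0 b0"
        using L Y LY mult_carrier_mat[OF Y unit_mat_carrier] by (simp add: mult_add_distrib_mat[of _ n n])
      then have "Y * unit_mat n a0 b0 * H = Y * (?G * H)"
        using assoc_mult_mat[OF Y G H(1)] by simp
      then have "Y = Y * unit_mat n a0 b0 * H" using H Y by simp
      then have "Y $$ (i, j) = (Y * unit_mat n a0 b0 * H) $$ (i, j)" by (rule arg_cong)
      also have "\<dots> = (\<Sum>k = 0..<n. \<Sum>l = 0..<n. Y $$ (i, k) * unit_mat n a0 b0 $$ (k, l) * H $$ (l, j))"
        by (rule mult3_mat_index[OF Y unit_mat_carrier H(1) ij])
      also have "\<dots> = (\<Sum>k = 0..<n. if k = a0 then Y $$ (i, a0) * H $$ (b0, j) else 0)"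
      proof (rule sum.cong)
        fix k assume "k \<in> {0..<n}"
        then have "(\<Sum>l = 0..<n. Y $$ (i, k) * unit_mat n a0 b0 $$ (k, l) * H $$ (l, j))
            = (\<Sum>l = 0..<n. if l = b0 then if k = a0 then Y $$ (i, a0) * H $$ (b0, j) else 0 else 0)"
          by (intro sum.cong refl) auto
        then show "(\<Sum>l = 0..<n. Y $$ (i, k) * unit_mat n a0 b0 $$ (k, l) * H $$ (l, j)) = (if k = a0 then Y $$ (i, a0) * H $$ (b0, j) else 0)"
          using ab by simp
      qed simp
      also have "\<dots> = Y $$ (i, a0) * H $$ (b0, j)" using ab by simp
      finally show ?thesis .
    qed
    show ?thesis using left[OF ij] right[OF ab(2) ij(2)] by simp
  qed
  show ?thesis using prod[OF Z LZ ij] prod[OF W LW ij] W0 by simp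
qed

section \<open>The leading part of \<open>Ad u * L * Ad v\<close>\<close>

abbreviation zero_pt :: "nat \<Rightarrow> nat \<Rightarrow> complex" where "zero_pt \<equiv> (\<lambda>_ _. 0)"

lemma square_mult_closed [simp]:
  "A \<in> carrier_mat n n \<Longrightarrow> B \<in> carrier_mat n n \<Longrightarrow> A * B \<in> carrier_mat n n"
  by simp

lemma smult_smult_mat: "c \<cdot>\<^sub>m (d \<cdot>\<^sub>m A) = (c * d) \<cdot>\<^sub>m (A :: complex mat)"
  by (intro eq_matI) auto

lemma punctured_constant:
  fixes f :: "complex \<Rightarrow> complex"
  assumes "isCont f 0" "\<And>s. s \<noteq> 0 \<Longrightarrow> f s = K" shows "f 0 = K"
proof -
  have "(f \<longlongrightarrow> f 0) (at 0)" using assms(1) by (simp add: isCont_def)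
  moreover have "(f \<longlongrightarrow> K) (at 0)"
    by (rule tendsto_eventually) (auto simp: eventually_at_filter assms(2))
  ultimately show ?thesis using tendsto_unique by (metis at_neq_bot)
qed

text \<open>\<open>affine\<close> encodes that non-constant entries have total degree one;
  \<open>rep\<close> alone admits higher degrees, which do arise in Schur complements. The pivot is
  a position where the adjugate at the origin is nonzero.\<close>

locale pivoted_rep =
  fixes m n :: nat and X :: "nat \<Rightarrow> nat \<Rightarrow> (nat \<Rightarrow> nat \<Rightarrow> complex) \<Rightarrow> complex"
    and \<mu> \<nu> :: "nat \<Rightarrow> nat \<Rightarrow> int" and \<gamma> :: complex and a0 b0 :: nat
  assumes m: "3 \<le> m"
    and rep: "weighted_rep m {0..<m} n X \<mu> \<nu> \<gamma>"
    and affine: "\<And>a b y. a < n \<Longrightarrow> b < n \<Longrightarrow> X a b y \<noteq> X a b zero_pt \<Longrightarrow> (\<Sum>i<m. \<mu> a i) = (\<Sum>i<m. \<nu> b i) + 1"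
    and a0: "a0 < n" and b0: "b0 < n"
    and pivot: "det (eval_mat n X zero_pt + unit_mat n a0 b0) \<noteq> 0"
begin

definition "L = eval_mat n X zero_pt"
definition "Ad y = adj_mat (eval_mat n X y)"
definition "wrow a = (\<Sum>i<m. \<mu> a i)"
definition "wcol b = (\<Sum>i<m. \<nu> b i)"
text \<open>If \<open>P * L * Q = L\<close>, replacing \<open>X\<close> by \<open>P * X * Q\<close>
  turns \<open>N u v\<close> into a multiple of \<open>adj_mat Q * N u v * adj_mat P\<close>,
  because the inner factors recombine to \<open>L\<close>. Two independent points allow the two
  adjugates to be restricted to different rows.\<close>

definition "N u v = Ad u * L * Ad v"
definition "B u v = N u v $$ (b0, a0)"

text \<open>The total degree, in \<open>u\<close> and \<open>v\<close> together, of the entry \<open>(b, a)\<close> of \<open>N u v\<close>.\<close>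

definition "T b a = 2 * int m + wcol b - wrow a"
abbreviation "\<kappa> \<equiv> Ad zero_pt $$ (b0, a0)"

lemma X_hom: "a < n \<Longrightarrow> b < n \<Longrightarrow> mhom (\<lambda>i. \<mu> a i - \<nu> b i) (X a b)"
  and det_X: "det (eval_mat n X y) = \<gamma> * pm m {0..<m} y"
  and \<gamma>: "\<gamma> \<noteq> 0"
  and weights_beyond: "i \<ge> m \<Longrightarrow> \<mu> a i = 0" "i \<ge> m \<Longrightarrow> \<nu> b i = 0"
  using rep by (auto simp: weighted_rep_def)

lemma carriers [simp]: "L \<in> carrier_mat n n" "Ad y \<in> carrier_mat n n" "N u v \<in> carrier_mat n n"
proof -
  show L: "L \<in> carrier_mat n n" by (simp add: L_def)
  show A: "Ad y \<in> carrier_mat n n" for y using adj_mat(1)[OF eval_mat_carrier] by (simp add: Ad_def)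
  show "N u v \<in> carrier_mat n n" unfolding N_def by (intro mult_carrier_mat[of _ n n] L A)
qed

lemma L_weight:
  assumes "a < n" "b < n" "L $$ (a, b) \<noteq> 0" shows "\<mu> a i = \<nu> b i" "wrow a = wcol b"
proof -
  have "(\<lambda>i. \<mu> a i - \<nu> b i) = (\<lambda>_. 0)"
    using mhom_at_zero[OF X_hom[OF assms(1,2)]] assms by (simp add: L_def)
  then have "\<mu> a i = \<nu> b i" for i by (metis eq_iff_diff_eq_0)
  then show "\<mu> a i = \<nu> b i" "wrow a = wcol b" by (simp_all add: wrow_def wcol_def)
qed

lemma det_L: "det L = 0"
proof -
  obtain k where "m = Suc k" using m by (cases m) auto
  then show ?thesis by (simp add: L_def det_X)
qed

lemma Ad_mult: "eval_mat n X y * Ad y = det (eval_mat n X y) \<cdot>\<^sub>m 1\<^sub>m n" "Ad y * eval_mat n X y = det (eval_mat n X y) \<cdot>\<^sub>m 1\<^sub>m n"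
  using adj_mat[OF eval_mat_carrier] by (simp_all add: Ad_def)

lemma L_Ad0: "L * Ad zero_pt = 0\<^sub>m n n" "Ad zero_pt * L = 0\<^sub>m n n"
proof -
  have "(0 :: complex) \<cdot>\<^sub>m 1\<^sub>m n = 0\<^sub>m n n" by (intro eq_matI) auto
  then show "L * Ad zero_pt = 0\<^sub>m n n" "Ad zero_pt * L = 0\<^sub>m n n"
    using Ad_mult[of zero_pt] det_L by (simp_all add: L_def)
qed

lemma Ad_hom:
  assumes "a < n" "b < n"
  shows "mhom (\<lambda>i. (if i < m then 1 else 0) - \<mu> a i + \<nu> b i) (\<lambda>y. Ad y $$ (b, a))"
proof -
  have "mhom (\<lambda>i. (\<Sum>a<n. \<mu> a i) - (\<Sum>b<n. \<nu> b i) - \<mu> a i + \<nu> b i) (\<lambda>y. adj_mat (eval_mat n X y) $$ (b, a))"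
    by (rule mhom_adj_mat) (use X_hom assms in auto)
  then show ?thesis unfolding weighted_rep_degree[OF rep] Ad_def .
qed

lemma Ad_weight_sum:
  "(\<Sum>i<m. (if i < m then 1 else 0) - \<mu> a i + \<nu> b i) = int m - wrow a + wcol b"
  by (simp add: wrow_def wcol_def sum.distrib sum_subtractf)

lemma Ad_scale:
  assumes "a < n" "b < n"
  shows "Ad (\<lambda>i j. s * y i j) $$ (b, a) = s ^ nat (int m - wrow a + wcol b) * Ad y $$ (b, a)"
  using mhom_scale_all[OF Ad_hom[OF assms], of m s y] weights_beyond unfolding Ad_weight_sum by simp

lemma Ad_neg:
  assumes "a < n" "b < n" "int m - wrow a + wcol b < 0" shows "Ad y $$ (b, a) = 0"
proof -
  have "\<exists>i. (if i < m then 1 else 0) - \<mu> a i + \<nu> b i < 0"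
  proof (rule ccontr)
    assume "\<not> ?thesis"
    then have nn: "(if i < m then 1 else 0) - \<mu> a i + \<nu> b i \<ge> 0" for i by (meson not_less)
    have "(\<Sum>i<m. (if i < m then 1 else 0) - \<mu> a i + \<nu> b i) \<ge> 0" by (rule sum_nonneg) (rule nn)
    with assms(3) show False unfolding Ad_weight_sum by simp
  qed
  then show ?thesis using mhom_neg[OF Ad_hom[OF assms(1,2)]] by blast
qed

lemma Ad_const:
  assumes "a < n" "b < n" "int m - wrow a + wcol b \<le> 0" shows "Ad y $$ (b, a) = Ad zero_pt $$ (b, a)"
proof (cases "\<exists>i. (if i < m then 1 else 0) - \<mu> a i + \<nu> b i < 0")
  case True
  then show ?thesis using mhom_neg[OF Ad_hom[OF assms(1,2)]] by metis
next
  case False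
  then have nn: "(if i < m then 1 else 0) - \<mu> a i + \<nu> b i \<ge> 0" for i by (meson not_less)
  have "(\<Sum>i<m. (if i < m then 1 else 0) - \<mu> a i + \<nu> b i) = 0"
    using sum_nonneg[of "{..<m}" "\<lambda>i. (if i < m then 1 else 0) - \<mu> a i + \<nu> b i"] nn assms(3)
    unfolding Ad_weight_sum by fastforce
  then have "\<forall>i\<in>{..<m}. (if i < m then 1 else 0) - \<mu> a i + \<nu> b i = 0"
    by (subst (asm) sum_nonneg_eq_0_iff) (simp_all only: nn finite_lessThan)
  then have "(if i < m then 1 else 0) - \<mu> a i + \<nu> b i = 0" for i
    using weights_beyond by (cases "i < m") auto
  then show ?thesis by (intro mhom_local[OF Ad_hom[OF assms(1,2)]]) auto
qed

lemma \<kappa>: "\<kappa> \<noteq> 0"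
proof -
  have "1 \<cdot>\<^sub>m unit_mat n a0 b0 = unit_mat n a0 b0" by (intro eq_matI) auto
  then show ?thesis
    using det_add_unit_mat[of L n a0 b0 1] pivot a0 b0 det_L
    by (simp add: Ad_def adj_mat_index[of _ n] L_def[symmetric])
qed

text \<open>The pivot entry of the adjugate is nonzero at the origin, so its multidegree is
  zero.\<close>

lemma pivot_weight: "\<mu> a0 i = (if i < m then 1 else 0) + \<nu> b0 i" "wrow a0 = int m + wcol b0"
proof -
  have "(\<lambda>i. (if i < m then 1 else 0) - \<mu> a0 i + \<nu> b0 i) = (\<lambda>_. 0)"
    by (rule mhom_at_zero[OF Ad_hom[OF a0 b0] \<kappa>])
  then have "(if i < m then 1 else 0) - \<mu> a0 i + \<nu> b0 i = 0" for i by meson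
  then have *: "\<mu> a0 i = (if i < m then 1 else 0) + \<nu> b0 i" for i by (simp add: algebra_simps)
  then show "\<mu> a0 i = (if i < m then 1 else 0) + \<nu> b0 i" .
  show "wrow a0 = int m + wcol b0" unfolding wrow_def wcol_def * by (simp add: sum.distrib)
qed

lemma N_index:
  assumes "b < n" "a < n"
  shows "N u v $$ (b, a) = (\<Sum>k = 0..<n. \<Sum>l = 0..<n. Ad u $$ (b, k) * L $$ (k, l) * Ad v $$ (l, a))"
  unfolding N_def by (rule mult3_mat_index) (use assms in auto)

lemma N_scale:
  assumes "b < n" "a < n"
  shows "N (\<lambda>i j. s * u i j) (\<lambda>i j. s * v i j) $$ (b, a) = s ^ nat (T b a) * N u v $$ (b, a)"
proof -
  let ?u = "\<lambda>i j. s * u i j" and ?v = "\<lambda>i j. s * v i j"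
  have step: "Ad ?u $$ (b, k) * L $$ (k, l) * Ad ?v $$ (l, a) = s ^ nat (T b a) * (Ad u $$ (b, k) * L $$ (k, l) * Ad v $$ (l, a))"
    if kl: "k < n" "l < n" for k l
  proof (cases "L $$ (k, l) = 0")
    case False
    then have w: "wrow k = wcol l" using L_weight(2) kl by blast
    let ?p = "int m - wrow k + wcol b" and ?q = "int m - wrow a + wcol l"
    \<comment> \<open>The degrees in \<open>u\<close> and in \<open>v\<close> depend on the
      intermediate \<open>k\<close> and \<open>l\<close>, but as \<open>L\<close> joins equal
      weights only, their sum does not.\<close>
    have pq: "?p + ?q = T b a" using w by (simp add: T_def)
    consider "?p < 0" | "?q < 0" | "?p \<ge> 0" "?q \<ge> 0" by linarith
    then show ?thesis
    proof cases
      case 3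
      then have "nat (T b a) = nat ?p + nat ?q" using pq by linarith
      then show ?thesis unfolding Ad_scale[OF kl(1) assms(1)] Ad_scale[OF assms(2) kl(2)]
        by (simp add: power_add)
    qed (use Ad_neg[OF kl(1) assms(1)] Ad_neg[OF assms(2) kl(2)] in auto)
  qed simp
  show ?thesis unfolding N_index[OF assms] sum_distrib_left
    by (intro sum.cong refl) (rule step; simp)
qed

lemma N_negative: "b < n \<Longrightarrow> a < n \<Longrightarrow> T b a < 0 \<Longrightarrow> N u v $$ (b, a) = 0"
proof -
  assume ba: "b < n" "a < n" and T: "T b a < 0"
  have "Ad u $$ (b, k) * L $$ (k, l) * Ad v $$ (l, a) = 0" if kl: "k < n" "l < n" for k l
  proof (cases "L $$ (k, l) = 0")
    case False
    then have "wrow k = wcol l" using L_weight(2) kl by blast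
    then have "int m - wrow k + wcol b < 0 \<or> int m - wrow a + wcol l < 0" using T by (simp add: T_def) linarith
    then show ?thesis using Ad_neg[OF kl(1) ba(1)] Ad_neg[OF ba(2) kl(2)] by auto
  qed simp
  then show "N u v $$ (b, a) = 0" unfolding N_index[OF ba] by (intro sum.neutral ballI) auto
qed

text \<open>Each entry of \<open>N u v\<close> is homogeneous, its degree depending on the position;
  so the component of degree \<open>d\<close> is a selection of positions.\<close>

definition "Z u v d = mat n n (\<lambda>(b, a). if T b a = d then N u v $$ (b, a) else 0)"

lemma Z_carrier [simp]: "Z u v d \<in> carrier_mat n n" by (simp add: Z_def)

lemma Z_index: "b < n \<Longrightarrow> a < n \<Longrightarrow> Z u v d $$ (b, a) = (if T b a = d then N u v $$ (b, a) else 0)"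
  by (simp add: Z_def)

text \<open>In \<open>X(u) * N u v = det X(u) * (L * Ad v)\<close> the part of degree
  \<open>d\<close> on the left is \<open>L * Z u v d\<close> plus the linear part of
  \<open>X(u)\<close> times \<open>Z u v (d - 1)\<close>. On the right \<open>det X(u)\<close>
  already has degree \<open>m\<close>, so for \<open>d \<le> m\<close> only the constant term
  \<open>L * Ad zero_pt = 0\<close> of the other factor can occur.\<close>

lemma L_Z:
  assumes d: "d \<le> int m" and prev: "Z u v (d - 1) = 0\<^sub>m n n"
  shows "L * Z u v d = 0\<^sub>m n n"
proof (rule eq_matI)
  fix c a assume "c < dim_row (0\<^sub>m n n :: complex mat)" "a < dim_col (0\<^sub>m n n :: complex mat)"
  then have ca: "c < n" "a < n" by auto
  let ?e = "2 * int m + wrow c - wrow a"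
  let ?M = "eval_mat n X u"
  have "(\<Sum>b = 0..<n. L $$ (c, b) * Z u v d $$ (b, a)) = 0"
  proof (cases "?e = d")
    case False
    have "L $$ (c, b) * Z u v d $$ (b, a) = 0" if "b < n" for b
    proof (cases "L $$ (c, b) = 0")
      case nz: False
      have "T b a \<noteq> d" using L_weight(2)[OF ca(1) that nz] False by (simp add: T_def)
      then show ?thesis using that ca by (simp add: Z_index)
    qed simp
    then show ?thesis by (intro sum.neutral ballI) simp
  next
    case True
    have "L $$ (c, b) * Z u v d $$ (b, a) = ?M $$ (c, b) * N u v $$ (b, a)" if b: "b < n" for b
    proof -
      have 1: "L $$ (c, b) * Z u v d $$ (b, a) = L $$ (c, b) * N u v $$ (b, a)"
      proof (cases "L $$ (c, b) = 0")
        case False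
        then have "T b a = d" using L_weight(2)[OF ca(1) b] True by (simp add: T_def)
        then show ?thesis using b ca by (simp add: Z_index)
      qed simp
      have 2: "(?M $$ (c, b) - L $$ (c, b)) * N u v $$ (b, a) = 0"
      proof (cases "?M $$ (c, b) = L $$ (c, b)")
        case False
        then have "wrow c = wcol b + 1" using affine[OF ca(1) b] ca b by (simp add: L_def wrow_def wcol_def)
        then have "T b a = d - 1" using True by (simp add: T_def)
        then have "N u v $$ (b, a) = 0" using prev Z_index[OF b ca(2), of u v "d - 1"] b ca by simp
        then show ?thesis by simp
      qed simp
      show ?thesis using 1 2 by (auto simp: algebra_simps)
    qed
    then have "(\<Sum>b = 0..<n. L $$ (c, b) * Z u v d $$ (b, a)) = (?M * N u v) $$ (c, a)"
      using ca by (subst mult_mat_index[of _ n n _ n]) (auto intro: sum.cong)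
    also have "?M * N u v = (?M * Ad u) * L * Ad v"
      unfolding N_def by (simp add: assoc_mult_mat[of _ n n _ n _ n])
    also have "\<dots> = det ?M \<cdot>\<^sub>m (L * Ad v)"
      unfolding Ad_mult by (simp add: mult_smult_assoc_mat[of _ n n _ n] left_mult_one_mat[OF carriers(1)])
    also have "(det ?M \<cdot>\<^sub>m (L * Ad v)) $$ (c, a) = det ?M * (L * Ad v) $$ (c, a)"
      using ca by (subst index_smult_mat) (auto dest: carrier_matD simp: carrier_matD[OF carriers(1)] carrier_matD[OF carriers(2)])
    also have "(L * Ad v) $$ (c, a) = (\<Sum>b = 0..<n. L $$ (c, b) * Ad v $$ (b, a))"
      by (rule mult_mat_index[OF _ _ ca]) auto
    also have "\<dots> = (\<Sum>b = 0..<n. L $$ (c, b) * Ad zero_pt $$ (b, a))"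
    proof (rule sum.cong)
      fix b assume "b \<in> {0..<n}"
      then have b: "b < n" by simp
      show "L $$ (c, b) * Ad v $$ (b, a) = L $$ (c, b) * Ad zero_pt $$ (b, a)"
      proof (cases "L $$ (c, b) = 0")
        case False
        then have "wrow c = wcol b" using L_weight(2)[OF ca(1) b] by blast
        then show ?thesis using Ad_const[OF ca(2) b, of v] True d by simp
      qed simp
    qed simp
    also have "\<dots> = (L * Ad zero_pt) $$ (c, a)"
      by (rule mult_mat_index[symmetric, OF _ _ ca]) auto
    finally show ?thesis using ca by (simp add: L_Ad0)
  qed
  then show "(L * Z u v d) $$ (c, a) = 0\<^sub>m n n $$ (c, a)"
    using ca by (subst mult_mat_index[of _ n n _ n]) auto
qed (use carrier_matD[OF carriers(1)] in \<open>auto simp: Z_def\<close>)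

lemma Z_L:
  assumes d: "d \<le> int m" and prev: "Z u v (d - 1) = 0\<^sub>m n n"
  shows "Z u v d * L = 0\<^sub>m n n"
proof (rule eq_matI)
  fix b c assume "b < dim_row (0\<^sub>m n n :: complex mat)" "c < dim_col (0\<^sub>m n n :: complex mat)"
  then have bc: "b < n" "c < n" by auto
  let ?e = "2 * int m + wcol b - wcol c"
  let ?M = "eval_mat n X v"
  have "(\<Sum>a = 0..<n. Z u v d $$ (b, a) * L $$ (a, c)) = 0"
  proof (cases "?e = d")
    case False
    have "Z u v d $$ (b, a) * L $$ (a, c) = 0" if "a < n" for a
    proof (cases "L $$ (a, c) = 0")
      case nz: False
      have "T b a \<noteq> d" using L_weight(2)[OF that bc(2) nz] False by (simp add: T_def)
      then show ?thesis using that bc by (simp add: Z_index)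
    qed simp
    then show ?thesis by (intro sum.neutral ballI) simp
  next
    case True
    have "Z u v d $$ (b, a) * L $$ (a, c) = N u v $$ (b, a) * ?M $$ (a, c)" if a: "a < n" for a
    proof -
      have 1: "Z u v d $$ (b, a) * L $$ (a, c) = N u v $$ (b, a) * L $$ (a, c)"
      proof (cases "L $$ (a, c) = 0")
        case False
        then have "T b a = d" using L_weight(2)[OF a bc(2)] True by (simp add: T_def)
        then show ?thesis using a bc by (simp add: Z_index)
      qed simp
      have 2: "N u v $$ (b, a) * (?M $$ (a, c) - L $$ (a, c)) = 0"
      proof (cases "?M $$ (a, c) = L $$ (a, c)")
        case False
        then have "wrow a = wcol c + 1" using affine[OF a bc(2)] a bc by (simp add: L_def wrow_def wcol_def)
        then have "T b a = d - 1" using True by (simp add: T_def)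
        then have "N u v $$ (b, a) = 0" using prev Z_index[OF bc(1) a, of u v "d - 1"] a bc by simp
        then show ?thesis by simp
      qed simp
      show ?thesis using 1 2 by (auto simp: algebra_simps)
    qed
    then have "(\<Sum>a = 0..<n. Z u v d $$ (b, a) * L $$ (a, c)) = (N u v * ?M) $$ (b, c)"
      using bc by (subst mult_mat_index[of _ n n _ n]) (auto intro: sum.cong)
    also have "N u v * ?M = Ad u * L * (Ad v * ?M)"
      unfolding N_def by (rule assoc_mult_mat[of _ n n _ n _ n]) simp_all
    also have "\<dots> = det ?M \<cdot>\<^sub>m (Ad u * L)"
      unfolding Ad_mult using mult_smult_distrib[of "Ad u * L" n n "1\<^sub>m n" n] by (simp add: right_mult_one_mat[of _ n n] mult_carrier_mat[of _ n n _ n])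
    also have "(det ?M \<cdot>\<^sub>m (Ad u * L)) $$ (b, c) = det ?M * (Ad u * L) $$ (b, c)"
      using bc by (subst index_smult_mat) (auto simp: carrier_matD[OF carriers(1)] carrier_matD[OF carriers(2)])
    also have "(Ad u * L) $$ (b, c) = (\<Sum>a = 0..<n. Ad u $$ (b, a) * L $$ (a, c))"
      by (rule mult_mat_index[OF _ _ bc]) auto
    also have "\<dots> = (\<Sum>a = 0..<n. Ad zero_pt $$ (b, a) * L $$ (a, c))"
    proof (rule sum.cong)
      fix a assume "a \<in> {0..<n}"
      then have a: "a < n" by simp
      show "Ad u $$ (b, a) * L $$ (a, c) = Ad zero_pt $$ (b, a) * L $$ (a, c)"
      proof (cases "L $$ (a, c) = 0")
        case False
        then have "wrow a = wcol c" using L_weight(2)[OF a bc(2)] by blast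
        then show ?thesis using Ad_const[OF a bc(1), of u] True d by simp
      qed simp
    qed simp
    also have "\<dots> = (Ad zero_pt * L) $$ (b, c)"
      by (rule mult_mat_index[symmetric, OF _ _ bc]) auto
    finally show ?thesis using bc by (simp add: L_Ad0)
  qed
  then show "(Z u v d * L) $$ (b, c) = 0\<^sub>m n n $$ (b, c)"
    using bc by (subst mult_mat_index[of _ n n _ n]) auto
qed (use carrier_matD[OF carriers(1)] in \<open>auto simp: Z_def\<close>)

lemma T_pivot: "T b0 a0 = int m"
  by (simp add: T_def pivot_weight)

lemma Z_multiple:
  assumes d: "d \<le> int m" and prev: "Z u v (d - 1) = 0\<^sub>m n n" and ba: "b < n" "a < n"
  shows "Z u v d $$ (b, a) = Z u v d $$ (b0, a0) / \<kappa> * Ad zero_pt $$ (b, a)"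
  by (rule corank_1_annihilator[OF _ _ _ a0 b0 _ L_Z[OF d prev] Z_L[OF d prev] L_Ad0 \<kappa> ba])
    (use pivot in \<open>simp_all add: L_def\<close>)

text \<open>By induction the component is annihilated by \<open>L\<close> on both sides, hence is a
  multiple of \<open>Ad zero_pt\<close>, whose pivot entry is nonzero. The pivot position has degree
  \<open>m\<close>, so in lower degree the multiple is zero.\<close>

lemma Z_low: "int k < int m \<Longrightarrow> Z u v (int k) = 0\<^sub>m n n"
proof (induction k)
  case 0
  have "Z u v (-1) = 0\<^sub>m n n" by (intro eq_matI) (auto simp: Z_def N_negative)
  then have "Z u v 0 $$ (b, a) = 0" if "b < n" "a < n" for b a
    using Z_multiple[of 0 u v b a] that T_pivot m a0 b0 by (simp add: Z_index)
  then show ?case by (intro eq_matI) (auto simp: Z_def)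
next
  case (Suc k)
  then have "Z u v (int (Suc k) - 1) = 0\<^sub>m n n" by simp
  then have "Z u v (int (Suc k)) $$ (b, a) = 0" if "b < n" "a < n" for b a
    using Z_multiple[of "int (Suc k)" u v b a] that T_pivot Suc.prems a0 b0 by (simp add: Z_index)
  then show ?case by (intro eq_matI) (auto simp: Z_def)
qed

lemma N_low:
  assumes ba: "b < n" "a < n"
  shows "T b a < int m \<Longrightarrow> N u v $$ (b, a) = 0"
    and "T b a = int m \<Longrightarrow> N u v $$ (b, a) = B u v / \<kappa> * Ad zero_pt $$ (b, a)"
proof -
  assume T: "T b a < int m"
  show "N u v $$ (b, a) = 0"
  proof (cases "T b a < 0")
    case False
    then obtain k where k: "T b a = int k" by (metis int_nat_eq not_less)
    then show ?thesis using Z_low[of k u v] T Z_index[OF ba, of u v "int k"] ba by simp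
  qed (use N_negative ba in blast)
next
  assume T: "T b a = int m"
  have "Z u v (int m - 1) = 0\<^sub>m n n" using Z_low[of "m - 1" u v] m by (simp add: of_nat_diff)
  then show "N u v $$ (b, a) = B u v / \<kappa> * Ad zero_pt $$ (b, a)"
    using Z_multiple[of "int m" u v b a] ba T T_pivot a0 b0 by (simp add: Z_index B_def)
qed

text \<open>The lift may mix positions of different degree, so single entries cannot be compared;
  the order of vanishing along \<open>s * u\<close>, \<open>s * v\<close> is compared instead. All
  entries of \<open>N\<close> have order at least \<open>m\<close>, those of order exactly
  \<open>m\<close> being multiples of \<open>B\<close>. If \<open>B\<close> vanished at the permuted
  point, the transformed pivot entry would vanish to higher order.\<close>

lemma B_equivariant:
  assumes P: "P \<in> carrier_mat n n" and Q: "Q \<in> carrier_mat n n" and dP: "det P \<noteq> 0" and dQ: "det Q \<noteq> 0"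
    and eq: "\<And>v. eval_mat n X (\<lambda>i. v (\<tau> i)) = P * eval_mat n X v * Q"
    and nz: "B u v \<noteq> 0"
  shows "B (\<lambda>i. u (\<tau> i)) (\<lambda>i. v (\<tau> i)) \<noteq> 0"
proof
  assume z: "B (\<lambda>i. u (\<tau> i)) (\<lambda>i. v (\<tau> i)) = 0"
  let ?\<delta> = "det P * det Q"
  note adjP = adj_mat[OF P] and adjQ = adj_mat[OF Q]
  note assoc = assoc_mult_mat[of _ n n _ n _ n]
  have LPQ: "L = P * L * Q" using eq[of zero_pt] by (simp add: L_def)
  have Ad\<tau>: "Ad (\<lambda>i. w (\<tau> i)) = adj_mat Q * Ad w * adj_mat P" for w
  proof -
    have PM: "P * eval_mat n X w \<in> carrier_mat n n" using P by (intro mult_carrier_mat[of _ n n]) auto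
    then show ?thesis
      unfolding Ad_def eq adj_mat_mult[OF PM Q] adj_mat_mult[OF P eval_mat_carrier]
      by (intro assoc_mult_mat[symmetric, of _ n n _ n _ n] adjP(1) adjQ(1) adj_mat(1)[OF eval_mat_carrier])
  qed
  have QA: "Q * Ad (\<lambda>i. w (\<tau> i)) * P = ?\<delta> \<cdot>\<^sub>m Ad w" for w
  proof -
    have "Q * Ad (\<lambda>i. w (\<tau> i)) * P = (Q * adj_mat Q) * Ad w * (adj_mat P * P)"
      unfolding Ad\<tau> using P Q adjP(1) adjQ(1) by (simp add: assoc)
    also have "\<dots> = ?\<delta> \<cdot>\<^sub>m Ad w"
      unfolding adjP(3) adjQ(2) by (intro eq_matI) (auto simp: carrier_matD[OF carriers(2)])
    finally show ?thesis .
  qed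
  have QN: "Q * N (\<lambda>i. w (\<tau> i)) (\<lambda>i. w' (\<tau> i)) * P = (?\<delta> * ?\<delta>) \<cdot>\<^sub>m N w w'" for w w'
  proof -
    have "Q * N (\<lambda>i. w (\<tau> i)) (\<lambda>i. w' (\<tau> i)) * P
        = (Q * Ad (\<lambda>i. w (\<tau> i)) * P) * L * (Q * Ad (\<lambda>i. w' (\<tau> i)) * P)"
      unfolding N_def by (subst LPQ) (use P Q in \<open>simp add: assoc\<close>)
    also have "\<dots> = (?\<delta> * ?\<delta>) \<cdot>\<^sub>m N w w'"
      unfolding QA N_def
      using mult_smult_assoc_mat[of "Ad w" n n L n ?\<delta>] mult_smult_assoc_mat[of "Ad w * L" n n "?\<delta> \<cdot>\<^sub>m Ad w'" n ?\<delta>]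
        mult_smult_distrib[of "Ad w * L" n n "Ad w'" n ?\<delta>] mult_carrier_mat[of "Ad w" n n L n]
      by (simp add: smult_smult_mat)
    finally show ?thesis .
  qed
  define c where "c b a = Q $$ (b0, b) * N (\<lambda>i. u (\<tau> i)) (\<lambda>i. v (\<tau> i)) $$ (b, a) * P $$ (a, a0)" for b a
  have c0: "c b a = 0" if "b < n" "a < n" "T b a \<le> int m" for b a
    using N_low[OF that(1,2)] that z by (cases "T b a = int m") (auto simp: c_def)
  \<comment> \<open>The transformed pivot entry divided by \<open>s ^ m\<close>. The truncated
    subtraction is harmless, since \<open>c b a = 0\<close> unless \<open>T b a\<close> exceeds
    \<open>m\<close>.\<close>
  define f where "f s = (\<Sum>b = 0..<n. \<Sum>a = 0..<n. c b a * s ^ (nat (T b a) - m))" for s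
  have "f s = ?\<delta> * ?\<delta> * B u v" if s: "s \<noteq> 0" for s
  proof -
    let ?u = "\<lambda>i j. s * u i j" and ?v = "\<lambda>i j. s * v i j"
    have "?\<delta> * ?\<delta> * (s ^ m * B u v) = ((?\<delta> * ?\<delta>) \<cdot>\<^sub>m N ?u ?v) $$ (b0, a0)"
      using a0 b0 N_scale[OF b0 a0, of s u v] T_pivot carrier_matD[OF carriers(3)] by (simp add: B_def)
    also have "\<dots> = (Q * N (\<lambda>i. ?u (\<tau> i)) (\<lambda>i. ?v (\<tau> i)) * P) $$ (b0, a0)"
      unfolding QN[of ?u ?v, symmetric] by (rule refl)
    also have "\<dots> = (\<Sum>b = 0..<n. \<Sum>a = 0..<n. Q $$ (b0, b) * N (\<lambda>i. ?u (\<tau> i)) (\<lambda>i. ?v (\<tau> i)) $$ (b, a) * P $$ (a, a0))"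
      by (rule mult3_mat_index) (use P Q a0 b0 in auto)
    also have "\<dots> = (\<Sum>b = 0..<n. \<Sum>a = 0..<n. s ^ m * (c b a * s ^ (nat (T b a) - m)))"
    proof (intro sum.cong refl)
      fix b a assume "b \<in> {0..<n}" "a \<in> {0..<n}"
      then have ba: "b < n" "a < n" by auto
      have "Q $$ (b0, b) * N (\<lambda>i. ?u (\<tau> i)) (\<lambda>i. ?v (\<tau> i)) $$ (b, a) * P $$ (a, a0) = s ^ nat (T b a) * c b a"
        using N_scale[OF ba, of s "\<lambda>i. u (\<tau> i)" "\<lambda>i. v (\<tau> i)"] by (simp add: c_def)
      also have "\<dots> = s ^ m * (c b a * s ^ (nat (T b a) - m))"
      proof (cases "T b a \<le> int m")
        case False
        then have "nat (T b a) = m + (nat (T b a) - m)" by linarith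
        then have "s ^ nat (T b a) = s ^ m * s ^ (nat (T b a) - m)" by (metis power_add)
        then show ?thesis by simp
      qed (use c0[OF ba] in simp)
      finally show "Q $$ (b0, b) * N (\<lambda>i. ?u (\<tau> i)) (\<lambda>i. ?v (\<tau> i)) $$ (b, a) * P $$ (a, a0)
        = s ^ m * (c b a * s ^ (nat (T b a) - m))" .
    qed
    also have "\<dots> = s ^ m * f s" by (simp add: f_def sum_distrib_left)
    finally have "s ^ m * (?\<delta> * ?\<delta> * B u v) = s ^ m * f s" by (metis mult.left_commute)
    then have "?\<delta> * ?\<delta> * B u v = f s" using s by (metis mult_left_cancel power_not_zero)
    then show ?thesis by (rule sym)
  qed
  moreover have "isCont f 0" unfolding f_def by (intro continuous_intros)
  ultimately have "f 0 = ?\<delta> * ?\<delta> * B u v" using punctured_constant by blast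
  moreover have "f 0 = 0"
    unfolding f_def
  proof (intro sum.neutral ballI)
    fix b a assume "b \<in> {0..<n}" "a \<in> {0..<n}"
    then have ba: "b < n" "a < n" by auto
    show "c b a * 0 ^ (nat (T b a) - m) = 0"
    proof (cases "T b a \<le> int m")
      case False
      then have "nat (T b a) - m > 0" by linarith
      then show ?thesis by simp
    qed (use c0[OF ba] in simp)
  qed
  ultimately show False using nz dP dQ by simp
qed

end

section \<open>Subsets of the rows as weights of columns\<close>

fun cyc3 :: "nat \<Rightarrow> nat \<Rightarrow> nat \<Rightarrow> nat \<Rightarrow> nat" where
  "cyc3 x y z i = (if i = x then y else if i = y then z else if i = z then x else i)"

lemma exchange_connected:
  assumes fin: "finite U" and ex: "\<And>I a b. I \<subseteq> U \<Longrightarrow> a \<in> I \<Longrightarrow> b \<in> U - I \<Longrightarrow> G I \<Longrightarrow> G (insert b (I - {a}))"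
    and "I \<subseteq> U" "K \<subseteq> U" "card I = card K" "G I"
  shows "G K"
  using assms(3-)
proof (induction "card (I - K)" arbitrary: I)
  case 0
  have f: "finite I" "finite K" using 0 fin finite_subset by auto
  with 0 have "I \<subseteq> K" by simp
  with 0 f have "I = K" by (metis card_subset_eq)
  with 0 show ?case by simp
next
  case (Suc k)
  have f: "finite I" "finite K" using Suc.prems fin finite_subset by auto
  obtain a where a: "a \<in> I" "a \<notin> K" using Suc.hyps(2) by (metis Diff_iff card_eq_0_iff ex_in_conv nat.distinct(1))
  have "\<not> K \<subseteq> I"
  proof
    assume "K \<subseteq> I"
    then have "K = I" using f Suc.prems(3) by (metis card_subset_eq)
    with a show False by simp
  qed
  then obtain b where b: "b \<in> K" "b \<notin> I" by blast
  let ?I = "insert b (I - {a})"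
  have "G ?I" using ex[of I a b] a b Suc.prems by auto
  moreover have "?I - K = (I - K) - {a}" using a b by auto
  then have "k = card (?I - K)" using Suc.hyps(2) a f by simp
  moreover have "card ?I = card K" using a b f Suc.prems(3) by (simp add: card.insert_remove card_gt_0_iff) (metis Suc_pred card_gt_0_iff empty_iff)
  ultimately show ?case using Suc.hyps(1)[of ?I] a b Suc.prems by auto
qed

context pivoted_rep
begin

text \<open>Stated through \<open>B\<close> alone, without weights, so that
  \<open>B_equivariant\<close> carries it from one subset to another.\<close>

definition "paired I \<longleftrightarrow> (\<exists>u v. (\<forall>i j. i \<in> I \<longrightarrow> u i j = 0) \<and> (\<forall>i j. i \<notin> I \<longrightarrow> v i j = 0) \<and> B u v \<noteq> 0)"

definition "term u v b = (\<Sum>a = 0..<n. Ad u $$ (b0, a) * L $$ (a, b) * Ad v $$ (b, a0))"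

lemma B_terms: "B u v = (\<Sum>b = 0..<n. term u v b)"
  unfolding B_def N_index[OF b0 a0] term_def by (rule sum.swap)

definition "offset b = (\<lambda>i. \<nu> b i - \<nu> b0 i)"

lemma right_hom: "b < n \<Longrightarrow> mhom (offset b) (\<lambda>v. Ad v $$ (b, a0))"
  using Ad_hom[OF a0, of b] by (simp add: offset_def pivot_weight(1))

text \<open>A nonzero entry of \<open>L\<close> identifies the weights of row \<open>a\<close> and
  column \<open>b\<close>. This makes the degree in \<open>u\<close> complementary to the degree in
  \<open>v\<close>: together they use every row once.\<close>

lemma left_hom:
  assumes "a < n" "b < n" "L $$ (a, b) \<noteq> 0"
  shows "mhom (\<lambda>i. (if i < m then 1 else 0) - offset b i) (\<lambda>u. Ad u $$ (b0, a))"
proof -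
  have "(\<lambda>i. (if i < m then 1 else 0) - \<mu> a i + \<nu> b0 i) = (\<lambda>i. (if i < m then 1 else 0) - offset b i)"
    using L_weight(1)[OF assms] by (auto simp: offset_def)
  then show ?thesis using Ad_hom[OF assms(1) b0] by simp
qed

lemma term_nonzero:
  assumes b: "b < n" and nz: "term u v b \<noteq> 0"
  shows "0 \<le> offset b i" "offset b i \<le> (if i < m then 1 else 0)"
    and "(\<And>j. v i j = 0) \<Longrightarrow> offset b i = 0"
    and "(\<And>j. u i j = 0) \<Longrightarrow> offset b i = (if i < m then 1 else 0)"
proof -
  from nz obtain a where "a \<in> {0..<n}" "Ad u $$ (b0, a) * L $$ (a, b) * Ad v $$ (b, a0) \<noteq> 0"
    unfolding term_def by (rule sum.not_neutral_contains_not_neutral)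
  then have a: "a < n" "Ad u $$ (b0, a) \<noteq> 0" "L $$ (a, b) \<noteq> 0" "Ad v $$ (b, a0) \<noteq> 0" by auto
  note r = right_hom[OF b] and l = left_hom[OF a(1) b a(3)]
  show "0 \<le> offset b i" by (rule mhom_nonneg[OF r a(4)])
  have "0 \<le> (if i < m then 1 else 0) - offset b i" by (rule mhom_nonneg[OF l a(2)])
  then show "offset b i \<le> (if i < m then 1 else 0)" by simp
  show "offset b i = 0" if "\<And>j. v i j = 0"
    using mhom_zero_row[OF r, of i v] that a(4) by auto
  show "offset b i = (if i < m then 1 else 0)" if z: "\<And>j. u i j = 0"
  proof -
    have "(if i < m then 1 else 0) - offset b i = 0"
      using mhom_zero_row[OF l, of i u] z a(2) by blast
    then show ?thesis by simp
  qed
qed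

text \<open>A nonzero term can involve neither \<open>v\<close> outside \<open>I\<close> nor
  \<open>u\<close> inside \<open>I\<close>; with complementary degrees only the indicator of
  \<open>I\<close> remains.\<close>

lemma paired_offset:
  assumes I: "I \<subseteq> {0..<m}" and p: "paired I"
  obtains b where "b < n" "offset b = (\<lambda>i. if i \<in> I then 1 else 0)"
proof -
  from p obtain u v where uv: "\<forall>i j. i \<in> I \<longrightarrow> u i j = 0" "\<forall>i j. i \<notin> I \<longrightarrow> v i j = 0" "B u v \<noteq> 0"
    by (auto simp: paired_def)
  from uv(3) obtain b where "b \<in> {0..<n}" "term u v b \<noteq> 0"
    unfolding B_terms by (rule sum.not_neutral_contains_not_neutral)
  then have b: "b < n" "term u v b \<noteq> 0" by auto
  have "offset b i = (if i \<in> I then 1 else 0)" for i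
    using term_nonzero(3)[OF b, of i] term_nonzero(4)[OF b, of i] uv(1,2) I by (cases "i \<in> I") auto
  with b(1) that show thesis by blast
qed

text \<open>The part of \<open>B y y\<close> that passes through level \<open>k\<close>, the level
  of a column being its total weight relative to the pivot column.\<close>

definition "S k y = (\<Sum>b = 0..<n. if wcol b - wcol b0 = k then term y y b else 0)"

lemma Ad_column: "a < n \<Longrightarrow> (\<Sum>b = 0..<n. eval_mat n X y $$ (a, b) * Ad y $$ (b, a0)) = (if a = a0 then det (eval_mat n X y) else 0)"
  using arg_cong[OF Ad_mult(1)[of y], of "\<lambda>M. M $$ (a, a0)"] a0
  by (subst (asm) mult_mat_index[of _ n n _ n]) auto

lemma Ad_row: "b < n \<Longrightarrow> (\<Sum>a = 0..<n. Ad y $$ (b0, a) * eval_mat n X y $$ (a, b)) = (if b = b0 then det (eval_mat n X y) else 0)"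
  using arg_cong[OF Ad_mult(2)[of y], of "\<lambda>M. M $$ (b0, b)"] b0
  by (subst (asm) mult_mat_index[of _ n n _ n]) auto

text \<open>At level zero the right factor is constant, so the sum runs over entries of
  \<open>L * Ad zero_pt = 0\<close>.\<close>

lemma S_0: "S 0 y = 0"
proof -
  have "(\<Sum>b = 0..<n. if wcol b - wcol b0 = 0 then term y y b else 0)
      = (\<Sum>b = 0..<n. \<Sum>a = 0..<n. (if wrow a = wcol b0 then Ad y $$ (b0, a) else 0) * (L $$ (a, b) * Ad zero_pt $$ (b, a0)))"
  proof (rule sum.cong)
    fix b assume "b \<in> {0..<n}"
    then have b: "b < n" by simp
    have "(if wcol b - wcol b0 = 0 then term y y b else 0)
        = (\<Sum>a = 0..<n. if wcol b - wcol b0 = 0 then Ad y $$ (b0, a) * L $$ (a, b) * Ad y $$ (b, a0) else 0)"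
      by (simp add: term_def)
    also have "\<dots> = (\<Sum>a = 0..<n. (if wrow a = wcol b0 then Ad y $$ (b0, a) else 0) * (L $$ (a, b) * Ad zero_pt $$ (b, a0)))"
    proof (rule sum.cong)
      fix a assume "a \<in> {0..<n}"
      then have a: "a < n" by simp
      show "(if wcol b - wcol b0 = 0 then Ad y $$ (b0, a) * L $$ (a, b) * Ad y $$ (b, a0) else 0)
          = (if wrow a = wcol b0 then Ad y $$ (b0, a) else 0) * (L $$ (a, b) * Ad zero_pt $$ (b, a0))"
      proof (cases "L $$ (a, b) = 0")
        case False
        then have "wrow a = wcol b" using L_weight(2)[OF a b] by blast
        then show ?thesis using Ad_const[OF a0 b, of y] pivot_weight(2) by auto
      qed auto
    qed simp
    finally show "(if wcol b - wcol b0 = 0 then term y y b else 0)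
        = (\<Sum>a = 0..<n. (if wrow a = wcol b0 then Ad y $$ (b0, a) else 0) * (L $$ (a, b) * Ad zero_pt $$ (b, a0)))" .
  qed simp
  also have "\<dots> = (\<Sum>a = 0..<n. (if wrow a = wcol b0 then Ad y $$ (b0, a) else 0) * (\<Sum>b = 0..<n. L $$ (a, b) * Ad zero_pt $$ (b, a0)))"
    by (subst sum.swap) (simp add: sum_distrib_left)
  also have "\<dots> = 0"
  proof (intro sum.neutral ballI)
    fix a assume "a \<in> {0..<n}"
    then show "(if wrow a = wcol b0 then Ad y $$ (b0, a) else 0) * (\<Sum>b = 0..<n. L $$ (a, b) * Ad zero_pt $$ (b, a0)) = 0"
      using Ad_column[of a zero_pt] det_L by (simp add: L_def)
  qed
  finally show ?thesis by (simp add: S_def)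
qed

text \<open>Let \<open>r\<close> be the right adjugate column, \<open>l\<close> the left adjugate
  row and \<open>D\<close> the linear part of the matrix. Then \<open>L * r = - D * r\<close> except
  in the pivot row, which lies at level \<open>m\<close>. As \<open>D\<close> raises the level by
  one, the sum moves to columns of level \<open>k - 1\<close>, where \<open>- l * D = l * L\<close>
  except in the pivot column at level zero. That exception is the only source, so all levels from
  \<open>1\<close> to \<open>m - 1\<close> carry the same amount.\<close>

lemma S_step:
  assumes k: "k \<noteq> int m"
  shows "S k y = S (k - 1) y - (if k = 1 then det (eval_mat n X y) * \<kappa> else 0)"
proof -
  let ?M = "eval_mat n X y"
  let ?l = "\<lambda>a. Ad y $$ (b0, a)" and ?r = "\<lambda>b. Ad y $$ (b, a0)"
  define D where "D a b = ?M $$ (a, b) - L $$ (a, b)" for a b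
  have D: "wrow a = wcol b + 1" if "a < n" "b < n" "D a b \<noteq> 0" for a b
    using affine[OF that(1,2), of y] that by (auto simp: D_def L_def wrow_def wcol_def)
  have "S k y = (\<Sum>b = 0..<n. \<Sum>a = 0..<n. if wrow a - wcol b0 = k then ?l a * (L $$ (a, b) * ?r b) else 0)"
    unfolding S_def
  proof (rule sum.cong)
    fix b assume "b \<in> {0..<n}"
    then have b: "b < n" by simp
    have "(if wcol b - wcol b0 = k then term y y b else 0)
        = (\<Sum>a = 0..<n. if wcol b - wcol b0 = k then ?l a * L $$ (a, b) * ?r b else 0)"
      by (simp add: term_def)
    also have "\<dots> = (\<Sum>a = 0..<n. if wrow a - wcol b0 = k then ?l a * (L $$ (a, b) * ?r b) else 0)"
    proof (rule sum.cong)
      fix a assume "a \<in> {0..<n}"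
      then have a: "a < n" by simp
      show "(if wcol b - wcol b0 = k then ?l a * L $$ (a, b) * ?r b else 0)
        = (if wrow a - wcol b0 = k then ?l a * (L $$ (a, b) * ?r b) else 0)"
        using L_weight(2)[OF a b] by (cases "L $$ (a, b) = 0") auto
    qed simp
    finally show "(if wcol b - wcol b0 = k then term y y b else 0)
        = (\<Sum>a = 0..<n. if wrow a - wcol b0 = k then ?l a * (L $$ (a, b) * ?r b) else 0)" .
  qed simp
  also have "\<dots> = (\<Sum>a = 0..<n. \<Sum>b = 0..<n. if wrow a - wcol b0 = k then ?l a * (L $$ (a, b) * ?r b) else 0)"
    by (rule sum.swap)
  also have "\<dots> = (\<Sum>a = 0..<n. \<Sum>b = 0..<n. if wrow a - wcol b0 = k then - (?l a * (D a b * ?r b)) else 0)"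
  proof (rule sum.cong)
    fix a assume "a \<in> {0..<n}"
    then have a: "a < n" by simp
    show "(\<Sum>b = 0..<n. if wrow a - wcol b0 = k then ?l a * (L $$ (a, b) * ?r b) else 0)
        = (\<Sum>b = 0..<n. if wrow a - wcol b0 = k then - (?l a * (D a b * ?r b)) else 0)"
    proof (cases "wrow a - wcol b0 = k")
      case True
      then have "a \<noteq> a0" using k pivot_weight(2) by auto
      then have "(\<Sum>b = 0..<n. ?M $$ (a, b) * ?r b) = 0" using Ad_column[OF a] by simp
      then have "(\<Sum>b = 0..<n. L $$ (a, b) * ?r b) = - (\<Sum>b = 0..<n. D a b * ?r b)"
        by (simp add: D_def left_diff_distrib sum_subtractf)
      then have "?l a * (\<Sum>b = 0..<n. L $$ (a, b) * ?r b) = - (?l a * (\<Sum>b = 0..<n. D a b * ?r b))" by simp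
      then show ?thesis using True by (simp add: sum_distrib_left sum_negf)
    qed simp
  qed simp
  also have "\<dots> = (\<Sum>b = 0..<n. \<Sum>a = 0..<n. if wrow a - wcol b0 = k then - (?l a * (D a b * ?r b)) else 0)"
    by (rule sum.swap)
  also have "\<dots> = (\<Sum>b = 0..<n. if wcol b - wcol b0 = k - 1 then
      (\<Sum>a = 0..<n. ?l a * L $$ (a, b) * ?r b) - (if b = b0 then det ?M else 0) * ?r b else 0)"
  proof (rule sum.cong)
    fix b assume "b \<in> {0..<n}"
    then have b: "b < n" by simp
    have "(\<Sum>a = 0..<n. if wrow a - wcol b0 = k then - (?l a * (D a b * ?r b)) else 0)
        = (\<Sum>a = 0..<n. if wcol b - wcol b0 = k - 1 then - (?l a * (D a b * ?r b)) else 0)"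
    proof (rule sum.cong)
      fix a assume "a \<in> {0..<n}"
      then show "(if wrow a - wcol b0 = k then - (?l a * (D a b * ?r b)) else 0)
        = (if wcol b - wcol b0 = k - 1 then - (?l a * (D a b * ?r b)) else 0)"
        using D[of a b] b by (cases "D a b = 0") auto
    qed simp
    also have "\<dots> = (if wcol b - wcol b0 = k - 1 then
      (\<Sum>a = 0..<n. ?l a * L $$ (a, b) * ?r b) - (if b = b0 then det ?M else 0) * ?r b else 0)"
    proof -
      have "(\<Sum>a = 0..<n. - (?l a * (D a b * ?r b)))
          = (\<Sum>a = 0..<n. ?l a * L $$ (a, b) * ?r b) - (\<Sum>a = 0..<n. ?l a * ?M $$ (a, b)) * ?r b"
      proof -
        have "(\<Sum>a = 0..<n. - (?l a * (D a b * ?r b))) = (\<Sum>a = 0..<n. ?l a * L $$ (a, b) * ?r b - ?l a * ?M $$ (a, b) * ?r b)"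
          by (intro sum.cong) (auto simp: D_def algebra_simps)
        then show ?thesis by (simp add: sum_subtractf sum_distrib_right)
      qed
      then show ?thesis using Ad_row[OF b, of y] by auto
    qed
    finally show "(\<Sum>a = 0..<n. if wrow a - wcol b0 = k then - (?l a * (D a b * ?r b)) else 0) =
      (if wcol b - wcol b0 = k - 1 then
      (\<Sum>a = 0..<n. ?l a * L $$ (a, b) * ?r b) - (if b = b0 then det ?M else 0) * ?r b else 0)" .
  qed simp
  also have "\<dots> = (\<Sum>b = 0..<n. (if wcol b - wcol b0 = k - 1 then term y y b else 0)
      - (if b = b0 then (if k = 1 then det ?M * \<kappa> else 0) else 0))"
    using Ad_const[OF a0 b0, of y] pivot_weight(2) by (intro sum.cong) (auto simp: term_def)
  also have "\<dots> = S (k - 1) y - (if k = 1 then det ?M * \<kappa> else 0)"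
    using b0 by (simp add: S_def sum_subtractf)
  finally show ?thesis .
qed

lemma S_value:
  assumes "1 \<le> k" "k < m" shows "S (int k) y = - (det (eval_mat n X y) * \<kappa>)"
  using assms
proof (induction k rule: nat_induct_at_least)
  case base
  then show ?case using S_step[of 1 y] S_0[of y] by simp
next
  case (Suc k)
  then show ?case using S_step[of "int (Suc k)" y] by simp
qed

text \<open>The level \<open>k\<close> part of \<open>B y y\<close> is nonzero and splits according
  to the set of rows used on the right; some set \<open>I\<close> contributes a nonzero sum. Erasing
  the rows in \<open>I\<close> from \<open>u\<close> and the others from \<open>v\<close> leaves
  exactly this contribution.\<close>

lemma paired_exists:
  assumes k: "1 \<le> k" "k < m"
  obtains I where "I \<subseteq> {0..<m}" "card I = k" "paired I"
proof -
  obtain y where "pm m {0..<m} y \<noteq> 0" using pm_nonzero[of "{0..<m}" m] by auto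
  then have S: "S (int k) y \<noteq> 0" unfolding S_value[OF k] using det_X \<gamma> \<kappa> by simp
  define supp where "supp b = {i \<in> {0..<m}. offset b i = 1}" for b
  define W where "W = {b \<in> {0..<n}. wcol b - wcol b0 = int k \<and> term y y b \<noteq> 0}"
  have W: "offset b = (\<lambda>i. if i \<in> supp b then 1 else 0)" "card (supp b) = k" if "b \<in> W" for b
  proof -
    from that have b: "b < n" "wcol b - wcol b0 = int k" "term y y b \<noteq> 0" by (auto simp: W_def)
    have "offset b i = 0 \<or> offset b i = 1 \<and> i < m" for i
      using term_nonzero(1,2)[OF b(1,3), of i] by (auto split: if_splits)
    then show *: "offset b = (\<lambda>i. if i \<in> supp b then 1 else 0)" by (force simp: supp_def)
    have "int k = (\<Sum>i<m. offset b i)" using b(2) by (simp add: offset_def wcol_def sum_subtractf)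
    also have "\<dots> = (\<Sum>i\<in>{..<m}. if i \<in> supp b then 1 else 0)" by (subst *) simp
    also have "\<dots> = int (card (supp b))"
      by (simp add: sum.If_cases) (simp add: supp_def Int_def conj_commute lessThan_def)
    finally show "card (supp b) = k" by simp
  qed
  have fW: "finite W" by (simp add: W_def)
  have "S (int k) y = (\<Sum>b\<in>W. term y y b)"
    unfolding S_def W_def by (subst sum.mono_neutral_cong_left[symmetric, where S = "{b \<in> {0..<n}. wcol b - wcol b0 = int k \<and> term y y b \<noteq> 0}"
      and h = "\<lambda>b. if wcol b - wcol b0 = int k then term y y b else 0" and g = "\<lambda>b. term y y b"]) auto
  also have "\<dots> = (\<Sum>I\<in>supp ` W. \<Sum>b\<in>{b \<in> W. supp b = I}. term y y b)"
    by (rule sum.group[symmetric]) (use fW in auto)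
  finally obtain I where I: "I \<in> supp ` W" "(\<Sum>b\<in>{b \<in> W. supp b = I}. term y y b) \<noteq> 0"
    using S by (metis (no_types, lifting) sum.not_neutral_contains_not_neutral)
  have I': "I \<subseteq> {0..<m}" "card I = k" using I(1) W(2) by (auto simp: supp_def)
  define u where "u = (\<lambda>i j. if i \<in> I then 0 else y i j)"
  define v where "v = (\<lambda>i j. if i \<in> I then y i j else 0)"
  have same: "term u v b = term y y b" if b: "b < n" "offset b = (\<lambda>i. if i \<in> I then 1 else 0)" for b
    unfolding term_def
  proof (rule sum.cong)
    fix a assume "a \<in> {0..<n}"
    then have a: "a < n" by simp
    have r: "Ad v $$ (b, a0) = Ad y $$ (b, a0)"
      by (rule mhom_local[OF right_hom[OF b(1)]]) (auto simp: b(2) v_def split: if_splits)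
    have "Ad u $$ (b0, a) = Ad y $$ (b0, a)" if nz: "L $$ (a, b) \<noteq> 0"
      by (rule mhom_local[OF left_hom[OF a b(1) nz]]) (use I'(1) in \<open>auto simp: b(2) u_def fun_eq_iff split: if_splits\<close>)
    with r show "Ad u $$ (b0, a) * L $$ (a, b) * Ad v $$ (b, a0) = Ad y $$ (b0, a) * L $$ (a, b) * Ad y $$ (b, a0)"
      by (cases "L $$ (a, b) = 0") auto
  qed simp
  have off: "offset b = (\<lambda>i. if i \<in> I then 1 else 0)" if b: "b < n" "term u v b \<noteq> 0" for b
  proof
    fix i
    show "offset b i = (if i \<in> I then 1 else 0)"
      using term_nonzero(3)[OF b, of i] term_nonzero(4)[OF b, of i] I'(1) by (cases "i \<in> I") (auto simp: u_def v_def)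
  qed
  have "B u v = (\<Sum>b\<in>{b \<in> W. supp b = I}. term y y b)"
    unfolding B_terms
  proof (rule sum.mono_neutral_cong_right)
    show "{b \<in> W. supp b = I} \<subseteq> {0..<n}" by (auto simp: W_def)
    show "\<forall>b\<in>{0..<n} - {b \<in> W. supp b = I}. term u v b = 0"
    proof (rule ballI, rule ccontr)
      fix b assume b: "b \<in> {0..<n} - {b \<in> W. supp b = I}" and nz: "term u v b \<noteq> 0"
      then have bn: "b < n" by simp
      note o = off[OF bn nz]
      have "wcol b - wcol b0 = (\<Sum>i<m. offset b i)" by (simp add: offset_def wcol_def sum_subtractf)
      also have "\<dots> = int (card I)" unfolding o using I'(1)
        by (simp add: sum.If_cases) (metis Int_absorb1 atLeast0LessThan)
      finally have "b \<in> W" using bn nz same[OF bn o] I'(2) by (simp add: W_def)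
      moreover have "supp b = I" using I'(1) by (auto simp: supp_def o)
      ultimately show False using b by simp
    qed
    fix b assume "b \<in> {b \<in> W. supp b = I}"
    then have b: "b \<in> W" "supp b = I" by auto
    then have "b < n" by (simp add: W_def)
    then show "term u v b = term y y b" using W(1)[OF b(1)] b(2) by (intro same) auto
  qed simp
  with I(2) have "B u v \<noteq> 0" by simp
  then have "paired I" unfolding paired_def by (intro exI[of _ u] exI[of _ v]) (simp add: u_def v_def)
  with I' that show thesis by blast
qed

text \<open>Subsets of equal size are connected by exchanging one element for another, and a 3-cycle
  performs such an exchange with the help of a third row.\<close>

theorem proper_subsets_le_size:
  assumes cyc: "\<And>x y z. \<lbrakk>x < m; y < m; z < m; x \<noteq> y; x \<noteq> z; y \<noteq> z\<rbrakk> \<Longrightarrow>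
      \<exists>P Q. P \<in> carrier_mat n n \<and> Q \<in> carrier_mat n n \<and> det P \<noteq> 0 \<and> det Q \<noteq> 0 \<and>
        (\<forall>v. eval_mat n X (\<lambda>i. v (cyc3 x y z i)) = P * eval_mat n X v * Q)"
  shows "2 ^ m - 1 \<le> n"
proof -
  have move: "paired J" if p: "paired I" and xyz: "x < m" "y < m" "z < m" "x \<noteq> y" "x \<noteq> z" "y \<noteq> z"
    and J: "\<And>i. i \<in> J \<longleftrightarrow> cyc3 x y z i \<in> I" for I J x y z
  proof -
    from p obtain u v where uv: "\<forall>i j. i \<in> I \<longrightarrow> u i j = 0" "\<forall>i j. i \<notin> I \<longrightarrow> v i j = 0" "B u v \<noteq> 0"
      by (auto simp: paired_def)
    obtain P Q where PQ: "P \<in> carrier_mat n n" "Q \<in> carrier_mat n n" "det P \<noteq> 0" "det Q \<noteq> 0"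
      "\<And>v. eval_mat n X (\<lambda>i. v (cyc3 x y z i)) = P * eval_mat n X v * Q" using cyc[OF xyz] by blast
    have "B (\<lambda>i. u (cyc3 x y z i)) (\<lambda>i. v (cyc3 x y z i)) \<noteq> 0"
      by (rule B_equivariant[OF PQ(1-4) PQ(5) uv(3)])
    then show ?thesis unfolding paired_def using uv(1,2) J
      by (intro exI[of _ "\<lambda>i. u (cyc3 x y z i)"] exI[of _ "\<lambda>i. v (cyc3 x y z i)"]) (auto simp del: cyc3.simps)
  qed
  have exchange: "paired (insert b (I - {a}))"
    if I: "I \<subseteq> {0..<m}" "a \<in> I" "b \<in> {0..<m} - I" and p: "paired I" for I a b
  proof -
    have "card {a, b} < card {0..<m}" using m I by (auto simp: card_insert_if)
    then have "\<not> {0..<m} \<subseteq> {a, b}" by (metis card_mono finite.emptyI finite.insertI not_less)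
    then obtain c where "c \<in> {0..<m}" "c \<notin> {a, b}" by blast
    then have c: "c < m" "c \<noteq> a" "c \<noteq> b" by auto
    \<comment> \<open>The direction of the cycle depends on whether the third row \<open>c\<close>
      lies in \<open>I\<close>, so that \<open>c\<close> keeps its status.\<close>
    show ?thesis
    proof (cases "c \<in> I")
      case True
      show ?thesis
        by (rule move[OF p, of a b c]) (use I c True in auto)
    next
      case False
      show ?thesis
        by (rule move[OF p, of b a c]) (use I c False in auto)
    qed
  qed
  \<comment> \<open>The empty set belongs to the pivot column itself; all others come from
    \<open>paired_exists\<close>, which covers the sizes from \<open>1\<close> to
    \<open>m - 1\<close>.\<close>
  have all: "\<exists>b < n. offset b = (\<lambda>i. if i \<in> I then 1 else 0)" if I: "I \<subset> {0..<m}" for I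
  proof (cases "I = {}")
    case True
    then show ?thesis using b0 by (intro exI[of _ b0]) (simp add: offset_def)
  next
    case False
    have fI: "finite I" using I by (meson finite_atLeastLessThan finite_subset psubset_imp_subset)
    have "card I < m" using psubset_card_mono[OF _ I] by simp
    moreover have "1 \<le> card I" using False fI by (simp add: Suc_le_eq card_gt_0_iff)
    ultimately obtain I' where I': "I' \<subseteq> {0..<m}" "card I' = card I" "paired I'" using paired_exists by metis
    have "paired I"
      by (rule exchange_connected[of "{0..<m}" paired, OF _ exchange I'(1) _ I'(2,3)]) (use I in auto)
    then show ?thesis using paired_offset[of I] I by blast
  qed
  then obtain f where f: "\<And>I. I \<subset> {0..<m} \<Longrightarrow> f I < n \<and> offset (f I) = (\<lambda>i. if i \<in> I then 1 else 0)" by metis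
  let ?P = "{I. I \<subset> {0..<m}}"
  have "inj_on f ?P"
  proof (rule inj_onI)
    fix I J assume "I \<in> ?P" "J \<in> ?P" "f I = f J"
    then have "(\<lambda>i. if i \<in> I then 1 else 0 :: int) = (\<lambda>i. if i \<in> J then 1 else 0)" using f[of I] f[of J] by simp
    then have "i \<in> I \<longleftrightarrow> i \<in> J" for i by (metis zero_neq_one)
    then show "I = J" by blast
  qed
  moreover have "f ` ?P \<subseteq> {0..<n}"
  proof (rule image_subsetI)
    fix I assume "I \<in> ?P"
    then have "I \<subset> {0..<m}" by simp
    from f[OF this] show "f I \<in> {0..<n}" by simp
  qed
  ultimately have "card ?P \<le> n" by (metis card_atLeastLessThan card_inj_on_le diff_zero finite_atLeastLessThan)
  moreover have "?P = Pow {0..<m} - {{0..<m}}" by auto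
  then have "card ?P = 2 ^ m - 1" by (simp add: card_Pow)
  ultimately show ?thesis by simp
qed

end

section \<open>Affine pencils and the bound for given lifts\<close>

lemma linear_functional_expand:
  fixes f :: "complex mat \<Rightarrow> complex"
  assumes add: "\<And>M N. M \<in> carrier_mat m m \<Longrightarrow> N \<in> carrier_mat m m \<Longrightarrow> f (M + N) = f M + f N"
    and smult: "\<And>c M. M \<in> carrier_mat m m \<Longrightarrow> f (c \<cdot>\<^sub>m M) = c * f M"
    and M: "M \<in> carrier_mat m m"
  shows "f M = (\<Sum>i = 0..<m. \<Sum>j = 0..<m. M $$ (i, j) * f (unit_mat m i j))"
proof -
  define R where "R K = mat m m (\<lambda>(i, j). if (i, j) \<in> K then M $$ (i, j) else 0)" for K
  have Rc: "R K \<in> carrier_mat m m" for K by (simp add: R_def)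
  have "f (R K) = (\<Sum>q\<in>K. M $$ q * f (unit_mat m (fst q) (snd q)))"
    if "finite K" "K \<subseteq> {0..<m} \<times> {0..<m}" for K
    using that
  proof (induction K rule: finite_induct)
    case empty
    have "R {} = 0 \<cdot>\<^sub>m R {}" by (intro eq_matI) (auto simp: R_def)
    then have "f (R {}) = 0 * f (R {})" using smult[OF Rc, of 0 "{}"] by simp
    then show ?case by simp
  next
    case (insert q K)
    have "R (insert q K) = R K + M $$ q \<cdot>\<^sub>m unit_mat m (fst q) (snd q)"
      using insert by (intro eq_matI) (auto simp: R_def)
    then have "f (R (insert q K)) = f (R K) + M $$ q * f (unit_mat m (fst q) (snd q))"
      by (simp add: add Rc smult)
    with insert show ?case by simp
  qed
  from this[of "{0..<m} \<times> {0..<m}"]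
  have "f (R ({0..<m} \<times> {0..<m})) = (\<Sum>q\<in>{0..<m} \<times> {0..<m}. M $$ q * f (unit_mat m (fst q) (snd q)))" by simp
  moreover have "R ({0..<m} \<times> {0..<m}) = M" using M by (intro eq_matI) (auto simp: R_def)
  ultimately show ?thesis by (simp add: sum.cartesian_product case_prod_unfold)
qed

definition pencil :: "nat \<Rightarrow> nat \<Rightarrow> complex mat \<Rightarrow> (nat \<Rightarrow> nat \<Rightarrow> complex mat) \<Rightarrow> (nat \<Rightarrow> nat \<Rightarrow> complex) \<Rightarrow> complex mat" where
  "pencil m n \<Lambda> C y = mat n n (\<lambda>(a, b). \<Lambda> $$ (a, b) + (\<Sum>i = 0..<m. \<Sum>j = 0..<m. y i j * C i j $$ (a, b)))"

lemma pencil_carrier [simp]: "pencil m n \<Lambda> C y \<in> carrier_mat n n"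
  by (simp add: pencil_def)

lemma pencil_zero: "\<Lambda> \<in> carrier_mat n n \<Longrightarrow> pencil m n \<Lambda> C zero_pt = \<Lambda>"
  by (intro eq_matI) (auto simp: pencil_def)

lemma pencil_single:
  assumes "\<Lambda> \<in> carrier_mat n n" "C i j \<in> carrier_mat n n" "i < m" "j < m"
  shows "pencil m n \<Lambda> C (\<lambda>k l. if k = i \<and> l = j then c else 0) = \<Lambda> + c \<cdot>\<^sub>m C i j"
proof (rule eq_matI)
  fix a b assume "a < dim_row (\<Lambda> + c \<cdot>\<^sub>m C i j)" "b < dim_col (\<Lambda> + c \<cdot>\<^sub>m C i j)"
  then have ab: "a < n" "b < n" using assms by auto
  have "(\<Sum>k = 0..<m. \<Sum>l = 0..<m. (if k = i \<and> l = j then c else 0) * C k l $$ (a, b))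
      = (\<Sum>k = 0..<m. if k = i then c * C k j $$ (a, b) else 0)"
  proof (rule sum.cong)
    fix k
    have "(\<Sum>l = 0..<m. (if k = i \<and> l = j then c else 0) * C k l $$ (a, b))
        = (\<Sum>l = 0..<m. if l = j then if k = i then c * C k l $$ (a, b) else 0 else 0)"
      by (intro sum.cong) auto
    then show "(\<Sum>l = 0..<m. (if k = i \<and> l = j then c else 0) * C k l $$ (a, b)) = (if k = i then c * C k j $$ (a, b) else 0)"
      using assms by simp
  qed simp
  then show "pencil m n \<Lambda> C (\<lambda>k l. if k = i \<and> l = j then c else 0) $$ (a, b) = (\<Lambda> + c \<cdot>\<^sub>m C i j) $$ (a, b)"
    using assms ab by (simp add: pencil_def)
qed (use assms in \<open>auto simp: pencil_def\<close>)

lemma sandwich_pencil: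
  assumes S: "S \<in> carrier_mat n n" and T: "T \<in> carrier_mat n n" and L: "\<Lambda> \<in> carrier_mat n n"
    and C: "\<And>i j. i < m \<Longrightarrow> j < m \<Longrightarrow> C i j \<in> carrier_mat n n" and ab: "a < n" "b < n"
  shows "(S * pencil m n \<Lambda> C y * T) $$ (a, b)
    = (S * \<Lambda> * T) $$ (a, b) + (\<Sum>i = 0..<m. \<Sum>j = 0..<m. y i j * (S * C i j * T) $$ (a, b))"
proof -
  let ?I = "{0..<n} \<times> {0..<n}" and ?J = "{0..<m} \<times> {0..<m}"
  have idx: "(S * Z * T) $$ (a, b) = (\<Sum>(k, l)\<in>?I. S $$ (a, k) * Z $$ (k, l) * T $$ (l, b))"
    if "Z \<in> carrier_mat n n" for Z
    using mult3_mat_index[OF S that T ab] by (simp add: sum.cartesian_product)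
  have "(S * pencil m n \<Lambda> C y * T) $$ (a, b)
      = (\<Sum>(k, l)\<in>?I. S $$ (a, k) * \<Lambda> $$ (k, l) * T $$ (l, b)
          + (\<Sum>(i, j)\<in>?J. y i j * (S $$ (a, k) * C i j $$ (k, l) * T $$ (l, b))))"
    unfolding idx[OF pencil_carrier]
  proof (rule sum.cong)
    fix q assume "q \<in> ?I"
    then obtain k l where q: "q = (k, l)" "k < n" "l < n" by auto
    have "S $$ (a, k) * pencil m n \<Lambda> C y $$ (k, l) * T $$ (l, b)
        = S $$ (a, k) * \<Lambda> $$ (k, l) * T $$ (l, b) + S $$ (a, k) * (\<Sum>(i, j)\<in>?J. y i j * C i j $$ (k, l)) * T $$ (l, b)"
      using q by (simp add: pencil_def sum.cartesian_product algebra_simps)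
    also have "S $$ (a, k) * (\<Sum>(i, j)\<in>?J. y i j * C i j $$ (k, l)) * T $$ (l, b)
        = (\<Sum>(i, j)\<in>?J. y i j * (S $$ (a, k) * C i j $$ (k, l) * T $$ (l, b)))"
      unfolding sum_distrib_left sum_distrib_right by (intro sum.cong) (auto simp: algebra_simps)
    finally show "(case q of (k, l) \<Rightarrow> S $$ (a, k) * pencil m n \<Lambda> C y $$ (k, l) * T $$ (l, b))
        = (case q of (k, l) \<Rightarrow> S $$ (a, k) * \<Lambda> $$ (k, l) * T $$ (l, b)
          + (\<Sum>(i, j)\<in>?J. y i j * (S $$ (a, k) * C i j $$ (k, l) * T $$ (l, b))))"
      by (simp add: q)
  qed simp
  also have "\<dots> = (S * \<Lambda> * T) $$ (a, b)
      + (\<Sum>(k, l)\<in>?I. \<Sum>(i, j)\<in>?J. y i j * (S $$ (a, k) * C i j $$ (k, l) * T $$ (l, b)))"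
    unfolding idx[OF L] by (simp add: sum.distrib case_prod_unfold)
  also have "(\<Sum>(k, l)\<in>?I. \<Sum>(i, j)\<in>?J. y i j * (S $$ (a, k) * C i j $$ (k, l) * T $$ (l, b)))
      = (\<Sum>(i, j)\<in>?J. \<Sum>(k, l)\<in>?I. y i j * (S $$ (a, k) * C i j $$ (k, l) * T $$ (l, b)))"
    unfolding case_prod_unfold by (rule sum.swap)
  also have "\<dots> = (\<Sum>(i, j)\<in>?J. y i j * (S * C i j * T) $$ (a, b))"
  proof (rule sum.cong)
    fix q assume "q \<in> ?J"
    then obtain i j where q: "q = (i, j)" "i < m" "j < m" by auto
    show "(case q of (i, j) \<Rightarrow> \<Sum>(k, l)\<in>?I. y i j * (S $$ (a, k) * C i j $$ (k, l) * T $$ (l, b)))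
        = (case q of (i, j) \<Rightarrow> y i j * (S * C i j * T) $$ (a, b))"
      unfolding q(1) by (simp add: idx[OF C[OF q(2,3)]] sum_distrib_left case_prod_unfold)
  qed simp
  finally show ?thesis by (simp add: sum.cartesian_product)
qed

text \<open>The lifts enter as bare pairs of matrices, one pair for each group element, with no
  relation between different pairs.\<close>

theorem equivariant_pencil_size:
  assumes m: "3 \<le> m" and L: "\<Lambda> \<in> carrier_mat n n"
    and C: "\<And>i j. i < m \<Longrightarrow> j < m \<Longrightarrow> C i j \<in> carrier_mat n n"
    and det: "\<And>y. det (pencil m n \<Lambda> C y) = pm m {0..<m} y"
    and torus: "\<And>t. \<forall>i. t i \<noteq> 0 \<Longrightarrow> \<exists>P Q. P \<in> carrier_mat n n \<and> Q \<in> carrier_mat n n \<and> det P \<noteq> 0 \<and> det Q \<noteq> 0 \<and>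
        (\<forall>y. pencil m n \<Lambda> C (\<lambda>i j. t i * y i j) = P * pencil m n \<Lambda> C y * Q)"
    and cyc: "\<And>x y z. \<lbrakk>x < m; y < m; z < m; x \<noteq> y; x \<noteq> z; y \<noteq> z\<rbrakk> \<Longrightarrow>
      \<exists>P Q. P \<in> carrier_mat n n \<and> Q \<in> carrier_mat n n \<and> det P \<noteq> 0 \<and> det Q \<noteq> 0 \<and>
        (\<forall>v. pencil m n \<Lambda> C (\<lambda>i. v (cyc3 x y z i)) = P * pencil m n \<Lambda> C v * Q)"
  shows "2 ^ m - 1 \<le> n"
proof -
  \<comment> \<open>One diagonal matrix with multiplicatively independent entries stands for the
    torus: an eigenvalue in the group that they generate determines its exponents.\<close>
  define p where "p = enumerate {q :: nat. prime q}"
  have "p i \<in> {q. prime q}" for i unfolding p_def by (rule enumerate_in_set[OF primes_infinite])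
  then have pr: "prime (p i)" for i by simp
  have inj: "inj p" unfolding p_def by (rule strict_mono_imp_inj_on[OF strict_mono_enumerate[OF primes_infinite]])
  have pnz: "(of_nat (p i) :: complex) \<noteq> 0" for i using pr[of i] by auto
  obtain P Q where PQ: "P \<in> carrier_mat n n" "Q \<in> carrier_mat n n" "det P \<noteq> 0" "det Q \<noteq> 0"
    "\<And>y. pencil m n \<Lambda> C (\<lambda>i j. of_nat (p i) * y i j) = P * pencil m n \<Lambda> C y * Q"
    using torus[of "\<lambda>i. of_nat (p i)"] pnz by blast
  have PL: "P * \<Lambda> * Q = \<Lambda>" using PQ(5)[of zero_pt] L by (simp add: pencil_zero)
  \<comment> \<open>Evaluating the lift at a matrix unit and subtracting the constant part shows
    that each coefficient matrix is an eigenvector.\<close>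
  have PC: "P * C i j * Q = of_nat (p i) \<cdot>\<^sub>m C i j" if ij: "i < m" "j < m" for i j
  proof -
    note Cij = C[OF ij]
    let ?e = "\<lambda>c k l. if k = i \<and> l = j then c else 0 :: complex"
    have "(\<lambda>k l. of_nat (p k) * ?e 1 k l) = ?e (of_nat (p i))" by (auto simp: fun_eq_iff)
    then have "\<Lambda> + of_nat (p i) \<cdot>\<^sub>m C i j = P * (\<Lambda> + 1 \<cdot>\<^sub>m C i j) * Q"
      using PQ(5)[of "?e 1"] by (simp add: pencil_single[of \<Lambda> n C i j m, OF L Cij ij])
    also have "\<dots> = P * \<Lambda> * Q + P * C i j * Q"
    proof -
      have "1 \<cdot>\<^sub>m C i j = C i j" by (intro eq_matI) auto
      then show ?thesis using PQ(1,2) L Cij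
        by (simp add: mult_add_distrib_mat[of _ n n] add_mult_distrib_mat[of _ n n])
    qed
    finally have eq: "\<Lambda> + of_nat (p i) \<cdot>\<^sub>m C i j = \<Lambda> + P * C i j * Q" unfolding PL .
    show ?thesis
    proof (rule eq_matI)
      fix a b assume "a < dim_row (of_nat (p i) \<cdot>\<^sub>m C i j)" "b < dim_col (of_nat (p i) \<cdot>\<^sub>m C i j)"
      then have ab: "a < n" "b < n" using Cij by auto
      have PCQ: "P * C i j * Q \<in> carrier_mat n n" using PQ(1,2) Cij by simp
      show "(P * C i j * Q) $$ (a, b) = (of_nat (p i) \<cdot>\<^sub>m C i j) $$ (a, b)"
        using arg_cong[OF eq, of "\<lambda>M. M $$ (a, b)"] ab L Cij carrier_matD[OF PCQ]
        by (simp del: index_mult_mat)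
    qed (use PQ Cij in auto)
  qed
  obtain S S' T T' lam kap where
    S: "S \<in> carrier_mat n n" "S' \<in> carrier_mat n n" "S * S' = 1\<^sub>m n" "S' * S = 1\<^sub>m n"
    and T: "T \<in> carrier_mat n n" "T' \<in> carrier_mat n n" "T * T' = 1\<^sub>m n" "T' * T = 1\<^sub>m n"
    and lk: "\<And>a. a < n \<Longrightarrow> lam a \<noteq> (0 :: complex)" "\<And>b. b < n \<Longrightarrow> kap b \<noteq> (0 :: complex)"
    and grade: "\<And>Z c a b. Z \<in> carrier_mat n n \<Longrightarrow> P * Z * Q = c \<cdot>\<^sub>m Z \<Longrightarrow> a < n \<Longrightarrow> b < n \<Longrightarrow>
        (S' * Z * T) $$ (a, b) \<noteq> 0 \<Longrightarrow> lam a * kap b = c"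
    by (rule simultaneous_grading[OF PQ(1-4)]) blast
  obtain \<mu> \<nu> :: "nat \<Rightarrow> nat \<Rightarrow> int" where
    beyond: "\<And>a i. i \<ge> m \<Longrightarrow> \<mu> a i = 0" "\<And>a i. i \<ge> m \<Longrightarrow> \<nu> a i = 0"
    and w0: "\<And>a b. a < n \<Longrightarrow> b < n \<Longrightarrow> lam a * kap b = 1 \<Longrightarrow> \<mu> a = \<nu> b"
    and w1: "\<And>a b i. a < n \<Longrightarrow> b < n \<Longrightarrow> i < m \<Longrightarrow> lam a * kap b = of_nat (p i) \<Longrightarrow> \<mu> a = (\<nu> b)(i := \<nu> b i + 1)"
    by (rule integer_weights[OF pr inj lk, where m = m]) blast+
  have wL: "\<mu> a = \<nu> b" if "a < n" "b < n" "(S' * \<Lambda> * T) $$ (a, b) \<noteq> 0" for a b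
  proof -
    have "P * \<Lambda> * Q = 1 \<cdot>\<^sub>m \<Lambda>" unfolding PL by (intro eq_matI) auto
    from w0[OF that(1,2) grade[OF L this that]] show ?thesis .
  qed
  have wC: "\<mu> a = (\<nu> b)(i := \<nu> b i + 1)"
    if "a < n" "b < n" "i < m" "j < m" "(S' * C i j * T) $$ (a, b) \<noteq> 0" for a b i j
    by (rule w1[OF that(1-3) grade[OF C[OF that(3,4)] PC[OF that(3,4)] that(1,2,5)]])
  define X where "X a b y = (S' * \<Lambda> * T) $$ (a, b) + (\<Sum>i = 0..<m. \<Sum>j = 0..<m. y i j * (S' * C i j * T) $$ (a, b))" for a b y
  have X: "eval_mat n X y = S' * pencil m n \<Lambda> C y * T" for y
    by (intro eq_matI) (use S(2) T(1) in \<open>auto simp: X_def sandwich_pencil[OF S(2) T(1) L C] simp del: index_mult_mat(1)\<close>)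
  have dS: "det S' \<noteq> 0" "det T \<noteq> 0"
    using det_mult[OF S(1,2)] det_mult[OF T(1,2)] S(3) T(3) by auto
  have rep: "weighted_rep m {0..<m} n X \<mu> \<nu> (det S' * det T)"
    unfolding weighted_rep_def
  proof (intro conjI allI impI)
    fix a b assume ab: "a < n" "b < n"
    have "mhom (\<lambda>i. \<mu> a i - \<nu> b i) (\<lambda>_. (S' * \<Lambda> * T) $$ (a, b))"
    proof (cases "(S' * \<Lambda> * T) $$ (a, b) = 0")
      case False
      then show ?thesis using wL[OF ab] by simp
    qed simp
    moreover have "mhom (\<lambda>i. \<mu> a i - \<nu> b i) (\<lambda>y. y i j * (S' * C i j * T) $$ (a, b))" if ij: "i < m" "j < m" for i j
    proof (cases "(S' * C i j * T) $$ (a, b) = 0")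
      case False
      then have "(\<lambda>k. \<mu> a k - \<nu> b k) = (\<lambda>k. if k = i then 1 else 0)" using wC[OF ab ij] by auto
      then show ?thesis using mhom_cmult[OF mhom_var[of i j], of "(S' * C i j * T) $$ (a, b)"] by (simp add: mult.commute)
    qed simp
    ultimately show "mhom (\<lambda>i. \<mu> a i - \<nu> b i) (X a b)"
      unfolding X_def[abs_def] by (intro mhom_add mhom_sum) auto
  next
    fix y
    show "det (eval_mat n X y) = det S' * det T * pm m {0..<m} y"
      unfolding X using S(2) T(1) by (simp add: det_mult[of _ n] det)
  qed (use dS beyond in auto)
  obtain a0 b0 where ab0: "a0 < n" "b0 < n" "det (eval_mat n X zero_pt + unit_mat n a0 b0) \<noteq> 0"
    using weighted_rep_corank[OF m rep] by (auto simp: corank_le_1_def)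
  interpret pivoted_rep m n X \<mu> \<nu> "det S' * det T" a0 b0
  proof
    fix a b y assume ab: "a < n" "b < n" "X a b y \<noteq> X a b zero_pt"
    then obtain i j where ij: "i < m" "j < m" "(S' * C i j * T) $$ (a, b) \<noteq> 0"
    proof -
      have "(\<Sum>i = 0..<m. \<Sum>j = 0..<m. y i j * (S' * C i j * T) $$ (a, b)) \<noteq> 0"
        using ab(3) by (simp add: X_def)
      then obtain i where "i \<in> {0..<m}" "(\<Sum>j = 0..<m. y i j * (S' * C i j * T) $$ (a, b)) \<noteq> 0"
        by (rule sum.not_neutral_contains_not_neutral)
      moreover from this(2) obtain j where "j \<in> {0..<m}" "y i j * (S' * C i j * T) $$ (a, b) \<noteq> 0"
        by (rule sum.not_neutral_contains_not_neutral)
      ultimately show thesis using that[of i j] by auto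
    qed
    have "(\<Sum>k<m. \<mu> a k) = (\<Sum>k<m. \<nu> b k + (if k = i then 1 else 0))"
      using wC[OF ab(1,2) ij] by (intro sum.cong) auto
    then show "(\<Sum>k<m. \<mu> a k) = (\<Sum>k<m. \<nu> b k) + 1" using ij(1) by (simp add: sum.distrib)
  qed (use m rep ab0 in auto)
  show ?thesis
  proof (rule proper_subsets_le_size)
    fix x y z assume xyz: "x < m" "y < m" "z < m" "x \<noteq> y" "x \<noteq> z" "y \<noteq> z"
    obtain P Q where PQ: "P \<in> carrier_mat n n" "Q \<in> carrier_mat n n" "det P \<noteq> 0" "det Q \<noteq> 0"
      "\<And>v. pencil m n \<Lambda> C (\<lambda>i. v (cyc3 x y z i)) = P * pencil m n \<Lambda> C v * Q"
      using cyc[OF xyz] by blast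
    note assoc = assoc_mult_mat[of _ n n _ n _ n]
    have "eval_mat n X (\<lambda>i. v (cyc3 x y z i)) = (S' * P * S) * eval_mat n X v * (T' * Q * T)" for v
    proof -
      have "(S' * P * S) * eval_mat n X v * (T' * Q * T) = S' * P * (S * S') * pencil m n \<Lambda> C v * (T * T') * Q * T"
        unfolding X using S(1,2) T(1,2) PQ(1,2) by (simp add: assoc)
      also have "\<dots> = S' * (P * pencil m n \<Lambda> C v * Q) * T"
        unfolding S(3) T(3) using S(1,2) T(1,2) PQ(1,2) by (simp add: assoc)
      finally show ?thesis unfolding X PQ(5) by simp
    qed
    moreover have "det (S' * P * S) \<noteq> 0" "det (T' * Q * T) \<noteq> 0"
    proof -
      have "det S \<noteq> 0" "det T' \<noteq> 0" using det_mult[OF S(1,2)] det_mult[OF T(1,2)] S(3) T(3) by auto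
      then show "det (S' * P * S) \<noteq> 0" "det (T' * Q * T) \<noteq> 0"
        using S(1,2) T(1,2) PQ dS by (simp_all add: det_mult[of _ n])
    qed
    moreover have "S' * P * S \<in> carrier_mat n n" "T' * Q * T \<in> carrier_mat n n"
      using S(1,2) T(1,2) PQ(1,2) by simp_all
    ultimately show "\<exists>P Q. P \<in> carrier_mat n n \<and> Q \<in> carrier_mat n n \<and> det P \<noteq> 0 \<and> det Q \<noteq> 0 \<and>
        (\<forall>v. eval_mat n X (\<lambda>i. v (cyc3 x y z i)) = P * eval_mat n X v * Q)"
      by blast
  qed
qed

section \<open>Linear maps preserving the determinant\<close>

definition dyad :: "nat \<Rightarrow> (nat \<Rightarrow> complex) \<Rightarrow> (nat \<Rightarrow> complex) \<Rightarrow> complex mat" where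
  "dyad n u v = mat n n (\<lambda>(i, j). u i * v j)"

lemma dyad_carrier [simp]: "dyad n u v \<in> carrier_mat n n"
  by (simp add: dyad_def)

lemma dyad_index [simp]: "i < n \<Longrightarrow> j < n \<Longrightarrow> dyad n u v $$ (i, j) = u i * v j"
  by (simp add: dyad_def)

lemma dyad_dim [simp]: "dim_row (dyad n u v) = n" "dim_col (dyad n u v) = n"
  by (simp_all add: dyad_def)

definition rank_le_1 :: "nat \<Rightarrow> complex mat \<Rightarrow> bool" where
  "rank_le_1 n X \<longleftrightarrow> (\<exists>u v. X = dyad n u v)"

lemma rank_le_1_minor:
  assumes "rank_le_1 n X" "i < n" "j < n" "k < n" "l < n"
  shows "X $$ (i, j) * X $$ (k, l) = X $$ (i, l) * X $$ (k, j)"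
  using assms by (auto simp: rank_le_1_def)

lemma det_diag_mat_fun:
  "det (mat n n (\<lambda>(i, j). if i = j then f i else 0)) = (\<Prod>i = 0..<n. f i :: complex)"
  by (subst det_upper_triangular[of _ n]) (auto simp: prod_list_diag_prod)

text \<open>Hence a linear bijection preserving determinants up to a factor preserves rank at most one.\<close>

lemma rank_le_1_iff_affine:
  assumes X: "X \<in> carrier_mat n n"
  shows "rank_le_1 n X \<longleftrightarrow> (\<forall>Z \<in> carrier_mat n n. \<exists>\<beta>. \<forall>s. det (Z + s \<cdot>\<^sub>m X) = det Z + s * \<beta>)"
proof -
  obtain P Q r where PQ: "P \<in> carrier_mat n n" "Q \<in> carrier_mat n n" "det P \<noteq> 0" "det Q \<noteq> 0" "r \<le> n"
    and nf: "P * X * Q = diag_ones n r" using rank_normal_form[OF X] by blast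
  obtain P' where P': "P' \<in> carrier_mat n n" "P * P' = 1\<^sub>m n" "P' * P = 1\<^sub>m n"
    by (rule det_nonzero_inverse[OF PQ(1,3)])
  obtain Q' where Q': "Q' \<in> carrier_mat n n" "Q * Q' = 1\<^sub>m n" "Q' * Q = 1\<^sub>m n"
    by (rule det_nonzero_inverse[OF PQ(2,4)])
  note assoc = assoc_mult_mat[of _ n n _ n _ n]
  have Xeq: "X = P' * diag_ones n r * Q'"
  proof -
    have "P' * (P * X * Q) * Q' = (P' * P) * X * (Q * Q')"
      using PQ(1,2) P'(1) Q'(1) X by (simp add: assoc)
    then show ?thesis unfolding nf P'(3) Q'(2) using X by simp
  qed
  have sandwich: "det (P * (Z + s \<cdot>\<^sub>m X) * Q) = det (P * Z * Q + s \<cdot>\<^sub>m diag_ones n r)"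
    and sandwich': "det (P * (Z + s \<cdot>\<^sub>m X) * Q) = det P * det (Z + s \<cdot>\<^sub>m X) * det Q"
    if Z: "Z \<in> carrier_mat n n" for Z s
  proof -
    have "P * (Z + s \<cdot>\<^sub>m X) * Q = P * Z * Q + s \<cdot>\<^sub>m (P * X * Q)"
      using PQ(1,2) X Z by (simp add: mult_add_distrib_mat[of _ n n] add_mult_distrib_mat[of _ n n]
        mult_smult_distrib[of _ n n] mult_smult_assoc_mat[of _ n n _ n])
    then show "det (P * (Z + s \<cdot>\<^sub>m X) * Q) = det (P * Z * Q + s \<cdot>\<^sub>m diag_ones n r)" by (simp add: nf)
    show "det (P * (Z + s \<cdot>\<^sub>m X) * Q) = det P * det (Z + s \<cdot>\<^sub>m X) * det Q"
      using PQ(1,2) X Z by (simp add: det_mult[of _ n])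
  qed
  show ?thesis
  proof
    assume r1: "rank_le_1 n X"
    then obtain u v where uv: "X = dyad n u v" by (auto simp: rank_le_1_def)
    \<comment> \<open>For larger \<open>r\<close>, the upper left two-by-two minor of the normal
      form would be one, but that of a dyad is zero.\<close>
    have "r \<le> 1"
    proof (rule ccontr)
      assume "\<not> r \<le> 1"
      then have n: "0 < n" "1 < n" "1 < r" "0 < r" using PQ(5) by auto
      define pu where "pu i = (\<Sum>k = 0..<n. P $$ (i, k) * u k)" for i
      define qv where "qv j = (\<Sum>l = 0..<n. v l * Q $$ (l, j))" for j
      have e: "diag_ones n r $$ (i, j) = pu i * qv j" if "i < n" "j < n" for i j
      proof -
        have "diag_ones n r $$ (i, j) = (\<Sum>k = 0..<n. \<Sum>l = 0..<n. P $$ (i, k) * X $$ (k, l) * Q $$ (l, j))"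
          unfolding nf[symmetric] by (rule mult3_mat_index[OF PQ(1) X PQ(2) that])
        also have "\<dots> = pu i * qv j"
          unfolding pu_def qv_def sum_product uv by (intro sum.cong) auto
        finally show ?thesis .
      qed
      have "pu 0 * qv 0 = 1" "pu 1 * qv 1 = 1" "pu 0 * qv 1 = 0"
        using e[of 0 0] e[of 1 1] e[of 0 1] n by (simp_all add: diag_ones_def)
      then show False by auto
    qed
    show "\<forall>Z \<in> carrier_mat n n. \<exists>\<beta>. \<forall>s. det (Z + s \<cdot>\<^sub>m X) = det Z + s * \<beta>"
    proof
      fix Z :: "complex mat" assume Z: "Z \<in> carrier_mat n n"
      let ?W = "P * Z * Q"
      have W: "?W \<in> carrier_mat n n" using PQ(1,2) Z by simp
      have dW: "det ?W = det P * det Z * det Q" using PQ(1,2) Z by (simp add: det_mult[of _ n])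
      have "\<exists>\<beta>. \<forall>s. det (?W + s \<cdot>\<^sub>m diag_ones n r) = det ?W + s * \<beta>"
      proof (cases "r = 0")
        case True
        have "s \<cdot>\<^sub>m diag_ones n r = 0\<^sub>m n n" for s
          by (intro eq_matI) (auto simp: diag_ones_def True)
        then have "?W + s \<cdot>\<^sub>m diag_ones n r = ?W" for s using right_add_zero_mat[OF W] by simp
        then show ?thesis by (intro exI[of _ 0]) simp
      next
        case False
        then have r: "r = 1" "0 < n" using \<open>r \<le> 1\<close> PQ(5) by auto
        have "diag_ones n r = unit_mat n 0 0"
          by (intro eq_matI) (auto simp: diag_ones_def r(1))
        then show ?thesis using det_add_unit_mat[OF W r(2) r(2)] by auto
      qed
      then obtain \<beta> where \<beta>: "\<And>s. det (?W + s \<cdot>\<^sub>m diag_ones n r) = det ?W + s * \<beta>" by blast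
      have "det (Z + s \<cdot>\<^sub>m X) = det Z + s * (\<beta> / (det P * det Q))" for s
      proof -
        have "det P * det (Z + s \<cdot>\<^sub>m X) * det Q = det P * det Z * det Q + s * \<beta>"
          using sandwich[OF Z, of s] sandwich'[OF Z, of s] \<beta>[of s] dW by simp
        then show ?thesis using PQ(3,4) by (simp add: field_simps)
      qed
      then show "\<exists>\<beta>. \<forall>s. det (Z + s \<cdot>\<^sub>m X) = det Z + s * \<beta>" by blast
    qed
  next
    assume aff: "\<forall>Z \<in> carrier_mat n n. \<exists>\<beta>. \<forall>s. det (Z + s \<cdot>\<^sub>m X) = det Z + s * \<beta>"
    have "r \<le> 1"
    proof (rule ccontr)
      assume r: "\<not> r \<le> 1"
      \<comment> \<open>\<open>D\<close> is complementary to \<open>diag_ones n r\<close>, which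
        makes the determinant along the line equal to \<open>s ^ r\<close>; this is not affine in
        \<open>s\<close> for \<open>r \<ge> 2\<close>.\<close>
      define D where "D = mat n n (\<lambda>(i, j). if i = j then if i < r then 0 else 1 else 0 :: complex)"
      have D: "D \<in> carrier_mat n n" by (simp add: D_def)
      define Z where "Z = P' * D * Q'"
      have Z: "Z \<in> carrier_mat n n" using P' Q' D by (simp add: Z_def)
      have PZQ: "P * Z * Q = D"
      proof -
        have "P * Z * Q = (P * P') * D * (Q' * Q)" unfolding Z_def using PQ(1,2) P'(1) Q'(1) D by (simp add: assoc)
        then show ?thesis unfolding P'(2) Q'(3) using D by simp
      qed
      have dets: "det (D + s \<cdot>\<^sub>m diag_ones n r) = s ^ r" for s
      proof -
        have "D + s \<cdot>\<^sub>m diag_ones n r = mat n n (\<lambda>(i, j). if i = j then if i < r then s else 1 else 0)"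
          by (intro eq_matI) (auto simp: D_def diag_ones_def)
        then have "det (D + s \<cdot>\<^sub>m diag_ones n r) = (\<Prod>i = 0..<n. if i < r then s else 1)"
          by (simp add: det_diag_mat_fun)
        also have "\<dots> = (\<Prod>i\<in>{i \<in> {0..<n}. i < r}. s)" by (rule prod.inter_filter[symmetric]) simp
        also have "{i \<in> {0..<n}. i < r} = {0..<r}" using PQ(5) by auto
        finally show ?thesis by simp
      qed
      obtain \<beta> where \<beta>: "\<And>s. det (Z + s \<cdot>\<^sub>m X) = det Z + s * \<beta>" using aff Z by blast
      define a b where "a = det P * det Q * det Z" and "b = det P * det Q * \<beta>"
      have eq: "s ^ r = a + s * b" for s
        using sandwich[OF Z, of s] sandwich'[OF Z, of s] \<beta>[of s] dets[of s] PZQ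
        by (simp add: algebra_simps a_def b_def)
      have "a = 0" using eq[of 0] r by (simp add: power_0_left)
      moreover have "a + b = 1" using eq[of 1] by simp
      ultimately have "(2 :: complex) ^ r = 2" using eq[of 2] by simp
      then have "of_nat (2 ^ r) = (of_nat 2 :: complex)" by simp
      then have "(2 :: nat) ^ r = 2" using of_nat_eq_iff by blast
      then have "r = 1" by (metis power_inject_exp one_less_numeral_iff power_one_right semiring_norm(76))
      with r show False by simp
    qed
    have "X = dyad n (\<lambda>i. if r = 0 then 0 else P' $$ (i, 0)) (\<lambda>j. Q' $$ (0, j))"
    proof (rule eq_matI)
      fix i j assume "i < dim_row (dyad n (\<lambda>i. if r = 0 then 0 else P' $$ (i, 0)) (\<lambda>j. Q' $$ (0, j)))"
        "j < dim_col (dyad n (\<lambda>i. if r = 0 then 0 else P' $$ (i, 0)) (\<lambda>j. Q' $$ (0, j)))"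
      then have ij: "i < n" "j < n" by auto
      have "diag_ones n r \<in> carrier_mat n n" by (simp add: diag_ones_def)
      then have "X $$ (i, j) = (\<Sum>k = 0..<n. \<Sum>l = 0..<n. P' $$ (i, k) * diag_ones n r $$ (k, l) * Q' $$ (l, j))"
        unfolding Xeq by (rule mult3_mat_index[OF P'(1) _ Q'(1) ij])
      also have "\<dots> = (\<Sum>k = 0..<n. if k = 0 then if r = 0 then 0 else P' $$ (i, 0) * Q' $$ (0, j) else 0)"
      proof (rule sum.cong)
        fix k assume k: "k \<in> {0..<n}"
        have "(\<Sum>l = 0..<n. P' $$ (i, k) * diag_ones n r $$ (k, l) * Q' $$ (l, j))
            = (\<Sum>l = 0..<n. if l = 0 then if k = 0 then if r = 0 then 0 else P' $$ (i, 0) * Q' $$ (0, j) else 0 else 0)"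
          using \<open>r \<le> 1\<close> k by (intro sum.cong) (auto simp: diag_ones_def)
        then show "(\<Sum>l = 0..<n. P' $$ (i, k) * diag_ones n r $$ (k, l) * Q' $$ (l, j))
            = (if k = 0 then if r = 0 then 0 else P' $$ (i, 0) * Q' $$ (0, j) else 0)" using ij by simp
      qed simp
      finally show "X $$ (i, j) = dyad n (\<lambda>i. if r = 0 then 0 else P' $$ (i, 0)) (\<lambda>j. Q' $$ (0, j)) $$ (i, j)"
        using ij by simp
    qed (use X in auto)
    then show "rank_le_1 n X" unfolding rank_le_1_def by blast
  qed
qed

section \<open>Linear spaces of matrices of rank at most one\<close>

definition parallel :: "nat \<Rightarrow> (nat \<Rightarrow> complex) \<Rightarrow> (nat \<Rightarrow> complex) \<Rightarrow> bool" where
  "parallel n u v \<longleftrightarrow> (\<forall>i < n. \<forall>k < n. u i * v k = u k * v i)"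

lemma parallelD:
  assumes "parallel n u v" "i0 < n" "u i0 \<noteq> 0"
  obtains c where "\<And>k. k < n \<Longrightarrow> v k = c * u k"
proof (rule that[of "v i0 / u i0"])
  fix k assume "k < n"
  then have "u i0 * v k = u k * v i0" using assms by (auto simp: parallel_def)
  then show "v k = v i0 / u i0 * u k" using assms(3) by (simp add: field_simps)
qed

text \<open>A two-by-two minor of the sum is the product of a minor of \<open>u\<close>,
  \<open>u'\<close> and a minor of \<open>v\<close>, \<open>v'\<close>.\<close>

lemma dyad_sum_rank_le_1:
  assumes "rank_le_1 n (dyad n u v + dyad n u' v')"
  shows "parallel n u u' \<or> parallel n v v'"
proof (rule disjCI)
  assume "\<not> parallel n v v'"
  then obtain j l where jl: "j < n" "l < n" "v j * v' l - v l * v' j \<noteq> 0" by (auto simp: parallel_def)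
  show "parallel n u u'"
    unfolding parallel_def
  proof (intro allI impI)
    fix i k assume ik: "i < n" "k < n"
    have "(u i * v j + u' i * v' j) * (u k * v l + u' k * v' l) = (u i * v l + u' i * v' l) * (u k * v j + u' k * v' j)"
      using rank_le_1_minor[OF assms ik(1) jl(1) ik(2) jl(2)] ik jl by simp
    moreover have "(u i * u' k - u k * u' i) * (v j * v' l - v l * v' j)
        = (u i * v j + u' i * v' j) * (u k * v l + u' k * v' l) - (u i * v l + u' i * v' l) * (u k * v j + u' k * v' j)"
      by (simp add: algebra_simps)
    ultimately have "(u i * u' k - u k * u' i) * (v j * v' l - v l * v' j) = 0" by simp
    then show "u i * u' k = u k * u' i" using jl(3) by simp
  qed
qed

lemma dyad_cong: "(\<And>i. i < n \<Longrightarrow> u i = u' i) \<Longrightarrow> (\<And>i. i < n \<Longrightarrow> v i = v' i) \<Longrightarrow> dyad n u v = dyad n u' v'"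
  by (intro eq_matI) auto

lemma dyad_nonzero_factors:
  assumes "dyad n u v \<noteq> 0\<^sub>m n n"
  obtains i j where "i < n" "u i \<noteq> 0" "j < n" "v j \<noteq> 0"
proof -
  have "\<exists>i < n. \<exists>j < n. u i * v j \<noteq> 0"
  proof (rule ccontr)
    assume "\<not> ?thesis"
    then have "dyad n u v = 0\<^sub>m n n" by (intro eq_matI) auto
    with assms show False by simp
  qed
  with that show thesis by auto
qed

text \<open>Adding the fixed nonzero dyad shows that each member shares the left or the right factor
  with it. The members of either kind form a subspace, and a vector space is not the union of two
  proper subspaces.\<close>

lemma rank_le_1_family:
  fixes g :: "(nat \<Rightarrow> complex) \<Rightarrow> complex mat"
  assumes gc: "\<And>x. rank_le_1 n (g x)" and add: "\<And>x y. g (\<lambda>i. x i + y i) = g x + g y"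
    and g0: "g x0 = dyad n a b" and nz: "dyad n a b \<noteq> 0\<^sub>m n n"
  shows "(\<forall>x. \<exists>p. g x = dyad n p b) \<or> (\<forall>x. \<exists>q. g x = dyad n a q)"
proof -
  obtain i0 j0 where ij0: "i0 < n" "a i0 \<noteq> 0" "j0 < n" "b j0 \<noteq> 0"
    by (rule dyad_nonzero_factors[OF nz])
  define Cb where "Cb x \<longleftrightarrow> (\<exists>p. g x = dyad n p b)" for x
  define Ra where "Ra x \<longleftrightarrow> (\<exists>q. g x = dyad n a q)" for x
  have either: "Cb x \<or> Ra x" for x
  proof -
    obtain p q where pq: "g x = dyad n p q" using gc[of x] by (auto simp: rank_le_1_def)
    have "rank_le_1 n (dyad n a b + dyad n p q)" using gc[of "\<lambda>i. x0 i + x i"] by (simp add: add g0 pq)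
    then have "parallel n a p \<or> parallel n b q" by (rule dyad_sum_rank_le_1)
    then show ?thesis
    proof
      assume "parallel n a p"
      then obtain c where "\<And>k. k < n \<Longrightarrow> p k = c * a k" using parallelD[of n a p] ij0 by blast
      then have "dyad n p q = dyad n a (\<lambda>j. c * q j)" by (intro eq_matI) auto
      then show ?thesis using pq by (auto simp: Ra_def)
    next
      assume "parallel n b q"
      then obtain c where "\<And>k. k < n \<Longrightarrow> q k = c * b k" using parallelD[of n b q] ij0 by blast
      then have "dyad n p q = dyad n (\<lambda>i. c * p i) b" by (intro eq_matI) auto
      then show ?thesis using pq by (auto simp: Cb_def)
    qed
  qed
  have gx: "g x + g y - g y = g x" for x y
  proof -
    obtain p q p' q' where "g x = dyad n p q" "g y = dyad n p' q'" using gc by (metis rank_le_1_def)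
    then show ?thesis by (intro eq_matI) auto
  qed
  have cancel: "Cb x" if "Cb (\<lambda>i. x i + y i)" "Cb y" for x y
  proof -
    from that obtain p p' where pp: "g x + g y = dyad n p b" "g y = dyad n p' b" by (auto simp: Cb_def add)
    then have "g x = dyad n p b - dyad n p' b" using gx[of x y] by simp
    also have "\<dots> = dyad n (\<lambda>i. p i - p' i) b" by (intro eq_matI) (auto simp: algebra_simps)
    finally show ?thesis by (auto simp: Cb_def)
  qed
  have cancel': "Ra x" if "Ra (\<lambda>i. x i + y i)" "Ra y" for x y
  proof -
    from that obtain p p' where pp: "g x + g y = dyad n a p" "g y = dyad n a p'" by (auto simp: Ra_def add)
    then have "g x = dyad n a p - dyad n a p'" using gx[of x y] by simp
    also have "\<dots> = dyad n a (\<lambda>i. p i - p' i)" by (intro eq_matI) (auto simp: algebra_simps)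
    finally show ?thesis by (auto simp: Ra_def)
  qed
  show ?thesis
  proof (rule ccontr)
    assume "\<not> ?thesis"
    then obtain x y where xy: "\<not> Cb x" "\<not> Ra y" by (auto simp: Cb_def Ra_def)
    then have "Ra x" "Cb y" using either by auto
    from either[of "\<lambda>i. x i + y i"] show False
    proof
      assume "Cb (\<lambda>i. x i + y i)"
      then show False using cancel \<open>Cb y\<close> xy by blast
    next
      assume "Ra (\<lambda>i. x i + y i)"
      moreover have "(\<lambda>i. x i + y i) = (\<lambda>i. y i + x i)" by auto
      ultimately show False using cancel'[of y x] \<open>Ra x\<close> xy by simp
    qed
  qed
qed

definition rank_preserver :: "nat \<Rightarrow> (complex mat \<Rightarrow> complex mat) \<Rightarrow> bool" where
  "rank_preserver n h \<longleftrightarrow> (\<forall>X \<in> carrier_mat n n. h X \<in> carrier_mat n n) \<and>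
     (\<forall>X \<in> carrier_mat n n. \<forall>Y \<in> carrier_mat n n. h (X + Y) = h X + h Y) \<and>
     (\<forall>c. \<forall>X \<in> carrier_mat n n. h (c \<cdot>\<^sub>m X) = c \<cdot>\<^sub>m h X) \<and>
     (\<forall>X \<in> carrier_mat n n. h X = 0\<^sub>m n n \<longrightarrow> X = 0\<^sub>m n n) \<and>
     (\<forall>X \<in> carrier_mat n n. rank_le_1 n X \<longrightarrow> rank_le_1 n (h X))"

lemma rank_preserver_inj:
  assumes h: "rank_preserver n h" and XY: "X \<in> carrier_mat n n" "Y \<in> carrier_mat n n" and eq: "h X = h Y"
  shows "X = Y"
proof -
  have Z: "X + (-1) \<cdot>\<^sub>m Y \<in> carrier_mat n n" using XY by simp
  have hY: "h Y \<in> carrier_mat n n" using h XY by (simp add: rank_preserver_def)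
  have "h (X + (-1) \<cdot>\<^sub>m Y) = h X + (-1) \<cdot>\<^sub>m h Y" using h XY by (simp add: rank_preserver_def)
  also have "\<dots> = 0\<^sub>m n n" unfolding eq using hY by (intro eq_matI) auto
  finally have "X + (-1) \<cdot>\<^sub>m Y = 0\<^sub>m n n" using h Z by (simp add: rank_preserver_def)
  then have "(X + (-1) \<cdot>\<^sub>m Y) $$ (i, j) = 0" if "i < n" "j < n" for i j using that by simp
  then show ?thesis using XY by (intro eq_matI) auto
qed

definition std :: "nat \<Rightarrow> nat \<Rightarrow> complex" where "std k = (\<lambda>i. if i = k then 1 else 0)"

lemma dyad_std: "dyad n (std i) (std j) = unit_mat n i j"
  by (intro eq_matI) (auto simp: std_def)

text \<open>For a fixed right factor the left factor depends linearly on \<open>x\<close>; its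
  matrix has the images of the unit vectors as columns, and injectivity makes it invertible.\<close>

lemma dyad_family_matrix:
  assumes add: "\<And>x y. g (\<lambda>i. x i + y i) = g x + g y" and smult: "\<And>c x. g (\<lambda>i. c * x i) = c \<cdot>\<^sub>m g x"
    and loc: "\<And>x y. (\<And>i. i < n \<Longrightarrow> x i = y i) \<Longrightarrow> g x = g y"
    and gc: "\<And>x. g x \<in> carrier_mat n n"
    and inj: "\<And>x. g x = 0\<^sub>m n n \<Longrightarrow> \<forall>i < n. x i = 0"
    and im: "\<And>x. \<exists>p. g x = dyad n p b"
  obtains P where "P \<in> carrier_mat n n" "det P \<noteq> 0" "\<And>x. g x = dyad n (\<lambda>i. \<Sum>j = 0..<n. P $$ (i, j) * x j) b"
proof -
  from im obtain p where p: "\<And>x. g x = dyad n (p x) b" by metis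
  define P where "P = mat n n (\<lambda>(i, j). p (std j) i)"
  have P: "P \<in> carrier_mat n n" by (simp add: P_def)
  have partial: "g (\<lambda>i. \<Sum>j\<in>K. x j * std j i) = dyad n (\<lambda>i. \<Sum>j\<in>K. p (std j) i * x j) b" if "finite K" for K x
    using that
  proof (induction K rule: finite_induct)
    case empty
    have "g (\<lambda>i. 0 * x i) = 0 \<cdot>\<^sub>m g x" by (rule smult)
    also have "\<dots> = 0\<^sub>m n n" using carrier_matD[OF gc[of x]] by (intro eq_matI) auto
    finally show ?case by (simp add: dyad_def zero_mat_def case_prod_unfold)
  next
    case (insert k K)
    have "g (\<lambda>i. \<Sum>j\<in>insert k K. x j * std j i) = g (\<lambda>i. x k * std k i + (\<Sum>j\<in>K. x j * std j i))"
      using insert by simp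
    also have "\<dots> = x k \<cdot>\<^sub>m dyad n (p (std k)) b + dyad n (\<lambda>i. \<Sum>j\<in>K. p (std j) i * x j) b"
      by (simp add: add smult insert.IH p[of "std k"])
    also have "\<dots> = dyad n (\<lambda>i. \<Sum>j\<in>insert k K. p (std j) i * x j) b"
      using insert by (intro eq_matI) (auto simp: algebra_simps)
    finally show ?case .
  qed
  have g: "g x = dyad n (\<lambda>i. \<Sum>j = 0..<n. P $$ (i, j) * x j) b" for x
  proof -
    have "g x = g (\<lambda>i. \<Sum>j = 0..<n. x j * std j i)"
      by (rule loc) (simp add: std_def if_distrib cong: if_cong)
    also have "\<dots> = dyad n (\<lambda>i. \<Sum>j = 0..<n. p (std j) i * x j) b" by (rule partial) simp
    also have "\<dots> = dyad n (\<lambda>i. \<Sum>j = 0..<n. P $$ (i, j) * x j) b"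
      by (intro dyad_cong sum.cong refl) (auto simp: P_def)
    finally show ?thesis .
  qed
  have "det P \<noteq> 0"
  proof
    assume "det P = 0"
    then obtain v where v: "v \<in> carrier_vec n" "v \<noteq> 0\<^sub>v n" "P *\<^sub>v v = 0\<^sub>v n"
      using det_0_iff_vec_prod_zero[OF P] by blast
    have "(\<Sum>j = 0..<n. P $$ (i, j) * v $ j) = 0" if "i < n" for i
    proof -
      have "(P *\<^sub>v v) $ i = (\<Sum>j = 0..<n. P $$ (i, j) * v $ j)" using P v(1) that by (simp add: scalar_prod_def)
      then show ?thesis using v(3) that by simp
    qed
    then have "g (\<lambda>j. v $ j) = 0\<^sub>m n n" unfolding g by (intro eq_matI) auto
    from inj[OF this] have "v = 0\<^sub>v n" using v(1) by (intro eq_vecI) auto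
    with v(2) show False by simp
  qed
  with P g that show thesis by blast
qed

context
  fixes n :: nat and h :: "complex mat \<Rightarrow> complex mat"
  assumes h: "rank_preserver n h" and n: "2 \<le> n"
begin

lemma rank_preserverD:
  "X \<in> carrier_mat n n \<Longrightarrow> h X \<in> carrier_mat n n"
  "X \<in> carrier_mat n n \<Longrightarrow> Y \<in> carrier_mat n n \<Longrightarrow> h (X + Y) = h X + h Y"
  "X \<in> carrier_mat n n \<Longrightarrow> h (c \<cdot>\<^sub>m X) = c \<cdot>\<^sub>m h X"
  "X \<in> carrier_mat n n \<Longrightarrow> h X = 0\<^sub>m n n \<Longrightarrow> X = 0\<^sub>m n n"
  "X \<in> carrier_mat n n \<Longrightarrow> rank_le_1 n X \<Longrightarrow> rank_le_1 n (h X)"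
  using h by (auto simp: rank_preserver_def)

lemma rank_preserver_dyad:
  "h (dyad n (\<lambda>i. x i + y i) v) = h (dyad n x v) + h (dyad n y v)"
  "h (dyad n v (\<lambda>i. x i + y i)) = h (dyad n v x) + h (dyad n v y)"
  "h (dyad n (\<lambda>i. c * x i) v) = c \<cdot>\<^sub>m h (dyad n x v)"
  "h (dyad n v (\<lambda>i. c * x i)) = c \<cdot>\<^sub>m h (dyad n v x)"
  "rank_le_1 n (h (dyad n x v))"
proof -
  have "dyad n (\<lambda>i. x i + y i) v = dyad n x v + dyad n y v" by (intro eq_matI) (auto simp: algebra_simps)
  then show "h (dyad n (\<lambda>i. x i + y i) v) = h (dyad n x v) + h (dyad n y v)" by (simp add: rank_preserverD(2))
  have "dyad n v (\<lambda>i. x i + y i) = dyad n v x + dyad n v y" by (intro eq_matI) (auto simp: algebra_simps)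
  then show "h (dyad n v (\<lambda>i. x i + y i)) = h (dyad n v x) + h (dyad n v y)" by (simp add: rank_preserverD(2))
  have "dyad n (\<lambda>i. c * x i) v = c \<cdot>\<^sub>m dyad n x v" by (intro eq_matI) auto
  then show "h (dyad n (\<lambda>i. c * x i) v) = c \<cdot>\<^sub>m h (dyad n x v)" by (simp add: rank_preserverD(3))
  have "dyad n v (\<lambda>i. c * x i) = c \<cdot>\<^sub>m dyad n v x" by (intro eq_matI) auto
  then show "h (dyad n v (\<lambda>i. c * x i)) = c \<cdot>\<^sub>m h (dyad n v x)" by (simp add: rank_preserverD(3))
  show "rank_le_1 n (h (dyad n x v))" by (rule rank_preserverD(5)) (auto simp: rank_le_1_def)
qed

lemma rank_preserver_dyad_inj:
  "h (dyad n x (std 0)) = 0\<^sub>m n n \<Longrightarrow> \<forall>i < n. x i = 0"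
  "h (dyad n (std 0) x) = 0\<^sub>m n n \<Longrightarrow> \<forall>i < n. x i = 0"
proof -
  assume "h (dyad n x (std 0)) = 0\<^sub>m n n"
  then have z: "dyad n x (std 0) = 0\<^sub>m n n" by (rule rank_preserverD(4)[OF dyad_carrier])
  show "\<forall>i < n. x i = 0"
  proof (intro allI impI)
    fix i assume i: "i < n"
    have "x i = dyad n x (std 0) $$ (i, 0)" using n i by (simp add: std_def)
    then show "x i = 0" unfolding z using n i by simp
  qed
next
  assume "h (dyad n (std 0) x) = 0\<^sub>m n n"
  then have z: "dyad n (std 0) x = 0\<^sub>m n n" by (rule rank_preserverD(4)[OF dyad_carrier])
  show "\<forall>i < n. x i = 0"
  proof (intro allI impI)
    fix i assume i: "i < n"
    have "x i = dyad n (std 0) x $$ (0, i)" using n i by (simp add: std_def)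
    then show "x i = 0" unfolding z using n i by simp
  qed
qed

lemma columns_matrix:
  assumes "\<And>x. \<exists>p. h (dyad n x (std 0)) = dyad n p b"
  obtains P where "P \<in> carrier_mat n n" "det P \<noteq> 0"
    "\<And>x. h (dyad n x (std 0)) = dyad n (\<lambda>i. \<Sum>j = 0..<n. P $$ (i, j) * x j) b"
proof (rule dyad_family_matrix[of "\<lambda>x. h (dyad n x (std 0))" n b])
  show "h (dyad n x (std 0)) = h (dyad n y (std 0))" if "\<And>i. i < n \<Longrightarrow> x i = y i" for x y
    using that by (intro arg_cong[where f = h] dyad_cong) auto
  show "h (dyad n (\<lambda>i. x i + y i) (std 0)) = h (dyad n x (std 0)) + h (dyad n y (std 0))" for x y
    by (rule rank_preserver_dyad(1))
  show "h (dyad n (\<lambda>i. c * x i) (std 0)) = c \<cdot>\<^sub>m h (dyad n x (std 0))" for c x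
    by (rule rank_preserver_dyad(3))
  show "h (dyad n x (std 0)) \<in> carrier_mat n n" for x by (rule rank_preserverD(1)[OF dyad_carrier])
  show "\<forall>i < n. x i = 0" if "h (dyad n x (std 0)) = 0\<^sub>m n n" for x by (rule rank_preserver_dyad_inj(1)[OF that])
  show "\<exists>p. h (dyad n x (std 0)) = dyad n p b" for x by (rule assms)
qed (rule that)

text \<open>Dimension count: the images of the first column already fill the space of dyads with
  right factor \<open>b\<close>, so a further image there contradicts injectivity.\<close>

lemma not_both_columns:
  assumes 1: "\<And>x. \<exists>p. h (dyad n x (std 0)) = dyad n p b" and 2: "\<exists>p. h (dyad n (std 0) (std 1)) = dyad n p b"
  shows False
proof -
  obtain P where P: "P \<in> carrier_mat n n" "det P \<noteq> 0"
    "\<And>x. h (dyad n x (std 0)) = dyad n (\<lambda>i. \<Sum>j = 0..<n. P $$ (i, j) * x j) b"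
    by (rule columns_matrix[OF 1]) blast
  obtain P' where P': "P' \<in> carrier_mat n n" "P * P' = 1\<^sub>m n"
    by (rule det_nonzero_inverse[OF P(1,2)])
  obtain p where p: "h (dyad n (std 0) (std 1)) = dyad n p b" using 2 by blast
  define x where "x j = (\<Sum>k = 0..<n. P' $$ (j, k) * p k)" for j
  have "(\<Sum>j = 0..<n. P $$ (i, j) * x j) = p i" if i: "i < n" for i
  proof -
    have "(\<Sum>j = 0..<n. P $$ (i, j) * x j) = (\<Sum>j = 0..<n. \<Sum>k = 0..<n. P $$ (i, j) * P' $$ (j, k) * p k)"
      by (simp add: x_def sum_distrib_left mult.assoc)
    also have "\<dots> = (\<Sum>k = 0..<n. (\<Sum>j = 0..<n. P $$ (i, j) * P' $$ (j, k)) * p k)"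
      by (subst sum.swap) (simp add: sum_distrib_right)
    also have "\<dots> = (\<Sum>k = 0..<n. if k = i then p k else 0)"
    proof (rule sum.cong)
      fix k assume "k \<in> {0..<n}"
      then have k: "k < n" by simp
      have "(\<Sum>j = 0..<n. P $$ (i, j) * P' $$ (j, k)) = (1\<^sub>m n :: complex mat) $$ (i, k)"
        unfolding P'(2)[symmetric] by (rule mult_mat_index[symmetric, OF P(1) P'(1) i k])
      then show "(\<Sum>j = 0..<n. P $$ (i, j) * P' $$ (j, k)) * p k = (if k = i then p k else 0)"
        using i k by simp
    qed simp
    finally show ?thesis using i by simp
  qed
  then have "h (dyad n x (std 0)) = h (dyad n (std 0) (std 1))"
    unfolding P(3) p by (intro dyad_cong) auto
  then have eq: "dyad n x (std 0) = dyad n (std 0) (std 1)"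
    by (intro rank_preserver_inj[OF h dyad_carrier dyad_carrier])
  have "(1 :: complex) = dyad n (std 0) (std 1) $$ (0, 1)" using n by (simp add: std_def)
  also have "\<dots> = dyad n x (std 0) $$ (0, 1)" by (simp only: eq)
  also have "\<dots> = 0" using n by (simp add: std_def)
  finally show False by simp
qed

end

definition mult_fun :: "nat \<Rightarrow> complex mat \<Rightarrow> (nat \<Rightarrow> complex) \<Rightarrow> nat \<Rightarrow> complex" where
  "mult_fun n A u = (\<lambda>i. \<Sum>j = 0..<n. A $$ (i, j) * u j)"

lemma mult_fun_inverse:
  assumes "A \<in> carrier_mat n n" "B \<in> carrier_mat n n" "A * B = 1\<^sub>m n" "i < n"
  shows "mult_fun n A (mult_fun n B u) i = u i"
proof -
  have "mult_fun n A (mult_fun n B u) i = (\<Sum>j = 0..<n. \<Sum>k = 0..<n. A $$ (i, j) * B $$ (j, k) * u k)"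
    by (simp add: mult_fun_def sum_distrib_left mult.assoc)
  also have "\<dots> = (\<Sum>k = 0..<n. (\<Sum>j = 0..<n. A $$ (i, j) * B $$ (j, k)) * u k)"
    by (subst sum.swap) (simp add: sum_distrib_right)
  also have "\<dots> = (\<Sum>k = 0..<n. if k = i then u k else 0)"
  proof (rule sum.cong)
    fix k assume "k \<in> {0..<n}"
    then have k: "k < n" by simp
    have "(\<Sum>j = 0..<n. A $$ (i, j) * B $$ (j, k)) = (1\<^sub>m n :: complex mat) $$ (i, k)"
      unfolding assms(3)[symmetric] by (rule mult_mat_index[symmetric, OF assms(1,2,4) k])
    then show "(\<Sum>j = 0..<n. A $$ (i, j) * B $$ (j, k)) * u k = (if k = i then u k else 0)"
      using assms(4) k by simp
  qed simp
  finally show ?thesis using assms(4) by simp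
qed

lemma sandwich_dyad:
  assumes A: "A \<in> carrier_mat n n" and B: "B \<in> carrier_mat n n"
  shows "A * dyad n u v * transpose_mat B = dyad n (mult_fun n A u) (mult_fun n B v)"
proof (rule eq_matI)
  fix i j assume "i < dim_row (dyad n (mult_fun n A u) (mult_fun n B v))" "j < dim_col (dyad n (mult_fun n A u) (mult_fun n B v))"
  then have ij: "i < n" "j < n" by auto
  have "transpose_mat B \<in> carrier_mat n n" using B by simp
  then have "(A * dyad n u v * transpose_mat B) $$ (i, j)
      = (\<Sum>k = 0..<n. \<Sum>l = 0..<n. A $$ (i, k) * dyad n u v $$ (k, l) * transpose_mat B $$ (l, j))"
    by (rule mult3_mat_index[OF A dyad_carrier _ ij])
  also have "\<dots> = (\<Sum>k = 0..<n. \<Sum>l = 0..<n. (A $$ (i, k) * u k) * (B $$ (j, l) * v l))"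
    using B ij by (intro sum.cong) auto
  also have "\<dots> = dyad n (mult_fun n A u) (mult_fun n B v) $$ (i, j)"
    using ij by (simp add: mult_fun_def sum_product)
  finally show "(A * dyad n u v * transpose_mat B) $$ (i, j) = dyad n (mult_fun n A u) (mult_fun n B v) $$ (i, j)" .
qed (use A B in auto)

text \<open>The image of a matrix unit off the cross stays of rank at most one after adding the
  fixed unit in its row or the one in its column, so the unit is mapped to a multiple
  \<open>l\<close> of itself. The dyad of \<open>std i + std 0\<close> and
  \<open>std j + std 0\<close> then forces \<open>l = 1\<close>.\<close>

lemma preserver_fixing_cross:
  assumes k: "rank_preserver n k" and n: "0 < n"
    and c: "\<And>x. k (dyad n x (std 0)) = dyad n x (std 0)" and r: "\<And>x. k (dyad n (std 0) x) = dyad n (std 0) x"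
    and M: "M \<in> carrier_mat n n"
  shows "k M = M"
proof -
  have props: "\<And>X. X \<in> carrier_mat n n \<Longrightarrow> k X \<in> carrier_mat n n"
    "\<And>X Y. X \<in> carrier_mat n n \<Longrightarrow> Y \<in> carrier_mat n n \<Longrightarrow> k (X + Y) = k X + k Y"
    "\<And>X c. X \<in> carrier_mat n n \<Longrightarrow> k (c \<cdot>\<^sub>m X) = c \<cdot>\<^sub>m k X"
    "\<And>X. X \<in> carrier_mat n n \<Longrightarrow> rank_le_1 n X \<Longrightarrow> rank_le_1 n (k X)"
    using k by (auto simp: rank_preserver_def)
  have units: "k (unit_mat n i j) = unit_mat n i j" if ij: "i < n" "j < n" for i j
  proof (cases "i = 0 \<or> j = 0")
    case True
    then show ?thesis using c[of "std i"] r[of "std j"] by (auto simp: dyad_std)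
  next
    case False
    have "rank_le_1 n (k (unit_mat n i j))"
      by (rule props(4)) (auto simp: dyad_std[symmetric] rank_le_1_def)
    then obtain u v where uv: "k (unit_mat n i j) = dyad n u v" by (auto simp: rank_le_1_def)
    have "unit_mat n i j \<noteq> 0\<^sub>m n n"
    proof
      assume "unit_mat n i j = 0\<^sub>m n n"
      then have "unit_mat n i j $$ (i, j) = 0\<^sub>m n n $$ (i, j)" by simp
      with ij show False by simp
    qed
    then have nz: "dyad n u v \<noteq> 0\<^sub>m n n"
      using k uv by (auto simp: rank_preserver_def)
    have sum: "rank_le_1 n (k (dyad n x y) + k (dyad n x' y'))" if "x = x' \<or> y = y'" for x y x' y'
    proof -
      have "k (dyad n x y) + k (dyad n x' y') = k (dyad n x y + dyad n x' y')" by (simp add: props(2))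
      moreover have "\<exists>p q. dyad n x y + dyad n x' y' = dyad n p q"
        using that
      proof
        assume "x = x'"
        then have "dyad n x y + dyad n x' y' = dyad n x (\<lambda>i. y i + y' i)" by (intro eq_matI) (auto simp: algebra_simps)
        then show ?thesis by blast
      next
        assume "y = y'"
        then have "dyad n x y + dyad n x' y' = dyad n (\<lambda>i. x i + x' i) y" by (intro eq_matI) (auto simp: algebra_simps)
        then show ?thesis by blast
      qed
      ultimately show ?thesis using props(4) by (metis add_carrier_mat dyad_carrier rank_le_1_def)
    qed
    have uvd: "k (dyad n (std i) (std j)) = dyad n u v" using uv by (simp add: dyad_std)
    have 1: "parallel n u (std i) \<or> parallel n v (std 0)"
      using sum[of "std i" "std i" "std j" "std 0"] by (intro dyad_sum_rank_le_1) (simp add: uvd c)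
    have 2: "parallel n u (std 0) \<or> parallel n v (std j)"
      using sum[of "std i" "std 0" "std j" "std j"] by (intro dyad_sum_rank_le_1) (simp add: uvd r)
    have par: "w a = 0" if "parallel n w (std b)" "b < n" "a < n" "a \<noteq> b" for w a b
    proof -
      have "w a * std b b = w b * std b a" using that by (auto simp: parallel_def)
      then show ?thesis using that by (simp add: std_def)
    qed
    obtain p q where pq: "p < n" "u p \<noteq> 0" "q < n" "v q \<noteq> 0" by (rule dyad_nonzero_factors[OF nz])
    have nu: "\<not> (parallel n u (std i) \<and> parallel n u (std 0))"
      using par[of u i p] par[of u 0 p] ij n pq False by auto
    have nv: "\<not> (parallel n v (std j) \<and> parallel n v (std 0))"
      using par[of v j q] par[of v 0 q] ij n pq False by auto
    \<comment> \<open>With both factors along \<open>std 0\<close>, the unit at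
      \<open>(i, j)\<close> would have the same image as a multiple of the fixed unit at
      \<open>(0, 0)\<close>.\<close>
    have n00: "\<not> (parallel n u (std 0) \<and> parallel n v (std 0))"
    proof
      assume p0: "parallel n u (std 0) \<and> parallel n v (std 0)"
      have "dyad n u v = (u 0 * v 0) \<cdot>\<^sub>m dyad n (std 0) (std 0)"
        using par[of u 0] par[of v 0] p0 n by (intro eq_matI) (auto simp: std_def)
      also have "\<dots> = k ((u 0 * v 0) \<cdot>\<^sub>m dyad n (std 0) (std 0))" by (simp add: props(3) c)
      finally have "k (unit_mat n i j) = k ((u 0 * v 0) \<cdot>\<^sub>m dyad n (std 0) (std 0))" using uv by simp
      then have eq: "unit_mat n i j = (u 0 * v 0) \<cdot>\<^sub>m dyad n (std 0) (std 0)"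
        by (rule rank_preserver_inj[OF k, rotated 2]) simp_all
      have "1 = unit_mat n i j $$ (i, j)" using ij by simp
      also have "\<dots> = 0" unfolding eq using ij False by (simp add: std_def)
      finally show False by simp
    qed
    from 1 2 nu nv n00 have p: "parallel n u (std i)" "parallel n v (std j)" by blast+
    define l where "l = u i * v j"
    have ul: "dyad n u v = l \<cdot>\<^sub>m unit_mat n i j"
      using par[OF p(1) ij(1)] par[OF p(2) ij(2)] by (intro eq_matI) (auto simp: l_def)
    let ?x = "\<lambda>a. std i a + std 0 a" and ?y = "\<lambda>a. std j a + std 0 a"
    have "dyad n ?x ?y = unit_mat n i j + (dyad n (std i) (std 0) + dyad n (std 0) ?y)"
      by (intro eq_matI) (auto simp: std_def)
    then have "k (dyad n ?x ?y) = l \<cdot>\<^sub>m unit_mat n i j + (dyad n (std i) (std 0) + dyad n (std 0) ?y)"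
      by (simp add: props(2) c r uv ul)
    then have "rank_le_1 n (l \<cdot>\<^sub>m unit_mat n i j + (dyad n (std i) (std 0) + dyad n (std 0) ?y))"
      using props(4)[of "dyad n ?x ?y"] by (auto simp: rank_le_1_def)
    from rank_le_1_minor[OF this ij n n] have "l = 1"
      using ij n False by (simp add: std_def)
    then have "l \<cdot>\<^sub>m unit_mat n i j = unit_mat n i j" by (intro eq_matI) auto
    then show ?thesis using uv ul by simp
  qed
  show ?thesis
  proof (rule eq_matI)
    fix a b assume "a < dim_row M" "b < dim_col M"
    then have ab: "a < n" "b < n" using M by auto
    have "k M $$ (a, b) = (\<Sum>i = 0..<n. \<Sum>j = 0..<n. M $$ (i, j) * k (unit_mat n i j) $$ (a, b))"
    proof (rule linear_functional_expand[OF _ _ M])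
      fix X Y :: "complex mat" assume XY: "X \<in> carrier_mat n n" "Y \<in> carrier_mat n n"
      show "k (X + Y) $$ (a, b) = k X $$ (a, b) + k Y $$ (a, b)"
        using props(1,2) XY ab by (metis carrier_matD index_add_mat(1))
    next
      fix d and X :: "complex mat" assume X: "X \<in> carrier_mat n n"
      show "k (d \<cdot>\<^sub>m X) $$ (a, b) = d * k X $$ (a, b)"
        using props(1)[OF X] props(3)[OF X, of d] ab by simp
    qed
    also have "\<dots> = (\<Sum>i = 0..<n. if i = a then M $$ (i, b) else 0)"
    proof (rule sum.cong)
      fix i assume i: "i \<in> {0..<n}"
      have "(\<Sum>j = 0..<n. M $$ (i, j) * k (unit_mat n i j) $$ (a, b)) = (\<Sum>j = 0..<n. if j = b then if i = a then M $$ (i, j) else 0 else 0)"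
        using i ab by (intro sum.cong) (auto simp: units)
      then show "(\<Sum>j = 0..<n. M $$ (i, j) * k (unit_mat n i j) $$ (a, b)) = (if i = a then M $$ (i, b) else 0)" using ab by simp
    qed simp
    finally show "k M $$ (a, b) = M $$ (a, b)" using ab by simp
  qed (use M props(1)[OF M] in auto)
qed

text \<open>\<open>P\<close> is read off the first column and \<open>Q\<close> off the first row;
  undoing both leaves a preserver that fixes the cross. The image of the unit at
  \<open>(0, 0)\<close> lies in both families, which makes the two normalisations agree.\<close>

lemma column_preserver_form:
  assumes h: "rank_preserver n h" and n: "2 \<le> n"
    and cols: "\<And>x. \<exists>p. h (dyad n x (std 0)) = dyad n p b" and h0: "h (dyad n (std 0) (std 0)) = dyad n a b"
  shows "\<exists>P Q. P \<in> carrier_mat n n \<and> Q \<in> carrier_mat n n \<and> det P \<noteq> 0 \<and> det Q \<noteq> 0 \<and>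
    (\<forall>X \<in> carrier_mat n n. h X = P * X * Q)"
proof -
  note hp = rank_preserverD[OF h n] and hd = rank_preserver_dyad[OF h n] and hi = rank_preserver_dyad_inj[OF h n]
  have nz: "dyad n a b \<noteq> 0\<^sub>m n n"
  proof
    assume "dyad n a b = 0\<^sub>m n n"
    then have "\<forall>i < n. std 0 i = 0" using hi(1)[of "std 0"] h0 by simp
    then show False using n by (auto simp: std_def dest!: spec[of _ 0])
  qed
  obtain i0 j0 where ij0: "i0 < n" "a i0 \<noteq> 0" "j0 < n" "b j0 \<noteq> 0" by (rule dyad_nonzero_factors[OF nz])
  have "(\<forall>x. \<exists>p. h (dyad n (std 0) x) = dyad n p b) \<or> (\<forall>x. \<exists>q. h (dyad n (std 0) x) = dyad n a q)"
    by (rule rank_le_1_family[of n "\<lambda>x. h (dyad n (std 0) x)", OF hd(5) hd(2) h0 nz])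
  moreover have "\<not> (\<forall>x. \<exists>p. h (dyad n (std 0) x) = dyad n p b)"
    using not_both_columns[OF h n cols] by blast
  ultimately have rows: "\<exists>q. h (dyad n (std 0) x) = dyad n a q" for x by blast
  obtain P where P: "P \<in> carrier_mat n n" "det P \<noteq> 0"
    "\<And>x. h (dyad n x (std 0)) = dyad n (mult_fun n P x) b"
    by (rule columns_matrix[OF h n cols]) (auto simp: mult_fun_def)
  have tr: "transpose_mat (dyad n u v) = dyad n v u" for u v by (intro eq_matI) auto
  obtain Q where Q: "Q \<in> carrier_mat n n" "det Q \<noteq> 0"
    "\<And>x. transpose_mat (h (dyad n (std 0) x)) = dyad n (\<lambda>i. \<Sum>j = 0..<n. Q $$ (i, j) * x j) a"
  proof (rule dyad_family_matrix[of "\<lambda>x. transpose_mat (h (dyad n (std 0) x))" n a])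
    show "transpose_mat (h (dyad n (std 0) (\<lambda>i. x i + y i))) = transpose_mat (h (dyad n (std 0) x)) + transpose_mat (h (dyad n (std 0) y))" for x y
      unfolding hd(2) by (rule transpose_add[OF hp(1)[OF dyad_carrier] hp(1)[OF dyad_carrier]])
    show "transpose_mat (h (dyad n (std 0) (\<lambda>i. c * x i))) = c \<cdot>\<^sub>m transpose_mat (h (dyad n (std 0) x))" for c x
      unfolding hd(4) by (intro eq_matI) auto
    show "transpose_mat (h (dyad n (std 0) x)) = transpose_mat (h (dyad n (std 0) y))" if "\<And>i. i < n \<Longrightarrow> x i = y i" for x y
      using that by (intro arg_cong[where f = "\<lambda>M. transpose_mat (h M)"] dyad_cong) auto
    show "transpose_mat (h (dyad n (std 0) x)) \<in> carrier_mat n n" for x using hp(1)[OF dyad_carrier] by simp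
    show "\<forall>i < n. x i = 0" if z: "transpose_mat (h (dyad n (std 0) x)) = 0\<^sub>m n n" for x
    proof (rule hi(2))
      have "h (dyad n (std 0) x) = transpose_mat (0\<^sub>m n n)" using arg_cong[OF z, of transpose_mat] by simp
      then show "h (dyad n (std 0) x) = 0\<^sub>m n n" by (simp add: zero_transpose_mat)
    qed
    show "\<exists>p. transpose_mat (h (dyad n (std 0) x)) = dyad n p a" for x using rows[of x] tr by metis
  qed blast
  have Qx: "h (dyad n (std 0) x) = dyad n a (mult_fun n Q x)" for x
    using arg_cong[OF Q(3)[of x], of transpose_mat] by (simp add: tr mult_fun_def)
  obtain P' where P': "P' \<in> carrier_mat n n" "P * P' = 1\<^sub>m n" "P' * P = 1\<^sub>m n" "det P' \<noteq> 0"
    by (rule det_nonzero_inverse[OF P(1,2)])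
  obtain Q' where Q': "Q' \<in> carrier_mat n n" "Q * Q' = 1\<^sub>m n" "Q' * Q = 1\<^sub>m n" "det Q' \<noteq> 0"
    by (rule det_nonzero_inverse[OF Q(1,2)])
  have bQ: "b i = mult_fun n Q (std 0) i" if "i < n" for i
  proof -
    have "dyad n a b = dyad n a (mult_fun n Q (std 0))" using h0 Qx by simp
    then have "dyad n a b $$ (i0, i) = dyad n a (mult_fun n Q (std 0)) $$ (i0, i)" by simp
    then show ?thesis using ij0 that by simp
  qed
  have aP: "a i = mult_fun n P (std 0) i" if "i < n" for i
  proof -
    have "dyad n a b = dyad n (mult_fun n P (std 0)) b" using h0 P(3) by simp
    then have "dyad n a b $$ (i, j0) = dyad n (mult_fun n P (std 0)) b $$ (i, j0)" by simp
    then show ?thesis using ij0 that by simp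
  qed
  have mf_cong: "mult_fun n A u = mult_fun n A v" if "\<And>i. i < n \<Longrightarrow> u i = v i" for A u v
    using that by (auto simp: mult_fun_def)
  have Q'b: "mult_fun n Q' b i = std 0 i" if "i < n" for i
    using mf_cong[of b "mult_fun n Q (std 0)" Q'] bQ mult_fun_inverse[OF Q'(1) Q(1) Q'(3) that] by simp
  have P'a: "mult_fun n P' a i = std 0 i" if "i < n" for i
    using mf_cong[of a "mult_fun n P (std 0)" P'] aP mult_fun_inverse[OF P'(1) P(1) P'(3) that] by simp
  define k where "k X = P' * h X * transpose_mat Q'" for X
  have tQ': "transpose_mat Q' \<in> carrier_mat n n" and tQ: "transpose_mat Q \<in> carrier_mat n n" using Q Q' by simp_all
  note assoc = assoc_mult_mat[of _ n n _ n _ n]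
  have tQQ: "transpose_mat Q' * transpose_mat Q = 1\<^sub>m n"
    using transpose_mult[OF Q(1) Q'(1)] Q'(2) by (simp add: transpose_one)
  have bk: "P * k X * transpose_mat Q = h X" if X: "X \<in> carrier_mat n n" for X
  proof -
    have "P * k X * transpose_mat Q = (P * P') * h X * (transpose_mat Q' * transpose_mat Q)"
      unfolding k_def using P(1) P'(1) tQ tQ' hp(1)[OF X] by (simp add: assoc)
    then show ?thesis unfolding P'(2) tQQ using hp(1)[OF X] by simp
  qed
  have "rank_preserver n k"
    unfolding rank_preserver_def
  proof (intro conjI ballI allI impI)
    fix X Y :: "complex mat" and c :: complex
    assume X: "X \<in> carrier_mat n n"
    show "k X \<in> carrier_mat n n" using P'(1) tQ' hp(1)[OF X] by (simp add: k_def)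
    show "k (c \<cdot>\<^sub>m X) = c \<cdot>\<^sub>m k X"
      using P'(1) tQ' hp(1)[OF X]
      by (simp add: k_def hp(3)[OF X] mult_smult_distrib[of _ n n] mult_smult_assoc_mat[of _ n n _ n])
    show "X = 0\<^sub>m n n" if z: "k X = 0\<^sub>m n n"
    proof -
      have "h X = P * 0\<^sub>m n n * transpose_mat Q" using bk[OF X] z by simp
      then have "h X = 0\<^sub>m n n" using P(1) tQ by simp
      then show ?thesis by (rule hp(4)[OF X])
    qed
    show "rank_le_1 n (k X)" if r: "rank_le_1 n X"
    proof -
      obtain u v where "h X = dyad n u v" using hp(5)[OF X r] by (auto simp: rank_le_1_def)
      then show ?thesis using sandwich_dyad[OF P'(1) Q'(1)] by (auto simp: k_def rank_le_1_def)
    qed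
    assume Y: "Y \<in> carrier_mat n n"
    show "k (X + Y) = k X + k Y"
      using P'(1) tQ' hp(1)[OF X] hp(1)[OF Y]
      by (simp add: k_def hp(2)[OF X Y] mult_add_distrib_mat[of _ n n] add_mult_distrib_mat[of _ n n])
  qed
  moreover have "k (dyad n x (std 0)) = dyad n x (std 0)" for x
    unfolding k_def P(3) sandwich_dyad[OF P'(1) Q'(1)]
    by (rule dyad_cong) (auto simp: Q'b mult_fun_inverse[OF P'(1) P(1) P'(3)])
  moreover have "k (dyad n (std 0) x) = dyad n (std 0) x" for x
    unfolding k_def Qx sandwich_dyad[OF P'(1) Q'(1)]
    by (rule dyad_cong) (auto simp: P'a mult_fun_inverse[OF Q'(1) Q(1) Q'(3)])
  ultimately have "k X = X" if "X \<in> carrier_mat n n" for X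
    using preserver_fixing_cross[of n k X] n that by simp
  then have "\<forall>X \<in> carrier_mat n n. h X = P * X * transpose_mat Q" using bk by metis
  moreover have "det (transpose_mat Q) \<noteq> 0" using Q(2) det_transpose[OF Q(1)] by simp
  ultimately show ?thesis using P(1,2) tQ by blast
qed

text \<open>If columns do not go to columns they go to rows, and then rows cannot go to rows as well
  (\<open>not_both_columns\<close> for the transposed map). So rows go to columns, and precomposing
  with the transposition reduces to \<open>column_preserver_form\<close>.\<close>

theorem rank_preserver_form:
  assumes h: "rank_preserver n h" and n: "2 \<le> n"
  shows "\<exists>P Q. P \<in> carrier_mat n n \<and> Q \<in> carrier_mat n n \<and> det P \<noteq> 0 \<and> det Q \<noteq> 0 \<and>
    ((\<forall>X \<in> carrier_mat n n. h X = P * X * Q) \<or> (\<forall>X \<in> carrier_mat n n. h X = P * transpose_mat X * Q))"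
proof -
  note hp = rank_preserverD[OF h n] and hd = rank_preserver_dyad[OF h n] and hi = rank_preserver_dyad_inj[OF h n]
  have tr: "transpose_mat (dyad n u v) = dyad n v u" for u v by (intro eq_matI) auto
  obtain a b where h0: "h (dyad n (std 0) (std 0)) = dyad n a b" using hd(5)[of "std 0" "std 0"] unfolding rank_le_1_def by blast
  have nz: "dyad n a b \<noteq> 0\<^sub>m n n"
  proof
    assume "dyad n a b = 0\<^sub>m n n"
    then have "\<forall>i < n. std 0 i = 0" using hi(1)[of "std 0"] h0 by simp
    then show False using n by (auto simp: std_def dest!: spec[of _ 0])
  qed
  have c: "(\<forall>x. \<exists>p. h (dyad n x (std 0)) = dyad n p b) \<or> (\<forall>x. \<exists>q. h (dyad n x (std 0)) = dyad n a q)"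
    by (rule rank_le_1_family[of n "\<lambda>x. h (dyad n x (std 0))", OF hd(5) hd(1) h0 nz])
  have r: "(\<forall>x. \<exists>p. h (dyad n (std 0) x) = dyad n p b) \<or> (\<forall>x. \<exists>q. h (dyad n (std 0) x) = dyad n a q)"
    by (rule rank_le_1_family[of n "\<lambda>x. h (dyad n (std 0) x)", OF hd(5) hd(2) h0 nz])
  have rt: "rank_le_1 n (transpose_mat X)" if "rank_le_1 n X" for X
    using that tr by (auto simp: rank_le_1_def)
  show ?thesis
  proof (cases "\<forall>x. \<exists>p. h (dyad n x (std 0)) = dyad n p b")
    case True
    then show ?thesis using column_preserver_form[OF h n _ h0] by blast
  next
    case False
    with c have rows: "\<forall>x. \<exists>q. h (dyad n x (std 0)) = dyad n a q" by blast
    define h3 where "h3 X = transpose_mat (h X)" for X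
    have h3: "rank_preserver n h3"
      unfolding rank_preserver_def
    proof (intro conjI ballI allI impI)
      fix X Y :: "complex mat" and c :: complex
      assume X: "X \<in> carrier_mat n n"
      show "h3 X \<in> carrier_mat n n" using hp(1)[OF X] by (simp add: h3_def)
      show "h3 (c \<cdot>\<^sub>m X) = c \<cdot>\<^sub>m h3 X" unfolding h3_def hp(3)[OF X] by (intro eq_matI) auto
      show "X = 0\<^sub>m n n" if z: "h3 X = 0\<^sub>m n n"
      proof (rule hp(4)[OF X])
        have "h X = transpose_mat (0\<^sub>m n n)" using arg_cong[OF z, of transpose_mat] by (simp add: h3_def)
        then show "h X = 0\<^sub>m n n" by (simp add: zero_transpose_mat)
      qed
      show "rank_le_1 n (h3 X)" if "rank_le_1 n X" using rt[OF hp(5)[OF X that]] by (simp add: h3_def)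
      assume Y: "Y \<in> carrier_mat n n"
      show "h3 (X + Y) = h3 X + h3 Y"
        unfolding h3_def hp(2)[OF X Y] by (rule transpose_add[OF hp(1)[OF X] hp(1)[OF Y]])
    qed
    have c3: "\<exists>p. h3 (dyad n x (std 0)) = dyad n p a" for x
      using rows tr unfolding h3_def by metis
    have "\<not> (\<forall>x. \<exists>q. h (dyad n (std 0) x) = dyad n a q)"
    proof
      assume "\<forall>x. \<exists>q. h (dyad n (std 0) x) = dyad n a q"
      then have "\<exists>p. h3 (dyad n (std 0) (std 1)) = dyad n p a" using tr unfolding h3_def by metis
      with not_both_columns[OF h3 n c3] show False by blast
    qed
    with r have cols: "\<exists>p. h (dyad n (std 0) x) = dyad n p b" for x by blast
    define h2 where "h2 X = h (transpose_mat X)" for X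
    have h2: "rank_preserver n h2"
      unfolding rank_preserver_def
    proof (intro conjI ballI allI impI)
      fix X Y :: "complex mat" and c :: complex
      assume X: "X \<in> carrier_mat n n"
      then have tX: "transpose_mat X \<in> carrier_mat n n" by simp
      show "h2 X \<in> carrier_mat n n" using hp(1)[OF tX] by (simp add: h2_def)
      have "transpose_mat (c \<cdot>\<^sub>m X) = c \<cdot>\<^sub>m transpose_mat X" by (intro eq_matI) auto
      then show "h2 (c \<cdot>\<^sub>m X) = c \<cdot>\<^sub>m h2 X" unfolding h2_def using hp(3)[OF tX] by simp
      show "X = 0\<^sub>m n n" if z: "h2 X = 0\<^sub>m n n"
      proof -
        have "transpose_mat X = 0\<^sub>m n n" using hp(4)[OF tX] z by (simp add: h2_def)
        from arg_cong[OF this, of transpose_mat] show ?thesis by (simp add: zero_transpose_mat)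
      qed
      show "rank_le_1 n (h2 X)" if "rank_le_1 n X" using hp(5)[OF tX rt[OF that]] by (simp add: h2_def)
      assume Y: "Y \<in> carrier_mat n n"
      show "h2 (X + Y) = h2 X + h2 Y"
        unfolding h2_def transpose_add[OF X Y] by (rule hp(2)[OF tX]) (use Y in simp)
    qed
    have "\<exists>P Q. P \<in> carrier_mat n n \<and> Q \<in> carrier_mat n n \<and> det P \<noteq> 0 \<and> det Q \<noteq> 0 \<and>
      (\<forall>X \<in> carrier_mat n n. h2 X = P * X * Q)"
      by (rule column_preserver_form[OF h2 n, of b a]) (use cols h0 in \<open>auto simp: h2_def tr\<close>)
    then obtain P Q where PQ: "P \<in> carrier_mat n n" "Q \<in> carrier_mat n n" "det P \<noteq> 0" "det Q \<noteq> 0"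
      "\<And>X. X \<in> carrier_mat n n \<Longrightarrow> h2 X = P * X * Q" by blast
    have "h X = P * transpose_mat X * Q" if "X \<in> carrier_mat n n" for X
      using PQ(5)[of "transpose_mat X"] that by (simp add: h2_def)
    with PQ(1-4) show ?thesis by blast
  qed
qed

text \<open>Frobenius' theorem. The determinant is affine along all lines of direction
  \<open>X\<close> exactly if \<open>X\<close> has rank at most one, so a linear bijection that
  preserves the determinant up to a factor preserves such matrices.\<close>

theorem det_preserver_form:
  assumes n: "2 \<le> n" and bij: "bij_betw h (carrier_mat n n) (carrier_mat n n)"
    and add: "\<And>X Y. X \<in> carrier_mat n n \<Longrightarrow> Y \<in> carrier_mat n n \<Longrightarrow> h (X + Y) = h X + h Y"
    and smult: "\<And>c X. X \<in> carrier_mat n n \<Longrightarrow> h (c \<cdot>\<^sub>m X) = c \<cdot>\<^sub>m h X"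
    and det: "\<And>X. X \<in> carrier_mat n n \<Longrightarrow> det (h X) = c * (det X :: complex)"
  shows "\<exists>P Q. P \<in> carrier_mat n n \<and> Q \<in> carrier_mat n n \<and> det P \<noteq> 0 \<and> det Q \<noteq> 0 \<and>
    ((\<forall>X \<in> carrier_mat n n. h X = P * X * Q) \<or> (\<forall>X \<in> carrier_mat n n. h X = P * transpose_mat X * Q))"
proof (rule rank_preserver_form[OF _ n])
  have car: "h X \<in> carrier_mat n n" if "X \<in> carrier_mat n n" for X using bij that by (auto simp: bij_betw_def)
  show "rank_preserver n h"
    unfolding rank_preserver_def
  proof (intro conjI ballI allI impI)
    fix X :: "complex mat" assume X: "X \<in> carrier_mat n n"
    show "X = 0\<^sub>m n n" if z: "h X = 0\<^sub>m n n"
    proof -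
      have "h (0\<^sub>m n n) = h (0 \<cdot>\<^sub>m X)" using X by (intro arg_cong[where f = h] eq_matI) auto
      also have "\<dots> = 0\<^sub>m n n" unfolding smult[OF X] using car[OF X] by (intro eq_matI) auto
      finally show ?thesis using bij X z by (metis bij_betw_def inj_onD zero_carrier_mat)
    qed
    show "rank_le_1 n (h X)" if r: "rank_le_1 n X"
      unfolding rank_le_1_iff_affine[OF car[OF X]]
    proof
      fix Z :: "complex mat" assume "Z \<in> carrier_mat n n"
      then obtain W where W: "W \<in> carrier_mat n n" "Z = h W" using bij by (auto simp: bij_betw_def)
      obtain \<beta> where \<beta>: "\<And>s. det (W + s \<cdot>\<^sub>m X) = det W + s * \<beta>"
        using r W(1) unfolding rank_le_1_iff_affine[OF X] by blast
      have "det (Z + s \<cdot>\<^sub>m h X) = det Z + s * (c * \<beta>)" for s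
      proof -
        have "Z + s \<cdot>\<^sub>m h X = h (W + s \<cdot>\<^sub>m X)" using X W by (simp add: add smult)
        then show ?thesis using X W by (simp add: det \<beta> algebra_simps)
      qed
      then show "\<exists>\<beta>. \<forall>s. det (Z + s \<cdot>\<^sub>m h X) = det Z + s * \<beta>" by blast
    qed
  qed (use car add smult in auto)
qed

section \<open>The normalizer of the torus\<close>

lemma mat_linear_iff:
  "mat_linear m n A \<longleftrightarrow> (\<forall>X \<in> carrier_mat m m. A X \<in> carrier_mat n n) \<and>
     (\<forall>X \<in> carrier_mat m m. \<forall>Y \<in> carrier_mat m m. A (X + Y) = A X + A Y) \<and>
     (\<forall>c. \<forall>X \<in> carrier_mat m m. A (c \<cdot>\<^sub>m X) = c \<cdot>\<^sub>m A X)"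
proof -
  have "mat_linear m n A \<longleftrightarrow>
    A \<in> LinearCombinations.module_hom class_ring (module_mat TYPE(complex) m m) (module_mat TYPE(complex) n n)"
    unfolding linear_map_def mod_hom_def mod_hom_axioms_def
    using matrix_vs[of m m, where 'a = complex] matrix_vs[of n n, where 'a = complex]
    by (auto simp: vectorspace_def)
  then show ?thesis
    unfolding LinearCombinations.module_hom_def by (auto simp: matrix_vs_simps Pi_def)
qed

text \<open>Indexed so that multiplication from the left puts row \<open>\<sigma> i\<close> of a
  matrix, scaled by \<open>d i\<close>, into row \<open>i\<close>.\<close>

definition monomial_mat :: "nat \<Rightarrow> (nat \<Rightarrow> complex) \<Rightarrow> (nat \<Rightarrow> nat) \<Rightarrow> complex mat" where
  "monomial_mat m d \<sigma> = mat m m (\<lambda>(i, j). if j = \<sigma> i then d i else 0)"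

lemma monomial_mat_carrier [simp]: "monomial_mat m d \<sigma> \<in> carrier_mat m m"
  by (simp add: monomial_mat_def)

lemma monomial_mat_index [simp]:
  "i < m \<Longrightarrow> j < m \<Longrightarrow> monomial_mat m d \<sigma> $$ (i, j) = (if j = \<sigma> i then d i else 0)"
  "dim_row (monomial_mat m d \<sigma>) = m" "dim_col (monomial_mat m d \<sigma>) = m"
  by (simp_all add: monomial_mat_def)

lemma monomial_mat_mult:
  assumes \<sigma>: "\<sigma> permutes {0..<m}" and M: "M \<in> carrier_mat m k" and ij: "i < m" "j < k"
  shows "(monomial_mat m d \<sigma> * M) $$ (i, j) = d i * M $$ (\<sigma> i, j)"
proof -
  have \<sigma>i: "\<sigma> i < m" using permutes_in_image[OF \<sigma>, of i] ij by simp
  have "(monomial_mat m d \<sigma> * M) $$ (i, j) = (\<Sum>l = 0..<m. monomial_mat m d \<sigma> $$ (i, l) * M $$ (l, j))"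
    using M ij by (simp add: scalar_prod_def monomial_mat_def)
  also have "\<dots> = (\<Sum>l = 0..<m. if l = \<sigma> i then d i * M $$ (l, j) else 0)"
    using ij by (intro sum.cong) (auto simp: monomial_mat_def)
  also have "\<dots> = d i * M $$ (\<sigma> i, j)" using \<sigma>i by simp
  finally show ?thesis .
qed

lemma monomial_mat_inverse:
  assumes \<sigma>: "\<sigma> permutes {0..<m}" and d: "\<And>i. i < m \<Longrightarrow> d i \<noteq> 0"
  obtains d' \<tau> where "\<tau> permutes {0..<m}" "\<And>i. i < m \<Longrightarrow> d' i \<noteq> 0"
    "monomial_mat m d \<sigma> * monomial_mat m d' \<tau> = 1\<^sub>m m" "monomial_mat m d' \<tau> * monomial_mat m d \<sigma> = 1\<^sub>m m"
proof (rule that)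
  let ?\<tau> = "inv_into UNIV \<sigma>"
  show \<tau>: "?\<tau> permutes {0..<m}" by (rule permutes_inv[OF \<sigma>])
  have \<tau>i: "?\<tau> i < m" if "i < m" for i using permutes_in_image[OF \<tau>, of i] that by simp
  have \<sigma>i: "\<sigma> i < m" if "i < m" for i using permutes_in_image[OF \<sigma>, of i] that by simp
  show "1 / d (?\<tau> i) \<noteq> 0" if "i < m" for i using d[OF \<tau>i[OF that]] by simp
  show "monomial_mat m d \<sigma> * monomial_mat m (\<lambda>i. 1 / d (?\<tau> i)) ?\<tau> = 1\<^sub>m m"
    by (rule eq_matI) (auto simp: monomial_mat_mult[OF \<sigma> monomial_mat_carrier] d \<sigma>i permutes_inverses[OF \<sigma>] simp del: index_mult_mat(1))
  show "monomial_mat m (\<lambda>i. 1 / d (?\<tau> i)) ?\<tau> * monomial_mat m d \<sigma> = 1\<^sub>m m"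
    by (rule eq_matI) (auto simp: monomial_mat_mult[OF \<tau> monomial_mat_carrier] d \<tau>i permutes_inverses[OF \<sigma>] simp del: index_mult_mat(1))
qed

lemma carrier_GL_group: "carrier (GL_group m) = {A \<in> carrier_mat m m. \<exists>B \<in> carrier_mat m m. B * A = 1\<^sub>m m \<and> A * B = 1\<^sub>m m}"
  by (auto simp: units_of_def Units_def ring_mat_simps)

lemma GL_group_inv:
  assumes "A \<in> carrier_mat m m" "B \<in> carrier_mat m m" "A * B = 1\<^sub>m m" "B * A = 1\<^sub>m m"
  shows "inv\<^bsub>GL_group m\<^esub> A = B"
proof -
  interpret R: ring "ring_mat TYPE(complex) m ()" by (rule ring_mat)
  have G: "group (GL_group m)" by (rule R.units_group)
  show ?thesis
  proof (rule group.inv_equality[OF G])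
    show "B \<otimes>\<^bsub>GL_group m\<^esub> A = \<one>\<^bsub>GL_group m\<^esub>" using assms by (simp add: units_of_def ring_mat_simps)
    show "A \<in> carrier (GL_group m)" "B \<in> carrier (GL_group m)" using assms by (auto simp: carrier_GL_group)
  qed
qed

lemma monomial_mat_GL:
  assumes \<sigma>: "\<sigma> permutes {0..<m}" and d: "\<And>i. i < m \<Longrightarrow> d i \<noteq> 0"
  shows "monomial_mat m d \<sigma> \<in> carrier (GL_group m)"
proof -
  obtain d' \<tau> where "monomial_mat m d \<sigma> * monomial_mat m d' \<tau> = 1\<^sub>m m" "monomial_mat m d' \<tau> * monomial_mat m d \<sigma> = 1\<^sub>m m"
    by (rule monomial_mat_inverse[OF \<sigma> d]) auto
  then show ?thesis unfolding carrier_GL_group using monomial_mat_carrier by blast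
qed

lemma torus_iff: "t \<in> torus m \<longleftrightarrow> (\<exists>d. (\<forall>i < m. d i \<noteq> 0) \<and> t = monomial_mat m d id)"
proof
  assume t: "t \<in> torus m"
  then have tc: "t \<in> carrier_mat m m" and td: "diagonal_mat t" by (auto simp: torus_def carrier_GL_group)
  obtain B where B: "B \<in> carrier_mat m m" "t * B = 1\<^sub>m m" using t by (auto simp: torus_def carrier_GL_group)
  have eq: "t = monomial_mat m (\<lambda>i. t $$ (i, i)) id"
    using tc td by (intro eq_matI) (auto simp: monomial_mat_def diagonal_mat_def)
  have "t $$ (i, i) \<noteq> 0" if "i < m" for i
  proof
    assume z: "t $$ (i, i) = 0"
    have "(t * B) $$ (i, i) = 0"
      by (subst eq, subst monomial_mat_mult[OF permutes_id B(1) that that]) (simp add: z)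
    then show False using B(2) that by simp
  qed
  then show "\<exists>d. (\<forall>i < m. d i \<noteq> 0) \<and> t = monomial_mat m d id"
    by (intro exI[of _ "\<lambda>i. t $$ (i, i)"] conjI allI impI eq)
next
  assume "\<exists>d. (\<forall>i < m. d i \<noteq> 0) \<and> t = monomial_mat m d id"
  then obtain d where d: "\<And>i. i < m \<Longrightarrow> d i \<noteq> 0" "t = monomial_mat m d id" by blast
  then show "t \<in> torus m" unfolding torus_def using monomial_mat_GL[OF permutes_id, of m d]
    by (auto simp: diagonal_mat_def monomial_mat_def)
qed

lemma normalizer_torus_iff_conj:
  "g \<in> normalizer (GL_group m) (torus m) \<longleftrightarrow>
     g \<in> carrier (GL_group m) \<and> (\<lambda>t. g * t * inv\<^bsub>GL_group m\<^esub> g) ` torus m = torus m"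
proof -
  have sub: "torus m \<subseteq> carrier (GL_group m)" by (auto simp: torus_def)
  have "(g <#\<^bsub>GL_group m\<^esub> torus m #>\<^bsub>GL_group m\<^esub> (inv\<^bsub>GL_group m\<^esub> g)) = (\<lambda>t. g * t * inv\<^bsub>GL_group m\<^esub> g) ` torus m"
    by (simp add: l_coset_def r_coset_def units_of_mult ring_mat_simps UNION_singleton_eq_range image_image)
  then show ?thesis unfolding normalizer_def stabilizer_def using sub by auto
qed

lemma monomial_conj_torus:
  assumes \<sigma>: "\<sigma> permutes {0..<m}" and d: "\<And>i. i < m \<Longrightarrow> d i \<noteq> 0"
    and inverse: "monomial_mat m d \<sigma> * B = 1\<^sub>m m" and B: "B \<in> carrier_mat m m" and t: "t \<in> torus m"
  shows "monomial_mat m d \<sigma> * t * B \<in> torus m"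
proof -
  obtain e where e: "\<And>i. i < m \<Longrightarrow> e i \<noteq> 0" "t = monomial_mat m e id" using t by (auto simp: torus_iff)
  have \<sigma>i: "\<sigma> i < m" if "i < m" for i using permutes_in_image[OF \<sigma>, of i] that by simp
  have tB: "t * B \<in> carrier_mat m m" using e(2) B by simp
  have "monomial_mat m d \<sigma> * t * B = monomial_mat m d \<sigma> * (t * B)"
    by (rule assoc_mult_mat[OF monomial_mat_carrier _ B]) (simp add: e(2))
  also have "\<dots> = monomial_mat m (\<lambda>i. e (\<sigma> i)) id"
  proof (rule eq_matI)
    fix i j assume "i < dim_row (monomial_mat m (\<lambda>i. e (\<sigma> i)) id)" "j < dim_col (monomial_mat m (\<lambda>i. e (\<sigma> i)) id)"
    then have ij: "i < m" "j < m" by (auto simp: monomial_mat_def)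
    have "d i * B $$ (\<sigma> i, j) = (1\<^sub>m m) $$ (i, j)"
      unfolding inverse[symmetric] by (rule monomial_mat_mult[OF \<sigma> B ij, symmetric])
    moreover have "(monomial_mat m d \<sigma> * (t * B)) $$ (i, j) = d i * (e (\<sigma> i) * B $$ (\<sigma> i, j))"
      unfolding monomial_mat_mult[OF \<sigma> tB ij] unfolding e(2) by (subst monomial_mat_mult[OF permutes_id B \<sigma>i[OF ij(1)] ij(2)]) (simp only: id_apply)
    ultimately have "(monomial_mat m d \<sigma> * (t * B)) $$ (i, j) = e (\<sigma> i) * (1\<^sub>m m) $$ (i, j)" by (simp add: algebra_simps)
    then show "(monomial_mat m d \<sigma> * (t * B)) $$ (i, j) = monomial_mat m (\<lambda>i. e (\<sigma> i)) id $$ (i, j)"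
      using ij by (auto simp del: index_mult_mat(1))
  qed (use B in \<open>auto simp: monomial_mat_def\<close>)
  finally show ?thesis unfolding torus_iff by (intro exI[of _ "\<lambda>i. e (\<sigma> i)"] conjI refl) (use e(1) \<sigma>i in simp)
qed

lemma monomial_in_normalizer:
  assumes \<sigma>: "\<sigma> permutes {0..<m}" and d: "\<And>i. i < m \<Longrightarrow> d i \<noteq> 0"
  shows "monomial_mat m d \<sigma> \<in> normalizer (GL_group m) (torus m)"
proof -
  let ?g = "monomial_mat m d \<sigma>"
  obtain d' \<tau> where \<tau>: "\<tau> permutes {0..<m}" and d': "\<And>i. i < m \<Longrightarrow> d' i \<noteq> 0"
    and gg: "?g * monomial_mat m d' \<tau> = 1\<^sub>m m" "monomial_mat m d' \<tau> * ?g = 1\<^sub>m m"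
    by (rule monomial_mat_inverse[OF \<sigma> d]) auto
  let ?h = "monomial_mat m d' \<tau>"
  have inv: "inv\<^bsub>GL_group m\<^esub> ?g = ?h" by (rule GL_group_inv) (simp_all add: gg)
  have "t \<in> (\<lambda>t. ?g * t * ?h) ` torus m" if t: "t \<in> torus m" for t
  proof
    show "?h * t * ?g \<in> torus m" by (rule monomial_conj_torus[OF \<tau> d' gg(2) _ t]) simp_all
    have tc: "t \<in> carrier_mat m m" using t by (auto simp: torus_def carrier_GL_group)
    have "?g * (?h * t * ?g) * ?h = (?g * ?h) * t * (?g * ?h)"
      using tc by (simp add: assoc_mult_mat[of _ m m _ m _ m])
    then show "t = ?g * (?h * t * ?g) * ?h" using tc gg by simp
  qed
  moreover have "?g * t * ?h \<in> torus m" if t: "t \<in> torus m" for t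
    by (rule monomial_conj_torus[OF \<sigma> d gg(1) _ t]) simp_all
  ultimately show ?thesis
    unfolding normalizer_torus_iff_conj inv using monomial_mat_GL[of \<sigma> m d, OF \<sigma>] d by blast
qed

text \<open>Conjugating a diagonal matrix with distinct entries into the torus forces every row of
  \<open>g\<close> to have at most one nonzero entry.\<close>

lemma normalizer_imp_monomial:
  assumes "g \<in> normalizer (GL_group m) (torus m)"
  obtains d \<sigma> where "\<sigma> permutes {0..<m}" "\<And>i. i < m \<Longrightarrow> d i \<noteq> 0" "g = monomial_mat m d \<sigma>"
proof -
  have g: "g \<in> carrier (GL_group m)" and conj: "(\<lambda>t. g * t * inv\<^bsub>GL_group m\<^esub> g) ` torus m = torus m"
    using assms by (auto simp: normalizer_torus_iff_conj)
  obtain h where gc: "g \<in> carrier_mat m m" and h: "h \<in> carrier_mat m m" "h * g = 1\<^sub>m m" "g * h = 1\<^sub>m m"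
    using g by (auto simp: carrier_GL_group)
  have inv: "inv\<^bsub>GL_group m\<^esub> g = h" by (rule GL_group_inv[OF gc h(1,3,2)])
  let ?t = "monomial_mat m (\<lambda>i. of_nat (Suc i)) id"
  have "?t \<in> torus m" unfolding torus_iff by (intro exI[of _ "\<lambda>i. of_nat (Suc i)"]) (simp del: of_nat_Suc)
  then have "g * ?t * h \<in> torus m" using conj inv by blast
  then obtain e where e: "g * ?t * h = monomial_mat m e id" by (auto simp: torus_iff)
  have gt: "g * ?t = monomial_mat m e id * g"
  proof -
    have "monomial_mat m e id * g = g * ?t * (h * g)"
      unfolding e[symmetric] using gc h(1) by (simp add: assoc_mult_mat[of _ m m _ m _ m])
    then show ?thesis using h(2) gc right_mult_one_mat[of "g * ?t" m m] by simp
  qed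
  have row: "g $$ (i, j) * of_nat (Suc j) = e i * g $$ (i, j)" if ij: "i < m" "j < m" for i j
  proof -
    have "(g * ?t) $$ (i, j) = (\<Sum>k = 0..<m. g $$ (i, k) * ?t $$ (k, j))"
      by (rule mult_mat_index[OF gc monomial_mat_carrier ij])
    also have "\<dots> = (\<Sum>k = 0..<m. if k = j then g $$ (i, j) * of_nat (Suc j) else 0)"
      using ij by (intro sum.cong) (auto simp: monomial_mat_def)
    also have "\<dots> = g $$ (i, j) * of_nat (Suc j)" using ij by simp
    finally show ?thesis unfolding gt using monomial_mat_mult[OF permutes_id gc ij, of e] unfolding id_apply by (rule trans[OF sym])
  qed
  have uniq: "j = k" if "i < m" "j < m" "k < m" "g $$ (i, j) \<noteq> 0" "g $$ (i, k) \<noteq> 0" for i j k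
  proof -
    have "of_nat (Suc j) = e i" "of_nat (Suc k) = e i" using row[of i j] row[of i k] that by (simp_all del: of_nat_Suc)
    then have "(of_nat (Suc j) :: complex) = of_nat (Suc k)" by simp
    then show ?thesis unfolding of_nat_eq_iff by simp
  qed
  have gh: "(\<Sum>j = 0..<m. g $$ (i, j) * h $$ (j, k)) = (if i = k then 1 else 0)" if "i < m" "k < m" for i k
    using mult_mat_index[OF gc h(1) that] h(3) that by simp
  have ex: "\<exists>j < m. g $$ (i, j) \<noteq> 0" if i: "i < m" for i
  proof (rule ccontr)
    assume "\<not> (\<exists>j < m. g $$ (i, j) \<noteq> 0)"
    then have "(\<Sum>j = 0..<m. g $$ (i, j) * h $$ (j, i)) = 0" by (intro sum.neutral) auto
    then show False using gh[OF i i] by simp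
  qed
  define \<sigma> where "\<sigma> i = (if i < m then SOME j. j < m \<and> g $$ (i, j) \<noteq> 0 else i)" for i
  have \<sigma>: "\<sigma> i < m \<and> g $$ (i, \<sigma> i) \<noteq> 0" if "i < m" for i
    unfolding \<sigma>_def using someI_ex[OF ex[OF that]] that by simp
  have prod: "g $$ (i, \<sigma> i) * h $$ (\<sigma> i, k) = (if i = k then 1 else 0)" if ik: "i < m" "k < m" for i k
  proof -
    have "(\<Sum>j = 0..<m. g $$ (i, j) * h $$ (j, k)) = (\<Sum>j = 0..<m. if j = \<sigma> i then g $$ (i, \<sigma> i) * h $$ (\<sigma> i, k) else 0)"
    proof (rule sum.cong)
      fix j assume j: "j \<in> {0..<m}"
      show "g $$ (i, j) * h $$ (j, k) = (if j = \<sigma> i then g $$ (i, \<sigma> i) * h $$ (\<sigma> i, k) else 0)"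
      proof (cases "j = \<sigma> i")
        case False
        then have "g $$ (i, j) = 0" using uniq[of i j "\<sigma> i"] \<sigma>[OF ik(1)] ik j by auto
        with False show ?thesis by simp
      qed simp
    qed simp
    also have "\<dots> = g $$ (i, \<sigma> i) * h $$ (\<sigma> i, k)" using \<sigma>[OF ik(1)] by simp
    finally show ?thesis using gh[OF ik] by simp
  qed
  have inj: "inj_on \<sigma> {0..<m}"
  proof (rule inj_onI)
    fix i k assume ik: "i \<in> {0..<m}" "k \<in> {0..<m}" "\<sigma> i = \<sigma> k"
    have "h $$ (\<sigma> k, k) \<noteq> 0" using prod[of k k] ik by auto
    then show "i = k" using prod[of i k] \<sigma>[of i] ik by (auto split: if_splits)
  qed
  have "\<sigma> ` {0..<m} \<subseteq> {0..<m}" using \<sigma> by auto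
  then have "bij_betw \<sigma> {0..<m} {0..<m}" using inj by (simp add: bij_betw_def endo_inj_surj)
  then have perm: "\<sigma> permutes {0..<m}" by (rule bij_imp_permutes) (auto simp: \<sigma>_def)
  show thesis
  proof (rule that[OF perm])
    show "g $$ (i, \<sigma> i) \<noteq> 0" if "i < m" for i using \<sigma>[OF that] by simp
    show "g = monomial_mat m (\<lambda>i. g $$ (i, \<sigma> i)) \<sigma>"
    proof (rule eq_matI)
      fix i j assume "i < dim_row (monomial_mat m (\<lambda>i. g $$ (i, \<sigma> i)) \<sigma>)" "j < dim_col (monomial_mat m (\<lambda>i. g $$ (i, \<sigma> i)) \<sigma>)"
      then have ij: "i < m" "j < m" by (auto simp: monomial_mat_def)
      show "g $$ (i, j) = monomial_mat m (\<lambda>i. g $$ (i, \<sigma> i)) \<sigma> $$ (i, j)"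
        using uniq[OF ij(1,2), of "\<sigma> i"] \<sigma>[OF ij(1)] ij by (cases "j = \<sigma> i") auto
    qed (use gc in \<open>auto simp: monomial_mat_def\<close>)
  qed
qed

section \<open>The lower bound\<close>

lemma pm_smult: "pm k J (\<lambda>i j. s * y i j) = s ^ k * pm k J y"
proof (induction k arbitrary: J)
  case (Suc k)
  then show ?case by (simp add: sum_distrib_left mult.assoc mult.left_commute)
qed simp

lemma perm_poly_pm:
  assumes "M \<in> carrier_mat m m"
  shows "perm_poly m M = pm m {0..<m} (\<lambda>i j. M $$ (i, j))"
  by (simp add: perm_poly_def pm_permutes)

lemma pencil_mat_linear:
  assumes L: "\<Lambda> \<in> carrier_mat n n" and A: "mat_linear m n A"
  shows "pencil m n \<Lambda> (\<lambda>i j. A (unit_mat m i j)) y = \<Lambda> + A (mat m m (\<lambda>(i, j). y i j))"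
proof (rule eq_matI)
  let ?Y = "mat m m (\<lambda>(i, j). y i j)"
  note lin = A[unfolded mat_linear_iff]
  have Yc: "?Y \<in> carrier_mat m m" by simp
  have car: "A X \<in> carrier_mat n n" if "X \<in> carrier_mat m m" for X using lin that by blast
  fix a b assume "a < dim_row (\<Lambda> + A ?Y)" "b < dim_col (\<Lambda> + A ?Y)"
  then have ab: "a < n" "b < n" using car[OF Yc] by auto
  have "A ?Y $$ (a, b) = (\<Sum>i = 0..<m. \<Sum>j = 0..<m. ?Y $$ (i, j) * A (unit_mat m i j) $$ (a, b))"
  proof (rule linear_functional_expand[OF _ _ Yc])
    fix X Z :: "complex mat" assume X: "X \<in> carrier_mat m m" and Z: "Z \<in> carrier_mat m m"
    have "A (X + Z) = A X + A Z" using lin X Z by blast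
    then show "A (X + Z) $$ (a, b) = A X $$ (a, b) + A Z $$ (a, b)" using car[OF X] car[OF Z] ab by simp
  next
    fix c and X :: "complex mat" assume X: "X \<in> carrier_mat m m"
    have "A (c \<cdot>\<^sub>m X) = c \<cdot>\<^sub>m A X" using lin X by blast
    then show "A (c \<cdot>\<^sub>m X) $$ (a, b) = c * A X $$ (a, b)" using car[OF X] ab by simp
  qed
  then show "pencil m n \<Lambda> (\<lambda>i j. A (unit_mat m i j)) y $$ (a, b) = (\<Lambda> + A ?Y) $$ (a, b)"
    using ab L car[OF Yc] by (simp add: pencil_def)
qed (use L A in \<open>auto simp: mat_linear_iff pencil_def\<close>)

lemma det_pencil_det_rep:
  assumes "det_rep m (perm_poly m) n \<Lambda> A"
  shows "det (pencil m n \<Lambda> (\<lambda>i j. A (unit_mat m i j)) y) = pm m {0..<m} y"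
proof -
  let ?Y = "mat m m (\<lambda>(i, j). y i j)"
  have L: "\<Lambda> \<in> carrier_mat n n" and A: "mat_linear m n A" using assms by (auto simp: det_rep_def)
  have Y: "?Y \<in> carrier_mat m m" by simp
  have "det (\<Lambda> + A ?Y) = perm_poly m ?Y" using assms Y by (metis det_rep_def)
  also have "\<dots> = pm m {0..<m} y" unfolding perm_poly_pm[OF Y] by (rule pm_cong) auto
  finally show ?thesis unfolding pencil_mat_linear[OF L A] .
qed

text \<open>A lift of \<open>g\<close> may transpose, but its square, a lift of \<open>g * g\<close>, is always of the form
  \<open>X \<mapsto> P * X * Q\<close>.\<close>

lemma det_preserver_square:
  assumes n: "2 \<le> n" and bij: "bij_betw h (carrier_mat n n) (carrier_mat n n)"
    and add: "\<And>X Y. X \<in> carrier_mat n n \<Longrightarrow> Y \<in> carrier_mat n n \<Longrightarrow> h (X + Y) = h X + h Y"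
    and smult: "\<And>c X. X \<in> carrier_mat n n \<Longrightarrow> h (c \<cdot>\<^sub>m X) = c \<cdot>\<^sub>m h X"
    and det: "\<And>X. X \<in> carrier_mat n n \<Longrightarrow> det (h X) = c * (det X :: complex)"
  obtains P Q where "P \<in> carrier_mat n n" "Q \<in> carrier_mat n n" "det P \<noteq> 0" "det Q \<noteq> 0"
    "\<forall>X \<in> carrier_mat n n. h (h X) = P * X * Q"
proof -
  obtain P Q where PQ: "P \<in> carrier_mat n n" "Q \<in> carrier_mat n n" "det P \<noteq> 0" "det Q \<noteq> 0"
    and form: "(\<forall>X \<in> carrier_mat n n. h X = P * X * Q) \<or> (\<forall>X \<in> carrier_mat n n. h X = P * transpose_mat X * Q)"
    using det_preserver_form[OF n bij add smult det] by blast
  note assoc = assoc_mult_mat[of _ n n _ n _ n]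
  from form show thesis
  proof
    assume h: "\<forall>X \<in> carrier_mat n n. h X = P * X * Q"
    show thesis
    proof (rule that[of "P * P" "Q * Q"])
      show "det (P * P) \<noteq> 0" "det (Q * Q) \<noteq> 0" using PQ by (simp_all add: det_mult[of _ n])
      show "\<forall>X \<in> carrier_mat n n. h (h X) = P * P * X * (Q * Q)" using h PQ(1,2) by (simp add: assoc)
    qed (use PQ in simp_all)
  next
    assume h: "\<forall>X \<in> carrier_mat n n. h X = P * transpose_mat X * Q"
    have tP: "transpose_mat P \<in> carrier_mat n n" and tQ: "transpose_mat Q \<in> carrier_mat n n" using PQ by simp_all
    show thesis
    proof (rule that[of "P * transpose_mat Q" "transpose_mat P * Q"])
      show "det (P * transpose_mat Q) \<noteq> 0" "det (transpose_mat P * Q) \<noteq> 0"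
        using PQ tP tQ by (simp_all add: det_mult[of _ n] det_transpose[of _ n])
      show "\<forall>X \<in> carrier_mat n n. h (h X) = P * transpose_mat Q * X * (transpose_mat P * Q)"
      proof
        fix X :: "complex mat" assume X: "X \<in> carrier_mat n n"
        have tX: "transpose_mat X \<in> carrier_mat n n" using X by simp
        have "transpose_mat (P * transpose_mat X * Q) = transpose_mat Q * transpose_mat (P * transpose_mat X)"
          by (rule transpose_mult[of _ n n _ n]) (use PQ tX in simp_all)
        also have "transpose_mat (P * transpose_mat X) = X * transpose_mat P"
          using transpose_mult[OF PQ(1) tX] by simp
        finally have t: "transpose_mat (P * transpose_mat X * Q) = transpose_mat Q * (X * transpose_mat P)" .
        have "P * transpose_mat X * Q \<in> carrier_mat n n" using PQ(1,2) tX by simp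
        then have "h (h X) = P * (transpose_mat Q * (X * transpose_mat P)) * Q"
          unfolding t[symmetric] using h X by auto
        then show "h (h X) = P * transpose_mat Q * X * (transpose_mat P * Q)"
          using PQ(1,2) tP tQ X by (simp add: assoc)
      qed
    qed (use PQ tP tQ in simp_all)
  qed
qed

text \<open>A determinant of size one is affine and one of size zero is constant, while the
  permanent is homogeneous of degree \<open>m \<ge> 2\<close>. This supplies the size condition of
  \<open>det_preserver_square\<close>.\<close>

lemma det_rep_size_ge_2:
  assumes m: "2 \<le> m" and rep: "det_rep m (perm_poly m) n \<Lambda> A"
  shows "2 \<le> n"
proof (rule ccontr)
  assume n: "\<not> 2 \<le> n"
  define C where "C = (\<lambda>i j. A (unit_mat m i j))"
  have L: "\<Lambda> \<in> carrier_mat n n" and A: "mat_linear m n A" using rep by (auto simp: det_rep_def)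
  have det: "det (pencil m n \<Lambda> C y) = pm m {0..<m} y" for y
    unfolding C_def by (rule det_pencil_det_rep[OF rep])
  obtain y where y: "pm m {0..<m} y \<noteq> 0" using pm_nonzero[of "{0..<m}" m] by auto
  show False
  proof (cases "n = 0")
    case True
    have "pm m {0..<m} (\<lambda>i j. 0 * y i j) = 1"
      unfolding det[symmetric] using True by (simp add: pencil_def)
    then show False unfolding pm_smult using m by (simp add: power_0_left)
  next
    case False
    then have n1: "n = 1" using n by simp
    define b where "b = (\<Sum>i = 0..<m. \<Sum>j = 0..<m. y i j * C i j $$ (0, 0))"
    have "s ^ m * pm m {0..<m} y = \<Lambda> $$ (0, 0) + s * b" for s
    proof -
      have "det (pencil m n \<Lambda> C (\<lambda>i j. s * y i j)) = \<Lambda> $$ (0, 0) + s * b"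
        unfolding n1 b_def by (subst det_single) (simp_all add: pencil_def sum_distrib_left mult.assoc)
      then show ?thesis unfolding det pm_smult .
    qed
    from this[of 0] this[of 1] this[of 2] m have "\<Lambda> $$ (0, 0) = 0" "pm m {0..<m} y = \<Lambda> $$ (0, 0) + b"
      "2 ^ m * pm m {0..<m} y = \<Lambda> $$ (0, 0) + 2 * b" by (simp_all add: power_0_left)
    then have "(2 :: complex) ^ m = 2" using y by simp
    then have "of_nat (2 ^ m) = (of_nat 2 :: complex)" by simp
    then have "(2 :: nat) ^ m = 2" using of_nat_eq_iff by blast
    moreover have "(2 :: nat) ^ 2 \<le> 2 ^ m" using m by (intro power_increasing) simp_all
    ultimately show False by simp
  qed
qed

text \<open>The lift of a monomial matrix \<open>g\<close> is applied twice; the factor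
  \<open>d i * d (\<sigma> i)\<close> and the row \<open>\<sigma> (\<sigma> i)\<close> are those of
  \<open>g * g\<close>.\<close>

lemma monomial_lift:
  assumes m: "2 \<le> m" and rep: "det_rep m (perm_poly m) n \<Lambda> A" and resp: "rep_respects m n \<Lambda> A (NT_action m)"
    and \<sigma>: "\<sigma> permutes {0..<m}" and d: "\<And>i. i < m \<Longrightarrow> d i \<noteq> 0"
  shows "\<exists>P Q. P \<in> carrier_mat n n \<and> Q \<in> carrier_mat n n \<and> det P \<noteq> 0 \<and> det Q \<noteq> 0 \<and>
    (\<forall>y. pencil m n \<Lambda> (\<lambda>i j. A (unit_mat m i j)) (\<lambda>i j. d i * d (\<sigma> i) * y (\<sigma> (\<sigma> i)) j)
       = P * pencil m n \<Lambda> (\<lambda>i j. A (unit_mat m i j)) y * Q)"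
proof -
  define g where "g = monomial_mat m d \<sigma>"
  have L: "\<Lambda> \<in> carrier_mat n n" and A: "mat_linear m n A" using rep by (auto simp: det_rep_def)
  have Ac: "A X \<in> carrier_mat n n" if "X \<in> carrier_mat m m" for X using A that by (auto simp: mat_linear_iff)
  have "g \<in> normalizer (GL_group m) (torus m)" unfolding g_def by (rule monomial_in_normalizer[OF \<sigma> d])
  then have "(\<lambda>M \<in> carrier_mat m m. g * M) \<in> NT_action m" by (simp add: NT_action_def)
  then obtain h where h: "h \<in> rep_group m n \<Lambda> A" and rho: "rho_bar m A h = (\<lambda>M \<in> carrier_mat m m. g * M)"
    using resp by (auto simp: rep_respects_def)
  have hL: "h \<Lambda> = \<Lambda>" and hA: "h ` A ` carrier_mat m m = A ` carrier_mat m m"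
    and hG: "h \<in> GL_mats n" and "\<exists>c. c \<noteq> 0 \<and> (\<forall>y \<in> carrier_mat n n. det (inv_into (carrier_mat n n) h y) = c * det y)"
    using h by (auto simp: rep_group_def symmetry_group_def)
  then obtain c where c: "c \<noteq> 0" "\<And>y. y \<in> carrier_mat n n \<Longrightarrow> det (inv_into (carrier_mat n n) h y) = c * det y" by blast
  have bij: "bij_betw h (carrier_mat n n) (carrier_mat n n)" and hlin: "mat_linear n n h" using hG by (auto simp: GL_mats_def)
  note hl = hlin[unfolded mat_linear_iff]
  have hX: "h X \<in> carrier_mat n n" if "X \<in> carrier_mat n n" for X using hl that by blast
  \<comment> \<open>The symmetry condition speaks of the inverse map, so \<open>h\<close> itself has
    the factor \<open>1 / c\<close>.\<close>
  have det: "det (h X) = (1 / c) * det X" if X: "X \<in> carrier_mat n n" for X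
    using c(2)[OF hX[OF X]] bij_betw_inv_into_left[OF bij X] c(1) by (simp add: field_simps)
  \<comment> \<open>\<open>h\<close> maps the image of \<open>A\<close> into itself, where
    \<open>inv_into\<close> is a right inverse of \<open>A\<close>.\<close>
  have hAy: "h (A M) = A (g * M)" if M: "M \<in> carrier_mat m m" for M
  proof -
    have "h (A M) \<in> A ` carrier_mat m m" using hA M by blast
    then have "A (inv_into (carrier_mat m m) A (h (A M))) = h (A M)" by (rule f_inv_into_f)
    moreover have "rho_bar m A h M = g * M" unfolding rho using M by simp
    ultimately show ?thesis using M by (simp add: rho_bar_def)
  qed
  have step: "h (pencil m n \<Lambda> (\<lambda>i j. A (unit_mat m i j)) y) = pencil m n \<Lambda> (\<lambda>i j. A (unit_mat m i j)) (\<lambda>i j. d i * y (\<sigma> i) j)" for y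
  proof -
    let ?Y = "mat m m (\<lambda>(i, j). y i j)"
    have Y: "?Y \<in> carrier_mat m m" by simp
    have "g * ?Y = mat m m (\<lambda>(i, j). d i * y (\<sigma> i) j)"
    proof (rule eq_matI)
      fix i j assume "i < dim_row (mat m m (\<lambda>(i, j). d i * y (\<sigma> i) j))" "j < dim_col (mat m m (\<lambda>(i, j). d i * y (\<sigma> i) j))"
      then have ij: "i < m" "j < m" by auto
      have "\<sigma> i < m" using permutes_in_image[OF \<sigma>, of i] ij by simp
      then show "(g * ?Y) $$ (i, j) = mat m m (\<lambda>(i, j). d i * y (\<sigma> i) j) $$ (i, j)"
        unfolding g_def monomial_mat_mult[OF \<sigma> Y ij] using ij by simp
    qed (simp_all add: g_def)
    moreover have "h (\<Lambda> + A ?Y) = h \<Lambda> + h (A ?Y)" using hl L Ac[OF Y] by blast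
    ultimately show ?thesis unfolding pencil_mat_linear[OF L A] by (simp add: hL hAy[OF Y])
  qed
  obtain P Q where PQ: "P \<in> carrier_mat n n" "Q \<in> carrier_mat n n" "det P \<noteq> 0" "det Q \<noteq> 0"
    and PXQ: "\<forall>X \<in> carrier_mat n n. h (h X) = P * X * Q"
    by (rule det_preserver_square[OF det_rep_size_ge_2[OF m rep] bij _ _ det]) (use hl in auto)
  have "pencil m n \<Lambda> (\<lambda>i j. A (unit_mat m i j)) (\<lambda>i j. d i * d (\<sigma> i) * y (\<sigma> (\<sigma> i)) j)
      = P * pencil m n \<Lambda> (\<lambda>i j. A (unit_mat m i j)) y * Q" for y
    unfolding PXQ[rule_format, OF pencil_carrier, symmetric] step by (simp add: mult.assoc)
  with PQ show ?thesis by blast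
qed

lemma cyc3_permutes:
  assumes "x < m" "y < m" "z < m" "x \<noteq> y" "x \<noteq> z" "y \<noteq> z"
  shows "cyc3 x y z permutes {0..<m}"
proof (rule bij_imp_permutes)
  show "bij_betw (cyc3 x y z) {0..<m} {0..<m}"
    by (rule bij_betw_byWitness[where f' = "cyc3 x z y"]) (use assms in auto)
qed (use assms in auto)

theorem equivariant_det_rep_size:
  assumes m: "3 \<le> m" and rep: "det_rep m (perm_poly m) n \<Lambda> A" and resp: "rep_respects m n \<Lambda> A (NT_action m)"
  shows "2 ^ m - 1 \<le> n"
proof (rule equivariant_pencil_size[OF m, of \<Lambda> n "\<lambda>i j. A (unit_mat m i j)"])
  have m2: "2 \<le> m" using m by simp
  show L: "\<Lambda> \<in> carrier_mat n n" using rep by (simp add: det_rep_def)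
  have A: "mat_linear m n A" using rep by (simp add: det_rep_def)
  show "A (unit_mat m i j) \<in> carrier_mat n n" for i j using A by (simp add: mat_linear_iff)
  show "det (pencil m n \<Lambda> (\<lambda>i j. A (unit_mat m i j)) y) = pm m {0..<m} y" for y
    by (rule det_pencil_det_rep[OF rep])
  show "\<exists>P Q. P \<in> carrier_mat n n \<and> Q \<in> carrier_mat n n \<and> det P \<noteq> 0 \<and> det Q \<noteq> 0 \<and>
      (\<forall>y. pencil m n \<Lambda> (\<lambda>i j. A (unit_mat m i j)) (\<lambda>i j. t i * y i j) = P * pencil m n \<Lambda> (\<lambda>i j. A (unit_mat m i j)) y * Q)"
    if t: "\<forall>i. t i \<noteq> 0" for t
  proof -
    \<comment> \<open>Every diagonal matrix over the complex numbers is a square of a diagonal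
      matrix.\<close>
    have "csqrt (t i) * csqrt (t i) = t i" for i by (metis power2_csqrt power2_eq_square)
    then show ?thesis using monomial_lift[OF m2 rep resp permutes_id, of "\<lambda>i. csqrt (t i)"] t by simp
  qed
  show "\<exists>P Q. P \<in> carrier_mat n n \<and> Q \<in> carrier_mat n n \<and> det P \<noteq> 0 \<and> det Q \<noteq> 0 \<and>
      (\<forall>v. pencil m n \<Lambda> (\<lambda>i j. A (unit_mat m i j)) (\<lambda>i. v (cyc3 x y z i)) = P * pencil m n \<Lambda> (\<lambda>i j. A (unit_mat m i j)) v * Q)"
    if xyz: "x < m" "y < m" "z < m" "x \<noteq> y" "x \<noteq> z" "y \<noteq> z" for x y z
  proof -
    \<comment> \<open>A 3-cycle is the square of its inverse.\<close>
    have "cyc3 x z y (cyc3 x z y i) = cyc3 x y z i" for i using xyz by simp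
    then show ?thesis using monomial_lift[OF m2 rep resp cyc3_permutes[of x m z y], of "\<lambda>_. 1"] xyz by simp
  qed
qed

section \<open>Grenet's representation\<close>

definition indicator_exp :: "nat set \<Rightarrow> nat \<Rightarrow>\<^sub>0 nat" where
  "indicator_exp I = (\<Sum>i\<in>I. Poly_Mapping.single i 1)"

lemma lookup_indicator_exp:
  "finite I \<Longrightarrow> Poly_Mapping.lookup (indicator_exp I) k = (if k \<in> I then 1 else 0)"
  unfolding indicator_exp_def by (induction I rule: finite_induct) (auto simp: lookup_add lookup_single when_def)

lemma indicator_exp_eq_iff:
  assumes "finite I" "finite J" shows "indicator_exp I = indicator_exp J \<longleftrightarrow> I = J"
proof
  assume eq: "indicator_exp I = indicator_exp J"
  have "(if k \<in> I then 1 else 0) = (if k \<in> J then 1 else (0 :: nat))" for k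
    unfolding lookup_indicator_exp[OF assms(1), symmetric] lookup_indicator_exp[OF assms(2), symmetric] eq ..
  then have "k \<in> I \<longleftrightarrow> k \<in> J" for k by (metis zero_neq_one)
  then show "I = J" by blast
qed simp

lemma single_add_indicator_exp:
  assumes "finite C" "finite R"
  shows "Poly_Mapping.single i 1 + indicator_exp C = indicator_exp R \<longleftrightarrow> i \<notin> C \<and> R = insert i C"
proof
  assume eq: "Poly_Mapping.single i 1 + indicator_exp C = indicator_exp R"
  have l: "(if k = i then 1 else 0) + (if k \<in> C then 1 else 0) = (if k \<in> R then 1 else (0 :: nat))" for k
  proof -
    have "Poly_Mapping.lookup (Poly_Mapping.single i 1 + indicator_exp C) k = (if k = i then 1 else 0) + (if k \<in> C then 1 else (0 :: nat))"
      by (simp add: lookup_add lookup_single lookup_indicator_exp[OF assms(1)] when_def)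
    then show ?thesis unfolding eq lookup_indicator_exp[OF assms(2)] by simp
  qed
  have "i \<notin> C" using l[of i] by (simp split: if_splits)
  moreover have "k \<in> R \<longleftrightarrow> k \<in> insert i C" for k using l[of k] by (auto split: if_split_asm)
  ultimately show "i \<notin> C \<and> R = insert i C" by blast
next
  assume "i \<notin> C \<and> R = insert i C"
  then show "Poly_Mapping.single i 1 + indicator_exp C = indicator_exp R"
    using assms by (simp add: indicator_exp_def)
qed

lemma sqfree_monom_single: "finite I \<Longrightarrow> sqfree_monom I = Poly_Mapping.single (indicator_exp I) 1"
  unfolding sqfree_monom_def indicator_exp_def
  by (induction I rule: finite_induct) (simp_all add: e_sym_def mult_single)

lemma sqfree_coeff_lookup: "sqfree_coeff I p = Poly_Mapping.lookup p (indicator_exp I)"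
  by (simp add: sqfree_coeff_def indicator_exp_def)

lemma sqfree_coeff_single:
  assumes "finite R" "finite C"
  shows "sqfree_coeff R (Poly_Mapping.single (indicator_exp C) a) = (if R = C then a else 0)"
  using indicator_exp_eq_iff[OF assms] by (auto simp: sqfree_coeff_lookup lookup_single when_def)

lemma sqfree_coeff_zero [simp]: "sqfree_coeff R 0 = 0"
  by (simp add: sqfree_coeff_lookup)

lemma sqfree_coeff_add: "sqfree_coeff R (p + q) = sqfree_coeff R p + sqfree_coeff R q"
  by (simp add: sqfree_coeff_lookup lookup_add)

lemma sqfree_coeff_sum: "sqfree_coeff R (\<Sum>a\<in>A. f a) = (\<Sum>a\<in>A. sqfree_coeff R (f a))"
  by (induction A rule: infinite_finite_induct) (simp_all add: sqfree_coeff_add)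

lemma sqfree_coeff_sign: "sqfree_coeff R ((- 1) ^ k * p) = (- 1) ^ k * sqfree_coeff R p"
  by (cases "even k") (simp_all add: sqfree_coeff_lookup)

lemma sqfree_coeff_const_monom:
  assumes "finite R" "finite I"
  shows "sqfree_coeff R (const_sym a * sqfree_monom I) = (if R = I then a else 0)"
  using sqfree_coeff_single[OF assms, of a]
  by (simp add: const_sym_def sqfree_monom_single[OF assms(2)] mult_single)

lemma sqfree_coeff_reg_proj:
  assumes "finite R"
  shows "sqfree_coeff R (reg_proj m k p) = (if R \<subseteq> {0..<m} \<and> card R = k then sqfree_coeff R p else 0)"
proof -
  let ?K = "{I. I \<subseteq> {0..<m} \<and> card I = k}"
  have fin: "finite ?K" by simp
  have "sqfree_coeff R (reg_proj m k p) = (\<Sum>I\<in>?K. if R = I then sqfree_coeff R p else 0)"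
    unfolding reg_proj_def sqfree_coeff_sum
  proof (intro sum.cong refl)
    fix I assume "I \<in> ?K"
    then have "finite I" using finite_subset by blast
    then show "sqfree_coeff R (const_sym (sqfree_coeff I p) * sqfree_monom I) = (if R = I then sqfree_coeff R p else 0)"
      by (simp add: sqfree_coeff_const_monom[OF assms])
  qed
  then show ?thesis using fin by simp
qed

lemma reg_proj_monom:
  assumes C: "C \<subseteq> {0..<m}"
  shows "reg_proj m k (sqfree_monom C) = (if card C = k then sqfree_monom C else 0)"
proof -
  let ?K = "{I. I \<subseteq> {0..<m} \<and> card I = k}"
  have fC: "finite C" using C finite_subset by blast
  have "const_sym (sqfree_coeff I (sqfree_monom C)) * sqfree_monom I = (if C = I then sqfree_monom C else 0)" if "I \<in> ?K" for I
  proof -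
    have "finite I" using that finite_subset by blast
    then show ?thesis using fC
      by (auto simp: sqfree_monom_single sqfree_coeff_single const_sym_def mult_single)
  qed
  then have "reg_proj m k (sqfree_monom C) = (\<Sum>I\<in>?K. if C = I then sqfree_monom C else 0)"
    unfolding reg_proj_def by (intro sum.cong) auto
  then show ?thesis using C by simp
qed

lemma sqfree_coeff_vec_mult:
  assumes "finite R" "finite C"
  shows "sqfree_coeff R (vec_sym v * sqfree_monom C) = (\<Sum>i = 0..<dim_vec v. if i \<notin> C \<and> R = insert i C then v $ i else 0)"
proof -
  have "sqfree_coeff R (const_sym (v $ i) * e_sym i * sqfree_monom C) = (if i \<notin> C \<and> R = insert i C then v $ i else 0)" for i
    using single_add_indicator_exp[OF assms(2,1), of i]
    by (auto simp: const_sym_def e_sym_def sqfree_monom_single[OF assms(2)] mult_single sqfree_coeff_lookup lookup_single when_def)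
  then show ?thesis unfolding vec_sym_def sum_distrib_right sqfree_coeff_sum by simp
qed

text \<open>The identification of \<open>(S\<^sup>mE)\<^sub>r\<^sub>e\<^sub>g\<close> with \<open>S\<^sup>0E\<close>, on indices.\<close>

definition wrap :: "nat \<Rightarrow> nat set \<Rightarrow> nat set" where
  "wrap m S = (if S = {0..<m} then {} else S)"

text \<open>\<open>wrap\<close> unites the top degree with the others: adding the last missing
  element lands in the empty set, that is, in \<open>S\<^sup>0E\<close>.\<close>

lemma sqfree_coeff_s_end:
  assumes R: "R \<subset> {0..<m}" and C: "C \<subset> {0..<m}" and v: "dim_vec v = m"
  shows "sqfree_coeff R (s_end m k v (sqfree_monom C))
    = (if card C = k then \<Sum>i = 0..<m. if i \<notin> C \<and> wrap m (insert i C) = R then v $ i else 0 else 0)"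
proof (cases "card C = k")
  case False
  have "reg_proj m j 0 = 0" for j by (simp add: reg_proj_def const_sym_def)
  then have "s_end m k v (sqfree_monom C) = 0"
    using False C by (simp add: s_end_def s_map_def top_ident_def reg_proj_monom const_sym_def Let_def)
  with False show ?thesis by simp
next
  case True
  have fR: "finite R" and fC: "finite C" using R C by (auto intro: finite_subset)
  have cC: "card C < m" using psubset_card_mono[OF _ C] by simp
  have cR: "card R < m" using psubset_card_mono[OF _ R] by simp
  have ins: "insert i C \<subseteq> {0..<m} \<and> card (insert i C) = Suc k" if "i < m" "i \<notin> C" for i
    using that C fC True by auto
  have q: "sqfree_coeff S (s_map m k v (sqfree_monom C)) = (\<Sum>i = 0..<m. if i \<notin> C \<and> S = insert i C then v $ i else 0)"
    if "finite S" for S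
  proof (cases "S \<subseteq> {0..<m} \<and> card S = Suc k")
    case True
    then show ?thesis by (simp add: s_map_def sqfree_coeff_reg_proj[OF that] sqfree_coeff_vec_mult[OF that fC] v)
  next
    case False
    have "(\<Sum>i = 0..<m. if i \<notin> C \<and> S = insert i C then v $ i else 0) = 0"
      using False ins by (intro sum.neutral ballI) (metis atLeastLessThan_iff)
    then show ?thesis using False by (auto simp add: s_map_def sqfree_coeff_reg_proj[OF that])
  qed
  have proj: "reg_proj m k (sqfree_monom C) = sqfree_monom C" using C True by (simp add: reg_proj_monom)
  show ?thesis
  proof (cases "Suc k = m")
    case False
    then have "insert i C \<noteq> {0..<m}" if "i < m" "i \<notin> C" for i using ins[OF that] by (metis card_atLeastLessThan diff_zero)
    then have "(\<Sum>i = 0..<m. if i \<notin> C \<and> R = insert i C then v $ i else 0)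
        = (\<Sum>i = 0..<m. if i \<notin> C \<and> wrap m (insert i C) = R then v $ i else 0)"
      by (intro sum.cong) (auto simp: wrap_def)
    then show ?thesis using False True by (simp add: s_end_def proj q[OF fR])
  next
    case full: True
    then have eq: "insert i C = {0..<m}" if "i < m" "i \<notin> C" for i
      using ins[OF that] by (intro card_subset_eq) auto
    have "s_end m k v (sqfree_monom C) = Poly_Mapping.single (indicator_exp {}) (\<Sum>i = 0..<m. if i \<notin> C \<and> {0..<m} = insert i C then v $ i else 0)"
      using full by (simp add: s_end_def proj top_ident_def q const_sym_def indicator_exp_def)
    then have "sqfree_coeff R (s_end m k v (sqfree_monom C))
        = (if R = {} then \<Sum>i = 0..<m. if i \<notin> C \<and> {0..<m} = insert i C then v $ i else 0 else 0)"
      by (simp add: sqfree_coeff_single[OF fR])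
    also have "\<dots> = (\<Sum>i = 0..<m. if R = {} then if i \<notin> C \<and> {0..<m} = insert i C then v $ i else 0 else 0)"
      by simp
    also have "\<dots> = (\<Sum>i = 0..<m. if i \<notin> C \<and> wrap m (insert i C) = R then v $ i else 0)"
    proof (intro sum.cong refl)
      fix i assume "i \<in> {0..<m}"
      then have "i \<notin> C \<Longrightarrow> insert i C = {0..<m}" using eq by simp
      then show "(if R = {} then if i \<notin> C \<and> {0..<m} = insert i C then v $ i else 0 else 0)
          = (if i \<notin> C \<and> wrap m (insert i C) = R then v $ i else 0)"
        by (cases "i \<in> C") (simp_all add: wrap_def eq_commute[of R])
    qed
    finally show ?thesis using True by simp
  qed
qed

lemma set_decode_proper:
  assumes "r < 2 ^ m - 1" shows "set_decode r \<subset> {0..<m}"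
proof -
  have "set_decode r \<in> set_decode ` {0..<2 ^ m - 1}" using assms by (intro imageI) simp
  then show ?thesis unfolding bij_betw_imp_surj_on[OF bij_betw_set_decode_proper] by simp
qed

lemma set_encode_proper:
  assumes "R \<subset> {0..<m}" shows "set_encode R < 2 ^ m - 1"
proof -
  have "R \<in> set_decode ` {0..<2 ^ m - 1}"
    unfolding bij_betw_imp_surj_on[OF bij_betw_set_decode_proper] using assms by simp
  then obtain r where "r \<in> {0..<2 ^ m - 1}" "R = set_decode r" by (rule imageE)
  then show ?thesis by (simp only: set_decode_inverse atLeastLessThan_iff)
qed

text \<open>The diagonal of \<open>grenet_const\<close> by degree. For \<open>m \<ge> 2\<close> its
  kernel is \<open>S\<^sup>0E\<close>, in line with corank one.\<close>

definition grenet_weight :: "nat \<Rightarrow> nat \<Rightarrow> complex" where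
  "grenet_weight m k = (if k = 0 then 0 else if k = 1 then (- 1) ^ (m + 1) else 1)"

lemma grenet_lin_carrier [simp]: "grenet_lin m y \<in> carrier_mat (2 ^ m - 1) (2 ^ m - 1)"
  by (simp add: grenet_lin_def end_mat_def)

lemma grenet_const_carrier [simp]: "grenet_const m \<in> carrier_mat (2 ^ m - 1) (2 ^ m - 1)"
  by (simp add: grenet_const_def end_mat_def)

lemma grenet_const_index:
  assumes m: "2 \<le> m" and r: "r < 2 ^ m - 1" and c: "c < 2 ^ m - 1"
  shows "grenet_const m $$ (r, c) = (if r = c then grenet_weight m (card (set_decode c)) else 0)"
proof -
  let ?R = "set_decode r" and ?C = "set_decode c"
  have R: "?R \<subset> {0..<m}" and C: "?C \<subset> {0..<m}" by (rule set_decode_proper[OF r] set_decode_proper[OF c])+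
  have fC: "finite ?C" using C by (auto intro: finite_subset)
  have cC: "card ?C \<le> m - 1" using psubset_card_mono[OF _ C] by simp
  have coeff: "sqfree_coeff ?R (reg_proj m k (sqfree_monom ?C)) = (if k = card ?C then if r = c then 1 else 0 else 0)" for k
  proof -
    have "sqfree_coeff ?R (sqfree_monom ?C) = (if r = c then 1 else 0)"
      using fC R by (simp add: sqfree_monom_single sqfree_coeff_single finite_subset) (metis set_decode_inverse)
    then show ?thesis using C by (auto simp: reg_proj_monom)
  qed
  have "grenet_const m $$ (r, c) = (- 1) ^ (m + 1) * (if 1 = card ?C then if r = c then 1 else 0 else 0)
      + (\<Sum>k = 2..m - 1. if k = card ?C then if r = c then 1 else 0 else 0)"
    using r c unfolding grenet_const_def end_mat_def
    by (simp only: index_mat prod.case sqfree_coeff_add sqfree_coeff_sign sqfree_coeff_sum coeff)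
  also have "(\<Sum>k = 2..m - 1. if k = card ?C then if r = c then 1 else 0 else (0 :: complex))
      = (if 2 \<le> card ?C then if r = c then 1 else 0 else 0)"
    using cC by (subst sum.delta) auto
  finally have e: "grenet_const m $$ (r, c) = (- 1) ^ (m + 1) * (if 1 = card ?C then if r = c then 1 else 0 else 0)
      + (if 2 \<le> card ?C then if r = c then 1 else 0 else 0)" .
  consider "card ?C = 0" | "card ?C = 1" | "2 \<le> card ?C" by linarith
  then show ?thesis unfolding e grenet_weight_def by cases (simp_all del: card_eq_0_iff, auto)
qed

lemma grenet_lin_index:
  assumes m: "1 \<le> m" and y: "y \<in> carrier_mat m m" and r: "r < 2 ^ m - 1" and c: "c < 2 ^ m - 1"
  shows "grenet_lin m y $$ (r, c) = (\<Sum>i = 0..<m.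
    if i \<notin> set_decode c \<and> wrap m (insert i (set_decode c)) = set_decode r then y $$ (i, card (set_decode c)) else 0)"
proof -
  let ?R = "set_decode r" and ?C = "set_decode c"
  have R: "?R \<subset> {0..<m}" and C: "?C \<subset> {0..<m}" by (rule set_decode_proper[OF r] set_decode_proper[OF c])+
  have cC: "card ?C \<le> m - 1" "card ?C < m" using psubset_card_mono[OF _ C] by simp_all
  have "grenet_lin m y $$ (r, c) = (\<Sum>k = 0..m - 1. sqfree_coeff ?R (s_end m k (col y k) (sqfree_monom ?C)))"
    using r c unfolding grenet_lin_def end_mat_def by (simp only: index_mat prod.case sqfree_coeff_sum)
  also have "\<dots> = (\<Sum>k = 0..m - 1. if k = card ?C then
      \<Sum>i = 0..<m. if i \<notin> ?C \<and> wrap m (insert i ?C) = ?R then col y (card ?C) $ i else 0 else 0)"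
    using y by (intro sum.cong refl) (auto simp: sqfree_coeff_s_end[OF R C])
  also have "\<dots> = (\<Sum>i = 0..<m. if i \<notin> ?C \<and> wrap m (insert i ?C) = ?R then col y (card ?C) $ i else 0)"
    using cC by (subst sum.delta) auto
  also have "\<dots> = (\<Sum>i = 0..<m. if i \<notin> ?C \<and> wrap m (insert i ?C) = ?R then y $$ (i, card ?C) else 0)"
    using y cC by (intro sum.cong refl) auto
  finally show ?thesis .
qed

lemma grenet_lin_linear:
  assumes m: "1 \<le> m"
  shows "mat_linear m (2 ^ m - 1) (grenet_lin m)"
  unfolding mat_linear_iff
proof (intro conjI ballI allI)
  fix X Y :: "complex mat" and c :: complex
  assume X: "X \<in> carrier_mat m m"
  have col: "card (set_decode r) < m" if "r < 2 ^ m - 1" for r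
    using psubset_card_mono[OF _ set_decode_proper[OF that]] by simp
  show "grenet_lin m (c \<cdot>\<^sub>m X) = c \<cdot>\<^sub>m grenet_lin m X"
  proof (rule eq_matI)
    fix a b assume "a < dim_row (c \<cdot>\<^sub>m grenet_lin m X)" "b < dim_col (c \<cdot>\<^sub>m grenet_lin m X)"
    then have ab: "a < 2 ^ m - 1" "b < 2 ^ m - 1" by (simp_all add: grenet_lin_def end_mat_def)
    have cX: "c \<cdot>\<^sub>m X \<in> carrier_mat m m" using X by simp
    have "grenet_lin m (c \<cdot>\<^sub>m X) $$ (a, b) = c * grenet_lin m X $$ (a, b)"
      unfolding grenet_lin_index[OF m X ab] grenet_lin_index[OF m cX ab] sum_distrib_left
      using X col[OF ab(2)] by (intro sum.cong refl) auto
    then show "grenet_lin m (c \<cdot>\<^sub>m X) $$ (a, b) = (c \<cdot>\<^sub>m grenet_lin m X) $$ (a, b)"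
      using ab by (simp add: grenet_lin_def end_mat_def)
  qed (simp_all add: grenet_lin_def end_mat_def)
  assume Y: "Y \<in> carrier_mat m m"
  show "grenet_lin m (X + Y) = grenet_lin m X + grenet_lin m Y"
  proof (rule eq_matI)
    fix a b assume "a < dim_row (grenet_lin m X + grenet_lin m Y)" "b < dim_col (grenet_lin m X + grenet_lin m Y)"
    then have ab: "a < 2 ^ m - 1" "b < 2 ^ m - 1" by (simp_all add: grenet_lin_def end_mat_def)
    have XY: "X + Y \<in> carrier_mat m m" using X Y by simp
    have "grenet_lin m (X + Y) $$ (a, b) = grenet_lin m X $$ (a, b) + grenet_lin m Y $$ (a, b)"
      unfolding grenet_lin_index[OF m X ab] grenet_lin_index[OF m Y ab] grenet_lin_index[OF m XY ab] sum.distrib[symmetric]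
      using X Y col[OF ab(2)] by (intro sum.cong refl) auto
    then show "grenet_lin m (X + Y) $$ (a, b) = (grenet_lin m X + grenet_lin m Y) $$ (a, b)"
      using ab by (simp add: grenet_lin_def end_mat_def)
  qed (simp_all add: grenet_lin_def end_mat_def)
qed (rule grenet_lin_carrier)

text \<open>The first column is replaced by \<open>X\<close> times \<open>v\<close>, an operation of
  determinant one as \<open>v 0 = 1\<close>. Only the top entry of that column survives, and the
  remaining block is triangular.\<close>

lemma det_via_kernel_vector:
  fixes X :: "'a :: comm_ring_1 mat"
  assumes X: "X \<in> carrier_mat (Suc n) (Suc n)" and v0: "v 0 = 1"
    and ker: "\<And>r. 0 < r \<Longrightarrow> r < Suc n \<Longrightarrow> (\<Sum>c = 0..<Suc n. X $$ (r, c) * v c) = 0"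
    and lower: "\<And>r c. 0 < r \<Longrightarrow> r < c \<Longrightarrow> c < Suc n \<Longrightarrow> X $$ (r, c) = 0"
  shows "det X = (\<Sum>c = 0..<Suc n. X $$ (0, c) * v c) * (\<Prod>r = 0..<n. X $$ (Suc r, Suc r))"
proof -
  define V where "V = mat (Suc n) (Suc n) (\<lambda>(i, j). if j = 0 then v i else if i = j then 1 else 0)"
  have V: "V \<in> carrier_mat (Suc n) (Suc n)" by (simp add: V_def)
  have "det V = (\<Prod>i = 0..<Suc n. V $$ (i, i))"
    using det_lower_triangular[OF _ V] V by (simp add: V_def prod_list_diag_prod)
  also have "\<dots> = 1" by (intro prod.neutral) (auto simp: V_def v0)
  finally have dV: "det V = 1" .
  define Z where "Z = X * V"
  have Z: "Z \<in> carrier_mat (Suc n) (Suc n)" using X V by (simp add: Z_def)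
  have Z0: "Z $$ (i, 0) = (\<Sum>c = 0..<Suc n. X $$ (i, c) * v c)" if i: "i < Suc n" for i
  proof -
    have "Z $$ (i, 0) = (\<Sum>c = 0..<Suc n. X $$ (i, c) * V $$ (c, 0))"
      unfolding Z_def by (rule mult_mat_index[OF X V i]) simp
    then show ?thesis by (simp add: V_def)
  qed
  have ZS: "Z $$ (i, j) = X $$ (i, j)" if ij: "i < Suc n" "j < Suc n" "0 < j" for i j
  proof -
    have "Z $$ (i, j) = (\<Sum>c = 0..<Suc n. X $$ (i, c) * V $$ (c, j))"
      unfolding Z_def by (rule mult_mat_index[OF X V ij(1,2)])
    also have "\<dots> = (\<Sum>c = 0..<Suc n. if c = j then X $$ (i, c) else 0)"
      using ij by (intro sum.cong) (auto simp: V_def)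
    finally show ?thesis using ij by simp
  qed
  have D: "mat_delete Z 0 0 \<in> carrier_mat n n" using Z by (rule mat_delete_carrier[where n = "Suc n" and m = "Suc n", simplified])
  have Di: "mat_delete Z 0 0 $$ (i, j) = X $$ (Suc i, Suc j)" if "i < n" "j < n" for i j
    using Z that ZS[of "Suc i" "Suc j"] by (simp add: mat_delete_def)
  have "det (mat_delete Z 0 0) = prod_list (diag_mat (mat_delete Z 0 0))"
    by (rule det_lower_triangular[OF _ D]) (simp add: Di lower)
  also have "\<dots> = (\<Prod>r = 0..<n. X $$ (Suc r, Suc r))"
    unfolding prod_list_diag_prod carrier_matD(1)[OF D] by (intro prod.cong refl) (simp add: Di)
  finally have dD: "det (mat_delete Z 0 0) = (\<Prod>r = 0..<n. X $$ (Suc r, Suc r))" .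
  have "det X = det Z" unfolding Z_def using dV by (simp add: det_mult[OF X V])
  also have "det Z = (\<Sum>i<Suc n. Z $$ (i, 0) * cofactor Z i 0)"
    by (rule laplace_expansion_column[OF Z]) simp
  also have "\<dots> = (\<Sum>i<Suc n. if i = 0 then Z $$ (0, 0) * cofactor Z 0 0 else 0)"
    by (intro sum.cong) (auto simp: Z0 ker simp del: sum.op_ivl_Suc)
  also have "\<dots> = Z $$ (0, 0) * cofactor Z 0 0" by simp
  finally show ?thesis by (simp add: cofactor_def dD Z0)
qed

text \<open>For \<open>r = 0\<close>, the empty set, \<open>wrap\<close> makes the contributions
  come from the sets that miss one element, and the diagonal weight is zero. Any other set is
  reached by adding one of its own elements.\<close>

lemma grenet_row_sum:
  assumes m: "2 \<le> m" and y: "y \<in> carrier_mat m m" and r: "r < 2 ^ m - 1"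
  shows "(\<Sum>c = 0..<2 ^ m - 1. (grenet_const m + grenet_lin m y) $$ (r, c) * v (set_decode c)) =
    (if r = 0 then \<Sum>i = 0..<m. y $$ (i, m - 1) * v ({0..<m} - {i})
     else grenet_weight m (card (set_decode r)) * v (set_decode r) +
       (\<Sum>i\<in>set_decode r. y $$ (i, card (set_decode r) - 1) * v (set_decode r - {i})))"
proof -
  let ?R = "set_decode r" and ?n = "2 ^ m - 1 :: nat"
  let ?F = "\<lambda>i C. if i \<notin> C \<and> wrap m (insert i C) = ?R then y $$ (i, card C) * v C else 0"
  have m1: "1 \<le> m" using m by simp
  have R: "?R \<subset> {0..<m}" by (rule set_decode_proper[OF r])
  have fR: "finite ?R" using R by (auto intro: finite_subset)
  have "(\<Sum>c = 0..<?n. (grenet_const m + grenet_lin m y) $$ (r, c) * v (set_decode c))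
      = (\<Sum>c = 0..<?n. (if r = c then grenet_weight m (card (set_decode c)) * v (set_decode c) else 0)
          + (\<Sum>i = 0..<m. ?F i (set_decode c)))"
  proof (rule sum.cong[OF refl])
    fix c assume "c \<in> {0..<?n}"
    then have c: "c < ?n" by simp
    have "(grenet_const m + grenet_lin m y) $$ (r, c) = grenet_const m $$ (r, c) + grenet_lin m y $$ (r, c)"
      by (rule index_add_mat(1)) (use c r in \<open>simp_all add: grenet_lin_def end_mat_def\<close>)
    then have e: "(grenet_const m + grenet_lin m y) $$ (r, c) = (if r = c then grenet_weight m (card (set_decode c)) else 0) + (\<Sum>i = 0..<m.
      if i \<notin> set_decode c \<and> wrap m (insert i (set_decode c)) = ?R then y $$ (i, card (set_decode c)) else 0)"
      unfolding grenet_const_index[OF m r c] grenet_lin_index[OF m1 y r c] .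
    show "(grenet_const m + grenet_lin m y) $$ (r, c) * v (set_decode c)
      = (if r = c then grenet_weight m (card (set_decode c)) * v (set_decode c) else 0) + (\<Sum>i = 0..<m. ?F i (set_decode c))"
      unfolding e distrib_right sum_distrib_right
      by (intro arg_cong2[where f = "(+)"] sum.cong) auto
  qed
  also have "\<dots> = grenet_weight m (card ?R) * v ?R + (\<Sum>c = 0..<?n. \<Sum>i = 0..<m. ?F i (set_decode c))"
    unfolding sum.distrib using r by (subst sum.delta') auto
  also have "(\<Sum>c = 0..<?n. \<Sum>i = 0..<m. ?F i (set_decode c)) = (\<Sum>C | C \<subset> {0..<m}. \<Sum>i = 0..<m. ?F i C)"
    by (rule sum.reindex_bij_betw[OF bij_betw_set_decode_proper])
  also have "\<dots> = (\<Sum>i = 0..<m. \<Sum>C | C \<subset> {0..<m}. ?F i C)" by (rule sum.swap)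
  also have "\<dots> = (\<Sum>i = 0..<m. if r = 0 then y $$ (i, m - 1) * v ({0..<m} - {i})
      else if i \<in> ?R then y $$ (i, card ?R - 1) * v (?R - {i}) else 0)"
  proof (rule sum.cong[OF refl])
    fix i assume iU: "i \<in> {0..<m}"
    then have i: "i < m" by simp
    have fin: "finite {C. C \<subset> {0..<m}}" by (rule finite_subset[of _ "Pow {0..<m}"]) auto
    show "(\<Sum>C | C \<subset> {0..<m}. ?F i C) = (if r = 0 then y $$ (i, m - 1) * v ({0..<m} - {i})
      else if i \<in> ?R then y $$ (i, card ?R - 1) * v (?R - {i}) else 0)"
    proof (cases "r = 0")
      case True
      have ps: "{0..<m} - {i} \<subset> {0..<m}" using iU by blast
      have "?F i C = (if C = {0..<m} - {i} then y $$ (i, m - 1) * v C else 0)" if C: "C \<subset> {0..<m}" for C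
      proof -
        have "i \<notin> C \<and> wrap m (insert i C) = ?R \<longleftrightarrow> C = {0..<m} - {i}"
          using True i C by (auto simp: wrap_def)
        moreover have "card ({0..<m} - {i}) = m - 1" using i by simp
        ultimately show ?thesis by (cases "C = {0..<m} - {i}") auto
      qed
      then have "(\<Sum>C | C \<subset> {0..<m}. ?F i C) = (\<Sum>C | C \<subset> {0..<m}. if C = {0..<m} - {i} then y $$ (i, m - 1) * v C else 0)"
        by (intro sum.cong) auto
      also have "\<dots> = y $$ (i, m - 1) * v ({0..<m} - {i})" unfolding sum.delta[OF fin] using ps by simp
      finally show ?thesis using True by simp
    next
      case False
      then have ne: "?R \<noteq> {}" by (metis set_decode_inverse set_encode_empty)
      show ?thesis
      proof (cases "i \<in> ?R")
        case iR: True
        have ps: "?R - {i} \<subset> {0..<m}" using R by blast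
        have "?F i C = (if C = ?R - {i} then y $$ (i, card ?R - 1) * v C else 0)" if C: "C \<subset> {0..<m}" for C
        proof -
          have "i \<notin> C \<and> wrap m (insert i C) = ?R \<longleftrightarrow> C = ?R - {i}"
            using iR ne R by (auto simp: wrap_def)
          moreover have "card (?R - {i}) = card ?R - 1" using iR fR by simp
          ultimately show ?thesis by (cases "C = ?R - {i}") auto
        qed
        then have "(\<Sum>C | C \<subset> {0..<m}. ?F i C) = (\<Sum>C | C \<subset> {0..<m}. if C = ?R - {i} then y $$ (i, card ?R - 1) * v C else 0)"
          by (intro sum.cong) auto
        also have "\<dots> = y $$ (i, card ?R - 1) * v (?R - {i})" unfolding sum.delta[OF fin] using ps by simp
        finally show ?thesis using False iR by simp
      next
        case iR: False
        have "?F i C = 0" for C using iR ne by (auto simp: wrap_def split: if_splits)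
        then show ?thesis using False iR by simp
      qed
    qed
  qed
  finally have e: "(\<Sum>c = 0..<?n. (grenet_const m + grenet_lin m y) $$ (r, c) * v (set_decode c)) =
    grenet_weight m (card ?R) * v ?R + (\<Sum>i = 0..<m. if r = 0 then y $$ (i, m - 1) * v ({0..<m} - {i})
      else if i \<in> ?R then y $$ (i, card ?R - 1) * v (?R - {i}) else 0)" .
  show ?thesis
  proof (cases "r = 0")
    case True
    then show ?thesis unfolding e by (simp add: grenet_weight_def)
  next
    case False
    have "(\<Sum>i = 0..<m. if i \<in> ?R then y $$ (i, card ?R - 1) * v (?R - {i}) else 0) = (\<Sum>i\<in>?R. y $$ (i, card ?R - 1) * v (?R - {i}))"
      using R by (subst sum.inter_restrict[symmetric]) (auto simp: Int_absorb1 psubset_imp_subset)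
    then show ?thesis unfolding e using False by simp
  qed
qed

text \<open>The sign occurs once for each of the \<open>m\<close> singletons, and
  \<open>(m + 1) * m\<close> is even.\<close>

lemma grenet_weight_prod:
  assumes m: "2 \<le> m"
  shows "(\<Prod>r = 0..<2 ^ m - 2. grenet_weight m (card (set_decode (Suc r)))) = 1"
proof -
  let ?n = "2 ^ m - 1 :: nat"
  have pm: "(4 :: nat) \<le> 2 ^ m" using power_increasing[OF m, of "2 :: nat"] by simp
  have "(\<Prod>r = 0..<2 ^ m - 2. grenet_weight m (card (set_decode (Suc r)))) = (\<Prod>r = 1..<?n. grenet_weight m (card (set_decode r)))"
  proof -
    have "?n = Suc (2 ^ m - 2)" using pm by simp
    then show ?thesis using prod.shift_bounds_Suc_ivl[of "\<lambda>r. grenet_weight m (card (set_decode r))" 0 "2 ^ m - 2"] by simp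
  qed
  also have "\<dots> = (\<Prod>r = 1..<?n. if card (set_decode r) = 1 then (- 1) ^ (m + 1) else 1)"
  proof (rule prod.cong[OF refl])
    fix r assume r: "r \<in> {1..<?n}"
    then have "set_decode r \<noteq> {}" by (metis atLeastLessThan_iff set_decode_inverse set_encode_empty not_one_le_zero)
    moreover have "finite (set_decode r)" by simp
    ultimately have "card (set_decode r) \<noteq> 0" by simp
    then show "grenet_weight m (card (set_decode r)) = (if card (set_decode r) = 1 then (- 1) ^ (m + 1) else 1)"
      by (simp add: grenet_weight_def)
  qed
  also have "\<dots> = (\<Prod>r\<in>{r \<in> {1..<?n}. card (set_decode r) = 1}. (- 1) ^ (m + 1))"
    by (rule prod.inter_filter[symmetric]) simp
  also have "{r \<in> {1..<?n}. card (set_decode r) = 1} = (\<lambda>i. 2 ^ i) ` {0..<m}"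
  proof (intro subset_antisym subsetI)
    fix r assume "r \<in> {r \<in> {1..<?n}. card (set_decode r) = 1}"
    then have r: "r < ?n" "card (set_decode r) = 1" by auto
    then obtain i where i: "set_decode r = {i}" by (auto simp: card_1_singleton_iff)
    have "r = set_encode {i}" by (metis i set_decode_inverse)
    then have "r = 2 ^ i" by (simp add: set_encode_def)
    moreover have "i < m" using set_decode_proper[OF r(1)] i by auto
    ultimately show "r \<in> (\<lambda>i. 2 ^ i) ` {0..<m}" by simp
  next
    fix r :: nat assume "r \<in> (\<lambda>i. 2 ^ i) ` {0..<m}"
    then obtain i where i: "i < m" "r = 2 ^ i" by auto
    have e: "r = set_encode {i}" using i by (simp add: set_encode_def)
    have "{i} \<noteq> {0..<m}" using m by (metis card_atLeastLessThan diff_zero is_singleton_altdef is_singletonI not_less_eq_eq numeral_2_eq_2 le_refl One_nat_def)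
    then have "{i} \<subset> {0..<m}" using i by auto
    then have "r < ?n" unfolding e by (rule set_encode_proper)
    moreover have "set_decode r = {i}" unfolding e by (rule set_encode_inverse) simp
    moreover have "1 \<le> r" using i by simp
    ultimately show "r \<in> {r \<in> {1..<?n}. card (set_decode r) = 1}" by simp
  qed
  also have "(\<Prod>r\<in>(\<lambda>i. 2 ^ i :: nat) ` {0..<m}. (- 1 :: complex) ^ (m + 1)) = ((- 1) ^ (m + 1)) ^ m"
    by (simp add: card_image inj_on_def)
  also have "\<dots> = (- 1) ^ ((m + 1) * m)" by (rule power_mult[symmetric])
  also have "\<dots> = 1" by simp
  finally show ?thesis .
qed

text \<open>A bridge between the recursion in Grenet's matrix, which adds columns of
  \<open>y\<close>, and that of \<open>pm\<close>, which adds rows.\<close>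

lemma pm_transpose: "pm m {0..<m} (\<lambda>i j. y j i) = pm m {0..<m} y"
proof -
  have "pm m {0..<m} (\<lambda>i j. y j i) = (\<Sum>\<sigma> | \<sigma> permutes {0..<m}. \<Prod>i = 0..<m. y (\<sigma> i) i)"
    by (rule pm_permutes)
  also have "\<dots> = (\<Sum>\<sigma> | \<sigma> permutes {0..<m}. \<Prod>i = 0..<m. y (inv_into UNIV \<sigma> i) i)"
    by (rule sum_permutations_inverse)
  also have "\<dots> = (\<Sum>\<sigma> | \<sigma> permutes {0..<m}. \<Prod>i = 0..<m. y i (\<sigma> i))"
  proof (rule sum.cong[OF refl])
    fix \<sigma> assume "\<sigma> \<in> {\<sigma>. \<sigma> permutes {0..<m}}"
    then have \<sigma>: "\<sigma> permutes {0..<m}" by simp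
    have "(\<Prod>i = 0..<m. y (inv_into UNIV \<sigma> i) i) = (\<Prod>i = 0..<m. y (inv_into UNIV \<sigma> (\<sigma> i)) (\<sigma> i))"
      using prod.permute[OF \<sigma>, of "\<lambda>i. y (inv_into UNIV \<sigma> i) i"] by (simp add: comp_def)
    then show "(\<Prod>i = 0..<m. y (inv_into UNIV \<sigma> i) i) = (\<Prod>i = 0..<m. y i (\<sigma> i))"
      by (simp add: permutes_inverses[OF \<sigma>])
  qed
  also have "\<dots> = pm m {0..<m} y" by (rule pm_permutes[symmetric])
  finally show ?thesis .
qed

text \<open>Column operations clear the first column: the coefficients are, up to sign, the
  permanents of the first \<open>k\<close> columns restricted to the rows in a \<open>k\<close>-set.\<close>

lemma grenet_det:
  assumes m: "2 \<le> m" and y: "y \<in> carrier_mat m m"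
  shows "det (grenet_const m + grenet_lin m y) = perm_poly m y"
proof -
  let ?X = "grenet_const m + grenet_lin m y"
  define p where "p R = pm (card R) R (\<lambda>k i. y $$ (i, k))" for R
  \<comment> \<open>Row \<open>R\<close> forces \<open>v R\<close> to be minus the sum over the
    elements of \<open>R\<close>, divided by the diagonal weight. So the sign is
    \<open>(- 1) ^ m\<close> at singletons, because of their weight \<open>(- 1) ^ (m + 1)\<close>,
    and alternates with the size from there on.\<close>
  define v where "v R = (if R = {} then 1 else (- 1) ^ (m + card R - 1) * p R)" for R
  define n where "n = (2 :: nat) ^ m - 2"
  have pm: "(4 :: nat) \<le> 2 ^ m" using power_increasing[OF m, of "2 :: nat"] by simp
  have n: "2 ^ m - 1 = Suc n" unfolding n_def using pm by simp
  have m1: "1 \<le> m" using m by simp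
  have X: "?X \<in> carrier_mat (Suc n) (Suc n)" unfolding n[symmetric] by (rule add_carrier_mat[OF grenet_lin_carrier])
  have pS: "p R = (\<Sum>i\<in>R. y $$ (i, card R - 1) * p (R - {i}))" if "finite R" "R \<noteq> {}" for R
  proof -
    have "card R \<noteq> 0" using that by simp
    then obtain k where k: "card R = Suc k" using not0_implies_Suc by blast
    have ck: "card (R - {i}) = k" if "i \<in> R" for i using card_Diff_singleton[OF that] k by simp
    have "pm (Suc k) R (\<lambda>k i. y $$ (i, k)) = (\<Sum>i\<in>R. y $$ (i, k) * pm k (R - {i}) (\<lambda>k i. y $$ (i, k)))" by simp
    also have "\<dots> = (\<Sum>i\<in>R. y $$ (i, Suc k - 1) * pm (card (R - {i})) (R - {i}) (\<lambda>k i. y $$ (i, k)))"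
      by (intro sum.cong refl) (simp only: ck diff_Suc_1)
    finally show ?thesis unfolding p_def k .
  qed
  have wv: "grenet_weight m (card R) * v R + (\<Sum>i\<in>R. y $$ (i, card R - 1) * v (R - {i})) = 0"
    if R: "finite R" "R \<noteq> {}" for R
  proof (cases "card R = 1")
    case True
    then obtain i where i: "R = {i}" by (auto simp: card_1_singleton_iff)
    have "p R = y $$ (i, 0)" unfolding pS[OF R] by (simp add: i p_def)
    moreover have "(- 1 :: complex) ^ (m + 1) * (- 1) ^ m = - 1" by (simp add: power_add[symmetric])
    ultimately show ?thesis by (simp add: i v_def grenet_weight_def)
  next
    case False
    have "card R \<noteq> 0" using R by simp
    with False have c: "2 \<le> card R" by linarith
    have "(\<Sum>i\<in>R. y $$ (i, card R - 1) * v (R - {i})) = (\<Sum>i\<in>R. (- 1) ^ (m + card R - 2) * (y $$ (i, card R - 1) * p (R - {i})))"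
    proof (rule sum.cong[OF refl])
      fix i assume i: "i \<in> R"
      have ci: "card (R - {i}) = card R - 1" using i R by simp
      then have "R - {i} \<noteq> {}" using c by (metis card.empty diff_is_0_eq not_less_eq_eq numeral_2_eq_2 One_nat_def)
      moreover have "m + card (R - {i}) - 1 = m + card R - 2" using ci c by simp
      ultimately show "y $$ (i, card R - 1) * v (R - {i}) = (- 1) ^ (m + card R - 2) * (y $$ (i, card R - 1) * p (R - {i}))"
        by (simp add: v_def)
    qed
    also have "\<dots> = (- 1) ^ (m + card R - 2) * p R" unfolding pS[OF R] sum_distrib_left ..
    finally have s: "(\<Sum>i\<in>R. y $$ (i, card R - 1) * v (R - {i})) = (- 1) ^ (m + card R - 2) * p R" .
    have "m + card R - 1 = Suc (m + card R - 2)" using c by simp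
    then show ?thesis unfolding s using R c by (simp add: v_def grenet_weight_def)
  qed
  have row: "(\<Sum>c = 0..<Suc n. ?X $$ (r, c) * v (set_decode c)) =
    (if r = 0 then \<Sum>i = 0..<m. y $$ (i, m - 1) * v ({0..<m} - {i})
     else grenet_weight m (card (set_decode r)) * v (set_decode r) +
       (\<Sum>i\<in>set_decode r. y $$ (i, card (set_decode r) - 1) * v (set_decode r - {i})))" if "r < Suc n" for r
    using grenet_row_sum[OF m y, of r v] that unfolding n by blast
  \<comment> \<open>At size \<open>m - 1\<close> the exponent is \<open>2 * (m - 1)\<close>, so the
    permanent appears with sign plus; this is the purpose of the sign in the constant part.\<close>
  have top: "(\<Sum>i = 0..<m. y $$ (i, m - 1) * v ({0..<m} - {i})) = p {0..<m}"
  proof -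
    have "(\<Sum>i = 0..<m. y $$ (i, m - 1) * v ({0..<m} - {i})) = (\<Sum>i = 0..<m. y $$ (i, m - 1) * p ({0..<m} - {i}))"
    proof (rule sum.cong[OF refl])
      fix i assume i: "i \<in> {0..<m}"
      have ci: "card ({0..<m} - {i}) = m - 1" using i by simp
      then have "{0..<m} - {i} \<noteq> {}" using m by (metis card.empty diff_is_0_eq not_less_eq_eq numeral_2_eq_2 One_nat_def)
      moreover have "m + card ({0..<m} - {i}) - 1 = 2 * (m - 1)" using ci m by simp
      ultimately have "v ({0..<m} - {i}) = p ({0..<m} - {i})" by (simp add: v_def)
      then show "y $$ (i, m - 1) * v ({0..<m} - {i}) = y $$ (i, m - 1) * p ({0..<m} - {i})" by simp
    qed
    also have "\<dots> = p {0..<m}" using pS[of "{0..<m}"] m by simp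
    finally show ?thesis .
  qed
  have entry: "?X $$ (r, c) = (if r = c then grenet_weight m (card (set_decode c)) else 0) + (\<Sum>i = 0..<m.
    if i \<notin> set_decode c \<and> wrap m (insert i (set_decode c)) = set_decode r then y $$ (i, card (set_decode c)) else 0)"
    if rc: "r < Suc n" "c < Suc n" for r c
  proof -
    have rc': "r < 2 ^ m - 1" "c < 2 ^ m - 1" using rc n by simp_all
    have "?X $$ (r, c) = grenet_const m $$ (r, c) + grenet_lin m y $$ (r, c)"
      by (rule index_add_mat(1)) (use rc' in \<open>simp_all add: grenet_lin_def end_mat_def\<close>)
    then show ?thesis unfolding grenet_const_index[OF m rc'] grenet_lin_index[OF m1 y rc'] .
  qed
  \<comment> \<open>Inserting an element raises the binary code, so apart from the first row the
    matrix is lower triangular.\<close>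
  have lower: "r > c" if "0 < r" "i \<notin> set_decode c" "wrap m (insert i (set_decode c)) = set_decode r" for r c i
  proof -
    have "set_decode r \<noteq> {}" using that(1) by (metis set_decode_inverse set_encode_empty less_irrefl)
    then have "set_decode r = insert i (set_decode c)" using that(3) by (auto simp: wrap_def split: if_splits)
    then have "r = set_encode (insert i (set_decode c))" by (metis set_decode_inverse)
    then have "r = 2 ^ i + c" using that(2) by simp
    then show ?thesis by simp
  qed
  have "det ?X = (\<Sum>c = 0..<Suc n. ?X $$ (0, c) * v (set_decode c)) * (\<Prod>r = 0..<n. ?X $$ (Suc r, Suc r))"
  proof (rule det_via_kernel_vector[OF X, where v = "\<lambda>c. v (set_decode c)"])
    show "v (set_decode 0) = 1" by (simp add: v_def)
    show "(\<Sum>c = 0..<Suc n. ?X $$ (r, c) * v (set_decode c)) = 0" if r: "0 < r" "r < Suc n" for r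
    proof -
      have "set_decode r \<noteq> {}" using r(1) by (metis set_decode_inverse set_encode_empty less_irrefl)
      then show ?thesis unfolding row[OF r(2)] using wv[of "set_decode r"] r by simp
    qed
    show "?X $$ (r, c) = 0" if rc: "0 < r" "r < c" "c < Suc n" for r c
    proof -
      have "(\<Sum>i = 0..<m. if i \<notin> set_decode c \<and> wrap m (insert i (set_decode c)) = set_decode r then y $$ (i, card (set_decode c)) else 0) = 0"
        using lower[OF rc(1), of _ c] rc by (intro sum.neutral) force
      then show ?thesis using entry[of r c] rc by simp
    qed
  qed
  also have "(\<Sum>c = 0..<Suc n. ?X $$ (0, c) * v (set_decode c)) = p {0..<m}"
    unfolding row[OF zero_less_Suc] using top by simp
  also have "(\<Prod>r = 0..<n. ?X $$ (Suc r, Suc r)) = (\<Prod>r = 0..<n. grenet_weight m (card (set_decode (Suc r))))"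
  proof (rule prod.cong[OF refl])
    fix r assume "r \<in> {0..<n}"
    then have r: "Suc r < Suc n" by simp
    have "(\<Sum>i = 0..<m. if i \<notin> set_decode (Suc r) \<and> wrap m (insert i (set_decode (Suc r))) = set_decode (Suc r) then y $$ (i, card (set_decode (Suc r))) else 0) = 0"
      using lower[of "Suc r" _ "Suc r"] by (intro sum.neutral) force
    then show "?X $$ (Suc r, Suc r) = grenet_weight m (card (set_decode (Suc r)))" using entry[OF r r] by simp
  qed
  also have "\<dots> = 1" unfolding n_def by (rule grenet_weight_prod[OF m])
  also have "p {0..<m} = perm_poly m y"
    unfolding p_def perm_poly_pm[OF y] using pm_transpose[of m "\<lambda>i j. y $$ (i, j)"] by simp
  finally show ?thesis by simp
qed

section \<open>Symmetry of Grenet's representation\<close>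

definition monomial_conj :: "nat \<Rightarrow> (nat \<Rightarrow> complex) \<Rightarrow> (nat \<Rightarrow> complex) \<Rightarrow> (nat \<Rightarrow> nat) \<Rightarrow> complex mat \<Rightarrow> complex mat" where
  "monomial_conj n a b \<pi> X = mat n n (\<lambda>(r, c). a r * b c * X $$ (\<pi> r, \<pi> c))"

lemma monomial_conj_index [simp]:
  "r < n \<Longrightarrow> c < n \<Longrightarrow> monomial_conj n a b \<pi> X $$ (r, c) = a r * b c * X $$ (\<pi> r, \<pi> c)"
  "dim_row (monomial_conj n a b \<pi> X) = n" "dim_col (monomial_conj n a b \<pi> X) = n"
  "monomial_conj n a b \<pi> X \<in> carrier_mat n n"
  by (simp_all add: monomial_conj_def)

text \<open>Rows and columns are permuted alike, so the two signs cancel and only the scaling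
  factors remain.\<close>

lemma det_monomial_conj:
  assumes X: "X \<in> carrier_mat n n" and \<pi>: "\<pi> permutes {0..<n}"
  shows "det (monomial_conj n a b \<pi> X) = (\<Prod>i = 0..<n. a i) * (\<Prod>i = 0..<n. b i) * det X"
proof -
  let ?N = "mat n n (\<lambda>(r, c). X $$ (\<pi> r, \<pi> c))"
  have N: "?N \<in> carrier_mat n n" by simp
  have "det (monomial_conj n a b \<pi> X) = (\<Sum>p | p permutes {0..<n}. signof p * (\<Prod>i = 0..<n. monomial_conj n a b \<pi> X $$ (i, p i)))"
    by (rule det_def') simp
  also have "\<dots> = (\<Sum>p | p permutes {0..<n}. (\<Prod>i = 0..<n. a i) * (\<Prod>i = 0..<n. b i) * (signof p * (\<Prod>i = 0..<n. ?N $$ (i, p i))))"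
  proof (rule sum.cong[OF refl])
    fix p assume "p \<in> {p. p permutes {0..<n}}"
    then have p: "p permutes {0..<n}" by simp
    have "(\<Prod>i = 0..<n. monomial_conj n a b \<pi> X $$ (i, p i)) = (\<Prod>i = 0..<n. a i * b (p i) * ?N $$ (i, p i))"
      using permutes_in_image[OF p] by (intro prod.cong) auto
    also have "\<dots> = (\<Prod>i = 0..<n. a i) * (\<Prod>i = 0..<n. b (p i)) * (\<Prod>i = 0..<n. ?N $$ (i, p i))"
      by (simp only: prod.distrib)
    also have "(\<Prod>i = 0..<n. b (p i)) = (\<Prod>i = 0..<n. b i)"
      using prod.permute[OF p, of b] by (simp add: comp_def)
    finally show "signof p * (\<Prod>i = 0..<n. monomial_conj n a b \<pi> X $$ (i, p i)) =
      (\<Prod>i = 0..<n. a i) * (\<Prod>i = 0..<n. b i) * (signof p * (\<Prod>i = 0..<n. ?N $$ (i, p i)))"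
      by (simp only: mult_ac)
  qed
  also have "\<dots> = (\<Prod>i = 0..<n. a i) * (\<Prod>i = 0..<n. b i) * det ?N"
    unfolding det_def'[OF N] sum_distrib_left ..
  also have "det ?N = det X"
    unfolding det_permute_rows_cols[OF X \<pi> \<pi>] by (simp add: sign_def)
  finally show ?thesis .
qed

lemma monomial_conj_inverse:
  assumes X: "X \<in> carrier_mat n n" and \<pi>: "\<pi> permutes {0..<n}" and \<tau>: "\<tau> permutes {0..<n}"
    and inv: "\<And>i. i < n \<Longrightarrow> \<pi> (\<tau> i) = i" and a: "\<And>i. i < n \<Longrightarrow> a i \<noteq> 0" and b: "\<And>i. i < n \<Longrightarrow> b i \<noteq> 0"
  shows "monomial_conj n (\<lambda>i. 1 / a (\<tau> i)) (\<lambda>i. 1 / b (\<tau> i)) \<tau> (monomial_conj n a b \<pi> X) = X"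
proof (rule eq_matI)
  fix i j assume "i < dim_row X" "j < dim_col X"
  then have ij: "i < n" "j < n" using X by auto
  then have "\<tau> i < n" "\<tau> j < n" using permutes_in_image[OF \<tau>, of i] permutes_in_image[OF \<tau>, of j] by simp_all
  then show "monomial_conj n (\<lambda>i. 1 / a (\<tau> i)) (\<lambda>i. 1 / b (\<tau> i)) \<tau> (monomial_conj n a b \<pi> X) $$ (i, j) = X $$ (i, j)"
    using ij a b inv by simp
qed (use X in simp_all)

lemma monomial_conj_symmetry:
  assumes \<pi>: "\<pi> permutes {0..<n}" and a: "\<And>i. i < n \<Longrightarrow> a i \<noteq> 0" and b: "\<And>i. i < n \<Longrightarrow> b i \<noteq> 0"
  shows "restrict (monomial_conj n a b \<pi>) (carrier_mat n n) \<in> symmetry_group n det"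
proof -
  let ?h = "monomial_conj n a b \<pi>" and ?\<tau> = "inv_into UNIV \<pi>"
  let ?k = "monomial_conj n (\<lambda>i. 1 / a (?\<tau> i)) (\<lambda>i. 1 / b (?\<tau> i)) ?\<tau>"
  have \<tau>: "?\<tau> permutes {0..<n}" by (rule permutes_inv[OF \<pi>])
  have \<tau>n: "?\<tau> i < n" if "i < n" for i using permutes_in_image[OF \<tau>, of i] that by simp
  have \<pi>n: "\<pi> i < n" if "i < n" for i using permutes_in_image[OF \<pi>, of i] that by simp
  have kh: "?k (?h X) = X" if X: "X \<in> carrier_mat n n" for X
    by (rule monomial_conj_inverse[OF X \<pi> \<tau> _ a b]) (simp_all add: permutes_inverses[OF \<pi>])
  have hk: "?h (?k X) = X" if X: "X \<in> carrier_mat n n" for X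
  proof (rule eq_matI)
    fix i j assume "i < dim_row X" "j < dim_col X"
    then have "i < n" "j < n" using X by auto
    then show "?h (?k X) $$ (i, j) = X $$ (i, j)" using \<pi>n a b by (simp add: permutes_inverses[OF \<pi>])
  qed (use X in simp_all)
  have "bij_betw ?h (carrier_mat n n) (carrier_mat n n)"
    by (rule bij_betw_byWitness[where f' = ?k]) (auto simp: kh hk)
  then have bij: "bij_betw (restrict ?h (carrier_mat n n)) (carrier_mat n n) (carrier_mat n n)"
    by (subst bij_betw_cong[of _ _ ?h]) simp_all
  have "mat_linear n n (restrict ?h (carrier_mat n n))"
    unfolding mat_linear_iff
  proof (intro conjI ballI allI)
    fix X Y :: "complex mat" and c assume X: "X \<in> carrier_mat n n"
    show "restrict ?h (carrier_mat n n) (c \<cdot>\<^sub>m X) = c \<cdot>\<^sub>m restrict ?h (carrier_mat n n) X"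
      using X \<pi>n by (intro eq_matI) auto
    assume Y: "Y \<in> carrier_mat n n"
    show "restrict ?h (carrier_mat n n) (X + Y) = restrict ?h (carrier_mat n n) X + restrict ?h (carrier_mat n n) Y"
      using X Y \<pi>n by (intro eq_matI) (auto simp: algebra_simps)
  qed simp
  moreover have "\<exists>c. c \<noteq> 0 \<and> (\<forall>y \<in> carrier_mat n n. det (inv_into (carrier_mat n n) (restrict ?h (carrier_mat n n)) y) = c * det y)"
  proof (intro exI conjI ballI)
    let ?c = "(\<Prod>i = 0..<n. a i) * (\<Prod>i = 0..<n. b i)"
    have c: "?c \<noteq> 0" using a b by simp
    show "1 / ?c \<noteq> 0" using c by simp
    fix y :: "complex mat" assume y: "y \<in> carrier_mat n n"
    have "inv_into (carrier_mat n n) (restrict ?h (carrier_mat n n)) y = ?k y"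
      by (rule inv_into_f_eq) (use bij y in \<open>auto simp: bij_betw_def hk\<close>)
    moreover have "det y = ?c * det (?k y)"
      using det_monomial_conj[of "?k y" n \<pi> a b] \<pi> hk[OF y] by simp
    ultimately show "det (inv_into (carrier_mat n n) (restrict ?h (carrier_mat n n)) y) = 1 / ?c * det y"
      using c by simp
  qed
  ultimately show ?thesis using bij by (simp add: symmetry_group_def GL_mats_def)
qed

definition subset_perm :: "nat \<Rightarrow> (nat \<Rightarrow> nat) \<Rightarrow> nat \<Rightarrow> nat" where
  "subset_perm m \<sigma> r = (if r < 2 ^ m - 1 then set_encode (\<sigma> ` set_decode r) else r)"

lemma permutes_image_psubset:
  assumes \<sigma>: "\<sigma> permutes U" and S: "S \<subset> U" shows "\<sigma> ` S \<subset> U"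
proof -
  have "\<sigma> ` S \<subset> \<sigma> ` U" using S permutes_inj[OF \<sigma>] by (metis image_strict_mono inj_on_subset subset_UNIV)
  then show ?thesis using permutes_image[OF \<sigma>] by simp
qed

lemma subset_perm:
  assumes \<sigma>: "\<sigma> permutes {0..<m}" and r: "r < 2 ^ m - 1"
  shows "set_decode (subset_perm m \<sigma> r) = \<sigma> ` set_decode r" "subset_perm m \<sigma> r < 2 ^ m - 1"
proof -
  have s: "\<sigma> ` set_decode r \<subset> {0..<m}" by (rule permutes_image_psubset[OF \<sigma> set_decode_proper[OF r]])
  show "subset_perm m \<sigma> r < 2 ^ m - 1" using set_encode_proper[OF s] r by (simp add: subset_perm_def)
  show "set_decode (subset_perm m \<sigma> r) = \<sigma> ` set_decode r"
    unfolding subset_perm_def using r by simp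
qed

lemma subset_perm_permutes:
  assumes \<sigma>: "\<sigma> permutes {0..<m}"
  shows "subset_perm m \<sigma> permutes {0..<2 ^ m - 1}"
proof (rule bij_imp_permutes)
  let ?\<tau> = "inv_into UNIV \<sigma>"
  have \<tau>: "?\<tau> permutes {0..<m}" by (rule permutes_inv[OF \<sigma>])
  have 1: "subset_perm m ?\<tau> (subset_perm m \<sigma> r) = r" if r: "r < 2 ^ m - 1" for r
  proof -
    have "set_decode (subset_perm m ?\<tau> (subset_perm m \<sigma> r)) = set_decode r"
      unfolding subset_perm(1)[OF \<tau> subset_perm(2)[OF \<sigma> r]] subset_perm(1)[OF \<sigma> r]
      by (simp add: image_image permutes_inverses[OF \<sigma>])
    then show ?thesis by (metis set_decode_inverse)
  qed
  have 2: "subset_perm m \<sigma> (subset_perm m ?\<tau> r) = r" if r: "r < 2 ^ m - 1" for r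
  proof -
    have "set_decode (subset_perm m \<sigma> (subset_perm m ?\<tau> r)) = set_decode r"
      unfolding subset_perm(1)[OF \<sigma> subset_perm(2)[OF \<tau> r]] subset_perm(1)[OF \<tau> r]
      by (simp add: image_image permutes_inverses[OF \<sigma>])
    then show ?thesis by (metis set_decode_inverse)
  qed
  show "bij_betw (subset_perm m \<sigma>) {0..<2 ^ m - 1} {0..<2 ^ m - 1}"
  proof (rule bij_betw_byWitness[where f' = "subset_perm m ?\<tau>"])
    show "\<forall>r\<in>{0..<2 ^ m - 1}. subset_perm m ?\<tau> (subset_perm m \<sigma> r) = r" using 1 by simp
    show "\<forall>r\<in>{0..<2 ^ m - 1}. subset_perm m \<sigma> (subset_perm m ?\<tau> r) = r" using 2 by simp
    show "subset_perm m \<sigma> ` {0..<2 ^ m - 1} \<subseteq> {0..<2 ^ m - 1}" using subset_perm(2)[OF \<sigma>] by auto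
    show "subset_perm m ?\<tau> ` {0..<2 ^ m - 1} \<subseteq> {0..<2 ^ m - 1}" using subset_perm(2)[OF \<tau>] by auto
  qed
qed (simp add: subset_perm_def)

lemma wrap_image:
  assumes \<sigma>: "\<sigma> permutes {0..<m}"
  shows "wrap m (\<sigma> ` S) = \<sigma> ` wrap m S"
proof -
  have "\<sigma> ` S = {0..<m} \<longleftrightarrow> S = {0..<m}"
    using permutes_image[OF \<sigma>] inj_image_eq_iff[OF permutes_inj[OF \<sigma>], of S "{0..<m}"] by simp
  then show ?thesis by (simp add: wrap_def)
qed

lemma wrap_insert_inj:
  assumes "i \<notin> C" "i' \<notin> C" "wrap m (insert i C) = wrap m (insert i' C)"
  shows "i = i'"
proof -
  have "insert i C = insert i' C" using assms(3) unfolding wrap_def by (metis insert_not_empty)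
  then show ?thesis using assms(1,2) by blast
qed

lemma grenet_lin_inj:
  assumes m: "1 \<le> m"
  shows "inj_on (grenet_lin m) (carrier_mat m m)"
proof (rule inj_onI)
  fix y y' :: "complex mat"
  assume y: "y \<in> carrier_mat m m" and y': "y' \<in> carrier_mat m m" and eq: "grenet_lin m y = grenet_lin m y'"
  show "y = y'"
  proof (rule eq_matI)
    fix i j assume "i < dim_row y'" "j < dim_col y'"
    then have ij: "i < m" "j < m" using y' by auto
    have "j \<le> card ({0..<m} - {i})" using ij by simp
    \<comment> \<open>Column \<open>j\<close> of \<open>y\<close> occurs in the columns of the
      matrix indexed by sets of size \<open>j\<close>; one that avoids \<open>i\<close> exhibits
      \<open>y $$ (i, j)\<close> as an entry.\<close>
    then obtain C where C: "C \<subseteq> {0..<m} - {i}" "card C = j" by (meson obtain_subset_with_card_n)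
    have iC: "i \<notin> C" "C \<subset> {0..<m}" using C(1) ij by (blast, auto)
    have fC: "finite C" using C(1) by (rule finite_subset) simp
    have W: "wrap m (insert i C) \<subset> {0..<m}"
    proof (cases "insert i C = {0..<m}")
      case True
      then show ?thesis using ij by (auto simp: wrap_def)
    next
      case False
      moreover have "insert i C \<subseteq> {0..<m}" using C(1) ij by auto
      ultimately show ?thesis by (simp add: wrap_def psubset_eq)
    qed
    then have fW: "finite (wrap m (insert i C))" by (auto intro: finite_subset)
    have "grenet_lin m z $$ (set_encode (wrap m (insert i C)), set_encode C) = z $$ (i, j)" if z: "z \<in> carrier_mat m m" for z
    proof -
      have "grenet_lin m z $$ (set_encode (wrap m (insert i C)), set_encode C) = (\<Sum>k = 0..<m.
          if k \<notin> C \<and> wrap m (insert k C) = wrap m (insert i C) then z $$ (k, card C) else 0)"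
        using grenet_lin_index[OF m z set_encode_proper[OF W] set_encode_proper[OF iC(2)]]
        by (simp only: set_encode_inverse[OF fC] set_encode_inverse[OF fW])
      also have "\<dots> = (\<Sum>k = 0..<m. if k = i then z $$ (i, j) else 0)"
        using wrap_insert_inj[OF _ iC(1)] iC(1) C(2) by (intro sum.cong) auto
      finally show ?thesis using ij by simp
    qed
    from this[OF y] this[OF y'] eq show "y $$ (i, j) = y' $$ (i, j)" by simp
  qed (use y y' in auto)
qed

lemma grenet_equivariant:
  assumes m: "2 \<le> m" and \<sigma>: "\<sigma> permutes {0..<m}" and d: "\<And>i. i < m \<Longrightarrow> d i \<noteq> 0"
  obtains h where "h \<in> symmetry_group (2 ^ m - 1) det" "h (grenet_const m) = grenet_const m"
    "\<And>y. y \<in> carrier_mat m m \<Longrightarrow> h (grenet_lin m y) = grenet_lin m (monomial_mat m d \<sigma> * y)"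
proof -
  \<comment> \<open>As a row index the empty set stands for the full set, as a column index for
    itself; elsewhere \<open>a\<close> and \<open>b\<close> are inverse to each other.\<close>
  define a where "a r = (if set_decode r = {} then \<Prod>i = 0..<m. d i else \<Prod>i\<in>set_decode r. d i)" for r
  define b where "b c = 1 / (\<Prod>i\<in>set_decode c. d i)" for c
  let ?n = "2 ^ m - 1 :: nat" and ?\<pi> = "subset_perm m \<sigma>" and ?g = "monomial_mat m d \<sigma>"
  let ?h = "monomial_conj ?n a b ?\<pi>"
  have m1: "1 \<le> m" using m by simp
  have \<pi>: "?\<pi> permutes {0..<?n}" by (rule subset_perm_permutes[OF \<sigma>])
  have \<pi>n: "?\<pi> r < ?n" if "r < ?n" for r by (rule subset_perm(2)[OF \<sigma> that])
  have dec: "set_decode (?\<pi> r) = \<sigma> ` set_decode r" if "r < ?n" for r by (rule subset_perm(1)[OF \<sigma> that])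
  have inj: "inj \<sigma>" by (rule permutes_inj[OF \<sigma>])
  have card: "card (\<sigma> ` S) = card S" for S by (rule card_image) (use inj in \<open>auto intro: inj_on_subset\<close>)
  have dn: "d i \<noteq> 0" if "i \<in> set_decode r" "r < ?n" for i r
    using set_decode_proper[OF that(2)] that(1) by (intro d) auto
  have a0: "a r \<noteq> 0" if "r < ?n" for r unfolding a_def using dn[OF _ that] d by simp
  have b0: "b c \<noteq> 0" if "c < ?n" for c unfolding b_def using dn[OF _ that] by simp
  have ab: "a r * b c = d j" if r: "r < ?n" and c: "c < ?n" and j: "j \<notin> set_decode c" "wrap m (insert j (set_decode c)) = set_decode r" for r c j
  proof -
    have "a r = (\<Prod>i\<in>insert j (set_decode c). d i)"
      using j(2) by (auto simp: a_def wrap_def split: if_splits)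
    also have "\<dots> = d j * (\<Prod>i\<in>set_decode c. d i)" using j(1) by simp
    finally show ?thesis using dn[OF _ c] by (simp add: b_def)
  qed
  show thesis
  proof (rule that[of "restrict ?h (carrier_mat ?n ?n)"])
    show "restrict ?h (carrier_mat ?n ?n) \<in> symmetry_group ?n det"
      by (rule monomial_conj_symmetry[OF \<pi> a0 b0])
    have "?h (grenet_const m) = grenet_const m"
    proof (rule eq_matI)
      fix r c assume "r < dim_row (grenet_const m)" "c < dim_col (grenet_const m)"
      then have rc: "r < ?n" "c < ?n" using carrier_matD[OF grenet_const_carrier[of m]] by auto
      have "?\<pi> r = ?\<pi> c \<longleftrightarrow> r = c" using permutes_inj[OF \<pi>] by (simp add: inj_eq)
      \<comment> \<open>At the empty set, the only place where \<open>a r * b r\<close> may differ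
        from one, the constant part is zero.\<close>
      moreover have "a r * b r * grenet_weight m (card (set_decode r)) = grenet_weight m (card (set_decode r))"
      proof (cases "set_decode r = {}")
        case False
        then have "a r * b r = 1" using dn[OF _ rc(1)] by (simp add: a_def b_def)
        then show ?thesis by simp
      qed (simp add: grenet_weight_def)
      ultimately show "?h (grenet_const m) $$ (r, c) = grenet_const m $$ (r, c)"
        unfolding monomial_conj_index(1)[OF rc] grenet_const_index[OF m rc] grenet_const_index[OF m \<pi>n[OF rc(1)] \<pi>n[OF rc(2)]] dec[OF rc(2)] card
        by auto
    qed (use carrier_matD[OF grenet_const_carrier[of m]] in simp_all)
    then show "restrict ?h (carrier_mat ?n ?n) (grenet_const m) = grenet_const m"
      using grenet_const_carrier[of m] by (simp only: restrict_apply if_True)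
    fix y :: "complex mat" assume y: "y \<in> carrier_mat m m"
    have gy: "?g * y \<in> carrier_mat m m" by (rule mult_carrier_mat[OF monomial_mat_carrier y])
    have "?h (grenet_lin m y) = grenet_lin m (?g * y)"
    proof (rule eq_matI)
      fix r c assume "r < dim_row (grenet_lin m (?g * y))" "c < dim_col (grenet_lin m (?g * y))"
      then have rc: "r < ?n" "c < ?n" using carrier_matD[OF grenet_lin_carrier[of m "?g * y"]] by auto
      let ?C = "set_decode c" and ?R = "set_decode r"
      have cC: "card ?C < m" using psubset_card_mono[OF _ set_decode_proper[OF rc(2)]] by simp
      have "grenet_lin m y $$ (?\<pi> r, ?\<pi> c) = (\<Sum>i = 0..<m.
          if i \<notin> \<sigma> ` ?C \<and> wrap m (insert i (\<sigma> ` ?C)) = \<sigma> ` ?R then y $$ (i, card ?C) else 0)"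
        unfolding grenet_lin_index[OF m1 y \<pi>n[OF rc(1)] \<pi>n[OF rc(2)]] dec[OF rc(1)] dec[OF rc(2)] card ..
      also have "\<dots> = (\<Sum>j = 0..<m.
          if \<sigma> j \<notin> \<sigma> ` ?C \<and> wrap m (insert (\<sigma> j) (\<sigma> ` ?C)) = \<sigma> ` ?R then y $$ (\<sigma> j, card ?C) else 0)"
        by (subst sum.permute[OF \<sigma>]) (simp add: comp_def)
      also have "\<dots> = (\<Sum>j = 0..<m. if j \<notin> ?C \<and> wrap m (insert j ?C) = ?R then y $$ (\<sigma> j, card ?C) else 0)"
        unfolding image_insert[symmetric] wrap_image[OF \<sigma>] inj_image_mem_iff[OF inj] inj_image_eq_iff[OF inj] ..
      finally have e: "grenet_lin m y $$ (?\<pi> r, ?\<pi> c)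
        = (\<Sum>j = 0..<m. if j \<notin> ?C \<and> wrap m (insert j ?C) = ?R then y $$ (\<sigma> j, card ?C) else 0)" .
      show "?h (grenet_lin m y) $$ (r, c) = grenet_lin m (?g * y) $$ (r, c)"
        unfolding monomial_conj_index(1)[OF rc] e grenet_lin_index[OF m1 gy rc] sum_distrib_left
      proof (rule sum.cong[OF refl])
        fix j assume "j \<in> {0..<m}"
        then have j: "j < m" by simp
        show "a r * b c * (if j \<notin> ?C \<and> wrap m (insert j ?C) = ?R then y $$ (\<sigma> j, card ?C) else 0)
          = (if j \<notin> ?C \<and> wrap m (insert j ?C) = ?R then (?g * y) $$ (j, card ?C) else 0)"
          unfolding monomial_mat_mult[OF \<sigma> y j cC] using ab[OF rc, of j] by simp
      qed
    qed (use carrier_matD[OF grenet_lin_carrier[of m "?g * y"]] in simp_all)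
    then show "restrict ?h (carrier_mat ?n ?n) (grenet_lin m y) = grenet_lin m (?g * y)"
      using grenet_lin_carrier[of m y] by (simp only: restrict_apply if_True)
  qed
qed

text \<open>Here the whole normalizer has to be covered, which requires that all its elements are
  monomial (\<open>normalizer_imp_monomial\<close>); the lower bound uses the converse inclusion
  \<open>monomial_in_normalizer\<close>.\<close>

lemma grenet_respects:
  assumes m: "2 \<le> m"
  shows "rep_respects m (2 ^ m - 1) (grenet_const m) (grenet_lin m) (NT_action m)"
  unfolding rep_respects_def
proof
  fix f assume "f \<in> NT_action m"
  then obtain g where g: "g \<in> normalizer (GL_group m) (torus m)" and f: "f = (\<lambda>M \<in> carrier_mat m m. g * M)"
    by (auto simp: NT_action_def)
  obtain d \<sigma> where \<sigma>: "\<sigma> permutes {0..<m}" and d: "\<And>i. i < m \<Longrightarrow> d i \<noteq> 0" and gd: "g = monomial_mat m d \<sigma>"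
    by (rule normalizer_imp_monomial[OF g]) blast
  obtain h where h: "h \<in> symmetry_group (2 ^ m - 1) det" "h (grenet_const m) = grenet_const m"
    "\<And>y. y \<in> carrier_mat m m \<Longrightarrow> h (grenet_lin m y) = grenet_lin m (g * y)"
    unfolding gd by (rule grenet_equivariant[OF m \<sigma> d]) blast+
  obtain d' \<tau> where g': "g * monomial_mat m d' \<tau> = 1\<^sub>m m"
    unfolding gd by (rule monomial_mat_inverse[OF \<sigma> d]) blast+
  have gc: "g \<in> carrier_mat m m" by (simp add: gd)
  have "(\<lambda>y. g * y) ` carrier_mat m m = carrier_mat m m"
  proof (intro subset_antisym subsetI)
    fix y :: "complex mat" assume y: "y \<in> carrier_mat m m"
    have "y = g * (monomial_mat m d' \<tau> * y)"
      using assoc_mult_mat[OF gc monomial_mat_carrier[of m d' \<tau>] y] g' y by simp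
    moreover have "monomial_mat m d' \<tau> * y \<in> carrier_mat m m" by (rule mult_carrier_mat[OF monomial_mat_carrier y])
    ultimately show "y \<in> (\<lambda>y. g * y) ` carrier_mat m m" by (rule image_eqI)
  qed (use gc in auto)
  moreover have "h ` grenet_lin m ` carrier_mat m m = grenet_lin m ` (\<lambda>y. g * y) ` carrier_mat m m"
    unfolding image_image by (rule image_cong[OF refl h(3)])
  ultimately have "h \<in> rep_group m (2 ^ m - 1) (grenet_const m) (grenet_lin m)"
    using h(1,2) by (simp add: rep_group_def)
  moreover have "rho_bar m (grenet_lin m) h = f"
  proof -
    have "1 \<le> m" using m by simp
    then have "inv_into (carrier_mat m m) (grenet_lin m) (h (grenet_lin m y)) = g * y" if y: "y \<in> carrier_mat m m" for y
      unfolding h(3)[OF y] by (rule inv_into_f_f[OF grenet_lin_inj]) (use gc y in simp)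
    then show ?thesis unfolding rho_bar_def f by (intro restrict_ext)
  qed
  ultimately show "f \<in> rho_bar m (grenet_lin m) ` rep_group m (2 ^ m - 1) (grenet_const m) (grenet_lin m)"
    by blast
qed

lemma grenet_det_rep:
  assumes m: "2 \<le> m"
  shows "det_rep m (perm_poly m) (2 ^ m - 1) (grenet_const m) (grenet_lin m)"
proof -
  have "1 \<le> m" using m by simp
  then show ?thesis unfolding det_rep_def
    by (intro conjI ballI grenet_const_carrier grenet_lin_linear grenet_det[OF m, symmetric])
qed

theorem theorem2p8:
  fixes m :: nat
  assumes "m \<ge> 3"
  shows "(\<forall>n \<Lambda> A. det_rep m (perm_poly m) n \<Lambda> A \<and> rep_respects m n \<Lambda> A (NT_action m)
            \<longrightarrow> n \<ge> 2 ^ m - 1) \<and>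
         det_rep m (perm_poly m) (2 ^ m - 1) (grenet_const m) (grenet_lin m) \<and>
         rep_respects m (2 ^ m - 1) (grenet_const m) (grenet_lin m) (NT_action m)"
proof (intro conjI allI impI)
  have m: "2 \<le> m" using assms by simp
  show "2 ^ m - 1 \<le> n" if "det_rep m (perm_poly m) n \<Lambda> A \<and> rep_respects m n \<Lambda> A (NT_action m)" for n \<Lambda> A
    using equivariant_det_rep_size[OF assms] that by blast
  show "det_rep m (perm_poly m) (2 ^ m - 1) (grenet_const m) (grenet_lin m)" by (rule grenet_det_rep[OF m])
  show "rep_respects m (2 ^ m - 1) (grenet_const m) (grenet_lin m) (NT_action m)" by (rule grenet_respects[OF m])
qed

end
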